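(* Let $\psi:\mathbb{R}^n\to(-\infty,+\infty]$ be convex and lower semicontinuous with $0\in \mathrm{Int}(Dom\,\psi)$ and $\psi(z)\ge\psi(0)=0$ for all $z\in\mathbb{R}^n$, and let $\varphi:\mathbb{R}\to(-\infty,+\infty]$ be convex and lower semicontinuous with $\varphi(y)\ge\varphi(0)=0$ for all $y\in\mathbb{R}$. Assume that $Dom\,\psi$ is locally compact, that $b:[0,T]\times\mathbb{R}^n\times\mathbb{R}\times\mathbb{R}^{1\times d}\to\mathbb{R}^n$, $\sigma$, $f:[0,T]\times\mathbb{R}^n\times\mathbb{R}\times\mathbb{R}^{1\times d}\to\mathbb{R}$ and $g:\mathbb{R}^n\to\mathbb{R}$ are jointly continuous, that $b$ and $f$ are Lipschitz continuous with respect to $(x,y,z)$ (uniformly in $t$), and that $\sigma(t,x,y)=\sigma(t,x)\in\mathbb{R}^{n\times d}$ does not depend on $y$ and is Lipschitz continuous with respect to $x$ (uniformly in $t$). Then the parabolic variational inequality (PVI) described in the context has at most one viscosity solution in the class of functions $u:[0,T]\times Dom\,\psi\to\mathbb{R}$ which are Lipschitz continuous in $x$ uniformly with respect to $t$ and continuous in $t$.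
   Context: Fix $T>0$ and integers $n,d\ge1$. $Dom\,\psi=\{x:\psi(x)<\infty\}$, similarly $Dom\,\varphi$; $\partial\psi,\partial\varphi$ are the subdifferentials of convex analysis; $^*$ denotes transposition. The PVI is: $$\frac{\partial u}{\partial s}(s,x)+(\mathcal{L}u)(s,x,u(s,x),(\nabla u(s,x))^*\sigma(s,x,u(s,x)))+f(s,x,u(s,x),(\nabla u(s,x))^*\sigma(s,x,u(s,x)))\in\partial\varphi(u(s,x))+\langle\partial\psi(x),\nabla u(s,x)\rangle$$ for $(s,x)\in[0,T]\times Dom\,\psi$, with $u(T,x)=g(x)$ for $x\in Dom\,\psi$, where $$(\mathcal{L}v)(s,x,y,z)=\frac12\sum_{i,j=1}^n(\sigma\sigma^* )_{i,j}(s,x,y)\frac{\partial^2v}{\partial x_i\partial x_j}(s,x)+\sum_{i=1}^nb_i(s,x,y,z)\frac{\partial v}{\partial x_i}(s,x).$$ Jets. For $u\in C([0,T]\times Dom\,\psi)$ and $(t,x)\in[0,T]\times Dom\,\psi$, $\mathcal{P}^{2,+}u(t,x)$ is the set of $(p,q,X)\in\mathbb{R}\times\mathbb{R}^n\times S(n)$ ($S(n)$: symmetric $n\times n$ matrices) such that $u(s,y)\le u(t,x)+p(s-t)+\langle q,y-x\rangle+\frac12\langle X(y-x),y-x\rangle+o(|s-t|+|y-x|^2)$ as $(s,y)\to(t,x)$ in $[0,T]\times Dom\,\psi$; $\mathcal{P}^{2,-}u(t,x)$ is defined with $\ge$ instead of $\le$. For $(x,q)\in Dom\,\psi\times\mathbb{R}^n$: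 $\partial\psi_*(x,q)=\liminf_{(x',q')\to(x,q),\,x^*\in\partial\psi(x')}\langle x^*,q'\rangle$ and $\partial\psi^*(x,q)=-\partial\psi_*(x,-q)$. $\varphi'_-(y)$ and $\varphi'_+(y)$ denote the left and right derivatives of $\varphi$ at $y$ (with values $-\infty$ resp. $+\infty$ at the left resp. right endpoint of $Dom\,\varphi$ when it belongs to $Dom\,\varphi$). Viscosity solution. A function $u\in C([0,T]\times Dom\,\psi)$ with $u(T,x)=g(x)$, $x\in Dom\,\psi$, is a viscosity subsolution (resp. supersolution) of the PVI if for all $(t,x)\in[0,T)\times Dom\,\psi$ one has $u(t,x)\in Dom\,\varphi$ and for every $(p,q,X)\in\mathcal{P}^{2,+}u(t,x)$ (resp. $\mathcal{P}^{2,-}u(t,x)$), the quantity $$-p-\tfrac12\mathrm{Tr}(\sigma\sigma^*(t,x,u(t,x))X)-\langle b(t,x,u(t,x),q^*\sigma(t,x,u(t,x))),q\rangle-f(t,x,u(t,x),q^*\sigma(t,x,u(t,x)))$$ is $\le-\varphi'_-(u(t,x))-\partial\psi_*(x,q)$ (resp. $\ge-\varphi'_+(u(t,x))-\partial\psi^*(x,q)$). It is a viscosity solution if it is both a sub- and a supersolution. *)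

theory Defs
  imports "HOL-Analysis.Analysis" "HOL-Library.Landau_Symbols"
begin

section \<open>Convex analysis for extended-real-valued functions\<close>

definition effective_domain :: "('a \<Rightarrow> ereal) \<Rightarrow> 'a set" where
  "effective_domain F = {x. F x < \<infinity>}"

text \<open>The functions below take values in \<open>(-\<infinity>, \<infinity>]\<close>, so the sum on the right never has the form
  \<open>\<infinity> - \<infinity>\<close>.\<close>

definition ereal_convex :: "('a::real_vector \<Rightarrow> ereal) \<Rightarrow> bool" where
  "ereal_convex F \<longleftrightarrow>
     (\<forall>x y. \<forall>\<theta>. 0 < \<theta> \<and> \<theta> < 1 \<longrightarrow>
        F (\<theta> *\<^sub>R x + (1 - \<theta>) *\<^sub>R y) \<le> ereal \<theta> * F x + ereal (1 - \<theta>) * F y)"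

definition lower_semicontinuous :: "('a::topological_space \<Rightarrow> ereal) \<Rightarrow> bool" where
  "lower_semicontinuous F \<longleftrightarrow> (\<forall>x. F x \<le> Liminf (at x) F)"

text \<open>When \<open>F\<close> is proper, the inequality forces \<open>F x < \<infinity>\<close>, so the subdifferential is empty outside
  the effective domain.\<close>

definition subdifferential :: "('a::real_inner \<Rightarrow> ereal) \<Rightarrow> 'a \<Rightarrow> 'a set" where
  "subdifferential F x = {\<xi>. \<forall>y. F x + ereal (\<xi> \<bullet> (y - x)) \<le> F y}"

text \<open>One-sided derivatives, for \<open>y\<close> in the effective domain. If \<open>y\<close> is the left endpoint of the
  domain, then \<open>F (y - h) = \<infinity>\<close> for all \<open>h > 0\<close>, the quotient is constantly \<open>-\<infinity>\<close>, and so is the left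
  derivative; symmetrically, the right derivative at the right endpoint is \<open>\<infinity>\<close>. For convex \<open>F\<close> the
  quotients are monotone in \<open>h\<close>, so the limits exist.\<close>

definition left_derivative :: "(real \<Rightarrow> ereal) \<Rightarrow> real \<Rightarrow> ereal" where
  "left_derivative F y = Lim (at_right 0) (\<lambda>h. (F y - F (y - h)) / ereal h)"

definition right_derivative :: "(real \<Rightarrow> ereal) \<Rightarrow> real \<Rightarrow> ereal" where
  "right_derivative F y = Lim (at_right 0) (\<lambda>h. (F (y + h) - F y) / ereal h)"

lemma left_derivative_left_endpoint:
  assumes "\<bar>F y\<bar> \<noteq> \<infinity>" and "\<And>z. z < y \<Longrightarrow> F z = \<infinity>"
  shows "left_derivative F y = -\<infinity>"
proof -
  have "((\<lambda>h. (F y - F (y - h)) / ereal h) \<longlongrightarrow> -\<infinity>) (at_right 0)"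
  proof (rule tendsto_eventually)
    show "\<forall>\<^sub>F h in at_right 0. (F y - F (y - h)) / ereal h = -\<infinity>"
      using assms by (auto simp: eventually_at_right_field divide_ereal_def intro!: exI[of _ 1])
  qed
  then show ?thesis
    unfolding left_derivative_def by (intro tendsto_Lim) auto
qed

lemma right_derivative_right_endpoint:
  assumes "\<bar>F y\<bar> \<noteq> \<infinity>" and "\<And>z. y < z \<Longrightarrow> F z = \<infinity>"
  shows "right_derivative F y = \<infinity>"
proof -
  have "((\<lambda>h. (F (y + h) - F y) / ereal h) \<longlongrightarrow> \<infinity>) (at_right 0)"
  proof (rule tendsto_eventually)
    show "\<forall>\<^sub>F h in at_right 0. (F (y + h) - F y) / ereal h = \<infinity>"
      using assms by (auto simp: eventually_at_right_field divide_ereal_def intro!: exI[of _ 1])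
  qed
  then show ?thesis
    unfolding right_derivative_def by (intro tendsto_Lim) auto
qed

text \<open>The lower limit of \<open>\<langle>\<xi>, q'\<rangle>\<close> over triples \<open>(x', q', \<xi>)\<close> with \<open>\<xi> \<in> \<partial>\<psi>(x')\<close> as \<open>(x', q') \<rightarrow> (x, q)\<close>.
  The point \<open>(x, q)\<close> itself is admitted; since \<open>q'\<close> varies freely, excluding it would give the same
  value in a nonzero space.\<close>

definition subdiff_lower ::
  "('a::real_inner \<Rightarrow> ereal) \<Rightarrow> 'a \<Rightarrow> 'a \<Rightarrow> ereal" where
  "subdiff_lower \<psi> x q =
     Liminf (inf (filtercomap (\<lambda>(x', q', \<xi>). (x', q')) (nhds (x, q)))
                 (principal {(x', q', \<xi>). \<xi> \<in> subdifferential \<psi> x'}))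
       (\<lambda>(x', q', \<xi>). ereal (\<xi> \<bullet> q'))"

definition subdiff_upper ::
  "('a::real_inner \<Rightarrow> ereal) \<Rightarrow> 'a \<Rightarrow> 'a \<Rightarrow> ereal" where
  "subdiff_upper \<psi> x q = - subdiff_lower \<psi> x (- q)"


section \<open>Parabolic jets\<close>

definition parabolic_expansion ::
  "(real \<Rightarrow> real^'n \<Rightarrow> real) \<Rightarrow> real \<Rightarrow> real^'n \<Rightarrow> real \<Rightarrow> real^'n \<Rightarrow> real^'n^'n
     \<Rightarrow> real \<Rightarrow> real^'n \<Rightarrow> real" where
  "parabolic_expansion u t x p q X s y =
     u t x + p * (s - t) + q \<bullet> (y - x) + (1/2) * ((X *v (y - x)) \<bullet> (y - x))"

definition superjet ::
  "real \<Rightarrow> (real^'n) set \<Rightarrow> (real \<Rightarrow> real^'n \<Rightarrow> real) \<Rightarrow> real \<Rightarrow> real^'n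
     \<Rightarrow> (real \<times> (real^'n) \<times> (real^'n^'n)) set" where
  "superjet T D u t x =
     {(p, q, X). transpose X = X \<and>
        (\<exists>r \<in> o[at (t, x) within {0..T} \<times> D](\<lambda>(s, y). \<bar>s - t\<bar> + (norm (y - x))\<^sup>2).
           \<forall>\<^sub>F (s, y) in at (t, x) within {0..T} \<times> D.
             u s y \<le> parabolic_expansion u t x p q X s y + r (s, y))}"

definition subjet ::
  "real \<Rightarrow> (real^'n) set \<Rightarrow> (real \<Rightarrow> real^'n \<Rightarrow> real) \<Rightarrow> real \<Rightarrow> real^'n
     \<Rightarrow> (real \<times> (real^'n) \<times> (real^'n^'n)) set" where
  "subjet T D u t x =
     {(p, q, X). transpose X = X \<and>
        (\<exists>r \<in> o[at (t, x) within {0..T} \<times> D](\<lambda>(s, y). \<bar>s - t\<bar> + (norm (y - x))\<^sup>2).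
           \<forall>\<^sub>F (s, y) in at (t, x) within {0..T} \<times> D.
             u s y \<ge> parabolic_expansion u t x p q X s y + r (s, y))}"


section \<open>Viscosity solutions of the parabolic variational inequality\<close>

text \<open>Row vectors in \<open>\<real>\<^bsup>1\<times>d\<^esup>\<close> are represented by the type \<^typ>\<open>real^'d\<close>; the row vector \<open>q\<^sup>*\<sigma>\<close> is
  \<^term>\<open>q v* \<sigma>\<close>, and an \<open>n\<times>d\<close> matrix has type \<^typ>\<open>real^'d^'n\<close>.\<close>

definition pvi_operator ::
  "(real \<Rightarrow> real^'n \<Rightarrow> real \<Rightarrow> real^'d \<Rightarrow> real^'n) \<Rightarrow>
   (real \<Rightarrow> real^'n \<Rightarrow> real \<Rightarrow> real^'d^'n) \<Rightarrow>
   (real \<Rightarrow> real^'n \<Rightarrow> real \<Rightarrow> real^'d \<Rightarrow> real) \<Rightarrow>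
   real \<Rightarrow> real^'n \<Rightarrow> real \<Rightarrow> real \<Rightarrow> real^'n \<Rightarrow> real^'n^'n \<Rightarrow> real" where
  "pvi_operator b \<sigma> f t x y p q X =
     - p - (1/2) * trace ((\<sigma> t x y ** transpose (\<sigma> t x y)) ** X)
       - b t x y (q v* \<sigma> t x y) \<bullet> q - f t x y (q v* \<sigma> t x y)"

text \<open>The right-hand sides \<open>-\<phi>'\<^sub>-(u) - \<partial>\<psi>\<^sub>*(x,q)\<close> and \<open>-\<phi>'\<^sub>+(u) - \<partial>\<psi>\<^sup>*(x,q)\<close> are extended reals and can
  be of the indeterminate form \<open>\<infinity> - \<infinity>\<close>. The convention is that the inequality then imposes no
  condition; this is the weakest possible requirement. As \<^prop>\<open>\<infinity> - \<infinity> = (\<infinity>::ereal)\<close>, the sum in the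
  supersolution inequality is formed before negating it, so that its indeterminate value is \<open>-\<infinity>\<close>.
  All other cases are unaffected by these groupings.\<close>

definition viscosity_subsolution ::
  "real \<Rightarrow> (real^'n \<Rightarrow> ereal) \<Rightarrow> (real \<Rightarrow> ereal) \<Rightarrow>
   (real \<Rightarrow> real^'n \<Rightarrow> real \<Rightarrow> real^'d \<Rightarrow> real^'n) \<Rightarrow>
   (real \<Rightarrow> real^'n \<Rightarrow> real \<Rightarrow> real^'d^'n) \<Rightarrow>
   (real \<Rightarrow> real^'n \<Rightarrow> real \<Rightarrow> real^'d \<Rightarrow> real) \<Rightarrow>
   (real^'n \<Rightarrow> real) \<Rightarrow> (real \<Rightarrow> real^'n \<Rightarrow> real) \<Rightarrow> bool" where
  "viscosity_subsolution T \<psi> \<phi> b \<sigma> f g u \<longleftrightarrow>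
     continuous_on ({0..T} \<times> effective_domain \<psi>) (\<lambda>(t, x). u t x) \<and>
     (\<forall>x \<in> effective_domain \<psi>. u T x = g x) \<and>
     (\<forall>t \<in> {0..<T}. \<forall>x \<in> effective_domain \<psi>.
        u t x \<in> effective_domain \<phi> \<and>
        (\<forall>(p, q, X) \<in> superjet T (effective_domain \<psi>) u t x.
           ereal (pvi_operator b \<sigma> f t x (u t x) p q X)
             \<le> - left_derivative \<phi> (u t x) - subdiff_lower \<psi> x q))"

definition viscosity_supersolution ::
  "real \<Rightarrow> (real^'n \<Rightarrow> ereal) \<Rightarrow> (real \<Rightarrow> ereal) \<Rightarrow>
   (real \<Rightarrow> real^'n \<Rightarrow> real \<Rightarrow> real^'d \<Rightarrow> real^'n) \<Rightarrow>
   (real \<Rightarrow> real^'n \<Rightarrow> real \<Rightarrow> real^'d^'n) \<Rightarrow>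
   (real \<Rightarrow> real^'n \<Rightarrow> real \<Rightarrow> real^'d \<Rightarrow> real) \<Rightarrow>
   (real^'n \<Rightarrow> real) \<Rightarrow> (real \<Rightarrow> real^'n \<Rightarrow> real) \<Rightarrow> bool" where
  "viscosity_supersolution T \<psi> \<phi> b \<sigma> f g u \<longleftrightarrow>
     continuous_on ({0..T} \<times> effective_domain \<psi>) (\<lambda>(t, x). u t x) \<and>
     (\<forall>x \<in> effective_domain \<psi>. u T x = g x) \<and>
     (\<forall>t \<in> {0..<T}. \<forall>x \<in> effective_domain \<psi>.
        u t x \<in> effective_domain \<phi> \<and>
        (\<forall>(p, q, X) \<in> subjet T (effective_domain \<psi>) u t x.
           ereal (pvi_operator b \<sigma> f t x (u t x) p q X)
             \<ge> - (right_derivative \<phi> (u t x) + subdiff_upper \<psi> x q)))"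

definition viscosity_solution ::
  "real \<Rightarrow> (real^'n \<Rightarrow> ereal) \<Rightarrow> (real \<Rightarrow> ereal) \<Rightarrow>
   (real \<Rightarrow> real^'n \<Rightarrow> real \<Rightarrow> real^'d \<Rightarrow> real^'n) \<Rightarrow>
   (real \<Rightarrow> real^'n \<Rightarrow> real \<Rightarrow> real^'d^'n) \<Rightarrow>
   (real \<Rightarrow> real^'n \<Rightarrow> real \<Rightarrow> real^'d \<Rightarrow> real) \<Rightarrow>
   (real^'n \<Rightarrow> real) \<Rightarrow> (real \<Rightarrow> real^'n \<Rightarrow> real) \<Rightarrow> bool" where
  "viscosity_solution T \<psi> \<phi> b \<sigma> f g u \<longleftrightarrow>
     viscosity_subsolution T \<psi> \<phi> b \<sigma> f g u \<and> viscosity_supersolution T \<psi> \<phi> b \<sigma> f g u"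

definition lipschitz_in_space_continuous_in_time ::
  "real \<Rightarrow> (real^'n) set \<Rightarrow> (real \<Rightarrow> real^'n \<Rightarrow> real) \<Rightarrow> bool" where
  "lipschitz_in_space_continuous_in_time T D u \<longleftrightarrow>
     (\<exists>L. \<forall>t \<in> {0..T}. L-lipschitz_on D (u t)) \<and>
     (\<forall>x \<in> D. continuous_on {0..T} (\<lambda>t. u t x))"

end

theory Submission
  imports Defs
begin

text \<open>The proof doubles the variables. If \<open>u\<close> exceeds \<open>v\<close> somewhere, then so it does after subtracting
  \<open>m W\<close>, where \<open>W(t,x) = exp (\<lambda> (T - t)) (1 + |x|\<^sup>2)\<close> and \<open>2 m\<close> is the supremum of \<open>(u - v) / W\<close>, and one maximizes
  \<open>u(t,x) - v(s,y) - \<alpha>/2 |x - y|\<^sup>2 - \<beta>/2 (t - s)\<^sup>2 - m/2 (W(t,x) + W(s,y)) - P(x) - P(y)\<close>.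
  The domain of \<open>\<psi>\<close> need not be closed; the barrier \<open>P\<close> keeps the maximum point inside it. \<open>P\<close> is a sum over
  dyadic scales of smoothed distances to the sets of points at which \<open>\<psi>\<close> has slope at most \<open>2\<^sup>l\<close>, thickened to
  cones over a ball. Its gradient and Hessian are dominated by the subgradients of \<open>\<psi>\<close> nearby, which are
  coercive because \<open>0\<close> is interior to the domain; monotonicity of \<open>\<partial>\<psi>\<close> and \<open>\<partial>\<phi>\<close> disposes of the other terms.
  The Lipschitz bounds make the growth in \<open>W\<close> independent of \<open>\<lambda>\<close>, so a large \<open>\<lambda>\<close> gives a contradiction.
  The second-order jets at the maximum point come from the theorem on sums, which rests on the second-order
  differentiability of convex functions at contact points, and this on Rademacher's theorem applied to the
  resolvent.\<close>

section \<open>Rademacher's theorem\<close>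

text \<open>No boundary behaviour is prescribed at points of the closure where \<open>\<psi>\<close>
  is infinite, and no viscosity inequality is available there; so the maximum must be kept away from
  them by a penalty. Any penalty returns to the equation through its gradient and, via the
  covariance, its Hessian, and nothing in \<open>b\<close>, \<open>\<sigma>\<close> or
  \<open>f\<close> compensates for this. What does is the pairing of \<open>q\<close> with a
  subgradient \<open>\<xi>\<close> of \<open>\<psi>\<close>: the weight contributes
  \<open>m e x\<close> to \<open>q\<close>, with \<open>e \<ge> 1\<close>, and yields a gain of
  order \<open>m \<rho> |\<xi>|\<close>. A penalty is affordable if, wherever its Hessian has size
  \<open>\<omega> \<kappa>\<close>, all nearby subgradients have norm at least
  \<open>\<kappa> / 2\<close>; this ties each scale of the barrier to a level of steepness of
  \<open>\<psi>\<close>. How large the outward derivative at the bad points must be is known in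
  advance: at a maximum it is bounded through the Lipschitz constants of the solutions, since these
  control \<open>\<alpha> |x - y|\<close> for every \<open>\<alpha>\<close> and every
  \<open>P\<close>. For the same reason \<open>\<alpha>\<close> and \<open>\<beta>\<close> are not
  sent to infinity; fixed large values suffice.\<close>

lemma cball_midpoint_eq_Icc: "cball ((a + b) / 2) ((b - a) / 2) = {a..b}" for a b :: real
  by (auto simp: cball_def dist_real_def abs_if field_simps)

section \<open>Differentiability of Lipschitz functions on the line\<close>

text \<open>No measurability of \<open>A\<close> is assumed, hence the outer measure. A Vitali cover
  of \<open>A\<close>, inside an open set \<open>U\<close>, by intervals on which \<open>F\<close>
  stretches lengths by at most \<open>p\<close> has a countable disjoint subfamily that misses only
  a null set. \<open>F\<close> is injective, so the image intervals stay disjoint, and Lipschitz, so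
  the null set stays null. Outer regularity then replaces \<open>U\<close> by
  \<open>A\<close>.\<close>

lemma outer_measure_bilipschitz_image_le:
  fixes F :: "real \<Rightarrow> real"
  assumes c: "0 < c" and F: "\<And>x y. x \<le> y \<Longrightarrow> c * (y - x) \<le> F y - F x \<and> F y - F x \<le> M * (y - x)"
    and p: "0 < p"
    and A: "\<And>x \<delta>. x \<in> A \<Longrightarrow> 0 < \<delta> \<Longrightarrow> \<exists>a b. a < b \<and> a \<le> x \<and> x \<le> b \<and> b - a < \<delta> \<and> F b - F a \<le> p * (b - a)"
  shows "outer_measure_of lebesgue (F ` A) \<le> ennreal p * outer_measure_of lebesgue A"
proof -
  have mono: "F x \<le> F y" if "x \<le> y" for x y
    using F[OF that] mult_nonneg_nonneg[of c "y - x"] c that by linarith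
  have smono: "F x < F y" if "x < y" for x y
    using F[of x y] mult_pos_pos[of c "y - x"] c that by linarith
  have M: "0 \<le> M" using F[of 0 1] c by simp
  have lip: "\<bar>F y - F x\<bar> \<le> M * \<bar>y - x\<bar>" for x y
    using F[of x y] F[of y x] mono[of x y] mono[of y x] by (cases "x \<le> y") auto
  have cont: "continuous_on UNIV F"
    by (rule lipschitz_on_continuous_on[of M], rule lipschitz_onI) (use lip M in \<open>auto simp: dist_real_def\<close>)
  have img: "F ` {a..b} = {F a..F b}" if "a \<le> b" for a b
  proof -
    have "y \<in> F ` {a..b}" if "F a \<le> y" "y \<le> F b" for y
      using IVT'[of F a y b] that \<open>a \<le> b\<close> continuous_on_subset[OF cont] by (metis atLeastAtMost_iff image_eqI subset_UNIV)
    then show ?thesis using mono by auto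
  qed
  have open_case: "outer_measure_of lebesgue (F ` A) \<le> ennreal p * emeasure lebesgue U"
    if U: "open U" "A \<subseteq> U" for U
  proof -
    define K where "K = {(a,b). a < b \<and> {a..b} \<subseteq> U \<and> F b - F a \<le> p * (b - a)}"
    define ctr where "ctr = (\<lambda>(a,b). (a + b) / 2 :: real)"
    define rad where "rad = (\<lambda>(a,b). (b - a) / 2 :: real)"
    have cb: "cball (ctr i) (rad i) = {fst i..snd i}" for i
      by (cases i) (simp add: ctr_def rad_def cball_midpoint_eq_Icc)
    obtain C where C: "countable C" "C \<subseteq> K"
      and disj: "pairwise (\<lambda>i j. disjnt (cball (ctr i) (rad i)) (cball (ctr j) (rad j))) C"
      and neg: "negligible (A - (\<Union>i\<in>C. cball (ctr i) (rad i)))"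
    proof (rule Vitali_covering_theorem_cballs[of K rad A ctr])
      show "0 < rad i" if "i \<in> K" for i using that by (auto simp: K_def rad_def)
      fix x d :: real assume x: "x \<in> A" "0 < d"
      obtain e where e: "e > 0" "ball x e \<subseteq> U" using U x openE by blast
      obtain a b where ab: "a < b" "a \<le> x" "x \<le> b" "b - a < min d e" "F b - F a \<le> p * (b - a)"
        using A[OF x(1), of "min d e"] x e by auto
      have "{a..b} \<subseteq> ball x e" using ab by (auto simp: dist_real_def)
      then have "(a,b) \<in> K" using ab e by (auto simp: K_def)
      moreover have "x \<in> cball (ctr (a,b)) (rad (a,b))" using ab by (simp add: cb)
      moreover have "rad (a,b) < d" using ab by (simp add: rad_def)
      ultimately show "\<exists>i. i \<in> K \<and> x \<in> cball (ctr i) (rad i) \<and> rad i < d" by blast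
    qed auto
    define N where "N = A - (\<Union>i\<in>C. {fst i..snd i})"
    have "negligible N" using neg by (simp add: N_def cb)
    then have Nn: "negligible (F ` N)"
      by (rule negligible_locally_Lipschitz_image[rotated])
        (auto intro!: exI[of _ UNIV] exI[of _ M] simp: lip)
    have CK: "fst i < snd i" "{fst i..snd i} \<subseteq> U" "F (snd i) - F (fst i) \<le> p * (snd i - fst i)" if "i \<in> C" for i
      using C(2) that unfolding K_def by (cases i; fastforce)+
    have disj1: "disjoint_family_on (\<lambda>i. {fst i..snd i}) C"
      using disj by (auto simp: disjoint_family_on_def pairwise_def cb disjnt_def)
    have inj: "inj F" using smono by (metis injI linorder_neqE_linordered_idom order_less_irrefl)
    have disj2: "disjoint_family_on (\<lambda>i. {F (fst i)..F (snd i)}) C"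
      unfolding disjoint_family_on_def
    proof (intro ballI impI)
      fix i j assume ij: "i \<in> C" "j \<in> C" "i \<noteq> j"
      have "{fst i..snd i} \<inter> {fst j..snd j} = {}" using disj1 ij by (auto simp: disjoint_family_on_def)
      then have "F ` {fst i..snd i} \<inter> F ` {fst j..snd j} = {}"
        using inj by (simp add: image_Int[symmetric])
      then show "{F (fst i)..F (snd i)} \<inter> {F (fst j)..F (snd j)} = {}"
        using CK ij by (metis img less_imp_le)
    qed
    let ?V = "\<Union>i\<in>C. {F (fst i)..F (snd i)}"
    have sub: "F ` A \<subseteq> F ` N \<union> ?V"
    proof
      fix y assume "y \<in> F ` A"
      then obtain x where x: "x \<in> A" "y = F x" by auto
      show "y \<in> F ` N \<union> ?V"
      proof (cases "x \<in> N")
        case False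
        then obtain i where "i \<in> C" "fst i \<le> x" "x \<le> snd i" using x by (auto simp: N_def)
        then show ?thesis using x mono by (intro UnI2 UN_I[of i]) auto
      qed (use x in auto)
    qed
    have Vs: "?V \<in> sets lebesgue" by (intro sets.countable_UN'' C) auto
    have Ns: "F ` N \<in> null_sets lebesgue" using Nn by (simp add: negligible_iff_null_sets)
    have "outer_measure_of lebesgue (F ` A) \<le> outer_measure_of lebesgue (F ` N \<union> ?V)"
      by (rule outer_measure_of_mono[OF sub])
    also have "\<dots> = emeasure lebesgue (F ` N \<union> ?V)" using Vs Ns by (intro outer_measure_of_eq) auto
    also have "\<dots> \<le> emeasure lebesgue (F ` N) + emeasure lebesgue ?V"
      using Vs Ns by (intro emeasure_subadditive) auto
    also have "\<dots> = emeasure lebesgue ?V" using Ns by auto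
    also have "\<dots> = (\<integral>\<^sup>+i. emeasure lebesgue {F (fst i)..F (snd i)} \<partial>count_space C)"
      using C disj2 by (intro emeasure_UN_countable) auto
    also have "\<dots> \<le> (\<integral>\<^sup>+i. ennreal p * emeasure lebesgue {fst i..snd i} \<partial>count_space C)"
    proof (rule nn_integral_mono)
      fix i assume "i \<in> space (count_space C)"
      then have i: "i \<in> C" by simp
      have "emeasure lebesgue {F (fst i)..F (snd i)} = ennreal (F (snd i) - F (fst i))"
        using mono CK[OF i] by simp
      also have "\<dots> \<le> ennreal (p * (snd i - fst i))" using CK[OF i] by (intro ennreal_leI)
      also have "\<dots> = ennreal p * emeasure lebesgue {fst i..snd i}" using p CK[OF i] by (simp add: ennreal_mult)
      finally show "emeasure lebesgue {F (fst i)..F (snd i)} \<le> ennreal p * emeasure lebesgue {fst i..snd i}" .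
    qed
    also have "\<dots> = ennreal p * (\<integral>\<^sup>+i. emeasure lebesgue {fst i..snd i} \<partial>count_space C)"
      by (rule nn_integral_cmult) auto
    also have "\<dots> = ennreal p * emeasure lebesgue (\<Union>i\<in>C. {fst i..snd i})"
      using C disj1 by (subst emeasure_UN_countable) auto
    also have "\<dots> \<le> ennreal p * emeasure lebesgue U"
      using U CK(2) by (intro mult_left_mono emeasure_mono UN_least) auto
    finally show ?thesis .
  qed
  obtain E where E: "E \<in> sets lebesgue" "A \<subseteq> E" "outer_measure_of lebesgue A = emeasure lebesgue E"
    using outer_measure_of_attain[of A lebesgue] by auto
  have "outer_measure_of lebesgue (F ` A) \<le> ennreal p * emeasure lebesgue E + ennreal e" if e: "e > 0" for e
  proof -
    obtain U where U: "open U" "E \<subseteq> U" "U - E \<in> lmeasurable" "emeasure lebesgue (U - E) < ennreal (e / p)"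
      using sets_lebesgue_outer_open[OF E(1), of "e/p"] e p by auto
    have "emeasure lebesgue U \<le> emeasure lebesgue (E \<union> (U - E))"
      using U E(1) by (intro emeasure_mono) auto
    also have "\<dots> \<le> emeasure lebesgue E + emeasure lebesgue (U - E)"
      using U E by (intro emeasure_subadditive) (auto simp: fmeasurable_def)
    also have "\<dots> \<le> emeasure lebesgue E + ennreal (e / p)" using U by (intro add_left_mono) auto
    finally have "ennreal p * emeasure lebesgue U \<le> ennreal p * (emeasure lebesgue E + ennreal (e / p))"
      by (rule mult_left_mono) auto
    also have "\<dots> = ennreal p * emeasure lebesgue E + ennreal e"
      using p e by (simp add: distrib_left ennreal_mult[symmetric])
    finally show ?thesis using open_case[OF U(1)] U(2) E(2) by (meson order_trans)
  qed
  then show ?thesis unfolding E(3) by (rule ennreal_le_epsilon)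
qed

text \<open>On a set where quotients below \<open>p\<close> and above \<open>q > p\<close> both
  occur at arbitrarily small scales, the stretching estimate for \<open>F\<close> gives a factor
  \<open>p\<close>, and the one for the inverse \<open>G\<close> a factor \<open>1 / q\<close> on
  the way back. The outer measure is thus at most \<open>p / q\<close> times itself. The lower bound
  \<open>c > 0\<close> is what makes \<open>G\<close> Lipschitz.\<close>

lemma bilipschitz_differentiable_ae:
  fixes F :: "real \<Rightarrow> real"
  assumes c: "0 < c" and F: "\<And>x y. x \<le> y \<Longrightarrow> c * (y - x) \<le> F y - F x \<and> F y - F x \<le> M * (y - x)"
  shows "negligible {x. \<not> (\<exists>D. ((\<lambda>h. (F (x + h) - F x) / h) \<longlongrightarrow> D) (at 0))}"
proof -
  define Q where "Q x h = (F (x + h) - F x) / h" for x h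
  \<comment> \<open>The bound \<open>k\<close> makes the outer measure finite, so that it can be
    cancelled at the end; countably many choices of \<open>p\<close>, \<open>q\<close>,
    \<open>k\<close> exhaust the exceptional set.\<close>
  define A where "A p q k = {x. \<bar>x\<bar> \<le> k \<and> (\<exists>\<^sub>F h in at 0. Q x h < p) \<and> (\<exists>\<^sub>F h in at 0. q < Q x h)}" for p q k :: real
  have smono: "F x < F y" if "x < y" for x y
    using F[of x y] mult_pos_pos[of c "y - x"] c that by linarith
  have inj: "inj F" using smono by (metis injI linorder_neqE_linordered_idom order_less_irrefl)
  have M: "0 < M" using F[of 0 1] c by simp
  have lip: "\<bar>F y - F x\<bar> \<le> M * \<bar>y - x\<bar>" for x y
    using F[of x y] F[of y x] smono[of x y] smono[of y x] by (cases "x < y"; cases "x = y") auto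
  have cont: "continuous_on UNIV F"
    by (rule lipschitz_on_continuous_on[of M], rule lipschitz_onI) (use lip M in \<open>auto simp: dist_real_def\<close>)
  have surj: "\<exists>x. F x = y" for y
  proof -
    define a where "a = - (\<bar>y - F 0\<bar> / c)"
    define b where "b = \<bar>y - F 0\<bar> / c"
    have ab: "a \<le> 0" "0 \<le> b" using c by (auto simp: a_def b_def)
    have "c * b \<le> F b - F 0" using F[of 0 b] ab by auto
    moreover have "c * (-a) \<le> F 0 - F a" using F[of a 0] ab by auto
    moreover have "c * b = \<bar>y - F 0\<bar>" "c * (-a) = \<bar>y - F 0\<bar>" using c by (auto simp: a_def b_def)
    ultimately have "F a \<le> y" "y \<le> F b" by linarith+
    then show ?thesis using IVT'[of F a y b] ab continuous_on_subset[OF cont] by (metis order_trans subset_UNIV)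
  qed
  define G where "G = inv F"
  have FG: "F (G y) = y" for y using surj by (metis G_def f_inv_into_f rangeI)
  have GF: "G (F x) = x" for x using inj by (simp add: G_def)
  have Gmono: "G x \<le> G y" if "x \<le> y" for x y using smono FG that by (metis linorder_not_le)
  have G: "inverse M * (y - x) \<le> G y - G x \<and> G y - G x \<le> inverse c * (y - x)" if "x \<le> y" for x y
    using F[OF Gmono[OF that]] c M by (auto simp: FG field_simps)
  have neg: "negligible (A p q k)" if pq: "0 < p" "p < q" for p q k
  proof -
    have ivl: "\<exists>a b. a < b \<and> a \<le> x \<and> x \<le> b \<and> b - a < \<delta> \<and> P ((F b - F a) / (b - a))"
      if ex: "\<exists>\<^sub>F h in at 0. P (Q x h)" and d: "0 < \<delta>" for x \<delta> P
    proof -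
      have "\<exists>h. h \<noteq> 0 \<and> \<bar>h\<bar> < \<delta> \<and> P (Q x h)"
        using ex d unfolding frequently_at by (auto simp: dist_real_def)
      then obtain h where h: "h \<noteq> 0" "\<bar>h\<bar> < \<delta>" "P (Q x h)" by auto
      show ?thesis
      proof (cases "h > 0")
        case True then show ?thesis using h by (intro exI[of _ x] exI[of _ "x+h"]) (auto simp: Q_def)
      next
        case False
        then have "(F x - F (x + h)) / (x - (x + h)) = Q x h" using h by (simp add: Q_def divide_simps) (simp add: algebra_simps)?
        then show ?thesis using h False by (intro exI[of _ "x+h"] exI[of _ x]) auto
      qed
    qed
    let ?m = "outer_measure_of lebesgue"
    have 1: "?m (F ` A p q k) \<le> ennreal p * ?m (A p q k)"
    proof (rule outer_measure_bilipschitz_image_le[OF c F pq(1)])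
      fix x \<delta> :: real assume "x \<in> A p q k" "0 < \<delta>"
      then show "\<exists>a b. a < b \<and> a \<le> x \<and> x \<le> b \<and> b - a < \<delta> \<and> F b - F a \<le> p * (b - a)"
        using ivl[of "\<lambda>r. r < p" x \<delta>] by (auto simp: A_def field_simps) (metis less_imp_le)
    qed
    have 2: "?m (G ` (F ` A p q k)) \<le> ennreal (inverse q) * ?m (F ` A p q k)"
    proof (rule outer_measure_bilipschitz_image_le[OF _ G])
      fix y \<delta> :: real assume y: "y \<in> F ` A p q k" "0 < \<delta>"
      then obtain x where x: "x \<in> A p q k" "y = F x" by auto
      obtain a b where ab: "a < b" "a \<le> x" "x \<le> b" "b - a < \<delta> / M" "q < (F b - F a) / (b - a)"
        using ivl[of "\<lambda>r. r > q" x "\<delta> / M"] x y M by (auto simp: A_def)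
      have "F b - F a \<le> M * (b - a)" using F ab by auto
      also have "\<dots> < \<delta>" using ab M by (simp add: field_simps)
      finally have "F b - F a < \<delta>" .
      moreover have "b - a \<le> inverse q * (F b - F a)" using ab pq by (simp add: field_simps)
      moreover have "F a < F b" "F a \<le> y" "y \<le> F b" using ab x smono by (auto simp: less_eq_real_def)
      ultimately show "\<exists>a b. a < b \<and> a \<le> y \<and> y \<le> b \<and> b - a < \<delta> \<and> G b - G a \<le> inverse q * (b - a)"
        by (intro exI[of _ "F a"] exI[of _ "F b"]) (auto simp: GF)
    qed (use M pq in auto)
    have GFA: "G ` (F ` A p q k) = A p q k" by (auto simp: image_image GF)
    have fin: "?m (A p q k) < \<infinity>"
    proof -
      have "?m (A p q k) \<le> ?m {-k..k}" by (intro outer_measure_of_mono) (auto simp: A_def)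
      also have "\<dots> < \<infinity>" by (simp add: emeasure_lborel_Icc_eq)
      finally show ?thesis .
    qed
    then obtain r where r: "?m (A p q k) = ennreal r" "0 \<le> r" by (cases "?m (A p q k)") auto
    have "?m (A p q k) \<le> ennreal (inverse q) * (ennreal p * ?m (A p q k))"
      using 2 1 unfolding GFA by (meson mult_left_mono order_trans zero_le)
    then have "ennreal r \<le> ennreal (inverse q * (p * r))" using r pq by (simp add: ennreal_mult)
    then have "r \<le> inverse q * (p * r)" using r pq by (simp add: ennreal_le_iff)
    then have "q * r \<le> p * r" using pq by (simp add: field_simps)
    then have "r = 0" using r pq by (simp add: mult_le_cancel_right)
    then have z: "?m (A p q k) = 0" using r by simp
    obtain E where "E \<in> sets lebesgue" "A p q k \<subseteq> E" "?m (A p q k) = emeasure lebesgue E"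
      using outer_measure_of_attain[of "A p q k" lebesgue] by auto
    then have "negligible E" using z by (auto simp: negligible_iff_null_sets null_sets_def)
    then show ?thesis using \<open>A p q k \<subseteq> E\<close> negligible_subset by blast
  qed
  have Qb: "c \<le> Q x h \<and> Q x h \<le> M" if "h \<noteq> 0" for x h
  proof (cases "h > 0")
    case True then show ?thesis using F[of x "x+h"] by (simp add: Q_def field_simps)
  next
    case False then show ?thesis using F[of "x+h" x] that by (simp add: Q_def field_simps)
  qed
  have conv: "\<exists>D. ((\<lambda>h. Q x h) \<longlongrightarrow> D) (at 0)"
    if no: "\<And>p q k. p \<in> \<rat> \<Longrightarrow> q \<in> \<rat> \<Longrightarrow> 0 < p \<Longrightarrow> p < q \<Longrightarrow> x \<notin> A p q (real k)" for x
  proof -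
    let ?q = "\<lambda>h. ereal (Q x h)"
    let ?l = "Liminf (at 0) ?q" let ?u = "Limsup (at 0) ?q"
    have nt: "at (0::real) \<noteq> bot" by simp
    have ev: "\<forall>\<^sub>F h in at 0. ereal c \<le> ?q h \<and> ?q h \<le> ereal M"
      using Qb by (auto simp: eventually_at intro!: exI[of _ 1])
    have lc: "ereal c \<le> ?l" by (rule Liminf_bounded) (use ev in \<open>auto elim: eventually_mono\<close>)
    have uM: "?u \<le> ereal M" by (rule Limsup_bounded) (use ev in \<open>auto elim: eventually_mono\<close>)
    have lu: "?l \<le> ?u" by (rule Liminf_le_Limsup[OF nt])
    have "?l = ?u"
    proof (rule ccontr)
      assume "?l \<noteq> ?u"
      then have lt: "?l < ?u" using lu by simp
      define l u where "l = real_of_ereal ?l" and "u = real_of_ereal ?u"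
      have l: "?l = ereal l" and u: "?u = ereal u"
        using lc uM lu unfolding l_def u_def by (cases ?l; cases ?u; auto)+
      have "l < u" "c \<le> l" using lt lc l u by auto
      then obtain p where p: "p \<in> \<rat>" "l < p" "p < u" using Rats_dense_in_real by blast
      then obtain q where q: "q \<in> \<rat>" "p < q" "q < u" using Rats_dense_in_real by blast
      have "\<exists>\<^sub>F h in at 0. Q x h < p"
      proof (rule ccontr)
        assume "\<not> ?thesis"
        then have "\<forall>\<^sub>F h in at 0. ereal p \<le> ?q h" by (simp add: frequently_def not_less)
        then have "ereal p \<le> ?l" by (rule Liminf_bounded)
        then show False using l p by simp
      qed
      moreover have "\<exists>\<^sub>F h in at 0. q < Q x h"
      proof (rule ccontr)
        assume "\<not> ?thesis"
        then have "\<forall>\<^sub>F h in at 0. ?q h \<le> ereal q" by (simp add: frequently_def not_less)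
        then have "?u \<le> ereal q" by (rule Limsup_bounded)
        then show False using u q by simp
      qed
      moreover obtain k where "\<bar>x\<bar> \<le> real k" using real_arch_simple by blast
      ultimately have "x \<in> A p q (real k)" by (simp add: A_def)
      then show False using no[of p q k] p q \<open>c \<le> l\<close> c by simp
    qed
    moreover obtain l where "?l = ereal l" using lc uM lu by (cases ?l) auto
    ultimately have "(?q \<longlongrightarrow> ereal l) (at 0)" using Liminf_eq_Limsup[OF nt] by metis
    then show ?thesis by auto
  qed
  have "{x. \<not> (\<exists>D. ((\<lambda>h. (F (x + h) - F x) / h) \<longlongrightarrow> D) (at 0))}
     \<subseteq> (\<Union>p\<in>{p\<in>\<rat>. 0 < p}. \<Union>q\<in>{q\<in>\<rat>. p < q}. \<Union>k. A p q (real k))"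
  proof
    fix x assume x: "x \<in> {x. \<not> (\<exists>D. ((\<lambda>h. (F (x + h) - F x) / h) \<longlongrightarrow> D) (at 0))}"
    show "x \<in> (\<Union>p\<in>{p\<in>\<rat>. 0 < p}. \<Union>q\<in>{q\<in>\<rat>. p < q}. \<Union>k. A p q (real k))"
      by (rule ccontr) (use conv[of x] x in \<open>auto simp: Q_def\<close>)
  qed
  moreover have "negligible (\<Union>p\<in>{p\<in>\<rat>. 0 < p}. \<Union>q\<in>{q\<in>\<rat>. p < q}. \<Union>k. A p q (real k))"
    using neg countable_rat by (intro negligible_countable_Union countable_image) 
      (auto intro!: negligible_countable_Union countable_image intro: countable_subset[OF _ countable_rat])
  ultimately show ?thesis using negligible_subset by blast
qed

lemma lipschitz_real_differentiable_ae:
  fixes f :: "real \<Rightarrow> real"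
  assumes f: "L-lipschitz_on UNIV f"
  shows "negligible {x. \<not> (\<exists>D. ((\<lambda>h. (f (x + h) - f x) / h) \<longlongrightarrow> D) (at 0))}"
proof -
  \<comment> \<open>The tilt puts all difference quotients into
    \<open>[1, 2 * L + 1]\<close>.\<close>
  define F where "F x = f x + (L + 1) * x" for x
  have Fb: "1 * (y - x) \<le> F y - F x \<and> F y - F x \<le> (2 * L + 1) * (y - x)" if "x \<le> y" for x y
  proof -
    have "\<bar>f y - f x\<bar> \<le> L * (y - x)" using lipschitz_onD[OF f, of y x] that by (simp add: dist_real_def)
    then show ?thesis unfolding F_def by (simp add: algebra_simps) linarith
  qed
  have neg: "negligible {x. \<not> (\<exists>D. ((\<lambda>h. (F (x + h) - F x) / h) \<longlongrightarrow> D) (at 0))}"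
    by (rule bilipschitz_differentiable_ae[OF _ Fb]) auto
  show ?thesis
  proof (rule negligible_subset[OF neg], intro subsetI CollectI notI)
    fix x assume x: "x \<in> {x. \<not> (\<exists>D. ((\<lambda>h. (f (x + h) - f x) / h) \<longlongrightarrow> D) (at 0))}"
    assume "\<exists>D. ((\<lambda>h. (F (x + h) - F x) / h) \<longlongrightarrow> D) (at 0)"
    then obtain D where D: "((\<lambda>h. (F (x + h) - F x) / h) \<longlongrightarrow> D) (at 0)" by auto
    have "((\<lambda>h. (F (x + h) - F x) / h - (L + 1)) \<longlongrightarrow> D - (L + 1)) (at 0)"
      by (intro tendsto_intros D)
    then have "((\<lambda>h. (f (x + h) - f x) / h) \<longlongrightarrow> D - (L + 1)) (at 0)"
      by (rule Lim_transform_eventually)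
        (auto simp: eventually_at F_def field_simps intro!: exI[of _ 1])
    then show False using x by auto
  qed
qed

section \<open>Directional derivatives almost everywhere\<close>

text \<open>Fubini along one direction without a change of coordinates: integrating
  \<open>indicator B (x + t *\<^sub>R v)\<close> over \<open>x\<close> gives the measure of
  \<open>B\<close> for every \<open>t\<close>, by translation invariance, while for fixed
  \<open>x\<close> the integral over \<open>t\<close> in \<open>[0, 1]\<close> vanishes.\<close>

lemma null_sets_if_line_sections_null:
  fixes B :: "'a::euclidean_space set"
  assumes B[measurable]: "B \<in> sets borel" and sec: "\<And>x. negligible {t. x + t *\<^sub>R v \<in> B}"
  shows "B \<in> null_sets lborel"
proof -
  let ?I = "\<lambda>x t. indicator B (x + t *\<^sub>R v) * indicator {0..1::real} t :: ennreal"
  have m[measurable]: "case_prod ?I \<in> borel_measurable (lborel \<Otimes>\<^sub>M lborel)" by measurable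
  have "(\<integral>\<^sup>+t. ?I x t \<partial>lborel) = 0" for x
  proof -
    have "{t. x + t *\<^sub>R v \<in> B} \<in> sets borel" by measurable
    then have "{t. x + t *\<^sub>R v \<in> B} \<in> null_sets lborel"
      using sec[of x] by (auto simp: negligible_iff_null_sets null_sets_def)
    then have "AE t in lborel. ?I x t = 0"
      by (rule AE_I'[OF _]) (auto simp: indicator_def)
    then have "(\<integral>\<^sup>+t. ?I x t \<partial>lborel) = (\<integral>\<^sup>+(t::real). 0 \<partial>lborel)" by (rule nn_integral_cong_AE)
    then show ?thesis by simp
  qed
  then have 0: "(\<integral>\<^sup>+x. \<integral>\<^sup>+t. ?I x t \<partial>lborel \<partial>lborel) = 0" by simp
  have "(\<integral>\<^sup>+x. \<integral>\<^sup>+t. ?I x t \<partial>lborel \<partial>lborel) = (\<integral>\<^sup>+t. \<integral>\<^sup>+x. ?I x t \<partial>lborel \<partial>lborel)"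
    using lborel_pair.Fubini'[OF m] by simp
  also have "\<dots> = (\<integral>\<^sup>+t. emeasure lborel B * indicator {0..1::real} t \<partial>lborel)"
  proof (rule nn_integral_cong)
    fix t :: real
    have "(\<integral>\<^sup>+x. ?I x t \<partial>lborel) = (\<integral>\<^sup>+x. indicator B (t *\<^sub>R v + x) \<partial>lborel) * indicator {0..1} t"
      by (subst nn_integral_multc) (auto simp: add.commute)
    also have "(\<integral>\<^sup>+x. indicator B (t *\<^sub>R v + x) \<partial>lborel) = (\<integral>\<^sup>+x. indicator B x \<partial>distr lborel borel ((+) (t *\<^sub>R v)))"
      by (subst nn_integral_distr) auto
    also have "\<dots> = emeasure lborel B" by (subst lborel_distr_plus) simp
    finally show "(\<integral>\<^sup>+x. ?I x t \<partial>lborel) = emeasure lborel B * indicator {0..1} t" .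
  qed
  also have "\<dots> = emeasure lborel B" by (subst nn_integral_cmult) auto
  finally show ?thesis using 0 by auto
qed

definition dirquot :: "('a::real_normed_vector \<Rightarrow> real) \<Rightarrow> 'a \<Rightarrow> 'a \<Rightarrow> real \<Rightarrow> real" where
  "dirquot f v x h = (f (x + h *\<^sub>R v) - f x) / h"

definition dirdiff :: "('a::real_normed_vector \<Rightarrow> real) \<Rightarrow> 'a \<Rightarrow> 'a \<Rightarrow> bool" where
  "dirdiff f v x \<longleftrightarrow> (\<exists>D. (dirquot f v x \<longlongrightarrow> D) (at 0))"

text \<open>The limit is taken along a single sequence so that the function is total and Borel
  measurable; it is the full limit wherever \<open>dirdiff\<close> holds.\<close>

definition dirderiv :: "('a::real_normed_vector \<Rightarrow> real) \<Rightarrow> 'a \<Rightarrow> 'a \<Rightarrow> real" where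
  "dirderiv f v x = lim (\<lambda>k. dirquot f v x (1 / real (Suc k)))"

text \<open>Serves measurability: a Cauchy condition over rational increments is a countable
  combination of Borel conditions on \<open>x\<close>. Continuity of the quotient away from
  increment zero recovers real increments.\<close>

lemma dirdiff_iff_rational_Cauchy:
  fixes f :: "'a::euclidean_space \<Rightarrow> real"
  assumes f: "continuous_on UNIV f"
  shows "dirdiff f v x \<longleftrightarrow> (\<forall>n::nat. \<exists>m::nat. \<forall>r s::rat. r \<noteq> 0 \<and> s \<noteq> 0 \<and> \<bar>real_of_rat r\<bar> < 1 / real (Suc m) \<and> \<bar>real_of_rat s\<bar> < 1 / real (Suc m)
      \<longrightarrow> \<bar>dirquot f v x (real_of_rat r) - dirquot f v x (real_of_rat s)\<bar> \<le> 1 / real (Suc n))" (is "_ \<longleftrightarrow> ?R")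
proof
  assume "dirdiff f v x"
  then obtain D where D: "(dirquot f v x \<longlongrightarrow> D) (at 0)" by (auto simp: dirdiff_def)
  show ?R
  proof
    fix n :: nat
    have "\<forall>\<^sub>F h in at 0. dist (dirquot f v x h) D < 1 / real (Suc n) / 2"
      by (rule tendstoD[OF D]) simp
    then obtain d where d: "d > 0" "\<And>h. h \<noteq> 0 \<Longrightarrow> \<bar>h\<bar> < d \<Longrightarrow> dist (dirquot f v x h) D < 1 / real (Suc n) / 2"
      unfolding eventually_at by (auto simp: dist_real_def)
    obtain m where m: "1 / real (Suc m) < d" using d nat_approx_posE by metis
    have "\<bar>dirquot f v x r - dirquot f v x s\<bar> \<le> 1 / real (Suc n)" 
      if "r \<noteq> 0" "s \<noteq> 0" "\<bar>r\<bar> < 1 / real (Suc m)" "\<bar>s\<bar> < 1 / real (Suc m)" for r s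
    proof -
      have a: "dist (dirquot f v x r) D < 1 / real (Suc n) / 2" using d(2)[of r] that m by linarith
      have b: "dist (dirquot f v x s) D < 1 / real (Suc n) / 2" using d(2)[of s] that m by linarith
      show ?thesis using dist_triangle_half_l[OF a b] by (simp add: dist_real_def less_imp_le)
    qed
    then show "\<exists>m::nat. \<forall>r s::rat. r \<noteq> 0 \<and> s \<noteq> 0 \<and> \<bar>real_of_rat r\<bar> < 1 / real (Suc m) \<and> \<bar>real_of_rat s\<bar> < 1 / real (Suc m)
      \<longrightarrow> \<bar>dirquot f v x (real_of_rat r) - dirquot f v x (real_of_rat s)\<bar> \<le> 1 / real (Suc n)"
      by (intro exI[of _ m]) auto
  qed
next
  assume R: ?R
  have cq: "continuous (at h) (dirquot f v x)" if "h \<noteq> 0" for h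
  proof -
    have "isCont (\<lambda>h. f (x + h *\<^sub>R v)) h"
      by (rule isCont_o2[of _ "\<lambda>h. x + h *\<^sub>R v"]) (use f in \<open>auto intro!: continuous_intros simp: continuous_on_eq_continuous_at\<close>)
    then show ?thesis using that unfolding dirquot_def by (auto intro!: continuous_intros)
  qed
  have R': "\<exists>m::nat. \<forall>r s. r \<noteq> 0 \<and> s \<noteq> 0 \<and> \<bar>r\<bar> < 1 / real (Suc m) \<and> \<bar>s\<bar> < 1 / real (Suc m)
      \<longrightarrow> \<bar>dirquot f v x r - dirquot f v x s\<bar> \<le> 1 / real (Suc n)" for n
  proof -
    obtain m where m: "\<And>r s::rat. r \<noteq> 0 \<Longrightarrow> s \<noteq> 0 \<Longrightarrow> \<bar>real_of_rat r\<bar> < 1 / real (Suc m) \<Longrightarrow> \<bar>real_of_rat s\<bar> < 1 / real (Suc m)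
      \<Longrightarrow> \<bar>dirquot f v x (real_of_rat r) - dirquot f v x (real_of_rat s)\<bar> \<le> 1 / real (Suc n)"
      using R by metis
    have appr: "\<exists>q::rat. q \<noteq> 0 \<and> \<bar>real_of_rat q\<bar> < 1 / real (Suc m) \<and> \<bar>dirquot f v x (real_of_rat q) - dirquot f v x r\<bar> < e"
      if r: "r \<noteq> 0" "\<bar>r\<bar> < 1 / real (Suc m)" and e: "e > 0" for r e
    proof -
      obtain d where d: "d > 0" "\<And>h. \<bar>h - r\<bar> < d \<Longrightarrow> \<bar>dirquot f v x h - dirquot f v x r\<bar> < e"
        using cq[OF r(1)] e unfolding continuous_at_eps_delta by (auto simp: dist_real_def)
      define d' where "d' = min d (min \<bar>r\<bar> (1 / real (Suc m) - \<bar>r\<bar>))"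
      have d': "d' > 0" using d r by (simp add: d'_def)
      obtain q :: rat where q: "r < real_of_rat q" "real_of_rat q < r + d'"
        using of_rat_dense[of r "r + d'"] d' by auto
      have lt: "\<bar>real_of_rat q - r\<bar> < d" "\<bar>real_of_rat q - r\<bar> < \<bar>r\<bar>" "\<bar>real_of_rat q - r\<bar> < 1 / real (Suc m) - \<bar>r\<bar>"
        using q by (auto simp: d'_def)
      from lt(2) have "q \<noteq> 0" by auto
      moreover have "\<bar>real_of_rat q\<bar> < 1 / real (Suc m)" using lt(3) abs_triangle_ineq2[of "real_of_rat q" r] by linarith
      ultimately show ?thesis using d(2)[OF lt(1)] by blast
    qed
    have "\<bar>dirquot f v x r - dirquot f v x s\<bar> \<le> 1 / real (Suc n)"
      if rs: "r \<noteq> 0" "s \<noteq> 0" "\<bar>r\<bar> < 1 / real (Suc m)" "\<bar>s\<bar> < 1 / real (Suc m)" for r s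
    proof (rule field_le_epsilon)
      fix e :: real assume "e > 0"
      then have e: "e / 2 > 0" by simp
      obtain q where q: "q \<noteq> 0" "\<bar>real_of_rat q\<bar> < 1 / real (Suc m)" "\<bar>dirquot f v x (real_of_rat q) - dirquot f v x r\<bar> < e/2"
        using appr[OF rs(1,3) e] by auto
      obtain q' where q': "q' \<noteq> 0" "\<bar>real_of_rat q'\<bar> < 1 / real (Suc m)" "\<bar>dirquot f v x (real_of_rat q') - dirquot f v x s\<bar> < e/2"
        using appr[OF rs(2,4) e] by auto
      show "\<bar>dirquot f v x r - dirquot f v x s\<bar> \<le> 1 / real (Suc n) + e"
        using m[OF q(1) q'(1) q(2) q'(2)] q(3) q'(3) by linarith
    qed
    then show ?thesis by (intro exI[of _ m]) auto
  qed
  let ?s = "\<lambda>k. dirquot f v x (1 / real (Suc k))"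
  have "Cauchy ?s"
  proof (rule metric_CauchyI)
    fix e :: real assume "e > 0"
    then obtain n where n: "1 / real (Suc n) < e" using nat_approx_posE by metis
    obtain m where m: "\<And>r s. r \<noteq> 0 \<Longrightarrow> s \<noteq> 0 \<Longrightarrow> \<bar>r\<bar> < 1 / real (Suc m) \<Longrightarrow> \<bar>s\<bar> < 1 / real (Suc m)
      \<Longrightarrow> \<bar>dirquot f v x r - dirquot f v x s\<bar> \<le> 1 / real (Suc n)" using R' by metis
    have "dist (?s k) (?s l) < e" if "k \<ge> Suc m" "l \<ge> Suc m" for k l
      using m[of "1 / real (Suc k)" "1 / real (Suc l)"] that n by (simp add: dist_real_def frac_less2)
    then show "\<exists>M. \<forall>m\<ge>M. \<forall>n\<ge>M. dist (?s m) (?s n) < e" by blast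
  qed
  then obtain D where D: "?s \<longlonglongrightarrow> D" using Cauchy_convergent convergent_def by blast
  have "(dirquot f v x \<longlongrightarrow> D) (at 0)"
  proof (rule tendstoI)
    fix e :: real assume "e > 0"
    then obtain n where n: "1 / real (Suc n) < e" using nat_approx_posE by metis
    obtain m where m: "\<And>r s. r \<noteq> 0 \<Longrightarrow> s \<noteq> 0 \<Longrightarrow> \<bar>r\<bar> < 1 / real (Suc m) \<Longrightarrow> \<bar>s\<bar> < 1 / real (Suc m)
      \<Longrightarrow> \<bar>dirquot f v x r - dirquot f v x s\<bar> \<le> 1 / real (Suc n)" using R' by metis
    have "dist (dirquot f v x h) D < e" if h: "h \<noteq> 0" "\<bar>h\<bar> < 1 / real (Suc m)" for h
    proof -
      have "(\<lambda>k. \<bar>dirquot f v x h - ?s k\<bar>) \<longlonglongrightarrow> \<bar>dirquot f v x h - D\<bar>" by (intro tendsto_intros D)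
      moreover have "\<forall>\<^sub>F k in sequentially. \<bar>dirquot f v x h - ?s k\<bar> \<le> 1 / real (Suc n)"
        using eventually_ge_at_top[of "Suc m"]
        by eventually_elim (rule m[OF h(1) _ h(2)], auto simp: frac_less2)
      ultimately have "\<bar>dirquot f v x h - D\<bar> \<le> 1 / real (Suc n)" by (rule tendsto_upperbound) simp
      then show ?thesis using n by (simp add: dist_real_def)
    qed
    then show "\<forall>\<^sub>F h in at 0. dist (dirquot f v x h) D < e"
      by (auto simp: eventually_at dist_real_def intro!: exI[of _ "1 / real (Suc m)"])
  qed
  then show "dirdiff f v x" by (auto simp: dirdiff_def)
qed

lemma lipschitz_borel_measurable:
  fixes f :: "'a::euclidean_space \<Rightarrow> real"
  assumes "L-lipschitz_on UNIV f" shows "f \<in> borel_measurable borel"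
  using assms lipschitz_on_continuous_on borel_measurable_continuous_onI by blast

lemma lipschitz_dirdiff_ae:
  fixes f :: "'a::euclidean_space \<Rightarrow> real"
  assumes f: "L-lipschitz_on UNIV f"
  shows "AE x in lborel. dirdiff f v x"
proof -
  have c: "continuous_on UNIV f" using f lipschitz_on_continuous_on by blast
  have [measurable]: "f \<in> borel_measurable borel" using c borel_measurable_continuous_onI by blast
  have [measurable]: "(\<lambda>x. dirquot f v x h) \<in> borel_measurable borel" for h
    unfolding dirquot_def by measurable
  have "Measurable.pred borel (dirdiff f v)"
    unfolding dirdiff_iff_rational_Cauchy[OF c] by measurable
  then have "Measurable.pred borel (\<lambda>x. \<not> dirdiff f v x)" by measurable
  then have B: "{x. \<not> dirdiff f v x} \<in> sets borel" by (simp add: pred_def)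
  have "{x. \<not> dirdiff f v x} \<in> null_sets lborel"
  proof (rule null_sets_if_line_sections_null[OF B, of v])
    fix x
    let ?g = "\<lambda>t. f (x + t *\<^sub>R v)"
    have g: "(L * norm v)-lipschitz_on UNIV ?g"
    proof (rule lipschitz_onI)
      fix s t :: real
      have "dist (?g s) (?g t) \<le> L * dist (x + s *\<^sub>R v) (x + t *\<^sub>R v)" by (rule lipschitz_onD[OF f]) auto
      also have "dist (x + s *\<^sub>R v) (x + t *\<^sub>R v) = \<bar>s - t\<bar> * norm v"
        by (simp add: dist_norm scaleR_diff_left[symmetric])
      finally show "dist (?g s) (?g t) \<le> L * norm v * dist s t" by (simp add: dist_real_def mult_ac)
    qed (use lipschitz_on_nonneg[OF f] in auto)
    show "negligible {t. x + t *\<^sub>R v \<in> {x. \<not> dirdiff f v x}}"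
      using lipschitz_real_differentiable_ae[OF g]
      by (simp add: dirdiff_def dirquot_def[abs_def] algebra_simps)
  qed
  then show ?thesis by (rule AE_I') auto
qed

lemma dirderiv_LIMSEQ:
  assumes "dirdiff f v x" shows "(dirquot f v x \<longlongrightarrow> dirderiv f v x) (at 0)"
    "(\<lambda>k. dirquot f v x (1 / real (Suc k))) \<longlonglongrightarrow> dirderiv f v x"
proof -
  obtain D where D: "(dirquot f v x \<longlongrightarrow> D) (at 0)" using assms by (auto simp: dirdiff_def)
  have "(\<lambda>k. dirquot f v x (1 / real (Suc k))) \<longlonglongrightarrow> D"
    by (rule filterlim_compose[OF D])
      (use LIMSEQ_inverse_real_of_nat in \<open>auto simp: filterlim_at inverse_eq_divide\<close>)
  then show "(dirquot f v x \<longlongrightarrow> dirderiv f v x) (at 0)"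
    "(\<lambda>k. dirquot f v x (1 / real (Suc k))) \<longlonglongrightarrow> dirderiv f v x"
    using D by (simp_all add: dirderiv_def limI)
qed

lemma dirquot_bound:
  assumes "L-lipschitz_on UNIV f" shows "\<bar>dirquot f v x h\<bar> \<le> L * norm v"
proof (cases "h = 0")
  case False
  have "\<bar>f (x + h *\<^sub>R v) - f x\<bar> \<le> L * (\<bar>h\<bar> * norm v)"
    using lipschitz_onD[OF assms, of "x + h *\<^sub>R v" x] by (simp add: dist_norm)
  then show ?thesis using False by (simp add: dirquot_def divide_le_eq mult_ac)
qed (use lipschitz_on_nonneg[OF assms] in \<open>auto simp: dirquot_def\<close>)

text \<open>\<open>1 + h / C\<close> is a nonnegative density whose measure agrees with Lebesgue
  measure on boxes, hence everywhere; densities are unique almost everywhere.\<close>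

lemma AE_zero_if_box_integrals_zero:
  fixes h :: "'a::euclidean_space \<Rightarrow> real"
  assumes [measurable]: "h \<in> borel_measurable borel" and C: "0 < C" "AE x in lborel. \<bar>h x\<bar> \<le> C"
    and box: "\<And>l u. (\<integral>x. indicator (box l u) x * h x \<partial>lborel) = 0"
  shows "AE x in lborel. h x = 0"
proof -
  let ?g = "\<lambda>x. 1 + h x / C"
  have nn: "AE x in lborel. 0 \<le> ?g x" using C(2) by eventually_elim (use C(1) in \<open>auto simp: field_simps\<close>)
  have "lborel = density lborel (\<lambda>x. ennreal (?g x))"
  proof (rule lborel_eqI)
    fix l u :: 'a assume lu: "\<And>b. b \<in> Basis \<Longrightarrow> l \<bullet> b \<le> u \<bullet> b"
    have ib: "integrable lborel (indicator (box l u) :: 'a \<Rightarrow> real)" by (simp add: emeasure_lborel_box_eq)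
    have ih: "integrable lborel (\<lambda>x. indicator (box l u) x * h x)"
    proof (rule Bochner_Integration.integrable_bound[of _ "\<lambda>x. indicator (box l u) x * C"])
      show "AE x in lborel. norm (indicator (box l u) x * h x) \<le> norm (indicator (box l u) x * C)"
        using C(2) by eventually_elim (use C(1) in \<open>auto simp: indicator_def\<close>)
    qed (use ib in auto)
    have i: "integrable lborel (\<lambda>x. indicator (box l u) x * ?g x)"
      using ib integrable_divide[OF ih, of C] by (simp add: distrib_left)
    have "emeasure (density lborel (\<lambda>x. ennreal (?g x))) (box l u)
        = (\<integral>\<^sup>+x. ennreal (?g x) * indicator (box l u) x \<partial>lborel)" by (subst emeasure_density) auto
    also have "\<dots> = (\<integral>\<^sup>+x. ennreal (indicator (box l u) x * ?g x) \<partial>lborel)"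
      by (intro nn_integral_cong) (auto simp: indicator_def)
    also have "\<dots> = ennreal (\<integral>x. indicator (box l u) x * ?g x \<partial>lborel)"
      using i nn by (intro nn_integral_eq_integral) (auto simp: indicator_def)
    also have "(\<integral>x. indicator (box l u) x * ?g x \<partial>lborel) =
       (\<integral>x. indicator (box l u) x \<partial>lborel) + (\<integral>x. indicator (box l u) x * h x / C \<partial>lborel)"
      using ib integrable_divide[OF ih, of C] by (simp add: distrib_left)
    also have "\<dots> = measure lborel (box l u)" using box[of l u] by simp
    also have "ennreal \<dots> = (\<Prod>b\<in>Basis. (u - l) \<bullet> b)"
      using lu by (simp add: measure_lborel_box_eq inner_diff_left)
    finally show "emeasure (density lborel (\<lambda>x. ennreal (?g x))) (box l u) = (\<Prod>b\<in>Basis. (u - l) \<bullet> b)" .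
  qed simp
  then have "density lborel (\<lambda>x. 1) = density lborel (\<lambda>x. ennreal (?g x))" by (simp add: density_1)
  then have "AE x in lborel. 1 = ennreal (?g x)" by (subst (asm) sigma_finite_measure.density_unique_iff[OF sigma_finite_lborel]) auto
  with nn show ?thesis by eventually_elim (use C in auto)
qed

text \<open>The defect of additivity is the limit of \<open>hk k\<close>, which is the difference of
  two translates of the quotient in direction \<open>w\<close>. In its integral over a box a change
  of variables moves the translation onto the box; what remains lives on the difference between the
  box and its translate, which shrinks to a null set.\<close>

lemma dirderiv_add_ae:
  fixes f :: "'a::euclidean_space \<Rightarrow> real"
  assumes f: "L-lipschitz_on UNIV f"
  shows "AE x in lborel. dirderiv f (v + w) x = dirderiv f v x + dirderiv f w x"
proof -
  have [measurable]: "f \<in> borel_measurable borel" by (rule lipschitz_borel_measurable[OF f])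
  have qm[measurable]: "(\<lambda>x. dirquot f v x h) \<in> borel_measurable borel" for h v
    unfolding dirquot_def by measurable
  have dm[measurable]: "dirderiv f v \<in> borel_measurable borel" for v
    unfolding dirderiv_def[abs_def] by measurable
  define s where "s k = 1 / real (Suc k)" for k
  have s: "s k > 0" "s k \<le> 1" for k by (auto simp: s_def)
  have s0: "s \<longlonglongrightarrow> 0" unfolding s_def using LIMSEQ_inverse_real_of_nat by (simp add: inverse_eq_divide)
  define h where "h x = dirderiv f (v + w) x - dirderiv f v x - dirderiv f w x" for x
  define hk where "hk k x = dirquot f (v + w) x (s k) - dirquot f v x (s k) - dirquot f w x (s k)" for k x
  define C where "C = 2 * (L * norm w) + 1"
  have L: "0 \<le> L" using lipschitz_on_nonneg[OF f] .
  have C: "0 < C" unfolding C_def using L by (simp add: add_nonneg_pos)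
  have hk_eq: "hk k x = dirquot f w (x + s k *\<^sub>R v) (s k) - dirquot f w x (s k)" for k x
    using s[of k] by (simp add: hk_def dirquot_def field_simps scaleR_add_right add.assoc)
  have hkb: "\<bar>hk k x\<bar> \<le> C" for k x
    using dirquot_bound[OF f, of w "x + s k *\<^sub>R v" "s k"] dirquot_bound[OF f, of w x "s k"]
    unfolding hk_eq C_def by linarith
  have lim: "AE x in lborel. (\<lambda>k. hk k x) \<longlonglongrightarrow> h x"
    using lipschitz_dirdiff_ae[OF f, of "v + w"] lipschitz_dirdiff_ae[OF f, of v] lipschitz_dirdiff_ae[OF f, of w]
    by eventually_elim (unfold hk_def h_def s_def, intro tendsto_diff dirderiv_LIMSEQ(2))
  have [measurable]: "h \<in> borel_measurable borel" "hk k \<in> borel_measurable borel" for k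
    unfolding h_def[abs_def] hk_def[abs_def] by measurable
  have hb: "AE x in lborel. \<bar>h x\<bar> \<le> C"
    using lim
  proof eventually_elim
    fix x assume "(\<lambda>k. hk k x) \<longlonglongrightarrow> h x"
    then have "(\<lambda>k. \<bar>hk k x\<bar>) \<longlonglongrightarrow> \<bar>h x\<bar>" by (rule tendsto_rabs)
    then show "\<bar>h x\<bar> \<le> C" by (rule LIMSEQ_le_const2) (use hkb in auto)
  qed
  have "AE x in lborel. h x = 0"
  proof (rule AE_zero_if_box_integrals_zero[OF _ C hb])
    fix l u :: 'a
    let ?B = "box l u"
    have fin: "integrable lborel (\<lambda>x. indicator ?B x * C)" by (simp add: emeasure_lborel_box_eq)
    have lim1: "(\<lambda>k. \<integral>x. indicator ?B x * hk k x \<partial>lborel) \<longlonglongrightarrow> (\<integral>x. indicator ?B x * h x \<partial>lborel)"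
    proof (rule integral_dominated_convergence[OF _ _ fin])
      show "AE x in lborel. (\<lambda>k. indicator ?B x * hk k x) \<longlonglongrightarrow> indicator ?B x * h x"
        using lim by eventually_elim (intro tendsto_intros)
      show "AE x in lborel. norm (indicator ?B x * hk k x) \<le> indicator ?B x * C" for k
        by (rule AE_I2) (simp add: indicator_def hkb)
    qed measurable
    obtain R where SR: "?B \<subseteq> cball 0 R" using bounded_box[of l u] by (meson bounded_iff mem_cball_0 subsetI)
    define B' where "B' = cball (0::'a) (\<bar>R\<bar> + norm v)"
    \<comment> \<open>The signed difference between the translated box and the box. Off the frontier
      of the box it is eventually zero, and the fixed ball \<open>B'\<close> dominates it for all
      \<open>k\<close>.\<close>
    define g where "g k x = indicator ?B (x - s k *\<^sub>R v) - (indicator ?B x :: real)" for k x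
    have [measurable]: "g k \<in> borel_measurable borel" for k unfolding g_def[abs_def] by measurable
    have gB': "\<bar>g k x\<bar> \<le> indicator B' x" for k x
    proof (cases "x \<in> B'")
      case False
      have "norm (s k *\<^sub>R v) \<le> norm v" using s[of k] by (simp add: mult_left_le_one_le)
      moreover have "norm x \<le> norm (x - s k *\<^sub>R v) + norm (s k *\<^sub>R v)" using norm_triangle_ineq[of "x - s k *\<^sub>R v" "s k *\<^sub>R v"] by simp
      moreover have "norm x > \<bar>R\<bar> + norm v" using False by (simp add: B'_def)
      ultimately have "\<not> norm (x - s k *\<^sub>R v) \<le> R" "\<not> norm x \<le> R"
        using norm_ge_zero[of v] abs_ge_self[of R] by linarith+
      then have "x - s k *\<^sub>R v \<notin> ?B" "x \<notin> ?B" using SR by auto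
      then show ?thesis by (simp add: g_def)
    qed (auto simp: g_def indicator_def)
    have fr: "AE x in lborel. x \<notin> frontier ?B"
      using negligible_convex_frontier[OF convex_box(2), of l u]
      by (intro AE_not_in) (simp add: negligible_iff_null_sets null_sets_def)
    have glim: "AE x in lborel. (\<lambda>k. \<bar>g k x\<bar>) \<longlonglongrightarrow> 0"
      using fr
    proof eventually_elim
      fix x assume x: "x \<notin> frontier ?B"
      have t: "(\<lambda>k. x - s k *\<^sub>R v) \<longlonglongrightarrow> x - 0 *\<^sub>R v" by (intro tendsto_intros s0)
      have "\<forall>\<^sub>F k in sequentially. \<bar>g k x\<bar> = 0"
      proof (cases "x \<in> ?B")
        case True
        then have "\<forall>\<^sub>F k in sequentially. x - s k *\<^sub>R v \<in> ?B" using topological_tendstoD[OF t open_box] by simp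
        then show ?thesis by eventually_elim (use True in \<open>simp add: g_def\<close>)
      next
        case False
        then have "x \<in> - closure ?B" using x by (auto simp: frontier_def interior_open[OF open_box])
        then have "\<forall>\<^sub>F k in sequentially. x - s k *\<^sub>R v \<in> - closure ?B"
          using topological_tendstoD[OF t, of "- closure ?B"] by (simp add: open_Compl del: Compl_iff)
        then show ?thesis by eventually_elim (use False closure_subset in \<open>auto simp: g_def indicator_def\<close>)
      qed
      then show "(\<lambda>k. \<bar>g k x\<bar>) \<longlonglongrightarrow> 0" by (rule tendsto_eventually)
    qed
    have fB': "integrable lborel (indicator B' :: 'a \<Rightarrow> real)"
      unfolding B'_def by (intro integrable_real_indicator) (use emeasure_lborel_cball_finite[of 0 "\<bar>R\<bar> + norm v"] in auto)
    have lim2: "(\<lambda>k. \<integral>x. \<bar>g k x\<bar> \<partial>lborel) \<longlonglongrightarrow> (\<integral>x. (0::real) \<partial>(lborel::'a measure))"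
      by (rule integral_dominated_convergence[OF _ _ fB' glim]) (measurable, simp add: gB')
    have gi: "integrable lborel (\<lambda>x. \<bar>g k x\<bar>)" for k
      by (rule Bochner_Integration.integrable_bound[OF fB']) (measurable, simp add: gB')
    have bd: "\<bar>\<integral>x. indicator ?B x * hk k x \<partial>lborel\<bar> \<le> C * (\<integral>x. \<bar>g k x\<bar> \<partial>lborel)" for k
    proof -
      let ?q = "\<lambda>x. dirquot f w x (s k)"
      have qb: "\<bar>?q x\<bar> \<le> C" for x using dirquot_bound[OF f, of w x "s k"] mult_nonneg_nonneg[OF L norm_ge_zero[of w]]
        unfolding C_def by linarith
      have gq: "\<bar>g k x * ?q x\<bar> \<le> C * \<bar>g k x\<bar>" for x
        using mult_right_mono[OF qb[of x] abs_ge_zero[of "g k x"]] by (simp add: abs_mult mult.commute)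
      have i1: "integrable lborel (\<lambda>x. indicator ?B x * ?q x)"
        by (rule Bochner_Integration.integrable_bound[OF fin]) (use qb C in \<open>auto simp: indicator_def\<close>)
      have i2: "integrable lborel (\<lambda>x. indicator ?B x * ?q (s k *\<^sub>R v + x))"
        by (rule Bochner_Integration.integrable_bound[OF fin]) (use qb C in \<open>auto simp: indicator_def\<close>)
      let ?G = "\<lambda>x. indicator ?B (x - s k *\<^sub>R v) * ?q x"
      have i3: "integrable lborel ?G"
      proof -
        have "integrable (distr lborel borel ((+) (s k *\<^sub>R v))) ?G"
          by (subst integrable_distr_eq) (measurable, use i2 in simp)
        then show ?thesis by (simp add: lborel_distr_plus)
      qed
      have e: "(\<integral>x. indicator ?B x * ?q (s k *\<^sub>R v + x) \<partial>lborel) = (\<integral>x. ?G x \<partial>lborel)"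
      proof -
        have "(\<integral>x. ?G x \<partial>lborel) = (\<integral>x. ?G x \<partial>distr lborel borel ((+) (s k *\<^sub>R v)))"
          by (simp add: lborel_distr_plus)
        also have "\<dots> = (\<integral>x. ?G (s k *\<^sub>R v + x) \<partial>lborel)" by (rule integral_distr) measurable
        finally show ?thesis by simp
      qed
      have "(\<integral>x. indicator ?B x * hk k x \<partial>lborel) = (\<integral>x. indicator ?B x * ?q (s k *\<^sub>R v + x) - indicator ?B x * ?q x \<partial>lborel)"
        by (simp add: hk_eq right_diff_distrib add.commute)
      also have "\<dots> = (\<integral>x. ?G x \<partial>lborel) - (\<integral>x. indicator ?B x * ?q x \<partial>lborel)"
        using i1 i2 e by simp
      also have "\<dots> = (\<integral>x. g k x * ?q x \<partial>lborel)"
        using i1 i3 by (subst Bochner_Integration.integral_diff[symmetric]) (auto simp: g_def left_diff_distrib)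
      finally have "\<bar>\<integral>x. indicator ?B x * hk k x \<partial>lborel\<bar> \<le> (\<integral>x. \<bar>g k x * ?q x\<bar> \<partial>lborel)"
        using integral_abs_bound by metis
      also have "\<dots> \<le> (\<integral>x. C * \<bar>g k x\<bar> \<partial>lborel)"
      proof (rule integral_mono)
        show "integrable lborel (\<lambda>x. \<bar>g k x * ?q x\<bar>)"
          by (rule Bochner_Integration.integrable_bound[OF integrable_mult_right[OF gi[of k], of C]])
            (use gq C in \<open>auto simp: abs_mult\<close>)
      qed (use gi gq in auto)
      finally show ?thesis by simp
    qed
    have "(\<lambda>k. \<integral>x. indicator ?B x * hk k x \<partial>lborel) \<longlonglongrightarrow> 0"
    proof (rule tendsto_rabs_zero_cancel, rule tendsto_sandwich[OF _ _ tendsto_const])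
      have "(\<lambda>k. C * (\<integral>x. \<bar>g k x\<bar> \<partial>lborel)) \<longlonglongrightarrow> C * (\<integral>x. (0::real) \<partial>(lborel::'a measure))" by (intro tendsto_intros lim2)
      then show "(\<lambda>k. C * (\<integral>x. \<bar>g k x\<bar> \<partial>lborel)) \<longlonglongrightarrow> 0" by simp
    qed (use bd in auto)
    then show "(\<integral>x. indicator ?B x * h x \<partial>lborel) = 0" using lim1 LIMSEQ_unique by blast
  qed simp
  then show ?thesis by eventually_elim (simp add: h_def)
qed

lemma dirdiff_scale:
  assumes "dirdiff f v x" shows "dirdiff f (c *\<^sub>R v) x" "dirderiv f (c *\<^sub>R v) x = c * dirderiv f v x"
proof -
  have "(dirquot f (c *\<^sub>R v) x \<longlongrightarrow> c * dirderiv f v x) (at 0)"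
  proof (cases "c = 0")
    case True then show ?thesis by (simp add: dirquot_def[abs_def])
  next
    case False
    have "((\<lambda>h. dirquot f v x (h * c)) \<longlongrightarrow> dirderiv f v x) (at 0)"
    proof (rule filterlim_compose[OF dirderiv_LIMSEQ(1)[OF assms]])
      have "((\<lambda>h. h * c) \<longlongrightarrow> 0 * c) (at 0)" by (intro tendsto_intros)
      then show "filterlim (\<lambda>h. h * c) (at 0) (at 0)"
        using False by (auto simp: filterlim_at eventually_at intro!: exI[of _ 1])
    qed
    then have "((\<lambda>h. c * dirquot f v x (h * c)) \<longlongrightarrow> c * dirderiv f v x) (at 0)" by (intro tendsto_intros)
    then show ?thesis using False by (simp add: dirquot_def[abs_def])
  qed
  then show "dirdiff f (c *\<^sub>R v) x" by (auto simp: dirdiff_def)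
  then have "(dirquot f (c *\<^sub>R v) x \<longlongrightarrow> dirderiv f (c *\<^sub>R v) x) (at 0)" by (rule dirderiv_LIMSEQ)
  then show "dirderiv f (c *\<^sub>R v) x = c * dirderiv f v x"
    using \<open>(dirquot f (c *\<^sub>R v) x \<longlongrightarrow> c * dirderiv f v x) (at 0)\<close> by (rule tendsto_unique[rotated]) simp
qed

lemma dirderiv_basis_ae:
  fixes f :: "'a::euclidean_space \<Rightarrow> real"
  assumes f: "L-lipschitz_on UNIV f"
  shows "AE x in lborel. dirderiv f v x = (\<Sum>b\<in>Basis. (v \<bullet> b) * dirderiv f b x)"
proof -
  have "AE x in lborel. dirderiv f (\<Sum>b\<in>S. (v \<bullet> b) *\<^sub>R b) x = (\<Sum>b\<in>S. (v \<bullet> b) * dirderiv f b x)"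
    if "finite S" for S
    using that
  proof (induction S rule: finite_induct)
    case empty
    have "dirderiv f 0 x = 0" for x :: 'a by (simp add: dirderiv_def dirquot_def)
    then show ?case by simp
  next
    case (insert b S)
    show ?case
      using insert.IH dirderiv_add_ae[OF f, of "(v \<bullet> b) *\<^sub>R b" "\<Sum>b\<in>S. (v \<bullet> b) *\<^sub>R b"] lipschitz_dirdiff_ae[OF f, of b]
      by eventually_elim (use insert.hyps in \<open>simp add: dirdiff_scale\<close>)
  qed
  from this[OF finite_Basis] show ?thesis by (simp add: euclidean_representation)
qed

section \<open>Total differentiability\<close>

text \<open>The exceptional null set depends on the direction, so at one point only countably many
  directions are available. A finite net of the unit sphere taken from a dense set \<open>V\<close>
  suffices, because both \<open>f\<close> and the candidate derivative are Lipschitz.\<close>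

theorem Rademacher_real:
  fixes f :: "'a::euclidean_space \<Rightarrow> real"
  assumes f: "L-lipschitz_on UNIV f"
  shows "AE x in lborel. f differentiable (at x)"
proof -
  obtain V :: "'a set" where V: "countable V" "\<And>U. open U \<Longrightarrow> U \<noteq> {} \<Longrightarrow> \<exists>v\<in>V. v \<in> U"
    using countable_dense_setE[where 'a='a] by metis
  have L: "0 \<le> L" using lipschitz_on_nonneg[OF f] .
  have "AE x in lborel. \<forall>v\<in>V. dirdiff f v x \<and> dirderiv f v x = (\<Sum>b\<in>Basis. (v \<bullet> b) * dirderiv f b x)"
    using lipschitz_dirdiff_ae[OF f] dirderiv_basis_ae[OF f] V(1) by (simp add: AE_ball_countable)
  then show ?thesis
  proof eventually_elim
    fix x assume x: "\<forall>v\<in>V. dirdiff f v x \<and> dirderiv f v x = (\<Sum>b\<in>Basis. (v \<bullet> b) * dirderiv f b x)"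
    define A where "A v = (\<Sum>b\<in>Basis. (v \<bullet> b) * dirderiv f b x)" for v
    have A: "bounded_linear A" unfolding A_def[abs_def]
      by (intro bounded_linear_sum bounded_linear_mult_const bounded_linear_inner_left)
    obtain K where K: "K > 0" "\<And>v. \<bar>A v\<bar> \<le> norm v * K" using bounded_linear.pos_bounded[OF A] by (auto simp: real_norm_def)
    interpret A: bounded_linear A by (rule A)
    have "(f has_derivative A) (at x)"
      unfolding has_derivative_at_alt
    proof (intro conjI allI impI A)
      fix e :: real assume e: "e > 0"
      \<comment> \<open>Three errors per unit length: \<open>L * \<epsilon>\<close> for moving the
        endpoint to a net direction, \<open>\<epsilon>\<close> for the quotient in that direction,
        \<open>K * \<epsilon>\<close> for the linear map.\<close>
      define \<epsilon> where "\<epsilon> = e / (L + K + 1)"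
      have \<epsilon>: "\<epsilon> > 0" using e L K by (simp add: \<epsilon>_def)
      have "sphere (0::'a) 1 \<subseteq> (\<Union>v\<in>V. ball v \<epsilon>)"
      proof
        fix z :: 'a assume "z \<in> sphere 0 1"
        obtain v where "v \<in> V" "v \<in> ball z \<epsilon>" using V(2)[of "ball z \<epsilon>"] \<epsilon> by auto
        then show "z \<in> (\<Union>v\<in>V. ball v \<epsilon>)" by (auto simp: dist_commute)
      qed
      from this obtain W where W: "W \<subseteq> V" "finite W" "sphere (0::'a) 1 \<subseteq> (\<Union>v\<in>W. ball v \<epsilon>)"
        by (rule compactE_image[OF compact_sphere, rotated]) (blast, rule open_ball)
      have "\<forall>v\<in>W. \<exists>d>0. \<forall>h. h \<noteq> 0 \<and> \<bar>h\<bar> < d \<longrightarrow> \<bar>dirquot f v x h - A v\<bar> < \<epsilon>"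
      proof
        fix v assume "v \<in> W"
        then have "(dirquot f v x \<longlongrightarrow> A v) (at 0)" using x W(1) dirderiv_LIMSEQ(1)[of f v x] by (auto simp: A_def)
        then show "\<exists>d>0. \<forall>h. h \<noteq> 0 \<and> \<bar>h\<bar> < d \<longrightarrow> \<bar>dirquot f v x h - A v\<bar> < \<epsilon>"
          using tendstoD[OF _ \<epsilon>, of "dirquot f v x" "A v" "at 0"] by (simp add: eventually_at dist_real_def)
      qed
      then obtain d where d: "\<And>v. v \<in> W \<Longrightarrow> d v > 0" 
        "\<And>v h. v \<in> W \<Longrightarrow> h \<noteq> 0 \<Longrightarrow> \<bar>h\<bar> < d v \<Longrightarrow> \<bar>dirquot f v x h - A v\<bar> < \<epsilon>" by metis
      define \<delta> where "\<delta> = Min (insert 1 (d ` W))"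
      have \<delta>: "\<delta> > 0" "\<And>v. v \<in> W \<Longrightarrow> \<delta> \<le> d v" using W d by (auto simp: \<delta>_def)
      have "norm (f y - f x - A (y - x)) \<le> e * norm (y - x)" if y: "norm (y - x) < \<delta>" for y
      proof (cases "y = x")
        case False
        define t where "t = norm (y - x)"
        have t: "t > 0" using False by (simp add: t_def)
        have "(1 / t) *\<^sub>R (y - x) \<in> sphere 0 1" using t by (simp add: t_def)
        then have "(1 / t) *\<^sub>R (y - x) \<in> (\<Union>v\<in>W. ball v \<epsilon>)" using W(3) by blast
        then obtain v where v: "v \<in> W" "dist v ((1 / t) *\<^sub>R (y - x)) < \<epsilon>" by auto
        define z where "z = t *\<^sub>R v - (y - x)"
        have "z = t *\<^sub>R (v - (1 / t) *\<^sub>R (y - x))" using t by (simp add: z_def scaleR_diff_right)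
        then have z: "norm z \<le> t * \<epsilon>" using v(2) t by (simp add: dist_norm)
        have "\<bar>dirquot f v x t - A v\<bar> < \<epsilon>" using d(2)[OF v(1), of t] t y \<delta>(2)[OF v(1)] by (simp add: t_def)
        moreover have "f (x + t *\<^sub>R v) - f x - t * A v = t * (dirquot f v x t - A v)" using t by (simp add: dirquot_def field_simps)
        ultimately have 1: "\<bar>f (x + t *\<^sub>R v) - f x - t * A v\<bar> \<le> t * \<epsilon>" using t by (simp add: abs_mult)
        have "dist (f y) (f (x + t *\<^sub>R v)) \<le> L * dist y (x + t *\<^sub>R v)" by (rule lipschitz_onD[OF f]) auto
        also have "dist y (x + t *\<^sub>R v) = norm z" by (simp add: dist_norm z_def norm_minus_commute algebra_simps)
        also have "L * norm z \<le> L * (t * \<epsilon>)" using z L by (rule mult_left_mono)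
        finally have 2: "\<bar>f y - f (x + t *\<^sub>R v)\<bar> \<le> L * (t * \<epsilon>)" by (simp add: dist_real_def)
        have "A z = t * A v - A (y - x)" by (simp add: z_def A.diff A.scaleR)
        moreover have "\<bar>A z\<bar> \<le> t * \<epsilon> * K" using K(2)[of z] mult_right_mono[OF z, of K] K(1) by linarith
        ultimately have 3: "\<bar>t * A v - A (y - x)\<bar> \<le> t * \<epsilon> * K" by simp
        have "\<bar>f y - f x - A (y - x)\<bar> \<le> L * (t * \<epsilon>) + t * \<epsilon> + t * \<epsilon> * K" using 1 2 3 by linarith
        also have "\<dots> = t * (\<epsilon> * (L + K + 1))" by (simp add: algebra_simps)
        also have "\<epsilon> * (L + K + 1) = e" using L K by (simp add: \<epsilon>_def)
        finally show ?thesis by (simp add: t_def mult.commute)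
      qed simp
      then show "\<exists>d>0. \<forall>y. norm (y - x) < d \<longrightarrow> norm (f y - f x - A (y - x)) \<le> e * norm (y - x)" using \<delta>(1) by blast
    qed
    then show "f differentiable (at x)" by (auto simp: differentiable_def)
  qed
qed

theorem Rademacher:
  fixes f :: "'a::euclidean_space \<Rightarrow> 'b::euclidean_space"
  assumes f: "L-lipschitz_on UNIV f"
  shows "negligible {x. \<not> f differentiable (at x)}"
proof -
  have "AE x in lborel. \<forall>b\<in>Basis. (\<lambda>x. f x \<bullet> b) differentiable (at x)"
  proof (subst AE_ball_countable[OF countable_finite[OF finite_Basis]], intro ballI Rademacher_real)
    fix b :: 'b assume b: "b \<in> Basis"
    show "L-lipschitz_on UNIV (\<lambda>x. f x \<bullet> b)"
    proof (rule lipschitz_onI)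
      fix x y
      have "dist (f x \<bullet> b) (f y \<bullet> b) \<le> dist (f x) (f y)"
        using Basis_le_norm[OF b, of "f x - f y"] by (simp add: dist_norm inner_diff_left)
      also have "\<dots> \<le> L * dist x y" by (rule lipschitz_onD[OF f]) auto
      finally show "dist (f x \<bullet> b) (f y \<bullet> b) \<le> L * dist x y" .
    qed (rule lipschitz_on_nonneg[OF f])
  qed
  then have "AE x in lborel. f differentiable (at x)"
    by eventually_elim (rule iffD2[OF differentiable_componentwise_within])
  then obtain N where "{x \<in> space lborel. \<not> f differentiable (at x)} \<subseteq> N" "emeasure lborel N = 0" "N \<in> sets lborel"
    by (rule AE_E)
  then have N: "{x. \<not> f differentiable (at x)} \<subseteq> N" "N \<in> null_sets lborel" by (auto simp: null_sets_def)
  then have "negligible N" by (simp add: negligible_iff_null_sets null_sets_completionI)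
  then show ?thesis using N(1) negligible_subset by blast
qed

section \<open>Second-order expansions of convex functions\<close>

text \<open>The counterpart of \<open>subdifferential\<close> for functions that are real-valued on
  the whole space, such as sup-convolutions.\<close>

definition subgradient :: "('a::real_inner \<Rightarrow> real) \<Rightarrow> 'a \<Rightarrow> 'a \<Rightarrow> bool" where
  "subgradient f z \<xi> \<longleftrightarrow> (\<forall>w. f z + \<xi> \<bullet> (w - z) \<le> f w)"

lemma norm_add_scaleR_square:
  fixes u h :: "'a::real_inner"
  shows "(norm (u + t *\<^sub>R h))\<^sup>2 = (norm u)\<^sup>2 + 2 * t * (u \<bullet> h) + t\<^sup>2 * (norm h)\<^sup>2"
  unfolding power2_norm_eq_inner by (simp add: inner_add_left inner_add_right inner_commute power2_eq_square)

lemma subgradient_monotone: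
  assumes "subgradient f z \<xi>" "subgradient f w \<eta>"
  shows "0 \<le> (\<xi> - \<eta>) \<bullet> (z - w)"
  using assms(1)[unfolded subgradient_def, rule_format, of w] assms(2)[unfolded subgradient_def, rule_format, of z]
  by (simp add: inner_diff_left inner_diff_right)

text \<open>Moving from \<open>z + k\<close> a distance comparable to \<open>|k|\<close> in the
  direction of \<open>\<xi> - G\<close>, the subgradient inequality forces \<open>f\<close> above
  the plane of slope \<open>G\<close> by \<open>|\<xi> - G|\<close> times that distance, while the
  paraboloid allows only \<open>c\<close> times the square of a comparable length.\<close>

lemma subgradient_calm_if_touched_above:
  fixes f :: "'a::real_inner \<Rightarrow> real"
  assumes sub: "subgradient f (z + k) \<xi>" and low: "f z + G \<bullet> k \<le> f (z + k)" and c: "0 \<le> c"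
    and up: "\<And>h. f (z + h) \<le> f z + G \<bullet> h + c * (norm h)\<^sup>2"
  shows "norm (\<xi> - G) \<le> 4 * c * norm k"
proof (cases "\<xi> = G")
  case False
  define w where "w = \<xi> - G"
  have w: "norm w > 0" using False by (simp add: w_def)
  have *: "w \<bullet> (h - k) \<le> c * (norm h)\<^sup>2" for h
  proof -
    have "f (z + k) + \<xi> \<bullet> (z + h - (z + k)) \<le> f (z + h)" using sub unfolding subgradient_def by blast
    then have "f (z + k) + \<xi> \<bullet> (h - k) \<le> f z + G \<bullet> h + c * (norm h)\<^sup>2" using up[of h] by simp
    then show ?thesis using low by (simp add: w_def inner_diff_left inner_diff_right)
  qed
  have "norm w \<le> 4 * c * (norm k + e)" if e: "e > 0" for e
  proof -
    \<comment> \<open>The margin \<open>e\<close> keeps \<open>r\<close> positive when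
      \<open>k = 0\<close>.\<close>
    define r where "r = norm k + e"
    have r: "r > 0" using e by (simp add: r_def add_nonneg_pos)
    define h where "h = k + (r / norm w) *\<^sub>R w"
    have "norm h \<le> norm k + r" unfolding h_def using norm_triangle_ineq[of k "(r / norm w) *\<^sub>R w"] w r by simp
    also have "\<dots> \<le> 2 * r" using e by (simp add: r_def)
    finally have "(norm h)\<^sup>2 \<le> (2 * r)\<^sup>2" by (intro power_mono) auto
    then have "c * (norm h)\<^sup>2 \<le> c * (4 * r\<^sup>2)" using c by (intro mult_left_mono) (auto simp: power_mult_distrib)
    moreover have "w \<bullet> (h - k) = r * norm w" using w by (simp add: h_def dot_square_norm power2_eq_square)
    ultimately have "r * norm w \<le> r * (4 * c * r)" using *[of h] by (simp add: power2_eq_square mult_ac)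
    then show ?thesis using r by (simp add: r_def)
  qed
  then have "norm w \<le> 4 * c * norm k + e" if "e > 0" for e
  proof (cases "c = 0")
    case True then show ?thesis using \<open>\<And>e. e > 0 \<Longrightarrow> norm w \<le> 4 * c * (norm k + e)\<close>[OF that] that by simp
  next
    case False
    then have "4 * c * (norm k + e / (4 * c)) = 4 * c * norm k + e" using c by (simp add: field_simps)
    then show ?thesis using \<open>\<And>e. e > 0 \<Longrightarrow> norm w \<le> 4 * c * (norm k + e)\<close>[of "e / (4 * c)"] that c False by simp
  qed
  then show ?thesis unfolding w_def[symmetric] by (rule field_le_epsilon)
qed (use c in simp)

lemma subgradient_eq_if_touched_above:
  fixes f :: "'a::real_inner \<Rightarrow> real"
  assumes sub: "subgradient f z \<xi>" and c: "0 \<le> c"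
    and up: "\<And>h. f (z + h) \<le> f z + G \<bullet> h + c * (norm h)\<^sup>2"
  shows "\<xi> = G"
  using subgradient_calm_if_touched_above[of f z 0 \<xi> G c] sub c up by simp

text \<open>Over equal pieces whose number tends to infinity the quadratic errors sum to zero. This
  replaces a mean value argument for a function whose differentiability is unknown.\<close>

lemma abs_increment_le:
  fixes m :: "real \<Rightarrow> real"
  assumes m: "\<And>s t. 0 \<le> s \<Longrightarrow> s \<le> t \<Longrightarrow> t \<le> 1 \<Longrightarrow> \<bar>m t - m s\<bar> \<le> A * (t - s) + B * (t - s)\<^sup>2"
  shows "\<bar>m 1 - m 0\<bar> \<le> A"
proof -
  have "\<bar>m 1 - m 0\<bar> \<le> A + B * (1 / real (Suc n))" for n
  proof -
    define N where "N = real (Suc n)"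
    have N: "N > 0" by (simp add: N_def)
    have "\<bar>m (real i / N) - m 0\<bar> \<le> real i * (A / N + B / N\<^sup>2)" if "i \<le> Suc n" for i
      using that
    proof (induction i)
      case (Suc i)
      have d: "real (Suc i) / N - real i / N = 1 / N" by (simp add: add_divide_distrib)
      have "\<bar>m (real (Suc i) / N) - m (real i / N)\<bar> \<le> A * (1 / N) + B * (1 / N)\<^sup>2"
        unfolding d[symmetric] using Suc.prems N by (intro m) (auto simp: N_def field_simps)
      moreover have "real (Suc i) * (A / N + B / N\<^sup>2) = real i * (A / N + B / N\<^sup>2) + (A * (1 / N) + B * (1 / N)\<^sup>2)"
        by (simp add: algebra_simps power_divide add_divide_distrib)
      moreover have "\<bar>m (real i / N) - m 0\<bar> \<le> real i * (A / N + B / N\<^sup>2)" using Suc by simp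
      ultimately show ?case by linarith
    qed simp
    have NS: "real (Suc n) = N" by (simp add: N_def)
    have "N * (A / N + B / N\<^sup>2) = A + B * (1 / N)" "N / N = 1" using N by (simp_all add: field_simps power2_eq_square)
    then show ?thesis using \<open>\<And>i. i \<le> Suc n \<Longrightarrow> _ i\<close>[of "Suc n"] unfolding NS by simp
  qed
  moreover have "(\<lambda>n. A + B * (1 / real (Suc n))) \<longlonglongrightarrow> A + B * 0"
    using LIMSEQ_inverse_real_of_nat by (intro tendsto_intros) (simp add: inverse_eq_divide)
  ultimately show ?thesis by (intro LIMSEQ_le_const[where X="\<lambda>n. A + B * (1 / real (Suc n))" and x=A]) auto
qed

text \<open>On the segment from \<open>z\<close> to \<open>z + h\<close>, subgradients at the two
  ends of a piece enclose the increment of \<open>f\<close>. After subtracting the expected linear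
  and quadratic parts, the increments are at most \<open>e |h|^2\<close> times the length, up to
  quadratic errors.\<close>

lemma second_order_of_subgradient_expansion:
  fixes f :: "'a::real_inner \<Rightarrow> real"
  assumes ex: "\<And>w. \<exists>\<xi>. subgradient f w \<xi>" and H: "linear H" and e: "0 \<le> e"
    and exp: "\<And>k \<xi>. norm k < d \<Longrightarrow> subgradient f (z + k) \<xi> \<Longrightarrow> norm (\<xi> - g - H k) \<le> e * norm k"
    and h: "norm h < d"
  shows "\<bar>f (z + h) - f z - g \<bullet> h - (1/2) * (H h \<bullet> h)\<bar> \<le> e * (norm h)\<^sup>2"
proof -
  interpret H: linear H by (rule H)
  define \<xi> where "\<xi> t = (SOME x. subgradient f (z + t *\<^sub>R h) x)" for t
  have \<xi>: "subgradient f (z + t *\<^sub>R h) (\<xi> t)" for t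
    unfolding \<xi>_def using ex by (rule someI_ex)
  define a where "a = H h \<bullet> h"
  define m where "m t = f (z + t *\<^sub>R h) - t * (g \<bullet> h) - t\<^sup>2 / 2 * a" for t
  have E: "\<bar>\<xi> t \<bullet> h - g \<bullet> h - t * a\<bar> \<le> e * (norm h)\<^sup>2" if t: "0 \<le> t" "t \<le> 1" for t
  proof -
    have nt: "norm (t *\<^sub>R h) \<le> norm h" using t by (simp add: mult_left_le_one_le)
    have "norm (\<xi> t - g - H (t *\<^sub>R h)) \<le> e * norm (t *\<^sub>R h)" using exp[OF _ \<xi>] nt h by simp
    also have "\<dots> \<le> e * norm h" using nt e by (rule mult_left_mono)
    finally have "norm (\<xi> t - g - H (t *\<^sub>R h)) * norm h \<le> e * norm h * norm h" by (rule mult_right_mono) simp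
    then have "\<bar>(\<xi> t - g - H (t *\<^sub>R h)) \<bullet> h\<bar> \<le> e * norm h * norm h"
      using Cauchy_Schwarz_ineq2[of "\<xi> t - g - H (t *\<^sub>R h)" h] by linarith
    then show ?thesis by (simp add: a_def H.scale inner_diff_left power2_eq_square mult.assoc)
  qed
  have "\<bar>m 1 - m 0\<bar> \<le> e * (norm h)\<^sup>2"
  proof (rule abs_increment_le[where B="\<bar>a\<bar>"])
    fix s t :: real assume st: "0 \<le> s" "s \<le> t" "t \<le> 1"
    have 1: "f (z + s *\<^sub>R h) + (t - s) * (\<xi> s \<bullet> h) \<le> f (z + t *\<^sub>R h)"
      using \<xi>[of s, unfolded subgradient_def, rule_format, of "z + t *\<^sub>R h"] by (simp add: algebra_simps)
    have 2: "f (z + t *\<^sub>R h) + (s - t) * (\<xi> t \<bullet> h) \<le> f (z + s *\<^sub>R h)"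
      using \<xi>[of t, unfolded subgradient_def, rule_format, of "z + s *\<^sub>R h"] by (simp add: algebra_simps)
    have 3: "(t - s) * (g \<bullet> h + s * a - e * (norm h)\<^sup>2) \<le> (t - s) * (\<xi> s \<bullet> h)"
      using E[of s] st by (intro mult_left_mono) auto
    have 4: "(t - s) * (\<xi> t \<bullet> h) \<le> (t - s) * (g \<bullet> h + t * a + e * (norm h)\<^sup>2)"
      using E[of t] st by (intro mult_left_mono) auto
    have 5: "t\<^sup>2 / 2 * a - s\<^sup>2 / 2 * a = (t - s) * (s * a) + (t - s)\<^sup>2 / 2 * a"
      "t\<^sup>2 / 2 * a - s\<^sup>2 / 2 * a = (t - s) * (t * a) - (t - s)\<^sup>2 / 2 * a"
      by (simp_all add: power2_eq_square field_simps)
    have 6: "\<bar>(t - s)\<^sup>2 / 2 * a\<bar> \<le> \<bar>a\<bar> * (t - s)\<^sup>2"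
      by (simp add: abs_mult mult.commute mult_right_mono)
    show "\<bar>m t - m s\<bar> \<le> e * (norm h)\<^sup>2 * (t - s) + \<bar>a\<bar> * (t - s)\<^sup>2"
      unfolding m_def using 1 2 3 4 5 6 by (simp add: algebra_simps)
  qed
  then show ?thesis by (simp add: m_def a_def)
qed

text \<open>The proximal map of \<open>f\<close> is the inverse of the monotone relation \<open>z \<mapsto> z + \<partial>f(z)\<close>.\<close>

lemma resolvent_exists:
  fixes f :: "'a::euclidean_space \<Rightarrow> real"
  assumes ex: "\<And>w. \<exists>\<xi>. subgradient f w \<xi>" and cont: "continuous_on UNIV f"
  shows "\<exists>z. subgradient f z (y - z)"
proof -
  define F where "F z = f z + (norm (z - y))\<^sup>2 / 2" for z
  obtain \<xi>0 where \<xi>0: "subgradient f 0 \<xi>0" using ex by blast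
  \<comment> \<open>Beyond this radius the quadratic term dominates the affine lower bound of
    \<open>f\<close> from the subgradient at \<open>0\<close>, so a minimum over the ball is
    global.\<close>
  define R where "R = 4 * norm \<xi>0 + 4 * norm y"
  have R: "0 \<le> R" by (simp add: R_def)
  have out: "F 0 \<le> F z" if z: "norm z \<ge> R" for z
  proof -
    have "f z \<ge> f 0 + \<xi>0 \<bullet> z" using \<xi>0 unfolding subgradient_def by (metis diff_zero)
    moreover have "\<xi>0 \<bullet> z \<ge> - (norm \<xi>0 * norm z)" using Cauchy_Schwarz_ineq2[of \<xi>0 z] by linarith
    moreover have "(norm (z - y))\<^sup>2 = (norm z)\<^sup>2 - 2 * (z \<bullet> y) + (norm y)\<^sup>2"
      by (simp add: power2_norm_eq_inner inner_diff_left inner_diff_right inner_commute)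
    moreover have "z \<bullet> y \<le> norm z * norm y" by (rule norm_cauchy_schwarz)
    moreover have "(norm z)\<^sup>2 / 2 \<ge> 2 * (norm \<xi>0 * norm z) + 2 * (norm z * norm y)"
      using mult_left_mono[OF z norm_ge_zero[of z]] by (simp add: R_def power2_eq_square algebra_simps)
    moreover have "0 \<le> norm \<xi>0 * norm z" "0 \<le> norm z * norm y" by simp_all
    moreover have "F 0 = f 0 + (norm y)\<^sup>2 / 2" by (simp add: F_def)
    ultimately show ?thesis unfolding F_def[of z] by linarith
  qed
  have "continuous_on (cball 0 R) F" unfolding F_def
    by (intro continuous_intros continuous_on_subset[OF cont]) auto
  then obtain z where z: "z \<in> cball 0 R" "\<And>w. w \<in> cball 0 R \<Longrightarrow> F z \<le> F w"
    using continuous_attains_inf[of "cball 0 R" F] R by auto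
  have min: "F z \<le> F w" for w
  proof (cases "w \<in> cball 0 R")
    case False
    then show ?thesis using out[of w] z(2)[of 0] R by force
  qed (rule z(2))
  have "subgradient f z (y - z)"
    unfolding subgradient_def
  proof
    fix w
    define h where "h = w - z"
    have st: "(y - z) \<bullet> h \<le> f w - f z + t * ((norm h)\<^sup>2 / 2)" if t: "0 < t" "t \<le> 1" for t
    proof -
      obtain \<xi> where \<xi>: "subgradient f (z + t *\<^sub>R h) \<xi>" using ex by blast
      have "f (z + t *\<^sub>R h) - t * (\<xi> \<bullet> h) \<le> f z"
        using \<xi>[unfolded subgradient_def, rule_format, of z] by simp
      moreover have "w - (z + t *\<^sub>R h) = (1 - t) *\<^sub>R h" by (simp add: h_def algebra_simps)
      then have "f (z + t *\<^sub>R h) + (1 - t) * (\<xi> \<bullet> h) \<le> f w"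
        using \<xi>[unfolded subgradient_def, rule_format, of w] by simp
      ultimately have "(1 - t) * (f (z + t *\<^sub>R h) - t * (\<xi> \<bullet> h)) + t * (f (z + t *\<^sub>R h) + (1 - t) * (\<xi> \<bullet> h)) \<le> (1 - t) * f z + t * f w"
        using t by (intro add_mono mult_left_mono) auto
      then have cv: "f (z + t *\<^sub>R h) \<le> (1 - t) * f z + t * f w" by (simp add: algebra_simps)
      have "(norm (z + t *\<^sub>R h - y))\<^sup>2 = (norm (z - y))\<^sup>2 - 2 * t * ((y - z) \<bullet> h) + t\<^sup>2 * (norm h)\<^sup>2"
        using norm_add_scaleR_square[of "z - y" t h] by (simp add: inner_diff_left algebra_simps)
      then have "t * ((y - z) \<bullet> h) \<le> t * (f w - f z + t * ((norm h)\<^sup>2 / 2))"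
        using min[of "z + t *\<^sub>R h"] cv unfolding F_def by (simp add: algebra_simps power2_eq_square)
      then show ?thesis using t by simp
    qed
    have "((\<lambda>t. f w - f z + t * ((norm h)\<^sup>2 / 2)) \<longlongrightarrow> f w - f z + 0 * ((norm h)\<^sup>2 / 2)) (at_right 0)"
      by (intro tendsto_intros)
    moreover have "\<forall>\<^sub>F t in at_right 0. (y - z) \<bullet> h \<le> f w - f z + t * ((norm h)\<^sup>2 / 2)"
      using st by (auto simp: eventually_at_right_field intro!: exI[of _ 1])
    ultimately have "(y - z) \<bullet> h \<le> f w - f z + 0 * ((norm h)\<^sup>2 / 2)"
      by (rule tendsto_lowerbound) simp
    then show "f z + (y - z) \<bullet> (w - z) \<le> f w" by (simp add: h_def)
  qed
  then show ?thesis ..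
qed

text \<open>Jensen's lemma together with Alexandrov's theorem. The set \<open>K\<close> of points at which a small tilt of the
  touching paraboloid is in contact with \<open>f\<close> is not negligible, since the tilt is a Lipschitz function
  of the contact point; the resolvent is Lipschitz, so some contact point is the image of a point of
  differentiability of the resolvent, whose derivative there is invertible.\<close>

theorem contact_second_order:
  fixes f :: "'a::euclidean_space \<Rightarrow> real"
  assumes ex: "\<And>w. \<exists>\<xi>. subgradient f w \<xi>" and cont: "continuous_on UNIV f"
    and A: "linear A" "\<And>x y. A x \<bullet> y = x \<bullet> A y" and \<epsilon>: "0 < \<epsilon>"
    and ub: "\<And>z. f z \<le> f 0 + G0 \<bullet> z + (1/2) * (A z \<bullet> z) - \<epsilon> * (norm z)\<^sup>2"
    and \<delta>: "0 < \<delta>"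
  obtains z g H where "norm z < \<delta>" "norm (g - G0) < \<delta>" "linear H" "\<And>h. H h \<bullet> h \<le> A h \<bullet> h"
    "\<And>e. 0 < e \<Longrightarrow> \<exists>d>0. \<forall>h. norm h < d \<longrightarrow> \<bar>f (z + h) - f z - g \<bullet> h - (1/2) * (H h \<bullet> h)\<bar> \<le> e * (norm h)\<^sup>2"
proof -
  interpret A: linear A by (rule A)
  have blA: "bounded_linear A" using A(1) by (rule linear_conv_bounded_linear[THEN iffD1])
  obtain a where a: "a > 0" "\<And>v. norm (A v) \<le> norm v * a" using bounded_linear.pos_bounded[OF blA] by auto
  define P where "P z = (1/2) * (A z \<bullet> z)" for z
  have P_add: "P (z + h) = P z + A z \<bullet> h + P h" for z h
    using A(2)[of h z] by (simp add: P_def A.add inner_add_left inner_add_right inner_commute field_simps)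
  have P_le: "P h \<le> a * (norm h)\<^sup>2" for h
  proof -
    have "A h \<bullet> h \<le> norm h * a * norm h" using norm_cauchy_schwarz[of "A h" h] mult_right_mono[OF a(2)[of h] norm_ge_zero[of h]] by linarith
    moreover have "0 \<le> norm h * a * norm h" using a by simp
    ultimately show ?thesis by (simp add: P_def power2_eq_square mult_ac)
  qed
  have contP: "continuous_on UNIV P" unfolding P_def
    by (intro continuous_intros linear_continuous_on blA)
  \<comment> \<open>Two demands on the tilts: contact points lie within
    \<open>\<delta>' / \<epsilon>\<close> of \<open>0\<close>, and there the gradient differs from
    \<open>G0\<close> by at most \<open>\<delta>' + \<delta>' / \<epsilon> * a\<close>.\<close>
  define \<delta>' where "\<delta>' = min (\<epsilon> * \<delta> / 2) (\<delta> / (2 * (1 + a / \<epsilon>)))"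
  have \<delta>': "\<delta>' > 0" using \<delta> \<epsilon> a by (simp add: \<delta>'_def add_pos_pos)
  have d1: "\<delta>' / \<epsilon> < \<delta>"
  proof -
    have "\<delta>' \<le> \<epsilon> * \<delta> / 2" unfolding \<delta>'_def by (rule min.cobounded1)
    also have "\<dots> < \<epsilon> * \<delta>" using \<epsilon> \<delta> by simp
    finally show ?thesis using \<epsilon> by (simp add: divide_less_eq mult.commute)
  qed
  have d2: "\<delta>' + \<delta>' / \<epsilon> * a < \<delta>"
  proof -
    have p: "1 + a / \<epsilon> > 0" using a \<epsilon> by (simp add: add_pos_pos)
    have "\<delta>' * (1 + a / \<epsilon>) \<le> \<delta> / (2 * (1 + a / \<epsilon>)) * (1 + a / \<epsilon>)" using p unfolding \<delta>'_def by (intro mult_right_mono) auto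
    also have "\<dots> = \<delta> / 2" proof -
      have "q \<noteq> 0 \<Longrightarrow> \<delta> / (2 * q) * q = \<delta> / 2" for q by simp
      then show ?thesis using p by (metis less_irrefl)
    qed
    also have "\<delta>' * (1 + a / \<epsilon>) = \<delta>' + \<delta>' / \<epsilon> * a" by (simp add: distrib_left)
    finally show ?thesis using \<delta> by linarith
  qed
  define F where "F p z = f z - G0 \<bullet> z - P z - p \<bullet> z" for p z
  define R where "R = \<delta>' / \<epsilon>"
  have R: "R > 0" using \<delta>' \<epsilon> by (simp add: R_def)
  define K where "K = {z \<in> cball 0 R. \<exists>p\<in>cball 0 \<delta>'. \<forall>w. F p w \<le> F p z}"
  have maxi: "\<exists>z\<in>cball 0 R. \<forall>w. F p w \<le> F p z" if p: "p \<in> cball 0 \<delta>'" for p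
  proof -
    have "continuous_on (cball 0 R) (F p)" unfolding F_def
      by (intro continuous_intros continuous_on_subset[OF cont] continuous_on_subset[OF contP]) auto
    then obtain z where z: "z \<in> cball 0 R" "\<And>w. w \<in> cball 0 R \<Longrightarrow> F p w \<le> F p z"
      using continuous_attains_sup[of "cball 0 R" "F p"] R by auto
    have "F p w \<le> F p z" for w
    proof (cases "w \<in> cball 0 R")
      case False
      then have w: "norm w > R" by simp
      have "- (p \<bullet> w) \<le> norm p * norm w" using Cauchy_Schwarz_ineq2[of p w] by linarith
      also have "\<dots> \<le> \<delta>' * norm w" using p by (intro mult_right_mono) auto
      also have "\<dots> \<le> \<epsilon> * norm w * norm w" using w \<epsilon> by (intro mult_right_mono) (auto simp: R_def field_simps)
      finally have "F p w \<le> f 0" using ub[of w] by (simp add: F_def P_def power2_eq_square mult.assoc)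
      also have "\<dots> = F p 0" by (simp add: F_def P_def A.zero)
      also have "\<dots> \<le> F p z" using z(2) R by simp
      finally show ?thesis .
    qed (rule z(2))
    then show ?thesis using z(1) by blast
  qed
  obtain \<xi> where \<xi>: "\<And>z. subgradient f z (\<xi> z)" using ex by metis
  have up: "f (z + h) \<le> f z + \<xi> z \<bullet> h + P h" and pz: "\<xi> z - G0 - A z = p"
    if "\<And>w. F p w \<le> F p z" for z p h
  proof -
    have up: "f (z + h) \<le> f z + (G0 + p + A z) \<bullet> h + P h" for h
      using that[of "z + h"] unfolding F_def P_add inner_add_left inner_add_right by linarith
    have "\<xi> z = G0 + p + A z"
    proof (rule subgradient_eq_if_touched_above[OF \<xi>, of a])
      show "f (z + h) \<le> f z + (G0 + p + A z) \<bullet> h + a * (norm h)\<^sup>2" for h using up[of h] P_le[of h] by linarith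
    qed (use a in simp)
    then show "f (z + h) \<le> f z + \<xi> z \<bullet> h + P h" "\<xi> z - G0 - A z = p" using up[of h] by auto
  qed
  have Kup: "f (z + h) \<le> f z + \<xi> z \<bullet> h + P h" if "z \<in> K" for z h
    using that up unfolding K_def by blast
  have calm: "norm (\<eta> - \<xi> z) \<le> 4 * a * norm k" if "z \<in> K" "subgradient f (z + k) \<eta>" for z k \<eta>
  proof (rule subgradient_calm_if_touched_above[OF that(2)])
    show "f z + \<xi> z \<bullet> k \<le> f (z + k)" using \<xi>[of z, unfolded subgradient_def, rule_format, of "z + k"] by simp
    show "f (z + h) \<le> f z + \<xi> z \<bullet> h + a * (norm h)\<^sup>2" for h using Kup[OF that(1), of h] P_le[of h] by linarith
  qed (use a in simp)
  define tilt where "tilt z = \<xi> z - G0 - A z" for z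
  have cover: "cball 0 \<delta>' \<subseteq> tilt ` K"
  proof
    fix p :: 'a assume p: "p \<in> cball 0 \<delta>'"
    then obtain z where z: "z \<in> cball 0 R" "\<And>w. F p w \<le> F p z" using maxi by blast
    have "tilt z = p" using pz[OF z(2)] by (simp add: tilt_def)
    moreover have "z \<in> K" unfolding K_def using z p by blast
    ultimately show "p \<in> tilt ` K" by blast
  qed
  have nonneg: "\<not> negligible K"
  proof
    assume "negligible K"
    have "negligible (tilt ` K)"
    proof (rule negligible_locally_Lipschitz_image[OF _ \<open>negligible K\<close>])
      fix z assume z: "z \<in> K"
      have "norm (tilt w - tilt z) \<le> (4 * a + a) * norm (w - z)" if "w \<in> K" for w
      proof -
        have "norm (\<xi> w - \<xi> z) \<le> 4 * a * norm (w - z)" using calm[OF z, of "w - z" "\<xi> w"] \<xi>[of w] by simp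
        moreover have "norm (A w - A z) \<le> a * norm (w - z)" using a(2)[of "w - z"] by (simp add: A.diff mult.commute)
        moreover have "norm (tilt w - tilt z) \<le> norm (\<xi> w - \<xi> z) + norm (A w - A z)"
          using norm_triangle_ineq4[of "\<xi> w - \<xi> z" "A w - A z"] by (simp add: tilt_def algebra_simps)
        ultimately show ?thesis by (simp add: distrib_right)
      qed
      then show "\<exists>T B. open T \<and> z \<in> T \<and> (\<forall>y\<in>K \<inter> T. norm (tilt y - tilt z) \<le> B * norm (y - z))"
        by (intro exI[of _ UNIV] exI[of _ "4 * a + a"]) auto
    qed simp
    then have "negligible (cball (0::'a) \<delta>')" using cover negligible_subset by blast
    then have "negligible (ball (0::'a) \<delta>')" using ball_subset_cball negligible_subset by blast
    then show False using \<delta>' open_not_negligible[of "ball (0::'a) \<delta>'"] by simp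
  qed
  obtain J where J: "\<And>y. subgradient f (J y) (y - J y)" using resolvent_exists[OF ex cont] by metis
  have Jlip: "norm (J x - J y) \<le> norm (x - y)" for x y
  proof -
    have "0 \<le> ((x - J x) - (y - J y)) \<bullet> (J x - J y)" by (rule subgradient_monotone[OF J J])
    then have "(norm (J x - J y))\<^sup>2 \<le> (x - y) \<bullet> (J x - J y)"
      by (simp add: power2_norm_eq_inner inner_diff_left algebra_simps)
    also have "\<dots> \<le> norm (x - y) * norm (J x - J y)" by (rule norm_cauchy_schwarz)
    finally show ?thesis by (cases "J x = J y") (auto simp: power2_eq_square)
  qed
  have Jeq: "J (z + \<eta>) = z" if "subgradient f z \<eta>" for z \<eta>
  proof -
    have "0 \<le> ((z + \<eta> - J (z + \<eta>)) - \<eta>) \<bullet> (J (z + \<eta>) - z)" by (rule subgradient_monotone[OF J that])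
    also have "\<dots> = - (norm (J (z + \<eta>) - z))\<^sup>2"
      by (simp add: power2_norm_eq_inner inner_diff_left inner_diff_right inner_commute)
    finally show ?thesis by simp
  qed
  define N where "N = {y. \<not> J differentiable (at y)}"
  have "1-lipschitz_on UNIV J" by (rule lipschitz_onI) (use Jlip in \<open>auto simp: dist_norm\<close>)
  then have "negligible N" unfolding N_def by (rule Rademacher)
  then have "negligible (J ` N)"
    by (rule negligible_locally_Lipschitz_image[rotated])
      (auto intro!: exI[of _ UNIV] exI[of _ 1] simp: Jlip)
  then have "\<not> K \<subseteq> J ` N" using nonneg negligible_subset by blast
  then obtain z where z: "z \<in> K" "z \<notin> J ` N" by blast
  define y where "y = z + \<xi> z"
  have Jy: "J y = z" unfolding y_def by (rule Jeq[OF \<xi>])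
  then have "J differentiable (at y)" using z(2) by (auto simp: N_def image_iff)
  then obtain L where L: "(J has_derivative L) (at y)" by (auto simp: differentiable_def)
  have linL: "linear L" using L by (simp add: has_derivative_def bounded_linear.linear)
  interpret L: linear L by (rule linL)
  define b where "b = 1 + 4 * a"
  have b: "b > 0" using a by (simp add: b_def)
  \<comment> \<open>At a contact point the inverse of the resolvent is calm too, so \<open>J\<close>
    does not contract to first order and its derivative \<open>L\<close> is injective.\<close>
  have expand: "norm (x - y) \<le> b * norm (J x - z)" for x
  proof -
    have "norm ((x - J x) - \<xi> z) \<le> 4 * a * norm (J x - z)"
      by (rule calm[OF z(1)]) (use J[of x] in simp)
    moreover have "x - y = (J x - z) + ((x - J x) - \<xi> z)" by (simp add: y_def)
    ultimately show ?thesis using norm_triangle_ineq[of "J x - z" "(x - J x) - \<xi> z"] by (simp add: b_def algebra_simps)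
  qed
  have Ld: "\<exists>d>0. \<forall>w. norm w < d \<longrightarrow> norm (J (y + w) - z - L w) \<le> e * norm w" if "e > 0" for e
  proof -
    obtain d where d: "d > 0" "\<And>x. norm (x - y) < d \<Longrightarrow> norm (J x - J y - L (x - y)) \<le> e * norm (x - y)"
      using L \<open>e > 0\<close> unfolding has_derivative_at_alt by blast
    then show ?thesis using d(2)[of "y + w" for w] by (intro exI[of _ d]) (auto simp: Jy)
  qed
  have Linj: "norm w \<le> 2 * b * norm (L w)" for w
  proof -
    have e: "1 / (2 * b) > 0" using b by simp
    obtain d where d: "d > 0" "\<And>w. norm w < d \<Longrightarrow> norm (J (y + w) - z - L w) \<le> 1 / (2 * b) * norm w"
      using Ld[OF e] by blast
    have small: "norm w \<le> 2 * b * norm (L w)" if "norm w < d" for w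
    proof -
      have "norm w \<le> b * norm (J (y + w) - z)" using expand[of "y + w"] by simp
      also have "\<dots> \<le> b * (norm (L w) + 1 / (2 * b) * norm w)"
        using d(2)[OF that] b norm_triangle_ineq2[of "J (y + w) - z" "L w"] by (intro mult_left_mono) auto
      also have "\<dots> = b * norm (L w) + norm w / 2" using b by (simp add: field_simps)
      finally show ?thesis by simp
    qed
    show ?thesis
    proof (cases "w = 0")
      case False
      define t where "t = d / (2 * norm w)"
      have t: "t > 0" using d False by (simp add: t_def)
      have "norm (t *\<^sub>R w) < d" using d False by (simp add: t_def)
      from small[OF this] show ?thesis using t by (simp add: L.scale)
    qed simp
  qed
  have "inj L" 
  proof (rule injI)
    fix u v assume "L u = L v"
    then have "L (u - v) = 0" by (simp add: L.diff)
    then show "u = v" using Linj[of "u - v"] by simp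
  qed
  then obtain M where M: "linear M" "\<And>v. M (L v) = v" "\<And>v. L (M v) = v"
    using linear_injective_isomorphism[OF linL] by auto
  interpret M: linear M by (rule M)
  obtain m where m: "m > 0" "\<And>v. norm (M v) \<le> norm v * m"
    using bounded_linear.pos_bounded[of M] M(1) linear_conv_bounded_linear by auto
  \<comment> \<open>Since \<open>J\<close> inverts the relation \<open>z + \<partial>f(z)\<close>,
    the derivative of the subdifferential at \<open>z\<close> is the inverse of \<open>L\<close>
    minus the identity. Only its quadratic form is used below.\<close>
  define H where "H v = M v - v" for v
  have H: "linear H" unfolding H_def[abs_def] by (intro linear_compose_sub M linear_id[unfolded id_def])
  have grad: "\<exists>d>0. \<forall>k \<eta>. norm k < d \<longrightarrow> subgradient f (z + k) \<eta> \<longrightarrow> norm (\<eta> - \<xi> z - H k) \<le> e * norm k" if e: "e > 0" for e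
  proof -
    define e' where "e' = e / (m * b)"
    have e': "e' > 0" using e m b by (simp add: e'_def)
    obtain d where d: "d > 0" "\<And>w. norm w < d \<Longrightarrow> norm (J (y + w) - z - L w) \<le> e' * norm w"
      using Ld[OF e'] by blast
    have "norm (\<eta> - \<xi> z - H k) \<le> e * norm k" if k: "norm k < d / b" and \<eta>: "subgradient f (z + k) \<eta>" for k \<eta>
    proof -
      define w where "w = k + (\<eta> - \<xi> z)"
      have "z + k + \<eta> = y + w" by (simp add: w_def y_def)
      then have Jw: "J (y + w) = z + k" using Jeq[OF \<eta>] by simp
      have nw: "norm w \<le> b * norm k" using expand[of "y + w"] Jw by simp
      also have "\<dots> < d" using k b by (simp add: field_simps)
      finally have "norm (k - L w) \<le> e' * norm w" using d(2)[of w] Jw by simp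
      also have "\<dots> \<le> e' * (b * norm k)" using nw e' by simp
      finally have 1: "norm (k - L w) \<le> e' * (b * norm k)" .
      have "\<eta> - \<xi> z - H k = - M (k - L w)" by (simp add: H_def M.diff M(2) w_def)
      then have "norm (\<eta> - \<xi> z - H k) \<le> norm (k - L w) * m" using m(2)[of "k - L w"] by simp
      also have "\<dots> \<le> e' * (b * norm k) * m" using 1 m by simp
      also have "\<dots> = e * norm k" using m b by (simp add: e'_def)
      finally show ?thesis .
    qed
    then show ?thesis using d b by (intro exI[of _ "d / b"]) auto
  qed
  have second: "\<exists>d>0. \<forall>h. norm h < d \<longrightarrow> \<bar>f (z + h) - f z - \<xi> z \<bullet> h - (1/2) * (H h \<bullet> h)\<bar> \<le> e * (norm h)\<^sup>2" if e: "e > 0" for e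
  proof -
    obtain d where d: "d > 0" "\<And>k \<eta>. norm k < d \<Longrightarrow> subgradient f (z + k) \<eta> \<Longrightarrow> norm (\<eta> - \<xi> z - H k) \<le> e * norm k"
      using grad[OF e] by blast
    show ?thesis using d(1) second_order_of_subgradient_expansion[OF ex H less_imp_le[OF e] d(2)] by blast
  qed
  have HA: "H h \<bullet> h \<le> A h \<bullet> h" for h
  proof (cases "h = 0")
    case False
    interpret H: linear H by (rule H)
    have "H h \<bullet> h \<le> A h \<bullet> h + e" if "e > 0" for e
    proof -
      define e' where "e' = e / (2 * (norm h)\<^sup>2)"
      have e': "e' > 0" using that False by (simp add: e'_def)
      obtain d where d: "d > 0" "\<And>h. norm h < d \<Longrightarrow> \<bar>f (z + h) - f z - \<xi> z \<bullet> h - (1/2) * (H h \<bullet> h)\<bar> \<le> e' * (norm h)\<^sup>2"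
        using second[OF e'] by blast
      define t where "t = d / (2 * norm h)"
      have t: "t > 0" using d False by (simp add: t_def)
      have "norm (t *\<^sub>R h) < d" using d False by (simp add: t_def)
      from d(2)[OF this] Kup[OF z(1), of "t *\<^sub>R h"]
      have "(1/2) * (H (t *\<^sub>R h) \<bullet> (t *\<^sub>R h)) \<le> P (t *\<^sub>R h) + e' * (norm (t *\<^sub>R h))\<^sup>2" by linarith
      then have "t\<^sup>2 * (H h \<bullet> h) \<le> t\<^sup>2 * (A h \<bullet> h + 2 * e' * (norm h)\<^sup>2)"
        by (simp add: P_def H.scale A.scale power2_eq_square algebra_simps)
      then have "H h \<bullet> h \<le> A h \<bullet> h + 2 * e' * (norm h)\<^sup>2" using t by simp
      also have "2 * e' * (norm h)\<^sup>2 = e" using False by (simp add: e'_def)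
      finally show ?thesis .
    qed
    then show ?thesis by (rule field_le_epsilon)
  qed (simp add: linear_0[OF H])
  have "norm z < \<delta>" using z(1) d1 by (auto simp: K_def R_def)
  moreover have "norm (\<xi> z - G0) < \<delta>"
  proof -
    obtain p where p: "p \<in> cball 0 \<delta>'" "\<And>w. F p w \<le> F p z" using z(1) unfolding K_def by blast
    have "\<xi> z - G0 = p + A z" using pz[OF p(2)] by (simp add: algebra_simps)
    then have "norm (\<xi> z - G0) \<le> norm p + norm (A z)" using norm_triangle_ineq by metis
    also have "norm (A z) \<le> norm z * a" by (rule a(2))
    also have "norm z * a \<le> R * a" using z(1) a by (intro mult_right_mono) (auto simp: K_def)
    finally show ?thesis using p d2 by (simp add: R_def)
  qed
  ultimately show thesis using that H HA second by blast
qed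

section \<open>The theorem on sums\<close>

text \<open>The sup-convolution \<open>x \<mapsto> SUP s\<in>S. g s - c |x - s|\<^sup>2\<close> with \<open>c |x|\<^sup>2\<close> added, which makes it convex.\<close>

definition convexified_sup_conv :: "('a::real_inner) set \<Rightarrow> ('a \<Rightarrow> real) \<Rightarrow> real \<Rightarrow> 'a \<Rightarrow> real" where
  "convexified_sup_conv S g c x = (SUP s\<in>S. g s - c * (norm s)\<^sup>2 + 2 * c * (s \<bullet> x))"

lemma convexified_sup_conv_attained:
  fixes S :: "'a::euclidean_space set"
  assumes S: "compact S" "S \<noteq> {}" and g: "continuous_on S g"
  obtains s where "s \<in> S" "convexified_sup_conv S g c x = g s - c * (norm s)\<^sup>2 + 2 * c * (s \<bullet> x)"
    "\<And>t. t \<in> S \<Longrightarrow> g t - c * (norm t)\<^sup>2 + 2 * c * (t \<bullet> x) \<le> convexified_sup_conv S g c x"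
proof -
  let ?k = "\<lambda>s. g s - c * (norm s)\<^sup>2 + 2 * c * (s \<bullet> x)"
  have "continuous_on S ?k" by (intro continuous_intros g)
  then obtain s where s: "s \<in> S" "\<And>t. t \<in> S \<Longrightarrow> ?k t \<le> ?k s" using continuous_attains_sup[OF S] by blast
  then have "convexified_sup_conv S g c x = ?k s" unfolding convexified_sup_conv_def
    by (intro cSup_eq_maximum) auto
  then show thesis using that[of s] s by simp
qed

lemma convexified_sup_conv_ge:
  fixes S :: "'a::euclidean_space set"
  assumes S: "compact S" "S \<noteq> {}" and g: "continuous_on S g" and t: "t \<in> S"
  shows "g t - c * (norm t)\<^sup>2 + 2 * c * (t \<bullet> x) \<le> convexified_sup_conv S g c x"
  by (rule convexified_sup_conv_attained[OF S g, of c x]) (use t in blast)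

lemma convexified_sup_conv_subgradient:
  fixes S :: "'a::euclidean_space set"
  assumes S: "compact S" "S \<noteq> {}" and g: "continuous_on S g"
  shows "\<exists>s\<in>S. subgradient (convexified_sup_conv S g c) x ((2 * c) *\<^sub>R s)"
proof -
  obtain s where s: "s \<in> S" "convexified_sup_conv S g c x = g s - c * (norm s)\<^sup>2 + 2 * c * (s \<bullet> x)"
    by (rule convexified_sup_conv_attained[OF S g])
  have "convexified_sup_conv S g c x + (2 * c) *\<^sub>R s \<bullet> (y - x) \<le> convexified_sup_conv S g c y" for y
    using convexified_sup_conv_ge[OF S g s(1), of c y] s(2) by (simp add: inner_diff_right algebra_simps)
  then show ?thesis using s(1) unfolding subgradient_def by blast
qed

text \<open>Every point has a subgradient \<open>(2 * c) *\<^sub>R s\<close> with \<open>s\<close>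
  in the bounded set \<open>S\<close>, which makes the function Lipschitz.\<close>

lemma convexified_sup_conv_continuous:
  fixes S :: "'a::euclidean_space set"
  assumes S: "compact S" "S \<noteq> {}" and g: "continuous_on S g" and c: "0 \<le> c"
  shows "continuous_on UNIV (convexified_sup_conv S g c)"
proof -
  obtain B where B: "B > 0" "\<And>s. s \<in> S \<Longrightarrow> norm s \<le> B" using compact_imp_bounded[OF S(1)] bounded_pos by blast
  let ?F = "convexified_sup_conv S g c"
  have 1: "?F x - ?F y \<le> 2 * c * B * norm (x - y)" for x y
  proof -
    obtain s where s: "s \<in> S" "subgradient ?F x ((2 * c) *\<^sub>R s)" using convexified_sup_conv_subgradient[OF S g] by blast
    have "?F x + ((2 * c) *\<^sub>R s) \<bullet> (y - x) \<le> ?F y" using s(2) unfolding subgradient_def by blast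
    moreover have "- (((2 * c) *\<^sub>R s) \<bullet> (y - x)) \<le> norm ((2 * c) *\<^sub>R s) * norm (y - x)"
      using Cauchy_Schwarz_ineq2[of "(2 * c) *\<^sub>R s" "y - x"] by linarith
    moreover have "norm ((2 * c) *\<^sub>R s) * norm (y - x) \<le> 2 * c * B * norm (x - y)"
      using B(2)[OF s(1)] c by (auto simp: norm_minus_commute intro!: mult_right_mono mult_left_mono)
    ultimately show ?thesis by linarith
  qed
  have "(2 * c * B)-lipschitz_on UNIV ?F"
    using 1 c B by (intro lipschitz_onI) (auto simp: dist_real_def dist_norm abs_le_iff norm_minus_commute, metis norm_minus_commute minus_diff_eq)
  then show ?thesis by (rule lipschitz_on_continuous_on)
qed

text \<open>A maximum point of \<open>g t - c |x - t|\<^sup>2\<close> inherits the superjet of the sup-convolution at \<open>x\<close>,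
  because the translate \<open>x + (t - s)\<close> may be used as a competitor.\<close>

lemma convexified_sup_conv_jet:
  fixes S :: "'a::euclidean_space set"
  assumes S: "compact S" "S \<noteq> {}" and g: "continuous_on S g"
    and s: "s \<in> S" "convexified_sup_conv S g c x = g s - c * (norm s)\<^sup>2 + 2 * c * (s \<bullet> x)"
    and t: "t \<in> S"
  shows "g t \<le> g s + (convexified_sup_conv S g c (x + (t - s)) - convexified_sup_conv S g c x)
      - 2 * c * (x \<bullet> (t - s)) - c * (norm (t - s))\<^sup>2"
proof -
  define h where "h = t - s"
  have th: "t = s + h" by (simp add: h_def)
  have "g t \<le> convexified_sup_conv S g c (x + h) + c * (norm t)\<^sup>2 - 2 * c * (t \<bullet> (x + h))"
    using convexified_sup_conv_ge[OF S g t, of c "x + h"] by linarith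
  moreover have "c * (norm t)\<^sup>2 - 2 * c * (t \<bullet> (x + h)) = c * (norm s)\<^sup>2 - 2 * c * (s \<bullet> x) - 2 * c * (x \<bullet> h) - c * (norm h)\<^sup>2"
    unfolding th power2_norm_eq_inner by (simp add: inner_add_left inner_add_right inner_commute algebra_simps)
  ultimately show ?thesis using s(2) unfolding h_def[symmetric] by linarith
qed

section \<open>Jets at a maximum of a sum\<close>

text \<open>Sup-convolution extends both functions from compact sets to the whole space, so the
  points may lie on the boundary of \<open>S1\<close> or \<open>S2\<close>. Instead of limits of
  jets the conclusion offers actual jets, at points and with gradients within
  \<open>\<epsilon>\<close> of the original ones. The two quadratic forms are the diagonal blocks of
  one expansion of the sum.\<close>

lemma theorem_on_sums_at_0:
  fixes S1 S2 :: "'a::euclidean_space set" and A :: "'a \<times> 'a \<Rightarrow> 'a \<times> 'a"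
  assumes S: "compact S1" "compact S2" "0 \<in> S1" "0 \<in> S2"
    and cont: "continuous_on S1 u" "continuous_on S2 w" and uw0: "u 0 = 0" "w 0 = 0"
    and A: "linear A" "\<And>x y. A x \<bullet> y = x \<bullet> A y"
    and ub: "\<And>x y. x \<in> S1 \<Longrightarrow> y \<in> S2 \<Longrightarrow> u x + w y \<le> (1/2) * (A (x, y) \<bullet> (x, y))"
    and \<epsilon>: "0 < \<epsilon>"
  obtains x y p r X Y where "x \<in> S1" "y \<in> S2" "norm x < \<epsilon>" "norm y < \<epsilon>" "norm p < \<epsilon>" "norm r < \<epsilon>"
    "linear X" "linear Y" "\<And>h k. X h \<bullet> h + Y k \<bullet> k \<le> A (h, k) \<bullet> (h, k) + \<epsilon> * ((norm h)\<^sup>2 + (norm k)\<^sup>2)"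
    "\<And>e. 0 < e \<Longrightarrow> \<exists>d>0. \<forall>x'\<in>S1. norm (x' - x) < d \<longrightarrow>
       u x' \<le> u x + p \<bullet> (x' - x) + (1/2) * (X (x' - x) \<bullet> (x' - x)) + e * (norm (x' - x))\<^sup>2"
    "\<And>e. 0 < e \<Longrightarrow> \<exists>d>0. \<forall>y'\<in>S2. norm (y' - y) < d \<longrightarrow>
       w y' \<le> w y + r \<bullet> (y' - y) + (1/2) * (Y (y' - y) \<bullet> (y' - y)) + e * (norm (y' - y))\<^sup>2"
proof -
  interpret A: linear A by (rule A)
  have blA: "bounded_linear A" using A(1) by (rule linear_conv_bounded_linear[THEN iffD1])
  obtain a where a: "a > 0" "\<And>v. norm (A v) \<le> norm v * a" using bounded_linear.pos_bounded[OF blA] by auto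
  define \<eta> where "\<eta> = \<epsilon> / 4"
  have \<eta>: "\<eta> > 0" using \<epsilon> by (simp add: \<eta>_def)
  \<comment> \<open>By Young's inequality the first summand absorbs the cross term between
    \<open>z\<close> and \<open>s - z\<close> at the price of \<open>\<eta> |z|^2\<close>; the
    second one keeps the maximizers \<open>s1\<close>, \<open>s2\<close> within \<open>3 |z|\<close>
    of the origin.\<close>
  define c where "c = a\<^sup>2 / (4 * \<eta>) + 4 * a"
  have c: "c > 0" "4 * a \<le> c" "a\<^sup>2 / (4 * \<eta>) + a \<le> c" using a \<eta> by (auto simp: c_def add_nonneg_pos)
  define F1 where "F1 = convexified_sup_conv S1 u c"
  define F2 where "F2 = convexified_sup_conv S2 w c"
  define f where "f z = F1 (fst z) + F2 (snd z)" for z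
  have ne: "S1 \<noteq> {}" "S2 \<noteq> {}" using S by auto
  have Ab: "\<bar>A r \<bullet> z\<bar> \<le> a * norm r * norm z" for r z
    using Cauchy_Schwarz_ineq2[of "A r" z] mult_right_mono[OF a(2)[of r] norm_ge_zero[of z]] by (simp add: mult_ac)
  have quad: "(1/2) * (A s \<bullet> s) - c * (norm (z - s))\<^sup>2 \<le> (1/2) * (A z \<bullet> z) + \<eta> * (norm z)\<^sup>2" for s z
  proof -
    define r where "r = s - z"
    have s: "s = z + r" by (simp add: r_def)
    have 1: "(1/2) * (A s \<bullet> s) = (1/2) * (A z \<bullet> z) + A z \<bullet> r + (1/2) * (A r \<bullet> r)"
      using A(2)[of r z] by (simp add: s A.add inner_add_left inner_add_right inner_commute)
    have 2: "A z \<bullet> r \<le> a * norm z * norm r" using Ab[of z r] by linarith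
    have 3: "(1/2) * (A r \<bullet> r) \<le> a * (norm r)\<^sup>2" using Ab[of r r] a mult_nonneg_nonneg[of a "(norm r)\<^sup>2"] by (simp add: power2_eq_square mult.assoc)
    have 4: "a * norm z * norm r \<le> \<eta> * (norm z)\<^sup>2 + a\<^sup>2 / (4 * \<eta>) * (norm r)\<^sup>2"
    proof -
      have "0 \<le> (2 * \<eta> * norm z - a * norm r)\<^sup>2 / (4 * \<eta>)" using \<eta> by simp
      also have "\<dots> = \<eta> * (norm z)\<^sup>2 + a\<^sup>2 / (4 * \<eta>) * (norm r)\<^sup>2 - a * norm z * norm r"
        using \<eta> by (simp add: power2_eq_square field_simps)
      finally show ?thesis by simp
    qed
    have "(a\<^sup>2 / (4 * \<eta>) + a) * (norm r)\<^sup>2 \<le> c * (norm r)\<^sup>2" using c(3) by (rule mult_right_mono) simp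
    moreover have nzs: "norm (z - s) = norm r" by (simp add: r_def norm_minus_commute)
    ultimately show ?thesis unfolding nzs using 1 2 3 4 distrib_right[of "a\<^sup>2 / (4 * \<eta>)" a "(norm r)\<^sup>2"] by linarith
  qed
  have sq: "c * (norm (z - s))\<^sup>2 = c * (norm (fst z))\<^sup>2 + c * (norm (snd z))\<^sup>2 + c * (norm (fst s))\<^sup>2 + c * (norm (snd s))\<^sup>2
       - 2 * c * (fst s \<bullet> fst z) - 2 * c * (snd s \<bullet> snd z)" for z s :: "'a \<times> 'a"
    by (cases z; cases s) (simp add: power2_norm_eq_inner inner_diff_left inner_diff_right inner_commute algebra_simps)
  have nsq: "(norm z)\<^sup>2 = (norm (fst z))\<^sup>2 + (norm (snd z))\<^sup>2" for z :: "'a \<times> 'a"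
    by (cases z) (simp add: power2_norm_eq_inner)
  have fs: "\<exists>s1\<in>S1. \<exists>s2\<in>S2. F1 (fst z) = u s1 - c * (norm s1)\<^sup>2 + 2 * c * (s1 \<bullet> fst z) \<and> F2 (snd z) = w s2 - c * (norm s2)\<^sup>2 + 2 * c * (s2 \<bullet> snd z)" for z
    unfolding F1_def F2_def
    by (rule convexified_sup_conv_attained[OF S(1) ne(1) cont(1), of c "fst z"],
        rule convexified_sup_conv_attained[OF S(2) ne(2) cont(2), of c "snd z"]) blast
  have f_ge0: "0 \<le> f z" for z
    using convexified_sup_conv_ge[OF S(1) ne(1) cont(1) S(3), of c "fst z"]
      convexified_sup_conv_ge[OF S(2) ne(2) cont(2) S(4), of c "snd z"] by (simp add: f_def F1_def F2_def uw0)
  have f_eq: "f z = u s1 + w s2 - c * (norm (z - (s1, s2)))\<^sup>2 + c * (norm z)\<^sup>2"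
    if "F1 (fst z) = u s1 - c * (norm s1)\<^sup>2 + 2 * c * (s1 \<bullet> fst z)" "F2 (snd z) = w s2 - c * (norm s2)\<^sup>2 + 2 * c * (s2 \<bullet> snd z)" for z s1 s2
    using that sq[of z "(s1, s2)"] by (simp add: f_def nsq[of z] distrib_left)
  \<comment> \<open>Half of this form is half of \<open>A\<close> plus
    \<open>c + 2 * \<eta>\<close>: \<open>c\<close> for the convexification, one
    \<open>\<eta>\<close> for the regularization error, one \<open>\<eta>\<close> for the strict
    contact that \<open>contact_second_order\<close> requires.\<close>
  define A' where "A' z = A z + (2 * c + 4 * \<eta>) *\<^sub>R z" for z
  have A': "linear A'" "\<And>x y. A' x \<bullet> y = x \<bullet> A' y" unfolding A'_def[abs_def]
    by (auto intro!: linear_compose_add A linear_compose_scale_right linear_id[unfolded id_def] simp: inner_add_left inner_add_right A(2))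
  have f_ub: "f z \<le> f 0 + 0 \<bullet> z + (1/2) * (A' z \<bullet> z) - \<eta> * (norm z)\<^sup>2" for z
  proof -
    obtain s1 s2 where s: "s1 \<in> S1" "s2 \<in> S2" 
      and e: "F1 (fst z) = u s1 - c * (norm s1)\<^sup>2 + 2 * c * (s1 \<bullet> fst z)" "F2 (snd z) = w s2 - c * (norm s2)\<^sup>2 + 2 * c * (s2 \<bullet> snd z)"
      using fs[of z] by blast
    have "f z \<le> (1/2) * (A z \<bullet> z) + \<eta> * (norm z)\<^sup>2 + c * (norm z)\<^sup>2"
      using f_eq[OF e] ub[OF s] quad[of "(s1, s2)" z] by linarith
    also have "\<dots> = (1/2) * (A' z \<bullet> z) - \<eta> * (norm z)\<^sup>2"
      by (simp add: A'_def inner_add_left power2_norm_eq_inner algebra_simps)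
    finally show ?thesis using f_ge0[of 0] by simp
  qed
  have f_sub: "\<exists>\<xi>. subgradient f z \<xi>" for z
  proof -
    obtain s1 s2 where "subgradient F1 (fst z) ((2 * c) *\<^sub>R s1)" "subgradient F2 (snd z) ((2 * c) *\<^sub>R s2)"
      using convexified_sup_conv_subgradient[OF S(1) ne(1) cont(1), of c "fst z"]
        convexified_sup_conv_subgradient[OF S(2) ne(2) cont(2), of c "snd z"] by (auto simp: F1_def F2_def)
    then have "subgradient f z ((2 * c) *\<^sub>R s1, (2 * c) *\<^sub>R s2)"
      unfolding subgradient_def f_def inner_prod_def by (auto simp: add_mono algebra_simps) (smt (verit))
    then show ?thesis by blast
  qed
  have f_cont: "continuous_on UNIV f" unfolding f_def F1_def F2_def
    by (intro continuous_intros continuous_on_compose2[OF convexified_sup_conv_continuous[OF S(1) ne(1) cont(1)]]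
      continuous_on_compose2[OF convexified_sup_conv_continuous[OF S(2) ne(2) cont(2)]]) (use c in auto)
  \<comment> \<open>\<open>3 * \<delta> \<le> \<epsilon>\<close> serves the points,
    \<open>\<delta> + 2 * c * \<delta> < \<epsilon>\<close> the gradients, which are shifted by
    \<open>2 * c\<close> times the point.\<close>
  define \<delta> where "\<delta> = \<epsilon> / (3 + 2 * c)"
  have \<delta>: "\<delta> > 0" "3 * \<delta> \<le> \<epsilon>" "\<delta> + 2 * c * \<delta> < \<epsilon>"
  proof -
    have e: "\<delta> * (3 + 2 * c) = \<epsilon>" using c by (simp add: \<delta>_def)
    show "\<delta> > 0" using \<epsilon> c by (simp add: \<delta>_def)
    then have "2 * c * \<delta> > 0" using c by simp
    then show "3 * \<delta> \<le> \<epsilon>" "\<delta> + 2 * c * \<delta> < \<epsilon>" using e \<open>\<delta> > 0\<close> by (auto simp: algebra_simps)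
  qed
  obtain z g H where z: "norm z < \<delta>" and g: "norm (g - 0) < \<delta>" and H: "linear H" "\<And>h. H h \<bullet> h \<le> A' h \<bullet> h"
    and exp: "\<And>e. 0 < e \<Longrightarrow> \<exists>d>0. \<forall>h. norm h < d \<longrightarrow> \<bar>f (z + h) - f z - g \<bullet> h - (1/2) * (H h \<bullet> h)\<bar> \<le> e * (norm h)\<^sup>2"
    using contact_second_order[OF f_sub f_cont A' \<eta> f_ub \<delta>(1)] by blast
  interpret H: linear H by (rule H)
  obtain s1 s2 where s: "s1 \<in> S1" "s2 \<in> S2" 
    and e: "F1 (fst z) = u s1 - c * (norm s1)\<^sup>2 + 2 * c * (s1 \<bullet> fst z)" "F2 (snd z) = w s2 - c * (norm s2)\<^sup>2 + 2 * c * (s2 \<bullet> snd z)"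
    using fs[of z] by blast
  have ns: "norm (s1, s2) < \<epsilon>"
  proof -
    define \<sigma> where "\<sigma> = (s1, s2)"
    have "u s1 + w s2 \<le> a * (norm \<sigma>)\<^sup>2"
    proof -
      have "u s1 + w s2 \<le> (1/2) * (A \<sigma> \<bullet> \<sigma>)" using ub[OF s] by (simp add: \<sigma>_def)
      moreover have "A \<sigma> \<bullet> \<sigma> \<le> a * (norm \<sigma>)\<^sup>2" using Ab[of \<sigma> \<sigma>] by (simp add: power2_eq_square mult.assoc)
      moreover have "0 \<le> a * (norm \<sigma>)\<^sup>2" using a by simp
      ultimately show ?thesis by linarith
    qed
    then have 1: "c * (norm (z - \<sigma>))\<^sup>2 \<le> c * (norm z)\<^sup>2 + a * (norm \<sigma>)\<^sup>2"
      using f_eq[OF e] f_ge0[of z] by (simp add: \<sigma>_def)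
    have "norm \<sigma> \<le> norm (z - \<sigma>) + norm z" using norm_triangle_ineq4[of z "z - \<sigma>"] by simp
    then have "(norm \<sigma>)\<^sup>2 \<le> (norm (z - \<sigma>) + norm z)\<^sup>2" by (intro power_mono) auto
    also have "\<dots> \<le> 2 * (norm (z - \<sigma>))\<^sup>2 + 2 * (norm z)\<^sup>2"
      using sum_squares_bound[of "norm (z - \<sigma>)" "norm z"] by (simp add: power2_sum)
    finally have "a * (norm \<sigma>)\<^sup>2 \<le> a * (2 * (norm (z - \<sigma>))\<^sup>2 + 2 * (norm z)\<^sup>2)" using a by (intro mult_left_mono) auto
    moreover have "4 * a * (norm (z - \<sigma>))\<^sup>2 \<le> c * (norm (z - \<sigma>))\<^sup>2" "4 * a * (norm z)\<^sup>2 \<le> c * (norm z)\<^sup>2"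
      using c(2) by (auto intro: mult_right_mono)
    moreover have "0 \<le> c * (norm z)\<^sup>2" using c by simp
    ultimately have "c * (norm (z - \<sigma>))\<^sup>2 \<le> c * (4 * (norm z)\<^sup>2)" using 1 by (simp add: algebra_simps)
    then have "(norm (z - \<sigma>))\<^sup>2 \<le> (2 * norm z)\<^sup>2" using c by (simp add: power_mult_distrib)
    then have "norm (z - \<sigma>) \<le> 2 * norm z" by (rule power2_le_imp_le) simp
    then have "norm \<sigma> \<le> 3 * norm z" using norm_triangle_ineq4[of z "z - \<sigma>"] by simp
    then show ?thesis using z \<delta>(2) by (simp add: \<sigma>_def)
  qed
  \<comment> \<open>Diagonal blocks of \<open>H\<close>, with the Hessian of the convexifying term
    taken out again.\<close>
  define X where "X h = fst (H (h, 0)) - (2 * c) *\<^sub>R h" for h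
  define Y where "Y k = snd (H (0, k)) - (2 * c) *\<^sub>R k" for k
  have XH: "X h \<bullet> h = H (h, 0) \<bullet> (h, 0) - 2 * c * (norm h)\<^sup>2" for h
    by (simp add: X_def inner_prod_def inner_diff_left power2_norm_eq_inner)
  have YH: "Y k \<bullet> k = H (0, k) \<bullet> (0, k) - 2 * c * (norm k)\<^sup>2" for k
    by (simp add: Y_def inner_prod_def inner_diff_left power2_norm_eq_inner)
  have linX: "linear X" and linY: "linear Y"
  proof -
    have "linear (\<lambda>h. (h, 0::'a))" "linear (\<lambda>h. (0::'a, h))" by (auto intro!: linearI)
    from linear_compose[OF this(1) H(1)] linear_compose[OF this(2) H(1)]
    have "linear (\<lambda>h. H (h, 0))" "linear (\<lambda>h. H (0, h))" by (simp_all add: o_def)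
    from linear_compose[OF this(1) linear_fst] linear_compose[OF this(2) linear_snd]
    show "linear X" "linear Y" unfolding X_def[abs_def] Y_def[abs_def]
      by (auto intro!: linear_compose_sub linear_compose_scale_right linear_id[unfolded id_def] simp: o_def)
  qed
  \<comment> \<open>\<open>f\<close> is a sum of functions of the two components, so its increments
    split exactly; comparing the three expansions at a small scale \<open>t\<close> eliminates the
    off-diagonal blocks.\<close>
  have block: "H (h, 0) \<bullet> (h, 0) + H (0, k) \<bullet> (0, k) \<le> H (h, k) \<bullet> (h, k)" for h k
  proof -
    have "H (h, 0) \<bullet> (h, 0) + H (0, k) \<bullet> (0, k) \<le> H (h, k) \<bullet> (h, k) + e" if "e > 0" for e
    proof -
      define n where "n = (norm (h, k))\<^sup>2 + (norm (h, 0::'a))\<^sup>2 + (norm (0::'a, k))\<^sup>2"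
      have n: "n \<ge> 0" by (simp add: n_def)
      define e' where "e' = e / (2 * (n + 1))"
      have e': "e' > 0" using that n by (simp add: e'_def)
      obtain d where d: "d > 0" "\<And>h. norm h < d \<Longrightarrow> \<bar>f (z + h) - f z - g \<bullet> h - (1/2) * (H h \<bullet> h)\<bar> \<le> e' * (norm h)\<^sup>2"
        using exp[OF e'] by blast
      define t where "t = d / (2 * (norm (h, k) + 1))"
      have t: "t > 0" using d by (simp add: t_def add_nonneg_pos)
      have tn: "t * norm (h, k) < d"
      proof -
        have "t * (norm (h, k) + 1) = d / 2" 
        proof -
          have "q \<noteq> 0 \<Longrightarrow> d / (2 * q) * q = d / 2" for q by simp
          then show ?thesis unfolding t_def by (metis add_nonneg_pos norm_ge_zero less_irrefl zero_less_one)
        qed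
        then show ?thesis using d t by (simp add: distrib_left)
      qed
      have le: "norm (h, 0::'a) \<le> norm (h, k)" "norm (0::'a, k) \<le> norm (h, k)" by (auto simp: norm_Pair)
      have D: "\<bar>f (z + t *\<^sub>R v) - f z - t * (g \<bullet> v) - t\<^sup>2 / 2 * (H v \<bullet> v)\<bar> \<le> e' * (t\<^sup>2 * (norm v)\<^sup>2)" if "norm v \<le> norm (h, k)" for v
      proof -
        have "norm (t *\<^sub>R v) \<le> t * norm (h, k)" using that t by (simp add: mult_left_mono)
        then have "norm (t *\<^sub>R v) < d" using tn by linarith
        from d(2)[OF this] show ?thesis using t by (simp add: H.scale power_mult_distrib power2_eq_square mult_ac)
      qed
      have add: "f (z + t *\<^sub>R (h, k)) - f z = (f (z + t *\<^sub>R (h, 0)) - f z) + (f (z + t *\<^sub>R (0, k)) - f z)"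
        by (simp add: f_def)
      have gadd: "g \<bullet> (h, k) = g \<bullet> (h, 0) + g \<bullet> (0, k)" by (simp add: inner_prod_def)
      have "t\<^sup>2 / 2 * (H (h, 0) \<bullet> (h, 0)) + t\<^sup>2 / 2 * (H (0, k) \<bullet> (0, k)) \<le> t\<^sup>2 / 2 * (H (h, k) \<bullet> (h, k)) + e' * (t\<^sup>2 * n)"
        using D[OF order_refl] D[OF le(1)] D[OF le(2)] add unfolding gadd n_def by (simp add: distrib_left abs_le_iff)
      then have "t\<^sup>2 * (H (h, 0) \<bullet> (h, 0) + H (0, k) \<bullet> (0, k)) \<le> t\<^sup>2 * (H (h, k) \<bullet> (h, k) + 2 * e' * n)"
        by (simp add: algebra_simps)
      then have "H (h, 0) \<bullet> (h, 0) + H (0, k) \<bullet> (0, k) \<le> H (h, k) \<bullet> (h, k) + 2 * e' * n" using t by simp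
      also have "2 * e' * n \<le> 2 * e' * (n + 1)" using e' by simp
      also have "\<dots> = e"
      proof -
        have "q \<noteq> 0 \<Longrightarrow> 2 * (e / (2 * q)) * q = e" for q by simp
        then show ?thesis unfolding e'_def using n by (metis add_nonneg_pos less_irrefl zero_less_one)
      qed
      finally show ?thesis by simp
    qed
    then show ?thesis by (rule field_le_epsilon)
  qed
  have XY: "X h \<bullet> h + Y k \<bullet> k \<le> A (h, k) \<bullet> (h, k) + \<epsilon> * ((norm h)\<^sup>2 + (norm k)\<^sup>2)" for h k
  proof -
    have "X h \<bullet> h + Y k \<bullet> k \<le> A' (h, k) \<bullet> (h, k) - 2 * c * ((norm h)\<^sup>2 + (norm k)\<^sup>2)"
      using block[of h k] H(2)[of "(h, k)"] unfolding XH YH by (simp add: distrib_left)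
    also have "\<dots> = A (h, k) \<bullet> (h, k) + \<epsilon> * ((norm h)\<^sup>2 + (norm k)\<^sup>2)"
      by (simp add: A'_def inner_add_left power2_norm_eq_inner \<eta>_def algebra_simps)
    finally show ?thesis .
  qed
  have jet1: "\<exists>d>0. \<forall>x'\<in>S1. norm (x' - s1) < d \<longrightarrow>
     u x' \<le> u s1 + (fst g - (2 * c) *\<^sub>R fst z) \<bullet> (x' - s1) + (1/2) * (X (x' - s1) \<bullet> (x' - s1)) + e' * (norm (x' - s1))\<^sup>2" if e': "0 < e'" for e'
  proof -
    obtain d where d: "d > 0" "\<And>h. norm h < d \<Longrightarrow> \<bar>f (z + h) - f z - g \<bullet> h - (1/2) * (H h \<bullet> h)\<bar> \<le> e' * (norm h)\<^sup>2"
      using exp[OF e'] by blast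
    have "u x' \<le> u s1 + (fst g - (2 * c) *\<^sub>R fst z) \<bullet> (x' - s1) + (1/2) * (X (x' - s1) \<bullet> (x' - s1)) + e' * (norm (x' - s1))\<^sup>2"
      if x': "x' \<in> S1" "norm (x' - s1) < d" for x'
    proof -
      define h where "h = x' - s1"
      have "u x' \<le> u s1 + (F1 (fst z + h) - F1 (fst z)) - 2 * c * (fst z \<bullet> h) - c * (norm h)\<^sup>2"
        using convexified_sup_conv_jet[OF S(1) ne(1) cont(1) s(1) e(1)[unfolded F1_def] x'(1)] by (simp add: h_def F1_def)
      moreover have "F1 (fst z + h) - F1 (fst z) = f (z + (h, 0)) - f z" by (simp add: f_def)
      moreover have "\<bar>f (z + (h, 0)) - f z - fst g \<bullet> h - (1/2) * (H (h, 0) \<bullet> (h, 0))\<bar> \<le> e' * (norm h)\<^sup>2"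
        using d(2)[of "(h, 0)"] x'(2) by (simp add: h_def norm_Pair inner_prod_def)
      ultimately show ?thesis unfolding h_def[symmetric] XH by (simp add: inner_diff_left algebra_simps abs_le_iff)
    qed
    then show ?thesis using d(1) by blast
  qed
  have jet2: "\<exists>d>0. \<forall>x'\<in>S2. norm (x' - s2) < d \<longrightarrow>
     w x' \<le> w s2 + (snd g - (2 * c) *\<^sub>R snd z) \<bullet> (x' - s2) + (1/2) * (Y (x' - s2) \<bullet> (x' - s2)) + e' * (norm (x' - s2))\<^sup>2" if e': "0 < e'" for e'
  proof -
    obtain d where d: "d > 0" "\<And>h. norm h < d \<Longrightarrow> \<bar>f (z + h) - f z - g \<bullet> h - (1/2) * (H h \<bullet> h)\<bar> \<le> e' * (norm h)\<^sup>2"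
      using exp[OF e'] by blast
    have "w x' \<le> w s2 + (snd g - (2 * c) *\<^sub>R snd z) \<bullet> (x' - s2) + (1/2) * (Y (x' - s2) \<bullet> (x' - s2)) + e' * (norm (x' - s2))\<^sup>2"
      if x': "x' \<in> S2" "norm (x' - s2) < d" for x'
    proof -
      define h where "h = x' - s2"
      have "w x' \<le> w s2 + (F2 (snd z + h) - F2 (snd z)) - 2 * c * (snd z \<bullet> h) - c * (norm h)\<^sup>2"
        using convexified_sup_conv_jet[OF S(2) ne(2) cont(2) s(2) e(2)[unfolded F2_def] x'(1)] by (simp add: h_def F2_def)
      moreover have "F2 (snd z + h) - F2 (snd z) = f (z + (0, h)) - f z" by (simp add: f_def)
      moreover have "\<bar>f (z + (0, h)) - f z - snd g \<bullet> h - (1/2) * (H (0, h) \<bullet> (0, h))\<bar> \<le> e' * (norm h)\<^sup>2"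
        using d(2)[of "(0, h)"] x'(2) by (simp add: h_def norm_Pair inner_prod_def)
      ultimately show ?thesis unfolding h_def[symmetric] YH by (simp add: inner_diff_left algebra_simps abs_le_iff)
    qed
    then show ?thesis using d(1) by blast
  qed
  have pb: "norm (g' - (2 * c) *\<^sub>R z') < \<epsilon>" if "norm g' \<le> norm g" "norm z' \<le> norm z" for g' z' :: 'a
  proof -
    have "norm (g' - (2 * c) *\<^sub>R z') \<le> norm g' + 2 * c * norm z'" using norm_triangle_ineq4[of g' "(2 * c) *\<^sub>R z'"] c by simp
    also have "\<dots> \<le> \<delta> + 2 * c * \<delta>" using that z g c by (intro add_mono mult_left_mono) auto
    finally show ?thesis using \<delta>(3) by linarith
  qed
  have "norm s1 \<le> norm (s1, s2)" "norm s2 \<le> norm (s1, s2)" by (auto simp: norm_Pair)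
  then have "norm s1 < \<epsilon>" "norm s2 < \<epsilon>" using ns by linarith+
  moreover have "norm (fst g - (2 * c) *\<^sub>R fst z) < \<epsilon>" "norm (snd g - (2 * c) *\<^sub>R snd z) < \<epsilon>"
    using pb norm_fst_le norm_snd_le by (metis prod.collapse)+
  ultimately show thesis using that[OF s _ _ _ _ linX linY XY jet1 jet2] by blast
qed

text \<open>Translating both points to \<open>0\<close> and subtracting the affine part leaves the
  second-order data unchanged.\<close>

theorem theorem_on_sums:
  fixes S1 S2 :: "'a::euclidean_space set" and A :: "'a \<times> 'a \<Rightarrow> 'a \<times> 'a"
  assumes S: "compact S1" "compact S2" "z1 \<in> S1" "z2 \<in> S2"
    and cont: "continuous_on S1 u" "continuous_on S2 w"
    and A: "linear A" "\<And>x y. A x \<bullet> y = x \<bullet> A y"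
    and ub: "\<And>x y. x \<in> S1 \<Longrightarrow> y \<in> S2 \<Longrightarrow> u x + w y \<le> u z1 + w z2 + q1 \<bullet> (x - z1) + q2 \<bullet> (y - z2)
       + (1/2) * (A (x - z1, y - z2) \<bullet> (x - z1, y - z2))"
    and \<epsilon>: "0 < \<epsilon>"
  obtains x y p r X Y where "x \<in> S1" "y \<in> S2" "norm (x - z1) < \<epsilon>" "norm (y - z2) < \<epsilon>" "norm (p - q1) < \<epsilon>" "norm (r - q2) < \<epsilon>"
    "linear X" "linear Y" "\<forall>h k. X h \<bullet> h + Y k \<bullet> k \<le> A (h, k) \<bullet> (h, k) + \<epsilon> * ((norm h)\<^sup>2 + (norm k)\<^sup>2)"
    "\<forall>e>0. \<exists>d>0. \<forall>x'\<in>S1. norm (x' - x) < d \<longrightarrow>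
       u x' \<le> u x + p \<bullet> (x' - x) + (1/2) * (X (x' - x) \<bullet> (x' - x)) + e * (norm (x' - x))\<^sup>2"
    "\<forall>e>0. \<exists>d>0. \<forall>y'\<in>S2. norm (y' - y) < d \<longrightarrow>
       w y' \<le> w y + r \<bullet> (y' - y) + (1/2) * (Y (y' - y) \<bullet> (y' - y)) + e * (norm (y' - y))\<^sup>2"
proof -
  define u' where "u' s = u (z1 + s) - q1 \<bullet> s - u z1" for s
  define w' where "w' s = w (z2 + s) - q2 \<bullet> s - w z2" for s
  define T1 where "T1 = (\<lambda>x. x - z1) ` S1"
  define T2 where "T2 = (\<lambda>x. x - z2) ` S2"
  have T: "compact T1" "compact T2" "0 \<in> T1" "0 \<in> T2"
    using S by (auto simp: T1_def T2_def image_iff intro!: compact_continuous_image continuous_intros) 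
  have c: "continuous_on T1 u'" "continuous_on T2 w'" unfolding u'_def w'_def
    by (intro continuous_intros continuous_on_compose2[OF cont(1)] continuous_on_compose2[OF cont(2)]; auto simp: T1_def T2_def)+
  have ub': "u' x + w' y \<le> (1/2) * (A (x, y) \<bullet> (x, y))" if "x \<in> T1" "y \<in> T2" for x y
    using ub[of "z1 + x" "z2 + y"] that by (auto simp: T1_def T2_def u'_def w'_def)
  obtain x y p r X Y where *: "x \<in> T1" "y \<in> T2" "norm x < \<epsilon>" "norm y < \<epsilon>" "norm p < \<epsilon>" "norm r < \<epsilon>"
    "linear X" "linear Y" "\<And>h k. X h \<bullet> h + Y k \<bullet> k \<le> A (h, k) \<bullet> (h, k) + \<epsilon> * ((norm h)\<^sup>2 + (norm k)\<^sup>2)"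
    and j1: "\<And>e. 0 < e \<Longrightarrow> \<exists>d>0. \<forall>x'\<in>T1. norm (x' - x) < d \<longrightarrow>
       u' x' \<le> u' x + p \<bullet> (x' - x) + (1/2) * (X (x' - x) \<bullet> (x' - x)) + e * (norm (x' - x))\<^sup>2"
    and j2: "\<And>e. 0 < e \<Longrightarrow> \<exists>d>0. \<forall>y'\<in>T2. norm (y' - y) < d \<longrightarrow>
       w' y' \<le> w' y + r \<bullet> (y' - y) + (1/2) * (Y (y' - y) \<bullet> (y' - y)) + e * (norm (y' - y))\<^sup>2"
    by (rule theorem_on_sums_at_0[OF T c _ _ A ub' \<epsilon>]) (auto simp: u'_def w'_def)
  show thesis
  proof (rule that[of "z1 + x" "z2 + y" "p + q1" "r + q2" X Y]; (intro allI impI)?)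
    fix e :: real assume e: "0 < e"
    obtain d where d: "d > 0" "\<And>x'. x' \<in> T1 \<Longrightarrow> norm (x' - x) < d \<Longrightarrow>
       u' x' \<le> u' x + p \<bullet> (x' - x) + (1/2) * (X (x' - x) \<bullet> (x' - x)) + e * (norm (x' - x))\<^sup>2" using j1[OF e] by blast
    have "u x' \<le> u (z1 + x) + (p + q1) \<bullet> (x' - (z1 + x)) + (1/2) * (X (x' - (z1 + x)) \<bullet> (x' - (z1 + x))) + e * (norm (x' - (z1 + x)))\<^sup>2"
      if "x' \<in> S1" "norm (x' - (z1 + x)) < d" for x'
      using d(2)[of "x' - z1"] that by (simp add: T1_def u'_def diff_diff_eq inner_add_left inner_diff_right inner_add_right)
    then show "\<exists>d>0. \<forall>x'\<in>S1. norm (x' - (z1 + x)) < d \<longrightarrow>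
       u x' \<le> u (z1 + x) + (p + q1) \<bullet> (x' - (z1 + x)) + (1/2) * (X (x' - (z1 + x)) \<bullet> (x' - (z1 + x))) + e * (norm (x' - (z1 + x)))\<^sup>2"
      using d(1) by blast
  next
    fix e :: real assume e: "0 < e"
    obtain d where d: "d > 0" "\<And>x'. x' \<in> T2 \<Longrightarrow> norm (x' - y) < d \<Longrightarrow>
       w' x' \<le> w' y + r \<bullet> (x' - y) + (1/2) * (Y (x' - y) \<bullet> (x' - y)) + e * (norm (x' - y))\<^sup>2" using j2[OF e] by blast
    have "w x' \<le> w (z2 + y) + (r + q2) \<bullet> (x' - (z2 + y)) + (1/2) * (Y (x' - (z2 + y)) \<bullet> (x' - (z2 + y))) + e * (norm (x' - (z2 + y)))\<^sup>2"
      if "x' \<in> S2" "norm (x' - (z2 + y)) < d" for x'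
      using d(2)[of "x' - z2"] that by (simp add: T2_def w'_def diff_diff_eq inner_add_left inner_diff_right inner_add_right)
    then show "\<exists>d>0. \<forall>x'\<in>S2. norm (x' - (z2 + y)) < d \<longrightarrow>
       w x' \<le> w (z2 + y) + (r + q2) \<bullet> (x' - (z2 + y)) + (1/2) * (Y (x' - (z2 + y)) \<bullet> (x' - (z2 + y))) + e * (norm (x' - (z2 + y)))\<^sup>2"
      using d(1) by blast
  qed (use * in \<open>auto simp: T1_def T2_def\<close>)
qed

section \<open>The structural inequality at a doubled maximum\<close>

lemma tendsto_SUP_at_right_0:
  fixes q :: "real \<Rightarrow> ereal"
  assumes q: "\<And>h k. 0 < h \<Longrightarrow> h < k \<Longrightarrow> q k \<le> q h"
  shows "(q \<longlongrightarrow> (SUP h\<in>{0<..}. q h)) (at_right 0)"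
proof (rule order_tendstoI)
  fix a assume "a < (SUP h\<in>{0<..}. q h)"
  then obtain k where k: "k > 0" "a < q k" by (auto simp: less_SUP_iff)
  have "a < q h" if "h > 0" "h < k" for h using q[OF that] k(2) by simp
  then show "\<forall>\<^sub>F h in at_right 0. a < q h" using k(1) by (auto simp: eventually_at_right_field)
next
  fix a assume a: "(SUP h\<in>{0<..}. q h) < a"
  have "q h < a" if "h > 0" for h using a that by (meson SUP_upper greaterThan_iff le_less_trans)
  then show "\<forall>\<^sub>F h in at_right 0. q h < a" by (auto simp: eventually_at_right_field intro: exI[of _ 1])
qed

lemma ereal_convex_left_quotient_mono:
  fixes F :: "real \<Rightarrow> ereal"
  assumes F: "ereal_convex F" "\<And>y. F y \<noteq> -\<infinity>" and a: "F a = ereal \<alpha>" and hk: "0 < h" "h < k"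
  shows "(F a - F (a - k)) / ereal k \<le> (F a - F (a - h)) / ereal h"
proof (cases "F (a - k)")
  case (real r)
  define \<theta> where "\<theta> = h / k"
  have \<theta>: "0 < \<theta>" "\<theta> < 1" using hk by (auto simp: \<theta>_def)
  have "\<theta> *\<^sub>R (a - k) + (1 - \<theta>) *\<^sub>R a = a - h" using hk by (simp add: \<theta>_def field_simps)
  then have le: "F (a - h) \<le> ereal (\<theta> * r + (1 - \<theta>) * \<alpha>)"
    using F(1)[unfolded ereal_convex_def, rule_format, of \<theta> "a - k" a] \<theta> real a by simp
  then obtain p where p: "F (a - h) = ereal p" using F(2)[of "a - h"] by (cases "F (a - h)") auto
  have "p \<le> \<theta> * r + (1 - \<theta>) * \<alpha>" using le p by simp
  then have "p \<le> (h / k) * r + \<alpha> - (h / k) * \<alpha>" by (simp add: \<theta>_def algebra_simps)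
  then have "p * k \<le> ((h / k) * r + \<alpha> - (h / k) * \<alpha>) * k" using hk by (intro mult_right_mono) auto
  then have "p * k \<le> h * r + \<alpha> * k - h * \<alpha>" using hk by (simp add: algebra_simps)
  then have "(\<alpha> - r) / k \<le> (\<alpha> - p) / h" using hk by (simp add: field_simps)
  then show ?thesis unfolding p a real using hk by simp
next
  case PInf
  then show ?thesis using a hk by (simp add: divide_ereal_def)
qed (use F(2) in auto)

lemma ereal_convex_left_derivative_ge:
  fixes F :: "real \<Rightarrow> ereal"
  assumes F: "ereal_convex F" "\<And>y. F y \<noteq> -\<infinity>" and a: "F a = ereal \<alpha>" and h: "0 < h"
  shows "((\<lambda>h. (F a - F (a - h)) / ereal h) \<longlongrightarrow> left_derivative F a) (at_right 0)"
    "(F a - F (a - h)) / ereal h \<le> left_derivative F a"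
proof -
  let ?q = "\<lambda>h. (F a - F (a - h)) / ereal h"
  have t: "(?q \<longlongrightarrow> (SUP h\<in>{0<..}. ?q h)) (at_right 0)"
    by (rule tendsto_SUP_at_right_0) (rule ereal_convex_left_quotient_mono[OF F a])
  then have "left_derivative F a = (SUP h\<in>{0<..}. ?q h)"
    unfolding left_derivative_def by (intro tendsto_Lim) auto
  then show "(?q \<longlongrightarrow> left_derivative F a) (at_right 0)" "?q h \<le> left_derivative F a"
    using t h by (auto intro: SUP_upper)
qed

text \<open>The slope of the chord from \<open>c\<close> to \<open>a\<close> separates the two
  derivatives. Besides expressing monotonicity, this excludes the value \<open>-\<infinity>\<close>
  for the left derivative at \<open>a\<close> and \<open>\<infinity>\<close> for the right
  derivative at \<open>c\<close>.\<close>

lemma ereal_convex_slope_between: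
  fixes F :: "real \<Rightarrow> ereal"
  assumes F: "ereal_convex F" "\<And>y. F y \<noteq> -\<infinity>" and fin: "F a < \<infinity>" "F c < \<infinity>" and ca: "c < a"
  obtains k where "ereal k \<le> left_derivative F a" "right_derivative F c \<le> ereal k"
proof -
  obtain \<alpha> \<gamma> where r: "F a = ereal \<alpha>" "F c = ereal \<gamma>" using fin F(2)[of a] F(2)[of c] by (cases "F a"; cases "F c") auto
  define k where "k = (\<alpha> - \<gamma>) / (a - c)"
  have 1: "ereal k \<le> left_derivative F a"
    using ereal_convex_left_derivative_ge(2)[OF F r(1), of "a - c"] ca r by (simp add: k_def)
  define G where "G z = F (- z)" for z
  have G: "ereal_convex G" "\<And>y. G y \<noteq> -\<infinity>" "G (- c) = ereal \<gamma>"
  proof -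
    show "ereal_convex G" unfolding ereal_convex_def
    proof (intro allI impI)
      fix x y \<theta> :: real assume "0 < \<theta> \<and> \<theta> < 1"
      then show "G (\<theta> *\<^sub>R x + (1 - \<theta>) *\<^sub>R y) \<le> ereal \<theta> * G x + ereal (1 - \<theta>) * G y"
        using F(1)[unfolded ereal_convex_def, rule_format, of \<theta> "- x" "- y"] by (simp add: G_def algebra_simps)
    qed
  qed (use F r in \<open>auto simp: G_def\<close>)
  have "((\<lambda>h. - ((G (- c) - G (- c - h)) / ereal h)) \<longlongrightarrow> - left_derivative G (- c)) (at_right 0)"
    using ereal_convex_left_derivative_ge(1)[OF G zero_less_one] by (intro tendsto_uminus_ereal)
  then have "((\<lambda>h. (F (c + h) - F c) / ereal h) \<longlongrightarrow> - left_derivative G (- c)) (at_right 0)"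
  proof (rule Lim_transform_eventually)
    have "- ((G (- c) - G (- c - h)) / ereal h) = (F (c + h) - F c) / ereal h" if "h > 0" for h
      using that r F(2)[of "c + h"] by (cases "F (c + h)") (auto simp: G_def divide_ereal_def algebra_simps)
    then show "\<forall>\<^sub>F h in at_right 0. - ((G (- c) - G (- c - h)) / ereal h) = (F (c + h) - F c) / ereal h"
      by (auto simp: eventually_at_right_field intro: exI[of _ 1])
  qed
  then have "right_derivative F c = - left_derivative G (- c)"
    unfolding right_derivative_def by (intro tendsto_Lim) auto
  moreover have "ereal (- k) \<le> left_derivative G (- c)"
    using ereal_convex_left_derivative_ge(2)[OF G, of "a - c"] ca r G(3) by (simp add: k_def G_def[of "- a"] minus_divide_left)
  ultimately have 2: "right_derivative F c \<le> ereal k" by (metis ereal_minus_le_minus ereal_uminus_uminus uminus_ereal.simps(1))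
  show thesis using that[OF 1 2] .
qed

section \<open>Lower limits of the subdifferential\<close>

lemma subdiff_lower_ge:
  assumes \<delta>: "0 < \<delta>"
    and ge: "\<And>x' q' \<xi>. dist x' x < \<delta> \<Longrightarrow> dist q' q < \<delta> \<Longrightarrow> \<xi> \<in> subdifferential \<psi> x' \<Longrightarrow> m \<le> ereal (\<xi> \<bullet> q')"
  shows "m \<le> subdiff_lower \<psi> x q"
  unfolding subdiff_lower_def
proof (rule Liminf_bounded)
  have "\<forall>\<^sub>F p in nhds (x, q). dist (fst p) x < \<delta> \<and> dist (snd p) q < \<delta>"
  proof -
    have "\<forall>\<^sub>F p in nhds (x, q). p \<in> ball x \<delta> \<times> ball q \<delta>"
      by (rule eventually_nhds_in_open) (use \<delta> in \<open>auto intro: open_Times\<close>)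
    then show ?thesis by eventually_elim (auto simp: dist_commute)
  qed
  then have "\<forall>\<^sub>F z in filtercomap (\<lambda>(x', q', \<xi>). (x', q')) (nhds (x, q)). dist (fst z) x < \<delta> \<and> dist (fst (snd z)) q < \<delta>"
    by (rule eventually_filtercomapI[THEN eventually_mono]) auto
  then show "\<forall>\<^sub>F z in inf (filtercomap (\<lambda>(x', q', \<xi>). (x', q')) (nhds (x, q))) (principal {(x', q', \<xi>). \<xi> \<in> subdifferential \<psi> x'}).
      m \<le> (case z of (x', q', \<xi>) \<Rightarrow> ereal (\<xi> \<bullet> q'))"
    unfolding eventually_inf_principal by eventually_elim (use ge in auto)
qed

text \<open>Only the sum of the two pairings is bounded below. If neither lower limit is
  \<open>\<infinity>\<close>, subgradients exist near both points; fixing one of them bounds the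
  other lower limit from below, so both are finite and can be added.\<close>

lemma subdiff_lower_add_ge:
  assumes \<delta>: "0 < \<delta>"
    and ge: "\<And>x' q' \<xi> y' r' \<eta>. dist x' x < \<delta> \<Longrightarrow> dist q' q < \<delta> \<Longrightarrow> \<xi> \<in> subdifferential \<psi> x' \<Longrightarrow>
        dist y' y < \<delta> \<Longrightarrow> dist r' r < \<delta> \<Longrightarrow> \<eta> \<in> subdifferential \<psi> y' \<Longrightarrow> B \<le> \<xi> \<bullet> q' + \<eta> \<bullet> r'"
    and fin: "subdiff_lower \<psi> x q \<noteq> \<infinity>" "subdiff_lower \<psi> y r \<noteq> \<infinity>"
  obtains s1 s2 where "subdiff_lower \<psi> x q = ereal s1" "subdiff_lower \<psi> y r = ereal s2" "B \<le> s1 + s2"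
proof -
  have ex: "\<exists>x' q' \<xi>. dist x' x < \<delta> \<and> dist q' q < \<delta> \<and> \<xi> \<in> subdifferential \<psi> x'" if "subdiff_lower \<psi> x q \<noteq> \<infinity>" for x q
  proof (rule ccontr)
    assume "\<not> ?thesis"
    then have "\<infinity> \<le> subdiff_lower \<psi> x q" by (intro subdiff_lower_ge[OF \<delta>]) auto
    then show False using that by simp
  qed
  obtain x' q' \<xi> where 1: "dist x' x < \<delta>" "dist q' q < \<delta>" "\<xi> \<in> subdifferential \<psi> x'" using ex[OF fin(1)] by blast
  obtain y' r' \<eta> where 2: "dist y' y < \<delta>" "dist r' r < \<delta>" "\<eta> \<in> subdifferential \<psi> y'" using ex[OF fin(2)] by blast
  have "ereal (B - \<eta> \<bullet> r') \<le> subdiff_lower \<psi> x q"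
    by (rule subdiff_lower_ge[OF \<delta>]) (use ge[OF _ _ _ 2] in \<open>auto simp: algebra_simps\<close>)
  then obtain s1 where s1: "subdiff_lower \<psi> x q = ereal s1" using fin(1) by (cases "subdiff_lower \<psi> x q") auto
  have "B - \<eta>' \<bullet> r'' \<le> s1" if "dist y'' y < \<delta>" "dist r'' r < \<delta>" "\<eta>' \<in> subdifferential \<psi> y''" for y'' r'' \<eta>'
  proof -
    have "ereal (B - \<eta>' \<bullet> r'') \<le> subdiff_lower \<psi> x q"
      by (rule subdiff_lower_ge[OF \<delta>]) (use ge[OF _ _ _ that] in \<open>auto simp: algebra_simps\<close>)
    then show ?thesis using s1 by simp
  qed
  then have "ereal (B - s1) \<le> subdiff_lower \<psi> y r"
    by (intro subdiff_lower_ge[OF \<delta>]) (auto simp: algebra_simps)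
  then obtain s2 where s2: "subdiff_lower \<psi> y r = ereal s2" "B - s1 \<le> s2" using fin(2) by (cases "subdiff_lower \<psi> y r") auto
  show thesis using that[OF s1 s2(1)] s2(2) by simp
qed

text \<open>As the value \<open>a\<close> of the subsolution exceeds the value \<open>c\<close> of
  the supersolution, a chord slope of \<open>\<phi>\<close> cancels in the difference, and the
  indeterminate cases, in which the inequalities say nothing, are ruled out. The supersolution
  contributes a lower limit at \<open>- r\<close> through the definition of
  \<open>subdiff_upper\<close>.\<close>

lemma viscosity_inequalities_combine:
  assumes phi: "ereal_convex \<phi>" "\<And>y. \<phi> y \<noteq> -\<infinity>" "a \<in> effective_domain \<phi>" "c \<in> effective_domain \<phi>" "c < a"
    and \<delta>: "0 < \<delta>"
    and ge: "\<And>x' q' \<xi> y' r' \<eta>. dist x' x < \<delta> \<Longrightarrow> dist q' q < \<delta> \<Longrightarrow> \<xi> \<in> subdifferential \<psi> x' \<Longrightarrow>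
        dist y' y < \<delta> \<Longrightarrow> dist r' (- r) < \<delta> \<Longrightarrow> \<eta> \<in> subdifferential \<psi> y' \<Longrightarrow> B \<le> \<xi> \<bullet> q' + \<eta> \<bullet> r'"
    and sub: "ereal P1 \<le> - left_derivative \<phi> a - subdiff_lower \<psi> x q"
    and super: "ereal P2 \<ge> - (right_derivative \<phi> c + subdiff_upper \<psi> y r)"
  shows "P1 - P2 \<le> - B"
proof -
  obtain k where k: "ereal k \<le> left_derivative \<phi> a" "right_derivative \<phi> c \<le> ereal k"
    using ereal_convex_slope_between[OF phi(1,2) _ _ phi(5)] phi(3,4) by (auto simp: effective_domain_def)
  have 1: "subdiff_lower \<psi> x q \<noteq> \<infinity>" using sub k(1) by (cases "left_derivative \<phi> a") auto
  have 2: "subdiff_lower \<psi> y (- r) \<noteq> \<infinity>"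
    using super k(2) by (cases "right_derivative \<phi> c") (auto simp: subdiff_upper_def)
  obtain s1 s2 where s: "subdiff_lower \<psi> x q = ereal s1" "subdiff_lower \<psi> y (- r) = ereal s2" "B \<le> s1 + s2"
    by (rule subdiff_lower_add_ge[OF \<delta> ge 1 2]) auto
  have "P1 \<le> - k - s1" using sub k(1) s(1) by (cases "left_derivative \<phi> a") auto
  moreover have "P2 \<ge> - k + s2" using super k(2) s(2) by (cases "right_derivative \<phi> c") (auto simp: subdiff_upper_def)
  ultimately show ?thesis using s(3) by linarith
qed

section \<open>Quadratic forms and parabolic jets\<close>

text \<open>The theorem on sums compares quadratic forms; this lets the comparison be applied to
  each pair of columns of the two covariance roots.\<close>

lemma trace_covariance_mult:
  fixes S :: "real^'d^'n" and X :: "real^'n^'n"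
  shows "trace ((S ** transpose S) ** X) = (\<Sum>k\<in>UNIV. (X *v column k S) \<bullet> column k S)"
proof -
  have "trace ((S ** transpose S) ** X) = trace (transpose S ** X ** S)"
    by (metis matrix_mul_assoc trace_mul_sym)
  also have "\<dots> = (\<Sum>k\<in>UNIV. (X *v column k S) \<bullet> column k S)"
    unfolding trace_def
  proof (rule sum.cong[OF refl])
    fix k
    have "(transpose S ** X ** S) $ k $ k = (\<Sum>j\<in>UNIV. (\<Sum>i\<in>UNIV. S $ i $ k * X $ i $ j) * S $ j $ k)"
      by (simp add: matrix_matrix_mult_def transpose_def)
    also have "\<dots> = (\<Sum>i\<in>UNIV. (\<Sum>j\<in>UNIV. X $ i $ j * S $ j $ k) * S $ i $ k)"
      unfolding sum_distrib_right by (subst sum.swap) (simp add: mult_ac)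
    also have "\<dots> = (X *v column k S) \<bullet> column k S"
      by (simp add: inner_vec_def matrix_vector_mult_def column_def)
    finally show "(transpose S ** X ** S) $ k $ k = (X *v column k S) \<bullet> column k S" .
  qed
  finally show ?thesis .
qed

text \<open>Jets require a symmetric matrix, while the second-order expansion delivers a linear map;
  its symmetric part has the same form.\<close>

lemma symmetric_matrix_of_form:
  fixes B :: "real^'n \<Rightarrow> real^'n"
  assumes B: "linear B"
  obtains M :: "real^'n^'n" where "transpose M = M" "\<And>y. (M *v y) \<bullet> y = B y \<bullet> y"
proof
  let ?M = "(1/2) *\<^sub>R (matrix B + transpose (matrix B))"
  show "transpose ?M = ?M"
    by (simp add: transpose_def vec_eq_iff add.commute)
  fix y
  have "(?M *v y) \<bullet> y = (1/2) * ((matrix B *v y) \<bullet> y + (transpose (matrix B) *v y) \<bullet> y)"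
    by (simp add: scaleR_matrix_vector_assoc[symmetric] matrix_vector_mult_add_rdistrib inner_add_left)
  also have "(transpose (matrix B) *v y) \<bullet> y = (matrix B *v y) \<bullet> y"
    by (simp add: dot_lmul_matrix[symmetric] inner_commute)
  finally show "(?M *v y) \<bullet> y = B y \<bullet> y" using matrix_works[of B y] B by (simp add: linear_matrix_vector_mul_eq)
qed

text \<open>Second-order terms involving time are of order \<open>o(|s - t| + |y - x|\<^sup>2)\<close>, so only the spatial block of an
  elliptic jet on \<open>[0,T] \<times> D\<close> enters the parabolic jet.\<close>

lemma superjet_of_elliptic_jet:
  fixes u :: "real \<Rightarrow> real^'n \<Rightarrow> real" and X :: "real \<times> (real^'n) \<Rightarrow> real \<times> (real^'n)"
  assumes X: "linear X" and r: "0 < r"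
    and S: "\<And>s y. s \<in> {0..T} \<Longrightarrow> y \<in> D \<Longrightarrow> norm ((s, y) - (t, x)) < r \<Longrightarrow> (s, y) \<in> S"
    and jet: "\<And>e. 0 < e \<Longrightarrow> \<exists>d>0. \<forall>z\<in>S. norm (z - (t, x)) < d \<longrightarrow>
       case_prod u z \<le> u t x + (p, q) \<bullet> (z - (t, x)) + (1/2) * (X (z - (t, x)) \<bullet> (z - (t, x))) + e * (norm (z - (t, x)))\<^sup>2"
  obtains M where "(p, q, M) \<in> superjet T D u t x" "\<And>y. (M *v y) \<bullet> y = X (0, y) \<bullet> (0, y)"
proof -
  interpret X: linear X by (rule X)
  have linB: "linear (\<lambda>y. snd (X (0, y)))"
  proof -
    have "linear (\<lambda>y. (0::real, y::real^'n))" by (auto intro!: linearI)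
    from linear_compose[OF linear_compose[OF this X] linear_snd] show ?thesis by (simp add: o_def)
  qed
  obtain M where M: "transpose M = M" "\<And>y. (M *v y) \<bullet> y = snd (X (0, y)) \<bullet> y"
    using symmetric_matrix_of_form[OF linB] by blast
  have M': "(M *v y) \<bullet> y = X (0, y) \<bullet> (0, y)" for y using M(2)[of y] by (simp add: inner_prod_def)
  obtain a where a: "a > 0" "\<And>v. norm (X v) \<le> norm v * a"
    using bounded_linear.pos_bounded[of X] X linear_conv_bounded_linear by auto
  \<comment> \<open>With the positive part of the defect as remainder the jet inequality is
    automatic, and only the order of the remainder has to be checked.\<close>
  define R where "R = (\<lambda>(s, y). max 0 (u s y - parabolic_expansion u t x p q M s y))"
  let ?F = "at (t, x) within {0..T} \<times> D"
  have Xdiff: "X (s, y) \<bullet> (s, y) - X (0, y) \<bullet> (0, y) \<le> a * (\<bar>s\<bar> * (3 * (\<bar>s\<bar> + norm y)))" for s y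
  proof -
    have e: "X (s, y) = X (s, 0) + X (0, y)" using X.add[of "(s, 0)" "(0, y)"] by simp
    have "X (s, y) \<bullet> (s, y) - X (0, y) \<bullet> (0, y) = X (s, 0) \<bullet> (s, y) + X (0, y) \<bullet> (s, 0)"
      unfolding e by (simp add: inner_add_left inner_prod_def distrib_right)
    also have "\<dots> \<le> norm (X (s, 0)) * norm (s, y) + norm (X (0, y)) * norm (s, 0::real^'n)"
      by (intro add_mono norm_cauchy_schwarz)
    also have "\<dots> \<le> (norm (s, 0::real^'n) * a) * norm (s, y) + (norm (0::real, y) * a) * norm (s, 0::real^'n)"
      by (intro add_mono mult_right_mono a) auto
    also have "\<dots> = a * (\<bar>s\<bar> * (norm (s, y) + norm y))" by (simp add: norm_Pair algebra_simps)
    also have "\<dots> \<le> a * (\<bar>s\<bar> * (3 * (\<bar>s\<bar> + norm y)))"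
    proof (intro mult_left_mono)
      have "norm (s, y) \<le> \<bar>s\<bar> + norm y" by (metis norm_Pair_le real_norm_def)
      then show "norm (s, y) + norm y \<le> 3 * (\<bar>s\<bar> + norm y)" using norm_ge_zero[of y] abs_ge_zero[of s] unfolding distrib_left by argo
    qed (use a in auto)
    finally show ?thesis .
  qed
  have "R \<in> o[?F](\<lambda>(s, y). \<bar>s - t\<bar> + (norm (y - x))\<^sup>2)"
  proof (rule landau_o.smallI)
    fix c :: real assume c: "c > 0"
    obtain d where d: "d > 0" "\<And>z. z \<in> S \<Longrightarrow> norm (z - (t, x)) < d \<Longrightarrow>
       case_prod u z \<le> u t x + (p, q) \<bullet> (z - (t, x)) + (1/2) * (X (z - (t, x)) \<bullet> (z - (t, x))) + (c / 2) * (norm (z - (t, x)))\<^sup>2"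
      using jet[of "c / 2"] c by (meson half_gt_zero)
    define d' where "d' = min (min d r) (min 1 (c / (2 * (3 * a + 1))))"
    have d': "d' > 0" using d r c a by (simp add: d'_def add_pos_pos)
    have bd: "norm (R z) \<le> c * norm (case z of (s, y) \<Rightarrow> \<bar>s - t\<bar> + (norm (y - x))\<^sup>2)"
      if z: "z \<in> {0..T} \<times> D" "norm (z - (t, x)) < d'" for z
    proof -
      obtain s y where zs: "z = (s, y)" by (cases z)
      define \<sigma> where "\<sigma> = s - t" define \<eta> where "\<eta> = y - x"
      have zz: "z - (t, x) = (\<sigma>, \<eta>)" by (simp add: zs \<sigma>_def \<eta>_def)
      have small: "norm (\<sigma>, \<eta>) < d'" using z(2) zz by simp
      have comp: "\<bar>\<sigma>\<bar> \<le> norm (\<sigma>, \<eta>)" "norm \<eta> \<le> norm (\<sigma>, \<eta>)" by (use norm_fst_le[of \<sigma> \<eta>] norm_snd_le[of \<eta> \<sigma>] in auto)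
      have zS: "z \<in> S" using S[of s y] z small zz by (auto simp: zs d'_def)
      have n2: "(norm (\<sigma>, \<eta>))\<^sup>2 = \<sigma>\<^sup>2 + (norm \<eta>)\<^sup>2" by (simp add: norm_Pair)
      have "u s y \<le> u t x + p * \<sigma> + q \<bullet> \<eta> + (1/2) * (X (\<sigma>, \<eta>) \<bullet> (\<sigma>, \<eta>)) + (c / 2) * (\<sigma>\<^sup>2 + (norm \<eta>)\<^sup>2)"
        using d(2)[OF zS] small unfolding zz n2 by (simp add: zs d'_def inner_prod_def)
      then have 1: "u s y - parabolic_expansion u t x p q M s y \<le> (1/2) * (a * (\<bar>\<sigma>\<bar> * (3 * (\<bar>\<sigma>\<bar> + norm \<eta>)))) + (c / 2) * (\<sigma>\<^sup>2 + (norm \<eta>)\<^sup>2)"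
        using Xdiff[of \<sigma> \<eta>] unfolding parabolic_expansion_def M' \<sigma>_def[symmetric] \<eta>_def[symmetric] by argo
      have d'1: "d' \<le> 1" "d' \<le> c / (2 * (3 * a + 1))" by (auto simp: d'_def)
      have s1: "\<bar>\<sigma>\<bar> \<le> d'" "norm \<eta> \<le> d'" using comp small by linarith+
      have "(1/2) * (a * (\<bar>\<sigma>\<bar> * (3 * (\<bar>\<sigma>\<bar> + norm \<eta>)))) \<le> (1/2) * (a * (\<bar>\<sigma>\<bar> * (3 * (d' + d'))))"
        using s1 a by (intro mult_left_mono add_mono) auto
      also have "\<dots> = \<bar>\<sigma>\<bar> * (3 * a * d')" by simp
      also have "\<dots> \<le> \<bar>\<sigma>\<bar> * (c / 2)"
      proof (rule mult_left_mono)
        have "3 * a * d' \<le> (3 * a + 1) * (c / (2 * (3 * a + 1)))" using d'1(2) a d' by (intro mult_mono) auto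
        also have "\<dots> = c / 2"
        proof -
          have "q \<noteq> 0 \<Longrightarrow> q * (c / (2 * q)) = c / 2" for q by simp
          then show ?thesis using a by (metis add_pos_pos less_irrefl mult_pos_pos zero_less_numeral zero_less_one)
        qed
        finally show "3 * a * d' \<le> c / 2" .
      qed simp
      finally have 2: "(1/2) * (a * (\<bar>\<sigma>\<bar> * (3 * (\<bar>\<sigma>\<bar> + norm \<eta>)))) \<le> \<bar>\<sigma>\<bar> * (c / 2)" .
      have "\<sigma>\<^sup>2 \<le> \<bar>\<sigma>\<bar>" using s1(1) d'1(1) mult_left_mono[of "\<bar>\<sigma>\<bar>" 1 "\<bar>\<sigma>\<bar>"] by (simp add: power2_eq_square)
      then have "(c / 2) * (\<sigma>\<^sup>2 + (norm \<eta>)\<^sup>2) \<le> (c / 2) * (\<bar>\<sigma>\<bar> + (norm \<eta>)\<^sup>2)" using c by (intro mult_left_mono) auto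
      then have "u s y - parabolic_expansion u t x p q M s y \<le> \<bar>\<sigma>\<bar> * (c / 2) + (c / 2) * (\<bar>\<sigma>\<bar> + (norm \<eta>)\<^sup>2)" using 1 2 by linarith
      also have "\<dots> \<le> c * (\<bar>\<sigma>\<bar> + (norm \<eta>)\<^sup>2)" using c by (simp add: algebra_simps)
      finally have "u s y - parabolic_expansion u t x p q M s y \<le> c * (\<bar>\<sigma>\<bar> + (norm \<eta>)\<^sup>2)" .
      then show ?thesis using c by (simp add: R_def zs \<sigma>_def \<eta>_def)
    qed
    show "\<forall>\<^sub>F z in ?F. norm (R z) \<le> c * norm (case z of (s, y) \<Rightarrow> \<bar>s - t\<bar> + (norm (y - x))\<^sup>2)"
      unfolding eventually_at using d' bd by (intro exI[of _ d']) (auto simp: dist_norm)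
  qed
  moreover have "\<forall>\<^sub>F (s, y) in ?F. u s y \<le> parabolic_expansion u t x p q M s y + R (s, y)"
    by (rule always_eventually) (auto simp: R_def)
  ultimately have "(p, q, M) \<in> superjet T D u t x" unfolding superjet_def using M(1) by blast
  then show thesis using that M' by blast
qed

lemma subjet_iff_superjet_uminus:
  "(p, q, M) \<in> subjet T D v t x \<longleftrightarrow> (- p, - q, - M) \<in> superjet T D (\<lambda>s y. - v s y) t x"
proof -
  have e: "parabolic_expansion (\<lambda>s y. - v s y) t x (- p) (- q) (- M) s y = - parabolic_expansion v t x p q M s y" for s y
    using matrix_vector_mult_diff_rdistrib[of 0 M "y - x"] by (simp add: parabolic_expansion_def)
  have tr: "transpose (- M) = - M \<longleftrightarrow> transpose M = M" by (simp add: transpose_def vec_eq_iff)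
  let ?F = "at (t, x) within {0..T} \<times> D" let ?G = "\<lambda>(s, y). \<bar>s - t\<bar> + (norm (y - x))\<^sup>2"
  have "(\<exists>r\<in>o[?F](?G). \<forall>\<^sub>F (s, y) in ?F. v s y \<ge> parabolic_expansion v t x p q M s y + r (s, y)) \<longleftrightarrow>
     (\<exists>r\<in>o[?F](?G). \<forall>\<^sub>F (s, y) in ?F. - v s y \<le> - parabolic_expansion v t x p q M s y + r (s, y))" (is "?L = ?R")
  proof
    assume ?L
    then obtain r where r: "r \<in> o[?F](?G)" "\<forall>\<^sub>F (s, y) in ?F. v s y \<ge> parabolic_expansion v t x p q M s y + r (s, y)" by blast
    have "\<forall>\<^sub>F (s, y) in ?F. - v s y \<le> - parabolic_expansion v t x p q M s y + (- r (s, y))"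
      using r(2) by eventually_elim auto
    then show ?R using r(1) by (intro bexI[of _ "\<lambda>z. - r z"]) auto
  next
    assume ?R
    then obtain r where r: "r \<in> o[?F](?G)" "\<forall>\<^sub>F (s, y) in ?F. - v s y \<le> - parabolic_expansion v t x p q M s y + r (s, y)" by blast
    have "\<forall>\<^sub>F (s, y) in ?F. v s y \<ge> parabolic_expansion v t x p q M s y + (- r (s, y))"
      using r(2) by eventually_elim auto
    then show ?L using r(1) by (intro bexI[of _ "\<lambda>z. - r z"]) auto
  qed
  then show ?thesis unfolding subjet_def superjet_def by (simp add: tr e)
qed

section \<open>The inequality at a doubled maximum\<close>

lemma tendsto_vector_matrix_mult:
  fixes q :: "nat \<Rightarrow> real^'n" and S :: "nat \<Rightarrow> real^'d^'n"
  assumes "q \<longlonglongrightarrow> q0" "S \<longlonglongrightarrow> S0"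
  shows "(\<lambda>n. q n v* S n) \<longlonglongrightarrow> q0 v* S0"
  unfolding vector_matrix_mult_def
  by (intro tendsto_vec_lambda tendsto_sum tendsto_mult tendsto_vec_nth assms)

lemma tendsto_column:
  fixes S :: "nat \<Rightarrow> real^'d^'n"
  assumes "S \<longlonglongrightarrow> S0"
  shows "(\<lambda>n. column k (S n)) \<longlonglongrightarrow> column k S0"
  unfolding column_def by (intro tendsto_vec_lambda tendsto_vec_nth assms)

text \<open>The theorem on sums works on compact sets; local compactness supplies them around each
  point of a domain that need not be closed.\<close>

lemma compact_spacetime_neighbourhood:
  fixes D :: "('a::euclidean_space) set"
  assumes D: "locally compact D" "x \<in> D" and r: "0 < r"
  obtains \<rho> where "0 < \<rho>" "\<rho> < r" "compact (({0..T::real} \<times> D) \<inter> cball (t, x) \<rho>)"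
proof -
  obtain e where e: "e > 0" "closed (cball x e \<inter> D)" using D locally_compact_Int_cball[of D] by auto
  define \<rho> where "\<rho> = min r e / 2"
  have \<rho>: "0 < \<rho>" "\<rho> < r" "\<rho> < e" using r e by (auto simp: \<rho>_def)
  have "compact (cball x e \<inter> D)" 
    by (intro compact_eq_bounded_closed[THEN iffD2] conjI e(2)) (auto intro: bounded_subset[OF bounded_cball])
  from compact_Times[OF compact_Icc this]
  have "compact (({0..T} \<times> (cball x e \<inter> D)) \<inter> cball (t, x) \<rho>)"
    by (rule compact_Int_closed) (rule closed_cball)
  moreover have "({0..T} \<times> (cball x e \<inter> D)) \<inter> cball (t, x) \<rho> = ({0..T} \<times> D) \<inter> cball (t, x) \<rho>"
  proof -
    have "dist x y \<le> e" if "dist (t, x) (s, y) \<le> \<rho>" for s y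
      using that \<rho>(3) dist_snd_le[of "(t, x)" "(s, y)"] by simp
    then show ?thesis by auto
  qed
  ultimately show thesis using that[OF \<rho>(1,2)] by simp
qed

text \<open>The jets from the theorem on sums give the inequality up to an error
  \<open>\<epsilon>\<close>, and continuity of the coefficients lets \<open>\<epsilon>\<close> tend
  to zero. The discontinuous terms, coming from \<open>\<phi>\<close> and \<open>\<psi>\<close>, are
  eliminated before the limit, which is possible because \<open>ge\<close> holds in a whole
  neighbourhood. The time coefficient \<open>C\<close> disappears because the covariance acts in
  space only.\<close>

theorem doubling_inequality:
  fixes \<psi> :: "real^'n \<Rightarrow> ereal" and \<sigma> :: "real \<Rightarrow> real^'n \<Rightarrow> real \<Rightarrow> real^'d^'n"
  assumes sub: "viscosity_subsolution T \<psi> \<phi> b \<sigma> f g u"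
    and super: "viscosity_supersolution T \<psi> \<phi> b \<sigma> f g' v"
    and phi: "ereal_convex \<phi>" "\<And>y. \<phi> y \<noteq> -\<infinity>"
    and D: "D = effective_domain \<psi>" "locally compact D"
    and contb: "continuous_on ({0..T} \<times> UNIV) (\<lambda>(t, x, y, z). b t x y z)"
    and conts: "continuous_on ({0..T} \<times> UNIV) (\<lambda>(t, x, y). \<sigma> t x y)"
    and contf: "continuous_on ({0..T} \<times> UNIV) (\<lambda>(t, x, y, z). f t x y z)"
    and pts: "t1 \<in> {0..<T}" "x1 \<in> D" "t2 \<in> {0..<T}" "x2 \<in> D" "v t2 x2 < u t1 x1"
    and r: "0 < r"
    and max: "\<And>t x s y. t \<in> {0..T} \<Longrightarrow> x \<in> D \<Longrightarrow> s \<in> {0..T} \<Longrightarrow> y \<in> D \<Longrightarrow>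
        norm ((t, x) - (t1, x1)) < r \<Longrightarrow> norm ((s, y) - (t2, x2)) < r \<Longrightarrow>
        u t x - v s y \<le> u t1 x1 - v t2 x2 + p1 * (t - t1) + q1 \<bullet> (x - x1) - p2 * (s - t2) - q2 \<bullet> (y - x2)
          + (1/2) * (\<alpha> * (norm ((x - x1) - (y - x2)))\<^sup>2 + A1 * (norm (x - x1))\<^sup>2 + A2 * (norm (y - x2))\<^sup>2)
          + C * ((t - t1)\<^sup>2 + (s - t2)\<^sup>2)"
    and \<delta>: "0 < \<delta>"
    and ge: "\<And>x' q' \<xi> y' r' \<eta>. dist x' x1 < \<delta> \<Longrightarrow> dist q' q1 < \<delta> \<Longrightarrow> \<xi> \<in> subdifferential \<psi> x' \<Longrightarrow>
        dist y' x2 < \<delta> \<Longrightarrow> dist r' (- q2) < \<delta> \<Longrightarrow> \<eta> \<in> subdifferential \<psi> y' \<Longrightarrow> B \<le> \<xi> \<bullet> q' + \<eta> \<bullet> r'"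
  defines "S1 \<equiv> \<sigma> t1 x1 (u t1 x1)" and "S2 \<equiv> \<sigma> t2 x2 (v t2 x2)"
  shows "- (p1 - p2) - (1/2) * (\<Sum>k\<in>UNIV. \<alpha> * (norm (column k S1 - column k S2))\<^sup>2 + A1 * (norm (column k S1))\<^sup>2 + A2 * (norm (column k S2))\<^sup>2)
     - (b t1 x1 (u t1 x1) (q1 v* S1) \<bullet> q1 - b t2 x2 (v t2 x2) (q2 v* S2) \<bullet> q2)
     - (f t1 x1 (u t1 x1) (q1 v* S1) - f t2 x2 (v t2 x2) (q2 v* S2)) \<le> - B"
proof -
  have nd: "norm (z - z') = dist z' z" for z z' :: "real \<times> (real^'n)"
    by (simp add: dist_norm norm_minus_commute)
  have cu: "continuous_on ({0..T} \<times> D) (case_prod u)" and cv: "continuous_on ({0..T} \<times> D) (case_prod v)"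
    using sub super by (auto simp: viscosity_subsolution_def viscosity_supersolution_def D(1))
  obtain \<rho>1 where \<rho>1: "0 < \<rho>1" "\<rho>1 < r" "compact (({0..T} \<times> D) \<inter> cball (t1, x1) \<rho>1)"
    by (rule compact_spacetime_neighbourhood[OF D(2) pts(2) r])
  obtain \<rho>2 where \<rho>2: "0 < \<rho>2" "\<rho>2 < r" "compact (({0..T} \<times> D) \<inter> cball (t2, x2) \<rho>2)"
    by (rule compact_spacetime_neighbourhood[OF D(2) pts(4) r])
  let ?K1 = "({0..T} \<times> D) \<inter> cball (t1, x1) \<rho>1" let ?K2 = "({0..T} \<times> D) \<inter> cball (t2, x2) \<rho>2"
  define w where "w z = - case_prod v z" for z
  \<comment> \<open>The Hessian of the quadratic bound in \<open>max\<close>, on pairs of space-time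
    increments.\<close>
  define A :: "(real \<times> (real^'n)) \<times> (real \<times> (real^'n)) \<Rightarrow> (real \<times> (real^'n)) \<times> (real \<times> (real^'n))"
    where "A z = (case z of ((s, h), (s', k)) \<Rightarrow> ((2 * C * s, \<alpha> *\<^sub>R (h - k) + A1 *\<^sub>R h), (2 * C * s', \<alpha> *\<^sub>R (k - h) + A2 *\<^sub>R k)))" for z
  have linA: "linear A" by (rule linearI) (auto simp: A_def algebra_simps split: prod.splits)
  have symA: "A x \<bullet> y = x \<bullet> A y" for x y
    by (auto simp: A_def inner_prod_def inner_add_left inner_add_right inner_diff_left inner_diff_right inner_commute algebra_simps split: prod.splits)
  have Aq: "A ((s, h), (s', k)) \<bullet> ((s, h), (s', k)) = 2 * C * (s\<^sup>2 + s'\<^sup>2) + \<alpha> * (norm (h - k))\<^sup>2 + A1 * (norm h)\<^sup>2 + A2 * (norm k)\<^sup>2" for s h s' k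
    unfolding power2_norm_eq_inner by (simp add: A_def inner_add_left inner_diff_left inner_diff_right inner_commute algebra_simps power2_eq_square)
  have ub: "case_prod u x + w y \<le> case_prod u (t1, x1) + w (t2, x2) + (p1, q1) \<bullet> (x - (t1, x1)) + (- p2, - q2) \<bullet> (y - (t2, x2))
       + (1/2) * (A (x - (t1, x1), y - (t2, x2)) \<bullet> (x - (t1, x1), y - (t2, x2)))" if x: "x \<in> ?K1" and y: "y \<in> ?K2" for x y
  proof -
    obtain t \<xi> s \<eta> where e: "x = (t, \<xi>)" "y = (s, \<eta>)" by (cases x; cases y)
    have "norm ((t, \<xi>) - (t1, x1)) < r" "norm ((s, \<eta>) - (t2, x2)) < r"
      using x y \<rho>1(2) \<rho>2(2) unfolding e nd by auto
    then have "u t \<xi> - v s \<eta> \<le> u t1 x1 - v t2 x2 + p1 * (t - t1) + q1 \<bullet> (\<xi> - x1) - p2 * (s - t2) - q2 \<bullet> (\<eta> - x2)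
          + (1/2) * (\<alpha> * (norm ((\<xi> - x1) - (\<eta> - x2)))\<^sup>2 + A1 * (norm (\<xi> - x1))\<^sup>2 + A2 * (norm (\<eta> - x2))\<^sup>2)
          + C * ((t - t1)\<^sup>2 + (s - t2)\<^sup>2)"
      using x y unfolding e by (intro max) auto
    then show ?thesis unfolding e diff_Pair Aq by (simp add: w_def inner_prod_def algebra_simps)
  qed
  \<comment> \<open>Keeps the approximating points well inside the compact neighbourhoods, before
    time \<open>T\<close>, and within half of the radius \<open>\<delta>\<close>.\<close>
  define \<epsilon>0 where "\<epsilon>0 = Min {\<rho>1 / 2, \<rho>2 / 2, T - t1, T - t2, \<delta> / 2}"
  have \<epsilon>0: "0 < \<epsilon>0" "\<epsilon>0 \<le> \<rho>1 / 2" "\<epsilon>0 \<le> \<rho>2 / 2" "\<epsilon>0 \<le> T - t1" "\<epsilon>0 \<le> T - t2" "\<epsilon>0 \<le> \<delta> / 2"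
  proof -
    show "0 < \<epsilon>0" using \<rho>1 \<rho>2 pts \<delta> by (auto simp: \<epsilon>0_def)
    have "\<epsilon>0 \<le> e" if "e \<in> {\<rho>1 / 2, \<rho>2 / 2, T - t1, T - t2, \<delta> / 2}" for e
      unfolding \<epsilon>0_def by (rule Min_le) (use that in auto)
    from this[of "\<rho>1 / 2"] this[of "\<rho>2 / 2"] this[of "T - t1"] this[of "T - t2"] this[of "\<delta> / 2"]
    show "\<epsilon>0 \<le> \<rho>1 / 2" "\<epsilon>0 \<le> \<rho>2 / 2" "\<epsilon>0 \<le> T - t1" "\<epsilon>0 \<le> T - t2" "\<epsilon>0 \<le> \<delta> / 2" by simp_all
  qed
  define E where "E \<epsilon> a x c y p q p' q' = - (p - p') - (1/2) * (\<Sum>k\<in>UNIV. \<alpha> * (norm (column k (\<sigma> a x (u a x)) - column k (\<sigma> c y (v c y))))\<^sup>2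
        + A1 * (norm (column k (\<sigma> a x (u a x))))\<^sup>2 + A2 * (norm (column k (\<sigma> c y (v c y))))\<^sup>2
        + \<epsilon> * ((norm (column k (\<sigma> a x (u a x))))\<^sup>2 + (norm (column k (\<sigma> c y (v c y))))\<^sup>2))
     - (b a x (u a x) (q v* \<sigma> a x (u a x)) \<bullet> q - b c y (v c y) (q' v* \<sigma> c y (v c y)) \<bullet> q')
     - (f a x (u a x) (q v* \<sigma> a x (u a x)) - f c y (v c y) (q' v* \<sigma> c y (v c y)))" for \<epsilon> a x c y p q p' q'
  have step: "\<exists>a x c y p q p' q'. (a, x) \<in> {0..T} \<times> D \<and> (c, y) \<in> {0..T} \<times> D \<and>
      norm ((a, x) - (t1, x1)) < \<epsilon> \<and> norm ((c, y) - (t2, x2)) < \<epsilon> \<and> norm ((p, q) - (p1, q1)) < \<epsilon> \<and> norm ((p', q') - (p2, q2)) < \<epsilon>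
      \<and> (v c y < u a x \<longrightarrow> E \<epsilon> a x c y p q p' q' \<le> - B)" if \<epsilon>: "0 < \<epsilon>" "\<epsilon> \<le> \<epsilon>0" for \<epsilon>
  proof -
    have z: "(t1, x1) \<in> ?K1" "(t2, x2) \<in> ?K2" using pts \<rho>1 \<rho>2 by auto
    have c1: "continuous_on ?K1 (case_prod u)" by (rule continuous_on_subset[OF cu]) auto
    have c2: "continuous_on ?K2 w" unfolding w_def by (intro continuous_on_minus continuous_on_subset[OF cv]) auto
    obtain X1 X2 P R X Y where k: "X1 \<in> ?K1" "X2 \<in> ?K2" "norm (X1 - (t1, x1)) < \<epsilon>" "norm (X2 - (t2, x2)) < \<epsilon>"
        "norm (P - (p1, q1)) < \<epsilon>" "norm (R - (- p2, - q2)) < \<epsilon>" and lin: "linear X" "linear Y"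
      and XY: "\<forall>h k. X h \<bullet> h + Y k \<bullet> k \<le> A (h, k) \<bullet> (h, k) + \<epsilon> * ((norm h)\<^sup>2 + (norm k)\<^sup>2)"
      and j1: "\<forall>e>0. \<exists>d>0. \<forall>x'\<in>?K1. norm (x' - X1) < d \<longrightarrow>
         case_prod u x' \<le> case_prod u X1 + P \<bullet> (x' - X1) + (1/2) * (X (x' - X1) \<bullet> (x' - X1)) + e * (norm (x' - X1))\<^sup>2"
      and j2: "\<forall>e>0. \<exists>d>0. \<forall>y'\<in>?K2. norm (y' - X2) < d \<longrightarrow>
         w y' \<le> w X2 + R \<bullet> (y' - X2) + (1/2) * (Y (y' - X2) \<bullet> (y' - X2)) + e * (norm (y' - X2))\<^sup>2"
      by (rule theorem_on_sums[OF \<rho>1(3) \<rho>2(3) z c1 c2 linA symA ub \<epsilon>(1)])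
    obtain a x where X1: "X1 = (a, x)" by (cases X1)
    obtain c y where X2: "X2 = (c, y)" by (cases X2)
    obtain p q where P: "P = (p, q)" by (cases P)
    obtain p' q' where R: "R = (- p', - q')" by (cases R) (metis minus_minus)
    have in1: "a \<in> {0..T}" "x \<in> D" and in2: "c \<in> {0..T}" "y \<in> D" using k(1,2) by (auto simp: X1 X2)
    have near: "norm ((a, x) - (t1, x1)) < \<epsilon>" "norm ((c, y) - (t2, x2)) < \<epsilon>" "norm ((p, q) - (p1, q1)) < \<epsilon>" using k by (auto simp: X1 X2 P)
    have near': "norm ((p', q') - (p2, q2)) < \<epsilon>"
    proof -
      have "R - (- p2, - q2) = - ((p', q') - (p2, q2))" by (simp add: R)
      then show ?thesis using k(6) by (metis norm_minus_cancel)
    qed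
    have lt: "a < T" "c < T"
      using near(1,2) \<epsilon> \<epsilon>0 norm_fst_le[of "a - t1" "x - x1"] norm_fst_le[of "c - t2" "y - x2"] by auto
    have sub1: "(s, z) \<in> ?K1" if "s \<in> {0..T}" "z \<in> D" "norm ((s, z) - (a, x)) < \<rho>1 / 2" for s z
    proof -
      have "dist (t1, x1) (s, z) \<le> norm ((a, x) - (t1, x1)) + norm ((s, z) - (a, x))"
        unfolding nd by (rule dist_triangle)
      then have "dist (t1, x1) (s, z) \<le> \<rho>1" using that near(1) \<epsilon> \<epsilon>0 by linarith
      then show ?thesis using that by auto
    qed
    have sub2: "(s, z) \<in> ?K2" if "s \<in> {0..T}" "z \<in> D" "norm ((s, z) - (c, y)) < \<rho>2 / 2" for s z
    proof -
      have "dist (t2, x2) (s, z) \<le> norm ((c, y) - (t2, x2)) + norm ((s, z) - (c, y))"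
        unfolding nd by (rule dist_triangle)
      then have "dist (t2, x2) (s, z) \<le> \<rho>2" using that near(2) \<epsilon> \<epsilon>0 by linarith
      then show ?thesis using that by auto
    qed
    have r1: "0 < \<rho>1 / 2" and r2: "0 < \<rho>2 / 2" using \<rho>1 \<rho>2 by auto
    obtain M1 where M1: "(p, q, M1) \<in> superjet T D u a x" "\<And>y. (M1 *v y) \<bullet> y = X (0, y) \<bullet> (0, y)"
      by (rule superjet_of_elliptic_jet[OF lin(1) r1 sub1, where u=u and p=p and q=q]) (use j1 in \<open>auto simp: X1 P\<close>)
    obtain M2 where M2: "(- p', - q', M2) \<in> superjet T D (\<lambda>s y. - v s y) c y" "\<And>y. (M2 *v y) \<bullet> y = Y (0, y) \<bullet> (0, y)"
    proof (rule superjet_of_elliptic_jet[OF lin(2) r2 sub2, where u="\<lambda>s y. - v s y" and p="- p'" and q="- q'"])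
      have "case_prod (\<lambda>s y. - v s y) = w" by (auto simp: w_def)
      then show "\<exists>d>0. \<forall>z\<in>?K2. norm (z - (c, y)) < d \<longrightarrow>
         (case z of (s, y) \<Rightarrow> - v s y) \<le> - v c y + (- p', - q') \<bullet> (z - (c, y)) + (1/2) * (Y (z - (c, y)) \<bullet> (z - (c, y))) + e * (norm (z - (c, y)))\<^sup>2" if "0 < e" for e
        using j2[rule_format, OF that] unfolding X2 R by (simp add: w_def)
    qed auto
    have M2': "(p', q', - M2) \<in> subjet T D v c y" using M2(1) by (simp add: subjet_iff_superjet_uminus)
    have "E \<epsilon> a x c y p q p' q' \<le> - B" if gt: "v c y < u a x"
    proof -
      let ?S1 = "\<sigma> a x (u a x)" let ?S2 = "\<sigma> c y (v c y)"
      let ?P1 = "pvi_operator b \<sigma> f a x (u a x) p q M1" let ?P2 = "pvi_operator b \<sigma> f c y (v c y) p' q' (- M2)"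
      have dom: "u a x \<in> effective_domain \<phi>" "v c y \<in> effective_domain \<phi>"
        using sub super in1 in2 lt unfolding viscosity_subsolution_def viscosity_supersolution_def D(1) by auto
      have s1: "ereal ?P1 \<le> - left_derivative \<phi> (u a x) - subdiff_lower \<psi> x q"
      proof -
        have "\<forall>(p, q, X) \<in> superjet T (effective_domain \<psi>) u a x.
           ereal (pvi_operator b \<sigma> f a x (u a x) p q X) \<le> - left_derivative \<phi> (u a x) - subdiff_lower \<psi> x q"
          using sub in1 lt unfolding viscosity_subsolution_def D(1) by auto
        from bspec[OF this M1(1)[unfolded D(1)]] show ?thesis by simp
      qed
      have s2: "ereal ?P2 \<ge> - (right_derivative \<phi> (v c y) + subdiff_upper \<psi> y q')"
      proof -
        have "\<forall>(p, q, X) \<in> subjet T (effective_domain \<psi>) v c y.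
           ereal (pvi_operator b \<sigma> f c y (v c y) p q X) \<ge> - (right_derivative \<phi> (v c y) + subdiff_upper \<psi> y q)"
          using super in2 lt unfolding viscosity_supersolution_def D(1) by auto
        from bspec[OF this M2'[unfolded D(1)]] show ?thesis by simp
      qed
      have d2: "0 < \<delta> / 2" using \<delta> by simp
      have dx: "dist x1 x < \<delta> / 2" "dist x2 y < \<delta> / 2" "dist q1 q < \<delta> / 2" "dist (- q2) (- q') < \<delta> / 2"
      proof -
        have "norm (x - x1) < \<epsilon>" "norm (y - x2) < \<epsilon>" "norm (q - q1) < \<epsilon>" "norm (q' - q2) < \<epsilon>"
          using near near' norm_snd_le[of "x - x1" "a - t1"] norm_snd_le[of "y - x2" "c - t2"]
          norm_snd_le[of "q - q1" "p - p1"] norm_snd_le[of "q' - q2" "p' - p2"] unfolding diff_Pair by linarith+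
        then show "dist x1 x < \<delta> / 2" "dist x2 y < \<delta> / 2" "dist q1 q < \<delta> / 2" "dist (- q2) (- q') < \<delta> / 2"
          using \<epsilon> \<epsilon>0 unfolding dist_minus by (simp_all only: dist_norm norm_minus_commute[of x1] norm_minus_commute[of x2] norm_minus_commute[of q1] norm_minus_commute[of q2])
      qed
      have PP: "?P1 - ?P2 \<le> - B"
      proof (rule viscosity_inequalities_combine[OF phi dom gt d2 _ s1 s2])
        fix x' q'' \<xi> y' r' \<eta> assume h: "dist x' x < \<delta> / 2" "dist q'' q < \<delta> / 2" "\<xi> \<in> subdifferential \<psi> x'"
          "dist y' y < \<delta> / 2" "dist r' (- q') < \<delta> / 2" "\<eta> \<in> subdifferential \<psi> y'"
        show "B \<le> \<xi> \<bullet> q'' + \<eta> \<bullet> r'"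
          by (rule ge[OF _ _ h(3) _ _ h(6)])
            (rule dist_triangle_half_l[OF h(1) dx(1)] dist_triangle_half_l[OF h(2) dx(3)] dist_triangle_half_l[OF h(4) dx(2)] dist_triangle_half_l[OF h(5) dx(4)])+
      qed
      have mv: "((- M2) *v y) = - (M2 *v y)" for y using matrix_vector_mult_diff_rdistrib[of 0 M2 y] by simp
      let ?c1 = "\<lambda>k. column k ?S1" let ?c2 = "\<lambda>k. column k ?S2"
      have "trace ((?S1 ** transpose ?S1) ** M1) - trace ((?S2 ** transpose ?S2) ** (- M2))
         = (\<Sum>k\<in>UNIV. X (0, ?c1 k) \<bullet> (0, ?c1 k) + Y (0, ?c2 k) \<bullet> (0, ?c2 k))"
        unfolding trace_covariance_mult by (simp add: M1(2) M2(2) mv sum.distrib sum_negf)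
      also have "\<dots> \<le> (\<Sum>k\<in>UNIV. \<alpha> * (norm (?c1 k - ?c2 k))\<^sup>2 + A1 * (norm (?c1 k))\<^sup>2 + A2 * (norm (?c2 k))\<^sup>2
            + \<epsilon> * ((norm (?c1 k))\<^sup>2 + (norm (?c2 k))\<^sup>2))"
        using XY[rule_format, of "(0, ?c1 k)" "(0, ?c2 k)" for k] unfolding Aq by (intro sum_mono) (simp add: norm_Pair)
      finally have tr: "trace ((?S1 ** transpose ?S1) ** M1) - trace ((?S2 ** transpose ?S2) ** (- M2)) \<le> \<dots>" .
      have ar: "- (p - p') - (1/2) * s - (b1 - b2) - (f1 - f2) \<le> - B"
        if "(- p - (1/2) * m1 - b1 - f1) - (- p' - (1/2) * m2 - b2 - f2) \<le> - B" "m1 - m2 \<le> s" for s b1 b2 f1 f2 m1 m2 :: real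
        using that by argo
      show ?thesis unfolding E_def by (rule ar[OF PP[unfolded pvi_operator_def] tr])
    qed
    moreover have "(a, x) \<in> {0..T} \<times> D" "(c, y) \<in> {0..T} \<times> D" using in1 in2 by auto
    ultimately show ?thesis using near near' by blast
  qed
  define en where "en n = \<epsilon>0 / real (Suc n)" for n
  have en: "0 < en n" "en n \<le> \<epsilon>0" for n using \<epsilon>0 by (auto simp: en_def field_simps)
  have en0: "en \<longlonglongrightarrow> 0"
  proof -
    have "(\<lambda>n. \<epsilon>0 * inverse (real (Suc n))) \<longlonglongrightarrow> \<epsilon>0 * 0" by (intro tendsto_intros LIMSEQ_inverse_real_of_nat)
    then show ?thesis by (simp add: en_def[abs_def] divide_inverse)
  qed
  obtain a x c y p q p' q' where z: "\<And>n. (a n, x n) \<in> {0..T} \<times> D" "\<And>n. (c n, y n) \<in> {0..T} \<times> D"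
      "\<And>n. norm ((a n, x n) - (t1, x1)) < en n" "\<And>n. norm ((c n, y n) - (t2, x2)) < en n"
      "\<And>n. norm ((p n, q n) - (p1, q1)) < en n" "\<And>n. norm ((p' n, q' n) - (p2, q2)) < en n"
      "\<And>n. v (c n) (y n) < u (a n) (x n) \<Longrightarrow> E (en n) (a n) (x n) (c n) (y n) (p n) (q n) (p' n) (q' n) \<le> - B"
    using step[OF en] by metis
  have lim: "Z \<longlonglongrightarrow> z0" if "\<And>n. norm (Z n - z0) < en n" for Z :: "nat \<Rightarrow> real \<times> (real^'n)" and z0
  proof (rule Lim_null[THEN iffD2], rule Lim_null_comparison[OF _ en0])
    show "\<forall>\<^sub>F n in sequentially. norm (Z n - z0) \<le> en n" using that by (simp add: less_imp_le)
  qed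
  note l1 = lim[OF z(3)] and l2 = lim[OF z(4)] and l3 = lim[OF z(5)] and l4 = lim[OF z(6)]
  have la: "a \<longlonglongrightarrow> t1" "x \<longlonglongrightarrow> x1" "c \<longlonglongrightarrow> t2" "y \<longlonglongrightarrow> x2" "p \<longlonglongrightarrow> p1" "q \<longlonglongrightarrow> q1" "p' \<longlonglongrightarrow> p2" "q' \<longlonglongrightarrow> q2"
    using tendsto_fst[OF l1] tendsto_snd[OF l1] tendsto_fst[OF l2] tendsto_snd[OF l2] tendsto_fst[OF l3] tendsto_snd[OF l3] tendsto_fst[OF l4] tendsto_snd[OF l4] by simp_all
  have lu: "(\<lambda>n. u (a n) (x n)) \<longlonglongrightarrow> u t1 x1"
    using continuous_on_tendsto_compose[OF cu l1] z(1) pts by simp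
  have lv: "(\<lambda>n. v (c n) (y n)) \<longlonglongrightarrow> v t2 x2"
    using continuous_on_tendsto_compose[OF cv l2] z(2) pts by simp
  have aT: "a n \<in> {0..T}" "c n \<in> {0..T}" for n using z(1)[of n] z(2)[of n] by auto
  have t12: "t1 \<in> {0..T}" "t2 \<in> {0..T}" using pts by auto
  have ls1: "(\<lambda>n. \<sigma> (a n) (x n) (u (a n) (x n))) \<longlonglongrightarrow> S1"
    using continuous_on_tendsto_compose[OF conts tendsto_Pair[OF la(1) tendsto_Pair[OF la(2) lu]]] aT t12 by (simp add: S1_def)
  have ls2: "(\<lambda>n. \<sigma> (c n) (y n) (v (c n) (y n))) \<longlonglongrightarrow> S2"
    using continuous_on_tendsto_compose[OF conts tendsto_Pair[OF la(3) tendsto_Pair[OF la(4) lv]]] aT t12 by (simp add: S2_def)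
  note lq1 = tendsto_vector_matrix_mult[OF la(6) ls1] and lq2 = tendsto_vector_matrix_mult[OF la(8) ls2]
  have lb1: "(\<lambda>n. b (a n) (x n) (u (a n) (x n)) (q n v* \<sigma> (a n) (x n) (u (a n) (x n)))) \<longlonglongrightarrow> b t1 x1 (u t1 x1) (q1 v* S1)"
    using continuous_on_tendsto_compose[OF contb tendsto_Pair[OF la(1) tendsto_Pair[OF la(2) tendsto_Pair[OF lu lq1]]]] aT t12 by simp
  have lb2: "(\<lambda>n. b (c n) (y n) (v (c n) (y n)) (q' n v* \<sigma> (c n) (y n) (v (c n) (y n)))) \<longlonglongrightarrow> b t2 x2 (v t2 x2) (q2 v* S2)"
    using continuous_on_tendsto_compose[OF contb tendsto_Pair[OF la(3) tendsto_Pair[OF la(4) tendsto_Pair[OF lv lq2]]]] aT t12 by simp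
  have lf1: "(\<lambda>n. f (a n) (x n) (u (a n) (x n)) (q n v* \<sigma> (a n) (x n) (u (a n) (x n)))) \<longlonglongrightarrow> f t1 x1 (u t1 x1) (q1 v* S1)"
    using continuous_on_tendsto_compose[OF contf tendsto_Pair[OF la(1) tendsto_Pair[OF la(2) tendsto_Pair[OF lu lq1]]]] aT t12 by simp
  have lf2: "(\<lambda>n. f (c n) (y n) (v (c n) (y n)) (q' n v* \<sigma> (c n) (y n) (v (c n) (y n)))) \<longlonglongrightarrow> f t2 x2 (v t2 x2) (q2 v* S2)"
    using continuous_on_tendsto_compose[OF contf tendsto_Pair[OF la(3) tendsto_Pair[OF la(4) tendsto_Pair[OF lv lq2]]]] aT t12 by simp
  have "(\<lambda>n. E (en n) (a n) (x n) (c n) (y n) (p n) (q n) (p' n) (q' n)) \<longlonglongrightarrow>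
      - (p1 - p2) - (1/2) * (\<Sum>k\<in>UNIV. \<alpha> * (norm (column k S1 - column k S2))\<^sup>2 + A1 * (norm (column k S1))\<^sup>2 + A2 * (norm (column k S2))\<^sup>2
        + 0 * ((norm (column k S1))\<^sup>2 + (norm (column k S2))\<^sup>2))
     - (b t1 x1 (u t1 x1) (q1 v* S1) \<bullet> q1 - b t2 x2 (v t2 x2) (q2 v* S2) \<bullet> q2)
     - (f t1 x1 (u t1 x1) (q1 v* S1) - f t2 x2 (v t2 x2) (q2 v* S2))" (is "?e \<longlonglongrightarrow> ?l")
    unfolding E_def by (intro tendsto_intros tendsto_column la ls1 ls2 lb1 lb2 lf1 lf2 en0)
  \<comment> \<open>The inequality at the approximating points is available only where
    \<open>v < u\<close>; this holds eventually because it is strict in the limit.\<close>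
  moreover have "\<forall>\<^sub>F n in sequentially. ?e n \<le> - B"
  proof -
    have "(\<lambda>n. u (a n) (x n) - v (c n) (y n)) \<longlonglongrightarrow> u t1 x1 - v t2 x2" by (intro tendsto_intros lu lv)
    then have "\<forall>\<^sub>F n in sequentially. 0 < u (a n) (x n) - v (c n) (y n)" by (rule order_tendstoD) (use pts in simp)
    then show ?thesis by eventually_elim (use z(7) in simp)
  qed
  ultimately have "?l \<le> - B" by (rule tendsto_upperbound) simp
  then show ?thesis by simp
qed

section \<open>A barrier at the boundary points outside the domain\<close>

lemma open_greater_lower_semicontinuous:
  fixes F :: "'a::metric_space \<Rightarrow> ereal" and h :: "'a \<Rightarrow> real"
  assumes F: "lower_semicontinuous F" and h: "continuous_on UNIV h"
  shows "open {z. ereal (h z) < F z}"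
proof (subst open_subopen, intro ballI)
  fix z assume "z \<in> {z. ereal (h z) < F z}"
  then obtain c where c: "ereal (h z) < ereal c" "ereal c < F z"
    using ereal_dense3[of "ereal (h z)" "F z"] by (auto simp: less_ereal.simps)
  have "ereal c < Liminf (at z) F" using c(2) F unfolding lower_semicontinuous_def by (meson less_le_trans)
  then have "\<forall>\<^sub>F y in at z. ereal c < F y" by (rule less_LiminfD)
  then have 1: "\<forall>\<^sub>F y in nhds z. ereal c < F y"
    unfolding eventually_at_filter by (rule eventually_mono) (use c(2) in auto)
  have "(h \<longlongrightarrow> h z) (nhds z)" using h continuous_on_eq_continuous_at[OF open_UNIV] isCont_def[of z h] by (auto simp: tendsto_nhds_iff)
  then have 2: "\<forall>\<^sub>F y in nhds z. h y < c" using c(1) by (intro order_tendstoD(2)) auto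
  have "\<forall>\<^sub>F y in nhds z. ereal (h y) < F y" using 1 2 by eventually_elim (auto intro: less_trans[of _ "ereal _"])
  then show "\<exists>T. open T \<and> z \<in> T \<and> T \<subseteq> {z. ereal (h z) < F z}" unfolding eventually_nhds by blast
qed

section \<open>Convex potentials near the origin\<close>

locale convex_potential =
  fixes \<psi> :: "'a::euclidean_space \<Rightarrow> ereal"
  assumes convex: "ereal_convex \<psi>" and lsc: "lower_semicontinuous \<psi>"
    and at_0: "\<psi> 0 = 0" and nonneg: "0 \<le> \<psi> z"
    and interior_0: "0 \<in> interior (effective_domain \<psi>)"
begin

lemma finiteE:
  assumes "\<psi> x < \<infinity>" obtains p where "\<psi> x = ereal p" "0 \<le> p"
  using nonneg[of x] assms by (cases "\<psi> x") auto

lemma convexD_real: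
  assumes "\<psi> x \<le> ereal p" "\<psi> y \<le> ereal q" "0 \<le> \<theta>" "\<theta> \<le> 1"
  shows "\<psi> (\<theta> *\<^sub>R x + (1 - \<theta>) *\<^sub>R y) \<le> ereal (\<theta> * p + (1 - \<theta>) * q)"
proof (cases "\<theta> = 0 \<or> \<theta> = 1")
  case False
  then have "\<psi> (\<theta> *\<^sub>R x + (1 - \<theta>) *\<^sub>R y) \<le> ereal \<theta> * \<psi> x + ereal (1 - \<theta>) * \<psi> y"
    using convex assms unfolding ereal_convex_def by auto
  also have "\<dots> \<le> ereal \<theta> * ereal p + ereal (1 - \<theta>) * ereal q"
    using assms by (intro add_mono ereal_mult_left_mono) auto
  finally show ?thesis by simp
qed (use assms in auto)

lemma closed_le: "continuous_on UNIV h \<Longrightarrow> closed {z. \<psi> z \<le> ereal (h z)}"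
  using open_greater_lower_semicontinuous[OF lsc] by (simp add: closed_def Collect_neg_eq[symmetric] not_le)

lemma convex_sublevel: "Convex.convex {x. \<psi> x \<le> ereal c}"
  unfolding convex_alt
proof (intro ballI allI impI)
  fix x y u assume "x \<in> {x. \<psi> x \<le> ereal c}" "y \<in> {x. \<psi> x \<le> ereal c}" "0 \<le> u \<and> u \<le> (1::real)"
  then show "(1 - u) *\<^sub>R x + u *\<^sub>R y \<in> {x. \<psi> x \<le> ereal c}"
    using convexD_real[of y c x c u] by (simp add: add.commute algebra_simps)
qed

text \<open>The ball lies in the convex hull of the points \<open>r *\<^sub>R b\<close> and
  \<open>- r *\<^sub>R b\<close> over the basis, where \<open>\<psi>\<close> takes finitely many
  finite values. The factor \<open>2\<close> leaves room for differences of two vectors of norm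
  \<open>\<rho>\<close>.\<close>

lemma bounded_near_0:
  obtains \<rho> C where "0 < \<rho>" "0 \<le> C" "\<And>x. norm x \<le> 2 * \<rho> \<Longrightarrow> \<psi> x \<le> ereal C"
proof -
  obtain r where r: "r > 0" "cball 0 r \<subseteq> effective_domain \<psi>" using interior_0 by (meson mem_interior_cball)
  have fin: "\<psi> x < \<infinity>" if "norm x \<le> r" for x using r(2) that by (auto simp: effective_domain_def subset_iff)
  define V where "V = (\<lambda>b. r *\<^sub>R b) ` Basis \<union> (\<lambda>b. - r *\<^sub>R b) ` (Basis :: 'a set)"
  define C where "C = Max (insert 0 ((\<lambda>x. real_of_ereal (\<psi> x)) ` V))"
  have Vf: "finite V" by (simp add: V_def)
  have VC: "\<psi> x \<le> ereal C" if "x \<in> V" for x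
  proof -
    have "norm x \<le> r" using that r(1) by (auto simp: V_def)
    then obtain p where p: "\<psi> x = ereal p" using finiteE[OF fin] by blast
    have "p \<le> C" unfolding C_def using Vf that p by (intro Max_ge) (auto intro!: image_eqI[of _ _ x])
    then show ?thesis using p by simp
  qed
  have C0: "0 \<le> C" unfolding C_def using Vf by (intro Max_ge) auto
  let ?S = "{x. \<psi> x \<le> ereal C}"
  have seg: "s *\<^sub>R b \<in> ?S" if b: "b \<in> Basis" and s: "\<bar>s\<bar> \<le> r" for b s
  proof -
    have V: "r *\<^sub>R b \<in> ?S" "- r *\<^sub>R b \<in> ?S" using VC b by (auto simp: V_def)
    define \<theta> where "\<theta> = (s + r) / (2 * r)"
    have \<theta>: "0 \<le> \<theta>" "\<theta> \<le> 1" using s r by (auto simp: \<theta>_def field_simps abs_le_iff)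
    have "\<theta> * r + (1 - \<theta>) * (- r) = s" using r by (simp add: \<theta>_def field_simps)
    then have "\<theta> *\<^sub>R (r *\<^sub>R b) + (1 - \<theta>) *\<^sub>R (- r *\<^sub>R b) = s *\<^sub>R b" by (metis scaleR_left.add scaleR_scaleR)
    then show ?thesis using convexD[OF convex_sublevel V, of \<theta> "1 - \<theta>"] \<theta> by simp
  qed
  define n where "n = real DIM('a)"
  have n: "n > 0" by (simp add: n_def)
  define \<rho> where "\<rho> = r / (2 * n)"
  have "x \<in> ?S" if x: "norm x \<le> 2 * \<rho>" for x
  proof -
    have "(\<Sum>b\<in>Basis. (1 / n) *\<^sub>R ((n * (x \<bullet> b)) *\<^sub>R b)) \<in> ?S"
    proof (rule convex_sum[OF finite_Basis convex_sublevel])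
      fix b :: 'a assume b: "b \<in> Basis"
      have "\<bar>x \<bullet> b\<bar> \<le> r / n" using Basis_le_norm[OF b, of x] x by (simp add: \<rho>_def)
      then have "\<bar>n * (x \<bullet> b)\<bar> \<le> r" using n by (simp add: abs_mult field_simps)
      then show "(n * (x \<bullet> b)) *\<^sub>R b \<in> ?S" by (rule seg[OF b])
    qed (use n in \<open>auto simp: n_def\<close>)
    moreover have "(\<Sum>b\<in>Basis. (1 / n) *\<^sub>R ((n * (x \<bullet> b)) *\<^sub>R b)) = x"
      using n euclidean_representation[of x] by simp
    ultimately show ?thesis by simp
  qed
  then show thesis using that[of \<rho> C] C0 r n by (simp add: \<rho>_def)
qed

section \<open>Points of bounded slope and cones over them\<close>

text \<open>For \<open>k \<ge> 0\<close>, the points at which \<open>\<psi>\<close> agrees with its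
  infimal convolution with \<open>k |.|\<close>. A subgradient of norm at most \<open>k\<close>
  implies this, and the form chosen here shows directly that the set is closed.\<close>

definition calm :: "real \<Rightarrow> 'a \<Rightarrow> bool" where
  "calm k z \<longleftrightarrow> (\<forall>x. \<psi> z \<le> \<psi> x + ereal (k * norm (x - z)))"

lemma calm_finite: "calm k z \<Longrightarrow> \<psi> z < \<infinity>"
proof -
  assume "calm k z"
  then have "\<psi> z \<le> \<psi> 0 + ereal (k * norm (0 - z))" unfolding calm_def by blast
  then show ?thesis by (cases "\<psi> z") (auto simp: at_0)
qed

lemma calm_mono: "calm k z \<Longrightarrow> k \<le> k' \<Longrightarrow> calm k' z"
  unfolding calm_def by (meson add_left_mono ereal_less_eq(3) mult_right_mono norm_ge_zero order_trans)

lemma calm_0: "0 \<le> k \<Longrightarrow> calm k 0"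
  unfolding calm_def at_0 by (auto intro!: add_nonneg_nonneg nonneg)

lemma closed_calm: "closed {z. calm k z}"
proof -
  have "{z. calm k z} = (\<Inter>x\<in>effective_domain \<psi>. {z. \<psi> z \<le> ereal (real_of_ereal (\<psi> x) + k * norm (x - z))})"
  proof -
    have "(\<psi> z \<le> \<psi> x + ereal (k * norm (x - z))) \<longleftrightarrow> (\<psi> x < \<infinity> \<longrightarrow> \<psi> z \<le> ereal (real_of_ereal (\<psi> x) + k * norm (x - z)))" for x z
      using nonneg[of x] by (cases "\<psi> x") auto
    then show ?thesis unfolding calm_def effective_domain_def by auto
  qed
  also have "closed \<dots>" by (intro closed_INT ballI closed_le continuous_intros)
  finally show ?thesis .
qed

text \<open>Moving from \<open>y = (1 - t) z + t b\<close> away from \<open>x\<close>, one stays in the cone over a ball on which \<open>\<psi>\<close> is bounded, so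
  convexity bounds the slope of \<open>\<psi>\<close> towards \<open>x\<close>.\<close>

lemma calm_in_cone:
  assumes \<rho>: "0 < \<rho>" "\<And>x. norm x \<le> 2 * \<rho> \<Longrightarrow> \<psi> x \<le> ereal C"
    and z: "\<psi> z = ereal pz" and t: "0 < t" "t \<le> 1" and b: "norm b \<le> \<rho>"
    and y: "y = (1 - t) *\<^sub>R z + t *\<^sub>R b" "\<psi> y = ereal py"
    and m: "(1 - t) * pz + t * C - py \<le> m" "0 \<le> m"
  shows "calm (m / (t * \<rho>)) y"
  unfolding calm_def
proof
  fix x
  show "\<psi> y \<le> \<psi> x + ereal (m / (t * \<rho>) * norm (x - y))"
  proof (cases "x = y \<or> \<psi> x = \<infinity>")
    case False
    then have "\<psi> x < \<infinity>" by simp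
    then obtain px where px: "\<psi> x = ereal px" "0 \<le> px" using finiteE by blast
    define n where "n = norm (x - y)"
    have n: "n > 0" using False by (simp add: n_def)
    define e where "e = (1 / n) *\<^sub>R (x - y)"
    have e: "norm e = 1" "n *\<^sub>R e = x - y" using n by (auto simp: e_def n_def)
    define w where "w = (1 - t) *\<^sub>R z + t *\<^sub>R (b - \<rho> *\<^sub>R e)"
    have wy: "w = y - (t * \<rho>) *\<^sub>R e" by (simp add: w_def y(1) scaleR_diff_right)
    have "norm (b - \<rho> *\<^sub>R e) \<le> 2 * \<rho>" using norm_triangle_ineq4[of b "\<rho> *\<^sub>R e"] b e \<rho> by simp
    then have "\<psi> (b - \<rho> *\<^sub>R e) \<le> ereal C" by (rule \<rho>(2))
    then have w: "\<psi> w \<le> ereal ((1 - t) * pz + t * C)"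
      using convexD_real[of z pz "b - \<rho> *\<^sub>R e" C "1 - t"] z t by (simp add: w_def)
    \<comment> \<open>With this weight the convex combination of \<open>x\<close> and
      \<open>w\<close> is exactly \<open>y\<close>.\<close>
    define \<theta> where "\<theta> = t * \<rho> / (t * \<rho> + n)"
    have tp: "t * \<rho> > 0" using t \<rho> by simp
    have \<theta>: "0 \<le> \<theta>" "\<theta> \<le> 1" using tp n by (auto simp: \<theta>_def)
    have th: "\<theta> * (t * \<rho> + n) = t * \<rho>" using tp n by (simp add: \<theta>_def)
    have "\<theta> *\<^sub>R x + (1 - \<theta>) *\<^sub>R w = y + (\<theta> * n - (1 - \<theta>) * (t * \<rho>)) *\<^sub>R e"
    proof -
      have "x = y + n *\<^sub>R e" by (simp add: e)
      then show ?thesis by (simp add: wy algebra_simps)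
    qed
    also have "\<theta> * n - (1 - \<theta>) * (t * \<rho>) = 0" using th by (simp add: algebra_simps)
    finally have "\<psi> y \<le> ereal (\<theta> * px + (1 - \<theta>) * ((1 - t) * pz + t * C))"
      using convexD_real[OF _ w \<theta>, of x px] px by simp
    then have "py \<le> \<theta> * px + (1 - \<theta>) * ((1 - t) * pz + t * C)" using y by simp
    also have "\<dots> \<le> \<theta> * px + (1 - \<theta>) * (py + m)" using \<theta> m by (intro add_left_mono mult_left_mono) auto
    finally have "\<theta> * py \<le> \<theta> * px + (1 - \<theta>) * m" by (simp add: algebra_simps)
    then have "(t * \<rho> + n) * (\<theta> * py) \<le> (t * \<rho> + n) * (\<theta> * px + (1 - \<theta>) * m)" using tp n by (intro mult_left_mono) auto
    moreover have "(t * \<rho> + n) * (\<theta> * py) = (t * \<rho>) * py" "(t * \<rho> + n) * (\<theta> * px + (1 - \<theta>) * m) = (t * \<rho>) * px + n * m"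
    proof -
      have "(t * \<rho> + n) * (\<theta> * py) = (\<theta> * (t * \<rho> + n)) * py" by algebra
      then show "(t * \<rho> + n) * (\<theta> * py) = (t * \<rho>) * py" by (simp only: th)
      have "(t * \<rho> + n) * (\<theta> * px + (1 - \<theta>) * m) = (\<theta> * (t * \<rho> + n)) * px + ((t * \<rho> + n) - \<theta> * (t * \<rho> + n)) * m"
        by algebra
      then show "(t * \<rho> + n) * (\<theta> * px + (1 - \<theta>) * m) = (t * \<rho>) * px + n * m" unfolding th by simp
    qed
    ultimately have "(t * \<rho>) * py \<le> (t * \<rho>) * px + n * m" by linarith
    moreover have "q * py \<le> q * px + n * m \<Longrightarrow> py \<le> px + m / q * n" if "q > 0" for q
      using that by (simp add: field_simps)
    ultimately have "py \<le> px + m / (t * \<rho>) * n" using tp by blast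
    then show ?thesis using y px by (simp add: n_def)
  qed (use m t \<rho>(1) in auto)
qed

text \<open>Supplies points of bounded slope arbitrarily close to a given point of the domain; the
  barrier will be made to vanish at such a point.\<close>

lemma calm_shrink:
  assumes x: "\<psi> x < \<infinity>" and t: "0 < t" "t \<le> 1"
  shows "\<exists>k. calm k ((1 - t) *\<^sub>R x)"
proof -
  obtain \<rho> C where \<rho>: "0 < \<rho>" "0 \<le> C" "\<And>x. norm x \<le> 2 * \<rho> \<Longrightarrow> \<psi> x \<le> ereal C" using bounded_near_0 by blast
  obtain p where p: "\<psi> x = ereal p" "0 \<le> p" using finiteE[OF x] by blast
  have "\<psi> ((1 - t) *\<^sub>R x) \<le> ereal ((1 - t) * p)" using convexD_real[of x p 0 0 "1 - t"] p t by (simp add: at_0)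
  then have "\<psi> ((1 - t) *\<^sub>R x) < \<infinity>" by (rule le_less_trans) simp
  then obtain py where py: "\<psi> ((1 - t) *\<^sub>R x) = ereal py" "0 \<le> py" using finiteE by blast
  have "(1 - t) * p \<le> p" "t * C \<le> C" using t p \<rho> by (auto simp: mult_left_le_one_le)
  then have "calm ((p + C) / (t * \<rho>)) ((1 - t) *\<^sub>R x)"
    using p py \<rho>(1,2) by (intro calm_in_cone[OF \<rho>(1,3) p(1) t, of 0]) auto
  then show ?thesis ..
qed

text \<open>Adding segments to a ball around \<open>0\<close> makes the set star-shaped with respect
  to the whole ball, so that directions leaving it are outward in a quantitative sense; the slope
  grows only by a constant factor. The cut-off at radius \<open>R\<close> gives compactness.\<close>

definition calm_cone :: "real \<Rightarrow> real \<Rightarrow> real \<Rightarrow> 'a set" where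
  "calm_cone \<rho> R k = (\<lambda>(t, z, b). (1 - t) *\<^sub>R z + t *\<^sub>R b) ` ({0..1} \<times> ({z. calm k z} \<inter> cball 0 R) \<times> cball 0 \<rho>)"

lemma compact_calm_cone: "compact (calm_cone \<rho> R k)"
  unfolding calm_cone_def
  by (intro compact_continuous_image compact_Times closed_Int_compact closed_calm compact_Icc compact_cball)
    (auto intro!: continuous_intros simp: case_prod_unfold)

lemma calm_in_calm_cone: "calm k z \<Longrightarrow> norm z \<le> R \<Longrightarrow> 0 \<le> \<rho> \<Longrightarrow> z \<in> calm_cone \<rho> R k"
  unfolding calm_cone_def by (rule image_eqI[of _ _ "(0, z, 0)"]) auto

lemma calm_cone_nonempty: "0 \<le> k \<Longrightarrow> 0 \<le> R \<Longrightarrow> 0 \<le> \<rho> \<Longrightarrow> calm_cone \<rho> R k \<noteq> {}"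
  using calm_in_calm_cone[OF calm_0] by fastforce

text \<open>Two successive steps towards points of the ball combine into one, with total weight
  \<open>\<tau>\<close> and an averaged point \<open>c'\<close> of the ball.\<close>

lemma calm_cone_star:
  assumes y: "y \<in> calm_cone \<rho> R k" and b: "norm b \<le> \<rho>" and s: "0 \<le> s" "s \<le> 1"
  shows "(1 - s) *\<^sub>R y + s *\<^sub>R b \<in> calm_cone \<rho> R k"
proof -
  obtain t z c where y': "y = (1 - t) *\<^sub>R z + t *\<^sub>R c" "0 \<le> t" "t \<le> 1" "calm k z" "norm z \<le> R" "norm c \<le> \<rho>"
    using y by (auto simp: calm_cone_def)
  define \<tau> where "\<tau> = 1 - (1 - s) * (1 - t)"
  have "(1 - s) * (1 - t) \<le> 1 * 1" using s y' by (intro mult_mono) auto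
  then have \<tau>: "0 \<le> \<tau>" "\<tau> \<le> 1" using s y' by (auto simp: \<tau>_def)
  show ?thesis
  proof (cases "\<tau> = 0")
    case True
    have e: "\<tau> = s + (1 - s) * t" by (simp add: \<tau>_def algebra_simps)
    have "s = 0" "t = 0"
    proof -
      have "(1 - s) * t \<ge> 0" using s y' by simp
      then show "s = 0" using e True s by linarith
      then show "t = 0" using e True by simp
    qed
    then show ?thesis using y by simp
  next
    case False
    define V where "V = ((1 - s) * t) *\<^sub>R c + s *\<^sub>R b"
    define c' where "c' = (1 / \<tau>) *\<^sub>R V"
    have e: "\<tau> = (1 - s) * t + s" by (simp add: \<tau>_def algebra_simps)
    have "norm V \<le> (1 - s) * t * \<rho> + s * \<rho>"
      unfolding V_def using norm_triangle_ineq[of "((1 - s) * t) *\<^sub>R c" "s *\<^sub>R b"] mult_left_mono[OF y'(6), of "(1 - s) * t"] mult_left_mono[OF b s(1)] s y'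
      by simp
    also have "\<dots> = \<tau> * \<rho>" by (simp add: e algebra_simps)
    finally have "norm V \<le> \<tau> * \<rho>" .
    then have "norm c' \<le> \<rho>" using \<tau> False by (simp add: c'_def divide_le_eq mult.commute)
    moreover have "(1 - s) *\<^sub>R y + s *\<^sub>R b = (1 - \<tau>) *\<^sub>R z + \<tau> *\<^sub>R c'"
      using False by (simp add: c'_def V_def y'(1)) (simp add: \<tau>_def scaleR_add_right)
    ultimately show ?thesis unfolding calm_cone_def using \<tau> y'
      by (intro image_eqI[of _ _ "(\<tau>, z, c')"]) auto
  qed
qed

text \<open>In \<open>calm_in_cone\<close> the excess can be taken as
  \<open>k * t * (C + R + \<rho>)\<close>; its factor \<open>t\<close> cancels the one in the
  denominator, so the slope stays bounded as \<open>t\<close> tends to zero.\<close>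

lemma calm_cone_calm:
  assumes \<rho>: "0 < \<rho>" "0 \<le> C" "\<And>x. norm x \<le> 2 * \<rho> \<Longrightarrow> \<psi> x \<le> ereal C"
    and k: "1 \<le> k" and y: "y \<in> calm_cone \<rho> R k" and R: "0 \<le> R"
  shows "calm ((C + R + \<rho>) / \<rho> * k) y"
proof -
  obtain t z b where y': "y = (1 - t) *\<^sub>R z + t *\<^sub>R b" "0 \<le> t" "t \<le> 1" "calm k z" "norm z \<le> R" "norm b \<le> \<rho>"
    using y by (auto simp: calm_cone_def)
  obtain pz where pz: "\<psi> z = ereal pz" "0 \<le> pz" using finiteE[OF calm_finite[OF y'(4)]] by blast
  show ?thesis
  proof (cases "t = 0")
    case True
    have "1 \<le> (C + R + \<rho>) / \<rho>" using \<rho> R by simp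
    then have "k \<le> (C + R + \<rho>) / \<rho> * k" using k mult_right_mono[of 1 "(C + R + \<rho>) / \<rho>" k] by simp
    then show ?thesis using y' True calm_mono by simp
  next
    case False
    then have t: "0 < t" using y' by simp
    have "\<psi> b \<le> ereal C" using \<rho> y' by simp
    then have "\<psi> y \<le> ereal ((1 - t) * pz + t * C)" using convexD_real[of z pz b C "1 - t"] y' pz by simp
    then have "\<psi> y < \<infinity>" by (rule le_less_trans) simp
    then obtain py where py: "\<psi> y = ereal py" "0 \<le> py" using finiteE by blast
    have "\<psi> z \<le> \<psi> y + ereal (k * norm (y - z))" using y'(4) unfolding calm_def by blast
    then have 1: "pz \<le> py + k * norm (y - z)" using pz py by simp
    have "y - z = t *\<^sub>R (b - z)" by (simp add: y'(1) algebra_simps)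
    then have "norm (y - z) = t * norm (b - z)" using t by simp
    also have "\<dots> \<le> t * (R + \<rho>)" using norm_triangle_ineq4[of b z] y' t by (intro mult_left_mono) auto
    finally have 2: "k * norm (y - z) \<le> k * (t * (R + \<rho>))" using k by (intro mult_left_mono) auto
    have 3: "t * C \<le> k * (t * C)" using k t \<rho> mult_right_mono[of 1 k "t * C"] by simp
    have 4: "(1 - t) * pz \<le> pz" using pz y' t by (simp add: mult_left_le_one_le)
    have "calm (k * t * (C + R + \<rho>) / (t * \<rho>)) y"
      by (rule calm_in_cone[OF \<rho>(1,3) pz(1) t y'(3) y'(6) y'(1) py(1)])
        (use 1 2 3 4 k t \<rho>(1,2) R in \<open>auto simp: algebra_simps\<close>)
    moreover have "k * t * (C + R + \<rho>) / (t * \<rho>) = (C + R + \<rho>) / \<rho> * k" using t \<rho> by simp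
    ultimately show ?thesis by simp
  qed
qed

lemma subdifferential_finite:
  assumes "\<xi> \<in> subdifferential \<psi> x" shows "\<psi> x < \<infinity>"
proof -
  have "\<psi> x + ereal (\<xi> \<bullet> (0 - x)) \<le> \<psi> 0" using assms unfolding subdifferential_def by blast
  then show ?thesis by (cases "\<psi> x") (auto simp: at_0)
qed

text \<open>A subgradient of norm at most \<open>k\<close> would make \<open>x\<close> calm and
  hence a point of the cone. Thus a barrier term that is active only off the cone meets only large
  subgradients.\<close>

lemma subgradient_large_off_calm_cone:
  assumes x: "norm x \<le> R" "x \<notin> calm_cone \<rho> R k" "0 \<le> \<rho>" and \<xi>: "\<xi> \<in> subdifferential \<psi> x"
  shows "k < norm \<xi>"
proof (rule ccontr)
  assume "\<not> k < norm \<xi>"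
  have "calm k x" unfolding calm_def
  proof
    fix y
    have "\<psi> x + ereal (\<xi> \<bullet> (y - x)) \<le> \<psi> y" using \<xi> unfolding subdifferential_def by blast
    moreover have "- (\<xi> \<bullet> (y - x)) \<le> k * norm (y - x)"
      using Cauchy_Schwarz_ineq2[of \<xi> "y - x"] mult_right_mono[of "norm \<xi>" k "norm (y - x)"] \<open>\<not> k < norm \<xi>\<close> by auto
    ultimately show "\<psi> x \<le> \<psi> y + ereal (k * norm (y - x))" using nonneg[of x] nonneg[of y]
      by (cases "\<psi> x"; cases "\<psi> y") auto
  qed
  then show False using x calm_in_calm_cone by blast
qed

text \<open>Monotonicity of the subdifferential with calmness at \<open>z\<close> in place of a
  subgradient there.\<close>

lemma subgradient_calm_ge:
  assumes "calm k z" "\<xi> \<in> subdifferential \<psi> x"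
  shows "- (k * norm (x - z)) \<le> \<xi> \<bullet> (x - z)"
proof -
  obtain p where p: "\<psi> x = ereal p" using finiteE[OF subdifferential_finite[OF assms(2)]] by blast
  obtain q where q: "\<psi> z = ereal q" using finiteE[OF calm_finite[OF assms(1)]] by blast
  have "\<psi> x + ereal (\<xi> \<bullet> (z - x)) \<le> \<psi> z" using assms(2) unfolding subdifferential_def by blast
  moreover have "\<psi> z \<le> \<psi> x + ereal (k * norm (x - z))" using assms(1) unfolding calm_def by blast
  ultimately show ?thesis using p q by (simp add: inner_diff_right)
qed

text \<open>If the series converged, the nearest points \<open>z l\<close> would have bounded values \<open>\<psi> (z l)\<close>, since \<open>z (l + 1)\<close> is
  \<open>O(2\<^sup>l)\<close>-calm; lower semicontinuity would then make \<open>\<psi> x\<close> finite.\<close>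

lemma calm_cone_distances_not_summable:
  assumes \<rho>: "0 < \<rho>" "0 \<le> C" "\<And>x. norm x \<le> 2 * \<rho> \<Longrightarrow> \<psi> x \<le> ereal C" and R: "0 \<le> R"
    and x: "\<psi> x = \<infinity>"
  shows "\<not> summable (\<lambda>l. min (2 ^ l * infdist x (calm_cone \<rho> R (2 ^ l))) 1)"
proof
  define J where "J l = calm_cone \<rho> R (2 ^ l)" for l :: nat
  define a where "a l = 2 ^ l * infdist x (J l)" for l
  assume "summable (\<lambda>l. min (2 ^ l * infdist x (calm_cone \<rho> R (2 ^ l))) 1)"
  then have sm: "summable (\<lambda>l. min (a l) 1)" by (simp add: a_def J_def)
  have a0: "0 \<le> a l" for l by (simp add: a_def infdist_nonneg)
  have "\<forall>\<^sub>F l in sequentially. min (a l) 1 < 1" using summable_LIMSEQ_zero[OF sm] by (rule order_tendstoD) simp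
  then obtain m where m: "\<And>l. l \<ge> m \<Longrightarrow> a l < 1" by (fastforce simp: eventually_sequentially)
  \<comment> \<open>Eventually the terms are below \<open>1\<close>, so the truncation is inactive
    in the tail.\<close>
  have "summable a"
    by (rule summable_comparison_test'[OF sm, of m]) (use m a0 in \<open>auto simp: min_def less_imp_le\<close>)
  define S where "S = suminf a"
  have aS: "sum a {..<n} \<le> S" for n unfolding S_def using \<open>summable a\<close> a0 by (intro sum_le_suminf) auto
  have ne: "J l \<noteq> {}" for l unfolding J_def using calm_cone_nonempty R \<rho> by simp
  have "\<exists>z\<in>J l. infdist x (J l) = dist x z" for l
    using infdist_attains_inf[OF compact_imp_closed[OF compact_calm_cone] ne[unfolded J_def]] unfolding J_def by metis
  then obtain z where z: "\<And>l. z l \<in> J l" "\<And>l. infdist x (J l) = dist x (z l)" by metis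
  define K where "K = (C + R + \<rho>) / \<rho>"
  have K: "0 \<le> K" using \<rho> R by (simp add: K_def)
  have calm: "calm (K * 2 ^ l) (z l)" for l unfolding K_def
    by (rule calm_cone_calm[OF \<rho>]) (use z(1)[of l] R in \<open>auto simp: J_def\<close>)
  define p where "p l = real_of_ereal (\<psi> (z l))" for l
  have fin: "\<psi> (z l) = ereal (p l)" for l
    using finiteE[OF calm_finite[OF calm[of l]]] unfolding p_def by (metis real_of_ereal.simps(1))
  have step: "p (Suc l) \<le> p l + K * (2 * a l + a (Suc l))" for l
  proof -
    have "\<psi> (z (Suc l)) \<le> \<psi> (z l) + ereal (K * 2 ^ Suc l * norm (z l - z (Suc l)))" using calm[of "Suc l"] unfolding calm_def by blast
    then have "p (Suc l) \<le> p l + K * 2 ^ Suc l * norm (z l - z (Suc l))" by (simp add: fin)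
    also have "norm (z l - z (Suc l)) \<le> dist x (z l) + dist x (z (Suc l))"
      using dist_triangle3[of "z l" "z (Suc l)" x] by (simp add: dist_norm)
    then have "K * 2 ^ Suc l * norm (z l - z (Suc l)) \<le> K * 2 ^ Suc l * (dist x (z l) + dist x (z (Suc l)))" using K by (intro mult_left_mono) auto
    also have "\<dots> = K * (2 * a l + a (Suc l))" by (simp add: a_def z(2) algebra_simps)
    finally show ?thesis by simp
  qed
  have pb: "p n \<le> p 0 + K * (2 * sum a {..<n} + sum a {..<Suc n})" for n
  proof (induction n)
    case 0 then show ?case using K a0 by simp
  next
    case (Suc n)
    have "K * (2 * sum a {..<Suc n} + sum a {..<Suc (Suc n)}) = K * (2 * sum a {..<n} + sum a {..<Suc n}) + K * (2 * a n + a (Suc n))"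
      by (simp add: algebra_simps)
    then show ?case using Suc step[of n] by linarith
  qed
  define c where "c = p 0 + K * (3 * S)"
  have pc: "p n \<le> c" for n
  proof -
    have "K * (2 * sum a {..<n} + sum a {..<Suc n}) \<le> K * (3 * S)" using K aS[of n] aS[of "Suc n"] by (intro mult_left_mono) auto
    then show ?thesis using pb[of n] by (simp add: c_def)
  qed
  have "z \<longlonglongrightarrow> x"
  proof -
    have "(\<lambda>l. norm (z l - x)) \<longlonglongrightarrow> 0"
    proof (rule tendsto_sandwich[OF _ _ tendsto_const summable_LIMSEQ_zero[OF \<open>summable a\<close>]])
      have "norm (z l - x) \<le> a l" for l
      proof -
        have "1 * dist x (z l) \<le> 2 ^ l * dist x (z l)" by (intro mult_right_mono) auto
        then show ?thesis by (simp add: a_def z(2) dist_norm norm_minus_commute)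
      qed
      then show "\<forall>\<^sub>F l in sequentially. norm (z l - x) \<le> a l" by simp
    qed simp
    then show ?thesis by (simp add: tendsto_norm_zero_iff LIM_zero_iff)
  qed
  moreover have "closed {z. \<psi> z \<le> ereal c}" by (rule closed_le) simp
  moreover have "\<psi> (z l) \<le> ereal c" for l using pc[of l] fin[of l] by simp
  ultimately have "x \<in> {z. \<psi> z \<le> ereal c}" using closed_sequentially[of "{z. \<psi> z \<le> ereal c}" z x] by simp
  then show False using x by simp
qed

text \<open>A compactness argument of Dini type: the partial sums are continuous, increasing and
  unbounded at each point of \<open>M\<close>, so one of the nested open sets \<open>U n\<close>
  contains \<open>M\<close>.\<close>

lemma calm_cone_distances_uniform:
  assumes \<rho>: "0 < \<rho>" "0 \<le> C" "\<And>x. norm x \<le> 2 * \<rho> \<Longrightarrow> \<psi> x \<le> ereal C" and R: "0 \<le> R"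
    and M: "compact M" "\<And>x. x \<in> M \<Longrightarrow> \<psi> x = \<infinity>"
  obtains n where "\<And>x. x \<in> M \<Longrightarrow> N \<le> (\<Sum>l<n. min (2 ^ l * infdist x (calm_cone \<rho> R (2 ^ l))) 1)"
proof -
  define h where "h l x = min (2 ^ l * infdist x (calm_cone \<rho> R (2 ^ l))) 1" for l :: nat and x
  have h0: "0 \<le> h l x" for l x by (simp add: h_def infdist_nonneg)
  have hc: "continuous_on UNIV (h l)" for l unfolding h_def by (intro continuous_intros)
  define U where "U n = {x. N < (\<Sum>l<n. h l x)}" for n
  have op: "open (U n)" for n unfolding U_def
    by (intro open_Collect_less continuous_intros hc)
  have mono: "U m \<subseteq> U n" if "m \<le> n" for m n
  proof -
    have "(\<Sum>l<m. h l x) \<le> (\<Sum>l<n. h l x)" for x using that h0 by (intro sum_mono2) auto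
    then show ?thesis unfolding U_def by (auto intro: less_le_trans)
  qed
  have "M \<subseteq> (\<Union>n\<in>UNIV. U n)"
  proof
    fix x assume "x \<in> M"
    have "\<exists>n. N < (\<Sum>l<n. h l x)"
    proof (rule ccontr)
      assume "\<not> ?thesis"
      then have "\<And>n. (\<Sum>l<n. norm (h l x)) \<le> N" using h0 by (simp add: not_less)
      then have "summable (\<lambda>l. h l x)" using h0 by (intro summableI_nonneg_bounded[of _ N]) auto
      then show False using calm_cone_distances_not_summable[OF \<rho> R M(2)[OF \<open>x \<in> M\<close>]] by (simp add: h_def)
    qed
    then show "x \<in> (\<Union>n\<in>UNIV. U n)" by (simp add: U_def)
  qed
  then obtain I where I: "finite I" "M \<subseteq> (\<Union>n\<in>I. U n)"
    using compactE_image[OF M(1), where f=U and C=UNIV] op by metis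
  have "M \<subseteq> U (Max (insert 0 I))"
  proof
    fix x assume "x \<in> M"
    then obtain n where "n \<in> I" "x \<in> U n" using I by blast
    moreover have "n \<le> Max (insert 0 I)" using I \<open>n \<in> I\<close> by simp
    ultimately show "x \<in> U (Max (insert 0 I))" using mono by blast
  qed
  then show thesis using that[of "Max (insert 0 I)"] unfolding U_def h_def by (blast intro: less_imp_le)
qed

end

section \<open>Smoothed distance to a star-shaped set\<close>

text \<open>Quadratic in the excess distance up to scale \<open>a\<close> and linear with slope
  about \<open>a\<close> beyond it: gradients have norm at most \<open>a\<close>, while the upper
  curvature is at most \<open>1\<close> for every \<open>a\<close>. The dead zone of width
  \<open>\<eta>\<close> makes it vanish on a whole neighbourhood of \<open>J\<close>.\<close>

definition smoothed_distance :: "'a::euclidean_space set \<Rightarrow> real \<Rightarrow> real \<Rightarrow> 'a \<Rightarrow> real" where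
  "smoothed_distance J a \<eta> x = a * sqrt (a\<^sup>2 + (max 0 (infdist x J - \<eta>))\<^sup>2) - a\<^sup>2"

lemma smoothed_distance_nonneg: "0 \<le> a \<Longrightarrow> 0 \<le> smoothed_distance J a \<eta> x"
proof -
  assume a: "0 \<le> a"
  have "sqrt (a\<^sup>2) \<le> sqrt (a\<^sup>2 + (max 0 (infdist x J - \<eta>))\<^sup>2)" by (rule real_sqrt_le_mono) simp
  then have "a * a \<le> a * sqrt (a\<^sup>2 + (max 0 (infdist x J - \<eta>))\<^sup>2)" using a by (intro mult_left_mono) auto
  then show ?thesis by (simp add: smoothed_distance_def power2_eq_square)
qed

lemma smoothed_distance_near: "0 \<le> a \<Longrightarrow> infdist x J \<le> \<eta> \<Longrightarrow> smoothed_distance J a \<eta> x = 0"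
  by (simp add: smoothed_distance_def power2_eq_square max_def)

lemma continuous_smoothed_distance: "continuous_on UNIV (smoothed_distance J a \<eta>)"
  unfolding smoothed_distance_def by (intro continuous_intros)

text \<open>The upper paraboloid at \<open>x0\<close> comes from the point \<open>z + \<eta> e\<close>, where \<open>z\<close> is a nearest point of \<open>J\<close> and \<open>e\<close> the
  unit vector from \<open>z\<close> to \<open>x0\<close>: \<open>max 0 (dist(x, J) - \<eta>) \<le> |x - z - \<eta> e|\<close> with equality at \<open>x0\<close>.\<close>

lemma smoothed_distance_expansion:
  fixes J :: "'a::euclidean_space set"
  assumes J: "closed J" "J \<noteq> {}"
    and star: "\<And>y b s. y \<in> J \<Longrightarrow> norm b \<le> \<rho> \<Longrightarrow> 0 \<le> s \<Longrightarrow> s \<le> 1 \<Longrightarrow> (1 - s) *\<^sub>R y + s *\<^sub>R b \<in> J"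
    and pos: "0 < \<rho>" "0 < a" "0 < \<eta>" and x0: "\<eta> \<le> infdist x0 J"
  shows "\<exists>z\<in>J. \<exists>\<gamma>\<ge>0. norm (\<gamma> *\<^sub>R (x0 - z)) \<le> a \<and> min (infdist x0 J - \<eta>) a \<le> 2 * norm (\<gamma> *\<^sub>R (x0 - z)) \<and>
     \<rho> * norm (\<gamma> *\<^sub>R (x0 - z)) \<le> (\<gamma> *\<^sub>R (x0 - z)) \<bullet> x0 \<and>
     (\<forall>x. smoothed_distance J a \<eta> x \<le> smoothed_distance J a \<eta> x0 + (\<gamma> *\<^sub>R (x0 - z)) \<bullet> (x - x0) + (1/2) * (norm (x - x0))\<^sup>2)"
proof -
  obtain z where z: "z \<in> J" "infdist x0 J = dist x0 z" using infdist_attains_inf[OF J] by metis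
  define d where "d = norm (x0 - z)"
  have dd: "infdist x0 J = d" by (simp add: z(2) d_def dist_norm)
  have d: "0 < d" "\<eta> \<le> d" using x0 pos by (auto simp: dd)
  define e where "e = (1 / d) *\<^sub>R (x0 - z)"
  have e: "norm e = 1" "x0 - z = d *\<^sub>R e" using d by (auto simp: e_def d_def)
  \<comment> \<open>First-order optimality of the nearest point \<open>z\<close> against moving
    towards \<open>\<rho> e\<close>, a point of the ball with respect to which \<open>J\<close> is
    star-shaped.\<close>
  have ez: "\<rho> * d \<le> (x0 - z) \<bullet> z"
  proof -
    define b where "b = \<rho> *\<^sub>R e"
    have nb: "norm b \<le> \<rho>" using pos e by (simp add: b_def)
    have st: "2 * ((x0 - z) \<bullet> (b - z)) \<le> s * (norm (b - z))\<^sup>2" if s: "0 < s" "s \<le> 1" for s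
    proof -
      have "z + s *\<^sub>R (b - z) \<in> J" using star[OF z(1) nb, of s] s by (simp add: algebra_simps)
      then have "d \<le> norm (x0 - (z + s *\<^sub>R (b - z)))" using infdist_le[of _ J x0] dd by (metis dist_norm)
      then have "d\<^sup>2 \<le> (norm ((x0 - z) + (- s) *\<^sub>R (b - z)))\<^sup>2" using d by (intro power_mono) (auto simp: algebra_simps)
      also have "\<dots> = d\<^sup>2 + 2 * (- s) * ((x0 - z) \<bullet> (b - z)) + (- s)\<^sup>2 * (norm (b - z))\<^sup>2"
        unfolding norm_add_scaleR_square d_def ..
      finally have "s * (2 * ((x0 - z) \<bullet> (b - z))) \<le> s * (s * (norm (b - z))\<^sup>2)" by (simp add: power2_eq_square mult.assoc)
      then show ?thesis using s by simp
    qed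
    have "((\<lambda>s. s * (norm (b - z))\<^sup>2) \<longlongrightarrow> 0 * (norm (b - z))\<^sup>2) (at_right 0)" by (intro tendsto_intros)
    moreover have "\<forall>\<^sub>F s in at_right 0. 2 * ((x0 - z) \<bullet> (b - z)) \<le> s * (norm (b - z))\<^sup>2"
      using st by (auto simp: eventually_at_right_field intro!: exI[of _ 1])
    ultimately have "2 * ((x0 - z) \<bullet> (b - z)) \<le> 0 * (norm (b - z))\<^sup>2" by (rule tendsto_lowerbound) simp
    then have "(x0 - z) \<bullet> b \<le> (x0 - z) \<bullet> z" by (simp add: inner_diff_right)
    moreover have "(x0 - z) \<bullet> b = \<rho> * d" using e by (simp add: b_def dot_square_norm)
    ultimately show ?thesis by simp
  qed
  define r where "r = d - \<eta>"
  have r: "0 \<le> r" using d by (simp add: r_def)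
  define q where "q = sqrt (a\<^sup>2 + r\<^sup>2)"
  have q: "a \<le> q" "r \<le> q" "q \<le> a + r" "q\<^sup>2 = a\<^sup>2 + r\<^sup>2" "0 < q"
  proof -
    show 1: "a \<le> q" unfolding q_def by (rule real_le_rsqrt) simp
    show "r \<le> q" unfolding q_def by (rule real_le_rsqrt) simp
    show "0 < q" using 1 pos by simp
    show "q\<^sup>2 = a\<^sup>2 + r\<^sup>2" by (simp add: q_def)
    have "a\<^sup>2 + r\<^sup>2 \<le> (a + r)\<^sup>2" using pos r by (simp add: power2_sum)
    then show "q \<le> a + r" unfolding q_def using pos r by (intro real_le_lsqrt) auto
  qed
  define \<gamma> where "\<gamma> = a / q * r / d"
  have \<gamma>: "0 \<le> \<gamma>" using pos r q d by (simp add: \<gamma>_def)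
  define g where "g = \<gamma> *\<^sub>R (x0 - z)"
  have ge: "g = (a / q * r) *\<^sub>R e" using d by (simp add: g_def e(2) \<gamma>_def)
  have ng: "norm g = a / q * r" using pos r q e by (simp add: ge)
  have 1: "norm g \<le> a"
  proof -
    have "a * r \<le> a * q" using q(2) pos by (intro mult_left_mono) auto
    then show ?thesis using q pos by (simp add: ng divide_le_eq)
  qed
  \<comment> \<open>\<open>q \<le> a + r\<close> bounds \<open>a * r / q\<close> from below by half
    of \<open>min r a\<close>.\<close>
  have 2: "min (infdist x0 J - \<eta>) a \<le> 2 * norm g"
  proof -
    have "min r a * q \<le> min r a * (a + r)" using q pos r by (intro mult_left_mono) auto
    also have "\<dots> = min r a * a + min r a * r" by (simp add: distrib_left)
    also have "\<dots> \<le> r * a + a * r" using pos r by (intro add_mono mult_right_mono) auto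
    finally show ?thesis using q pos by (simp add: ng dd r_def[symmetric] field_simps)
  qed
  have 3: "\<rho> * norm g \<le> g \<bullet> x0"
  proof -
    have "(x0 - z) \<bullet> x0 = (x0 - z) \<bullet> z + d\<^sup>2" by (simp add: d_def power2_norm_eq_inner inner_diff_left inner_diff_right inner_commute)
    then have "\<rho> * d \<le> (x0 - z) \<bullet> x0" using ez by (smt (verit) zero_le_power2)
    then have "\<gamma> * (\<rho> * d) \<le> \<gamma> * ((x0 - z) \<bullet> x0)" using \<gamma> by (rule mult_left_mono)
    moreover have "norm g = \<gamma> * d" using \<gamma> by (simp add: g_def d_def)
    ultimately show ?thesis by (simp add: g_def mult_ac)
  qed
  have 4: "smoothed_distance J a \<eta> x \<le> smoothed_distance J a \<eta> x0 + g \<bullet> (x - x0) + (1/2) * (norm (x - x0))\<^sup>2" for x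
  proof -
    define h where "h = x - x0"
    have "infdist x J \<le> norm (x - z)" using infdist_le[OF z(1), of x] by (simp add: dist_norm)
    also have "x - z = (r *\<^sub>R e + h) + \<eta> *\<^sub>R e" using e(2) by (simp add: h_def r_def algebra_simps)
    also have "norm \<dots> \<le> norm (r *\<^sub>R e + h) + \<eta>" using norm_triangle_ineq[of "r *\<^sub>R e + h" "\<eta> *\<^sub>R e"] e pos by simp
    finally have "max 0 (infdist x J - \<eta>) \<le> norm (r *\<^sub>R e + h)" by simp
    then have "(max 0 (infdist x J - \<eta>))\<^sup>2 \<le> (norm (r *\<^sub>R e + h))\<^sup>2" by (intro power_mono) auto
    also have "\<dots> = r\<^sup>2 + 2 * r * (e \<bullet> h) + (norm h)\<^sup>2"
      using norm_add_scaleR_square[of h r e] e by (simp add: add.commute inner_commute)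
    finally have "a\<^sup>2 + (max 0 (infdist x J - \<eta>))\<^sup>2 \<le> q\<^sup>2 + 2 * r * (e \<bullet> h) + (norm h)\<^sup>2" using q(4) by simp
    \<comment> \<open>Completing the square; this encodes the tangent line of the concave square
      root at \<open>q^2\<close>.\<close>
    also have "\<dots> \<le> (q + (2 * r * (e \<bullet> h) + (norm h)\<^sup>2) / (2 * q))\<^sup>2"
    proof -
      define m where "m = 2 * r * (e \<bullet> h) + (norm h)\<^sup>2"
      have "(q + m / (2 * q))\<^sup>2 = q\<^sup>2 + m + (m / (2 * q))\<^sup>2" using q by (simp add: power2_sum)
      then show ?thesis unfolding m_def[symmetric] by (simp add: m_def add.assoc)
    qed
    finally have "sqrt (a\<^sup>2 + (max 0 (infdist x J - \<eta>))\<^sup>2) \<le> \<bar>q + (2 * r * (e \<bullet> h) + (norm h)\<^sup>2) / (2 * q)\<bar>"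
      by (metis real_sqrt_abs real_sqrt_le_mono)
    moreover have "0 \<le> q + (2 * r * (e \<bullet> h) + (norm h)\<^sup>2) / (2 * q)"
    proof -
      have "0 \<le> (norm (r *\<^sub>R e + h))\<^sup>2" by simp
      then have "0 \<le> r\<^sup>2 + 2 * r * (e \<bullet> h) + (norm h)\<^sup>2"
        using norm_add_scaleR_square[of h r e] e by (simp add: add.commute inner_commute)
      then have "0 \<le> q * (2 * q) + (2 * r * (e \<bullet> h) + (norm h)\<^sup>2)"
      proof -
        have "q * (2 * q) = 2 * q\<^sup>2" by (simp add: power2_eq_square)
        then show ?thesis using q(4) \<open>0 \<le> r\<^sup>2 + 2 * r * (e \<bullet> h) + (norm h)\<^sup>2\<close> zero_le_power2[of a] zero_le_power2[of r] by linarith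
      qed
      then have "0 \<le> (q * (2 * q) + (2 * r * (e \<bullet> h) + (norm h)\<^sup>2)) / (2 * q)" using q by (intro divide_nonneg_nonneg) auto
      also have "\<dots> = q + (2 * r * (e \<bullet> h) + (norm h)\<^sup>2) / (2 * q)" using q by (simp add: add_divide_distrib)
      finally show ?thesis .
    qed
    ultimately have "sqrt (a\<^sup>2 + (max 0 (infdist x J - \<eta>))\<^sup>2) \<le> q + (2 * r * (e \<bullet> h) + (norm h)\<^sup>2) / (2 * q)" by simp
    then have "a * sqrt (a\<^sup>2 + (max 0 (infdist x J - \<eta>))\<^sup>2) \<le> a * (q + (2 * r * (e \<bullet> h) + (norm h)\<^sup>2) / (2 * q))"
      using pos by (intro mult_left_mono) auto
    also have "\<dots> = a * q + (a / q * r) * (e \<bullet> h) + (a / q) * ((1/2) * (norm h)\<^sup>2)" using q by (simp add: field_simps)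
    also have "\<dots> \<le> a * q + (a / q * r) * (e \<bullet> h) + 1 * ((1/2) * (norm h)\<^sup>2)"
      using q pos by (intro add_left_mono mult_right_mono) auto
    finally have "smoothed_distance J a \<eta> x \<le> a * q - a\<^sup>2 + g \<bullet> h + (1/2) * (norm h)\<^sup>2"
      by (simp add: smoothed_distance_def ge)
    moreover have "smoothed_distance J a \<eta> x0 = a * q - a\<^sup>2"
      using r by (simp add: smoothed_distance_def dd q_def r_def)
    ultimately show ?thesis by (simp add: h_def)
  qed
  show ?thesis using z(1) \<gamma> 1 2 3 4 unfolding g_def by blast
qed

section \<open>Assembly of the barrier\<close>

lemma sum_power_2_real: "(\<Sum>l<n. 2 ^ l) = (2::real) ^ n - 1"
  by (induction n) auto

context convex_potential
begin

text \<open>At scale \<open>2\<^sup>l\<close> the barrier has gradient of order one, but only where all nearby subgradients exceed \<open>2\<^sup>l\<close>, so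
  that its Hessian is dominated by the subgradients. On the set where \<open>\<psi> = \<infinity>\<close> infinitely many scales
  contribute to the gradient.\<close>

theorem barrier_exists:
  assumes \<rho>: "0 < \<rho>" "0 \<le> C" "\<And>x. norm x \<le> 2 * \<rho> \<Longrightarrow> \<psi> x \<le> ereal C" and R: "0 \<le> R" and \<omega>: "0 < \<omega>"
    and M: "compact M" "\<And>x. x \<in> M \<Longrightarrow> \<psi> x = \<infinity>"
    and xs: "calm k xs" "norm xs \<le> R + 1"
  defines "K \<equiv> (C + (R + 1) + \<rho>) / \<rho>"
  obtains P where "continuous_on UNIV P" "\<And>x. 0 \<le> P x" "P xs = 0"
    "\<And>x0. norm x0 \<le> R \<Longrightarrow> \<exists>G \<kappa>. 0 \<le> \<kappa> \<and> norm G \<le> \<omega> * \<kappa> \<and> \<rho> * norm G \<le> G \<bullet> x0 \<and> (x0 \<in> M \<longrightarrow> N \<le> G \<bullet> x0) \<and>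
       (\<forall>\<^sub>F x in nhds x0. P x \<le> P x0 + G \<bullet> (x - x0) + (1/2) * (\<omega> * \<kappa>) * (norm (x - x0))\<^sup>2) \<and>
       (\<forall>\<epsilon>>0. \<forall>\<^sub>F x in nhds x0. \<forall>\<xi>\<in>subdifferential \<psi> x. \<kappa> \<le> 2 * norm \<xi> \<and> - (K * \<omega> * \<kappa>) - \<epsilon> * (1 + norm \<xi>) \<le> \<xi> \<bullet> G)"
proof -
  define J where "J l = calm_cone \<rho> (R + 1) (2 ^ l)" for l :: nat
  have R1: "0 \<le> R + 1" using R by simp
  have K: "0 \<le> K" using \<rho> R by (simp add: K_def)
  \<comment> \<open>From this scale on \<open>xs\<close> belongs to every set \<open>J l\<close>;
    leaving out the coarser scales makes the barrier vanish at \<open>xs\<close>.\<close>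
  obtain l0 where l0: "k \<le> 2 ^ l0" using real_arch_pow[of 2 k] by (auto intro: less_imp_le)
  \<comment> \<open>The target \<open>N / (\<omega> * \<rho>)\<close> is doubled because the
    truncated distance is bounded by twice the gradient; \<open>l0\<close> makes up for the omitted
    scales and \<open>1\<close> for the dead zones.\<close>
  obtain n where n: "\<And>x. x \<in> M \<Longrightarrow> 2 * N / (\<omega> * \<rho>) + real l0 + 1 \<le> (\<Sum>l<n. min (2 ^ l * infdist x (J l)) 1)"
    unfolding J_def using calm_cone_distances_uniform[OF \<rho> R1 M, of "2 * N / (\<omega> * \<rho>) + real l0 + 1"] by blast
  define l1 where "l1 = max n l0"
  \<comment> \<open>Keeps the total loss from the dead zones, the sum of
    \<open>2 ^ l * \<eta>\<close> over the scales in \<open>I\<close>, at most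
    \<open>1\<close>.\<close>
  define \<eta> where "\<eta> = 1 / (2::real) ^ l1"
  have \<eta>: "0 < \<eta>" by (simp add: \<eta>_def)
  define I where "I = {l0..<l1}"
  have I: "finite I" by (simp add: I_def)
  define E where "E l = smoothed_distance (J l) (1 / 2 ^ l) \<eta>" for l
  have E0: "0 \<le> E l x" for l x unfolding E_def by (rule smoothed_distance_nonneg) simp
  define P where "P x = (\<Sum>l\<in>I. \<omega> * 2 ^ l * E l x)" for x
  have Jcl: "closed (J l)" "J l \<noteq> {}" for l
    unfolding J_def using compact_imp_closed[OF compact_calm_cone] calm_cone_nonempty[of "2 ^ l" "R + 1" \<rho>] R \<rho>(1) by auto
  have Jcalm: "calm (K * 2 ^ l) z" if "z \<in> J l" for l z
    unfolding K_def by (rule calm_cone_calm[OF \<rho> _ _ R1]) (use that in \<open>auto simp: J_def\<close>)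
  have exp: "\<exists>z\<in>J l. \<exists>\<gamma>\<ge>0. norm (\<gamma> *\<^sub>R (x0 - z)) \<le> 1 / 2 ^ l \<and> min (infdist x0 (J l) - \<eta>) (1 / 2 ^ l) \<le> 2 * norm (\<gamma> *\<^sub>R (x0 - z)) \<and>
     \<rho> * norm (\<gamma> *\<^sub>R (x0 - z)) \<le> (\<gamma> *\<^sub>R (x0 - z)) \<bullet> x0 \<and>
     (\<forall>x. E l x \<le> E l x0 + (\<gamma> *\<^sub>R (x0 - z)) \<bullet> (x - x0) + (1/2) * (norm (x - x0))\<^sup>2)" if "\<eta> \<le> infdist x0 (J l)" for l x0
    unfolding E_def
  proof (rule smoothed_distance_expansion[OF Jcl])
    show "(1 - s) *\<^sub>R y + s *\<^sub>R b \<in> J l" if "y \<in> J l" "norm b \<le> \<rho>" "0 \<le> s" "s \<le> 1" for y b s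
      using that calm_cone_star unfolding J_def by blast
  qed (use \<rho> \<eta> that in auto)
  show thesis
  proof (rule that[of P])
    show "continuous_on UNIV P" unfolding P_def E_def by (intro continuous_intros continuous_smoothed_distance)
    show "0 \<le> P x" for x unfolding P_def using E0 \<omega> by (intro sum_nonneg) auto
    have "E l xs = 0" if "l \<in> I" for l
    proof -
      have "(2::real) ^ l0 \<le> 2 ^ l" using that by (intro power_increasing) (auto simp: I_def)
      then have "k \<le> 2 ^ l" using l0 by linarith
      then have "xs \<in> J l" unfolding J_def using xs calm_mono \<rho> by (intro calm_in_calm_cone) auto
      then have "infdist xs (J l) = 0" by simp
      then show ?thesis unfolding E_def using \<eta> by (intro smoothed_distance_near) auto
    qed
    then show "P xs = 0" by (simp add: P_def)
  next
    fix x0 :: 'a assume x0: "norm x0 \<le> R"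
    \<comment> \<open>The active scales. At the others the distance is strictly below
      \<open>\<eta>\<close>, so the term vanishes near \<open>x0\<close>; at these it is positive,
      so points near \<open>x0\<close> stay off \<open>J l\<close>.\<close>
    define \<Lambda> where "\<Lambda> = {l\<in>I. \<eta> \<le> infdist x0 (J l)}"
    have \<Lambda>: "finite \<Lambda>" "\<Lambda> \<subseteq> I" using I by (auto simp: \<Lambda>_def)
    have "\<forall>l. \<exists>z \<gamma>. l \<in> \<Lambda> \<longrightarrow> z \<in> J l \<and> 0 \<le> \<gamma> \<and> norm (\<gamma> *\<^sub>R (x0 - z)) \<le> 1 / 2 ^ l \<and> min (infdist x0 (J l) - \<eta>) (1 / 2 ^ l) \<le> 2 * norm (\<gamma> *\<^sub>R (x0 - z)) \<and>
     \<rho> * norm (\<gamma> *\<^sub>R (x0 - z)) \<le> (\<gamma> *\<^sub>R (x0 - z)) \<bullet> x0 \<and>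
     (\<forall>x. E l x \<le> E l x0 + (\<gamma> *\<^sub>R (x0 - z)) \<bullet> (x - x0) + (1/2) * (norm (x - x0))\<^sup>2)"
      using exp[of x0] unfolding \<Lambda>_def by blast
    then obtain z \<gamma> where zg: "\<And>l. l \<in> \<Lambda> \<Longrightarrow> z l \<in> J l \<and> 0 \<le> \<gamma> l \<and> norm (\<gamma> l *\<^sub>R (x0 - z l)) \<le> 1 / 2 ^ l \<and> min (infdist x0 (J l) - \<eta>) (1 / 2 ^ l) \<le> 2 * norm (\<gamma> l *\<^sub>R (x0 - z l)) \<and>
     \<rho> * norm (\<gamma> l *\<^sub>R (x0 - z l)) \<le> (\<gamma> l *\<^sub>R (x0 - z l)) \<bullet> x0 \<and>
     (\<forall>x. E l x \<le> E l x0 + (\<gamma> l *\<^sub>R (x0 - z l)) \<bullet> (x - x0) + (1/2) * (norm (x - x0))\<^sup>2)"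
      by metis
    define g where "g l = \<gamma> l *\<^sub>R (x0 - z l)" for l
    have zJ: "z l \<in> J l" and \<gamma>0: "0 \<le> \<gamma> l" and g1: "norm (g l) \<le> 1 / 2 ^ l" and g2: "min (infdist x0 (J l) - \<eta>) (1 / 2 ^ l) \<le> 2 * norm (g l)"
      and g3: "\<rho> * norm (g l) \<le> g l \<bullet> x0" and g4: "E l x \<le> E l x0 + g l \<bullet> (x - x0) + (1/2) * (norm (x - x0))\<^sup>2" if "l \<in> \<Lambda>" for l x
      using zg[OF that] unfolding g_def by blast+
    define w where "w l = \<omega> * 2 ^ l" for l :: nat
    have w: "0 < w l" for l using \<omega> by (simp add: w_def)
    define G where "G = (\<Sum>l\<in>\<Lambda>. w l *\<^sub>R g l)"
    \<comment> \<open>Size of the Hessian up to the factor \<open>\<omega>\<close>. As a sum of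
      distinct powers of two it is at most twice the largest one, which lies below the norm of every
      nearby subgradient.\<close>
    define \<kappa> where "\<kappa> = (\<Sum>l\<in>\<Lambda>. (2::real) ^ l)"
    have \<kappa>: "0 \<le> \<kappa>" by (simp add: \<kappa>_def sum_nonneg)
    have Gx: "G \<bullet> v = (\<Sum>l\<in>\<Lambda>. w l * (g l \<bullet> v))" for v by (simp add: G_def inner_sum_left)
    define s where "s = (\<Sum>l\<in>\<Lambda>. w l * norm (g l))"
    have Gs: "norm G \<le> s" unfolding G_def s_def
      by (rule order_trans[OF norm_sum]) (use w in \<open>auto simp: abs_of_pos intro!: sum_mono\<close>)
    have s\<kappa>: "s \<le> \<omega> * \<kappa>"
      unfolding s_def \<kappa>_def sum_distrib_left
    proof (rule sum_mono)
      fix l assume l: "l \<in> \<Lambda>"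
      have "norm (g l) \<le> 1" using g1[OF l] by (rule order_trans) simp
      then show "w l * norm (g l) \<le> \<omega> * 2 ^ l" using w[of l] mult_left_mono[of "norm (g l)" 1 "w l"] by (simp add: w_def)
    qed
    have \<rho>s: "\<rho> * s \<le> G \<bullet> x0"
      unfolding Gx s_def sum_distrib_left
    proof (rule sum_mono)
      fix l assume l: "l \<in> \<Lambda>"
      show "\<rho> * (w l * norm (g l)) \<le> w l * (g l \<bullet> x0)"
        using mult_left_mono[OF g3[OF l] less_imp_le[OF w[of l]]] by (simp add: mult_ac)
    qed
    have \<rho>G: "\<rho> * norm G \<le> G \<bullet> x0" using mult_left_mono[OF Gs less_imp_le[OF \<rho>(1)]] \<rho>s by linarith
    have NM: "N \<le> G \<bullet> x0" if "x0 \<in> M"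
    proof -
      define m where "m l = min (2 ^ l * infdist x0 (J l)) 1" for l :: nat
      have m1: "m l \<le> 1" "0 \<le> m l" for l by (auto simp: m_def infdist_nonneg)
      have ml: "m l - 2 ^ l * \<eta> \<le> (if l \<in> \<Lambda> then 2 * (2 ^ l * norm (g l)) else 0)" if "l \<in> I" for l
      proof (cases "l \<in> \<Lambda>")
        case True
        have "2 ^ l * min (infdist x0 (J l) - \<eta>) (1 / 2 ^ l) \<le> 2 ^ l * (2 * norm (g l))" using g2[OF True] by (intro mult_left_mono) auto
        moreover have "2 ^ l * min (infdist x0 (J l) - \<eta>) (1 / 2 ^ l) = min (2 ^ l * infdist x0 (J l) - 2 ^ l * \<eta>) 1"
          by (simp add: min_mult_distrib_left right_diff_distrib)
        moreover have "m l - 2 ^ l * \<eta> \<le> min (2 ^ l * infdist x0 (J l) - 2 ^ l * \<eta>) 1"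
        proof -
          have "0 \<le> 2 ^ l * \<eta>" using \<eta> by simp
          then show ?thesis using m1(1)[of l] min.cobounded1[of "2 ^ l * infdist x0 (J l)" 1] unfolding m_def[of l] by linarith
        qed
        ultimately have "m l - 2 ^ l * \<eta> \<le> 2 ^ l * (2 * norm (g l))" by linarith
        then show ?thesis using True by simp
      next
        case False
        then have "infdist x0 (J l) \<le> \<eta>" using that by (simp add: \<Lambda>_def)
        then have "2 ^ l * infdist x0 (J l) \<le> 2 ^ l * \<eta>" by (rule mult_left_mono) simp
        moreover have "m l \<le> 2 ^ l * infdist x0 (J l)" by (simp add: m_def)
        ultimately have "m l - 2 ^ l * \<eta> \<le> 0" by linarith
        then show ?thesis using False by simp
      qed
      have "(\<Sum>l<n. m l) \<le> (\<Sum>l<l1. m l)" using m1 by (intro sum_mono2) (auto simp: l1_def)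
      also have "\<dots> = (\<Sum>l<l0. m l) + (\<Sum>l\<in>I. m l)"
      proof -
        have "{..<l1} = {..<l0} \<union> I" by (auto simp: I_def l1_def)
        then show ?thesis by (simp add: sum.union_disjoint I_def disjoint_iff)
      qed
      also have "(\<Sum>l<l0. m l) \<le> real l0" using sum_mono[of "{..<l0}" m "\<lambda>_. 1"] m1 by simp
      finally have "2 * N / (\<omega> * \<rho>) + 1 \<le> (\<Sum>l\<in>I. m l)" using n[OF that] by (simp add: m_def)
      also have "\<dots> \<le> (\<Sum>l\<in>I. (if l \<in> \<Lambda> then 2 * (2 ^ l * norm (g l)) else 0) + 2 ^ l * \<eta>)"
        using ml by (intro sum_mono) (simp add: algebra_simps)
      also have "\<dots> = (\<Sum>l\<in>\<Lambda>. 2 * (2 ^ l * norm (g l))) + (\<Sum>l\<in>I. 2 ^ l) * \<eta>"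
      proof -
        have "(\<Sum>l\<in>I. if l \<in> \<Lambda> then 2 * (2 ^ l * norm (g l)) else 0) = (\<Sum>l\<in>\<Lambda>. 2 * (2 ^ l * norm (g l)))"
          using sum.inter_restrict[OF I, of "\<lambda>l. 2 * (2 ^ l * norm (g l))" \<Lambda>] \<Lambda>(2) by (simp add: Int_absorb1)
        then show ?thesis by (simp add: sum.distrib sum_distrib_right)
      qed
      also have "(\<Sum>l\<in>I. 2 ^ l) * \<eta> \<le> 1"
      proof -
        have "(\<Sum>l\<in>I. (2::real) ^ l) \<le> (\<Sum>l<l1. 2 ^ l)" by (intro sum_mono2) (auto simp: I_def)
        also have "\<dots> \<le> 2 ^ l1" by (simp add: sum_power_2_real)
        finally show ?thesis by (simp add: \<eta>_def divide_le_eq)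
      qed
      finally have "2 * N / (\<omega> * \<rho>) \<le> 2 * (\<Sum>l\<in>\<Lambda>. 2 ^ l * norm (g l))" by (simp add: sum_distrib_left)
      then have "N / (\<omega> * \<rho>) \<le> (\<Sum>l\<in>\<Lambda>. 2 ^ l * norm (g l))" by simp
      then have "N \<le> (\<Sum>l\<in>\<Lambda>. 2 ^ l * norm (g l)) * (\<omega> * \<rho>)" using \<omega> \<rho> by (simp add: divide_le_eq)
      also have "\<dots> = \<rho> * s" by (simp add: s_def w_def sum_distrib_left sum_distrib_right mult_ac)
      finally show ?thesis using \<rho>s by linarith
    qed
    have infl: "\<forall>\<^sub>F x in nhds x0. \<bar>infdist x A - infdist x0 A\<bar> < \<epsilon>" if "0 < \<epsilon>" for A :: "'a set" and \<epsilon>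
    proof -
      have "((\<lambda>x. infdist x A) \<longlongrightarrow> infdist x0 A) (nhds x0)"
        by (intro tendsto_infdist) (simp add: filterlim_ident)
      from tendstoD[OF this that] show ?thesis unfolding dist_real_def .
    qed
    have off: "\<forall>\<^sub>F x in nhds x0. \<forall>l\<in>I - \<Lambda>. E l x = 0"
    proof (intro eventually_ball_finite ballI)
      fix l assume l: "l \<in> I - \<Lambda>"
      then have "0 < \<eta> - infdist x0 (J l)" by (auto simp: \<Lambda>_def)
      from infl[of _ "J l", OF this] show "\<forall>\<^sub>F x in nhds x0. E l x = 0"
        by (rule eventually_mono) (auto simp: E_def intro!: smoothed_distance_near)
    qed (use I in simp)
    have quad: "\<forall>\<^sub>F x in nhds x0. P x \<le> P x0 + G \<bullet> (x - x0) + (1/2) * (\<omega> * \<kappa>) * (norm (x - x0))\<^sup>2"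
      using off
    proof eventually_elim
      fix x assume off: "\<forall>l\<in>I - \<Lambda>. E l x = 0"
      have sp: "(\<Sum>l\<in>I. w l * E l y) = (\<Sum>l\<in>I - \<Lambda>. w l * E l y) + (\<Sum>l\<in>\<Lambda>. w l * E l y)" for y
        by (rule sum.subset_diff[OF \<Lambda>(2) I])
      have "P x = (\<Sum>l\<in>\<Lambda>. w l * E l x)" using sp[of x] off by (simp add: P_def w_def)
      also have "\<dots> \<le> (\<Sum>l\<in>\<Lambda>. w l * (E l x0 + g l \<bullet> (x - x0) + (1/2) * (norm (x - x0))\<^sup>2))"
        using g4 w by (intro sum_mono mult_left_mono) (auto simp: less_imp_le)
      also have "\<dots> = (\<Sum>l\<in>\<Lambda>. w l * E l x0) + G \<bullet> (x - x0) + (1/2) * (\<omega> * \<kappa>) * (norm (x - x0))\<^sup>2"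
        by (simp add: Gx \<kappa>_def w_def sum.distrib sum_distrib_left sum_distrib_right distrib_left mult_ac)
      also have "(\<Sum>l\<in>\<Lambda>. w l * E l x0) \<le> P x0"
        using sp[of x0] sum_nonneg[of "I - \<Lambda>" "\<lambda>l. w l * E l x0"] E0 w by (simp add: P_def w_def less_imp_le)
      finally show "P x \<le> P x0 + G \<bullet> (x - x0) + (1/2) * (\<omega> * \<kappa>) * (norm (x - x0))\<^sup>2" by simp
    qed
    have sd: "\<forall>\<^sub>F x in nhds x0. \<forall>\<xi>\<in>subdifferential \<psi> x. \<kappa> \<le> 2 * norm \<xi> \<and> - (K * \<omega> * \<kappa>) - \<epsilon> * (1 + norm \<xi>) \<le> \<xi> \<bullet> G"
      if \<epsilon>: "0 < \<epsilon>" for \<epsilon>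
    proof -
      \<comment> \<open>Collects the factors with which replacing \<open>x0\<close> by a nearby
        \<open>x\<close> enters the pairing; \<open>\<delta>\<close> is chosen to turn this loss
        into \<open>\<epsilon>\<close>.\<close>
      define L where "L = (\<Sum>l\<in>\<Lambda>. w l * \<gamma> l * (K * 2 ^ l + 1))"
      have L: "0 \<le> L" unfolding L_def using w \<gamma>0 K by (intro sum_nonneg mult_nonneg_nonneg) (auto simp: less_imp_le)
      define \<delta> where "\<delta> = min 1 (\<epsilon> / (L + 1))"
      have \<delta>: "0 < \<delta>" "L * \<delta> \<le> \<epsilon>" "\<delta> \<le> 1"
      proof -
        show "0 < \<delta>" using \<epsilon> L by (simp add: \<delta>_def)
        have "L * \<delta> \<le> (L + 1) * (\<epsilon> / (L + 1))" using L \<epsilon> by (intro mult_mono) (auto simp: \<delta>_def)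
        also have "\<dots> = \<epsilon>" using L by simp
        finally show "L * \<delta> \<le> \<epsilon>" .
      qed (simp add: \<delta>_def)
      have ev1: "\<forall>\<^sub>F x in nhds x0. dist x x0 < \<delta>" using \<delta>(1) by (auto simp: eventually_nhds_metric)
      have ev2: "\<forall>\<^sub>F x in nhds x0. \<forall>l\<in>\<Lambda>. x \<notin> J l"
      proof (intro eventually_ball_finite ballI \<Lambda>(1))
        fix l assume l: "l \<in> \<Lambda>"
        have "\<forall>\<^sub>F x in nhds x0. \<bar>infdist x (J l) - infdist x0 (J l)\<bar> < \<eta>" by (rule infl[OF \<eta>])
        then show "\<forall>\<^sub>F x in nhds x0. x \<notin> J l"
        proof eventually_elim
          fix x assume "\<bar>infdist x (J l) - infdist x0 (J l)\<bar> < \<eta>"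
          then have "0 < infdist x (J l)" using l by (auto simp: \<Lambda>_def)
          then show "x \<notin> J l" by auto
        qed
      qed
      from ev1 ev2 show ?thesis
      proof eventually_elim
        fix x assume dx: "dist x x0 < \<delta>" and xJ: "\<forall>l\<in>\<Lambda>. x \<notin> J l"
        have nx: "norm x \<le> R + 1" using x0 dx \<delta>(3) norm_triangle_sub[of x x0] by (simp add: dist_norm)
        show "\<forall>\<xi>\<in>subdifferential \<psi> x. \<kappa> \<le> 2 * norm \<xi> \<and> - (K * \<omega> * \<kappa>) - \<epsilon> * (1 + norm \<xi>) \<le> \<xi> \<bullet> G"
        proof (intro ballI conjI)
          fix \<xi> assume \<xi>: "\<xi> \<in> subdifferential \<psi> x"
          have big: "2 ^ l < norm \<xi>" if "l \<in> \<Lambda>" for l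
            by (rule subgradient_large_off_calm_cone[OF nx _ less_imp_le[OF \<rho>(1)] \<xi>]) (use xJ that in \<open>auto simp: J_def\<close>)
          show "\<kappa> \<le> 2 * norm \<xi>"
          proof (cases "\<Lambda> = {}")
            case False
            have "\<kappa> \<le> (\<Sum>l<Suc (Max \<Lambda>). 2 ^ l)" unfolding \<kappa>_def using \<Lambda>(1) by (intro sum_mono2) (auto simp: less_Suc_eq_le)
            also have "\<dots> \<le> 2 * 2 ^ Max \<Lambda>" unfolding sum_power_2_real by simp
            also have "\<dots> \<le> 2 * norm \<xi>" using big[OF Max_in[OF \<Lambda>(1) False]] by simp
            finally show ?thesis .
          qed (simp add: \<kappa>_def)
          define N1 where "N1 = 1 + norm \<xi>"
          have N1: "1 \<le> N1" by (simp add: N1_def)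
          \<comment> \<open>The gradient at scale \<open>l\<close> is \<open>\<gamma> l\<close>
            times \<open>x0 - z l\<close>, and \<open>z l\<close> is calm with constant
            \<open>K * 2 ^ l\<close>. The loss in monotonicity is that constant times the gradient
            length, which is at most \<open>1 / 2 ^ l\<close>, so only \<open>K\<close> times the
            weight \<open>w l\<close> is lost.\<close>
          have tm: "- (K * \<omega> * 2 ^ l) - (w l * \<gamma> l * (K * 2 ^ l + 1)) * \<delta> * N1 \<le> w l * (g l \<bullet> \<xi>)" if l: "l \<in> \<Lambda>" for l
          proof -
            have "- (K * 2 ^ l * norm (x - z l)) \<le> \<xi> \<bullet> (x - z l)" by (rule subgradient_calm_ge[OF Jcalm[OF zJ[OF l]] \<xi>])
            moreover have "- (norm \<xi> * \<delta>) \<le> \<xi> \<bullet> (x0 - x)"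
            proof -
              have "- (\<xi> \<bullet> (x0 - x)) \<le> norm \<xi> * norm (x0 - x)" using Cauchy_Schwarz_ineq2[of \<xi> "x0 - x"] by linarith
              also have "\<dots> \<le> norm \<xi> * \<delta>" using dx by (intro mult_left_mono) (auto simp: dist_norm norm_minus_commute)
              finally show ?thesis by linarith
            qed
            moreover have "norm (x - z l) \<le> norm (x0 - z l) + \<delta>"
              using norm_triangle_ineq[of "x - x0" "x0 - z l"] dx by (simp add: dist_norm)
            then have "K * 2 ^ l * norm (x - z l) \<le> K * 2 ^ l * (norm (x0 - z l) + \<delta>)" using K by (intro mult_left_mono) auto
            ultimately have "- (K * 2 ^ l * (norm (x0 - z l) + \<delta>)) - norm \<xi> * \<delta> \<le> \<xi> \<bullet> (x0 - z l)"
              by (simp add: inner_diff_right)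
            then have "(w l * \<gamma> l) * (- (K * 2 ^ l * (norm (x0 - z l) + \<delta>)) - norm \<xi> * \<delta>) \<le> (w l * \<gamma> l) * (\<xi> \<bullet> (x0 - z l))"
              using w[of l] \<gamma>0[OF l] by (intro mult_left_mono) auto
            also have "\<dots> = w l * (g l \<bullet> \<xi>)" by (simp add: g_def inner_commute)
            finally have 1: "- (w l * (K * 2 ^ l) * (\<gamma> l * norm (x0 - z l))) - (w l * \<gamma> l) * \<delta> * (K * 2 ^ l + norm \<xi>) \<le> w l * (g l \<bullet> \<xi>)"
              by (simp add: algebra_simps)
            have "\<gamma> l * norm (x0 - z l) \<le> 1 / 2 ^ l" using g1[OF l] \<gamma>0[OF l] by (simp add: g_def)
            then have "w l * (K * 2 ^ l) * (\<gamma> l * norm (x0 - z l)) \<le> w l * (K * 2 ^ l) * (1 / 2 ^ l)"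
              using w[of l] K by (intro mult_left_mono) auto
            also have "\<dots> = K * \<omega> * 2 ^ l" by (simp add: w_def)
            finally have 2: "w l * (K * 2 ^ l) * (\<gamma> l * norm (x0 - z l)) \<le> K * \<omega> * 2 ^ l" .
            have "K * 2 ^ l + norm \<xi> \<le> (K * 2 ^ l + 1) * N1"
            proof -
              have "0 \<le> K * 2 ^ l * norm \<xi>" using K by simp
              then show ?thesis by (simp add: N1_def algebra_simps)
            qed
            then have "(w l * \<gamma> l) * \<delta> * (K * 2 ^ l + norm \<xi>) \<le> (w l * \<gamma> l) * \<delta> * ((K * 2 ^ l + 1) * N1)"
              using w[of l] \<gamma>0[OF l] \<delta>(1) by (intro mult_left_mono) auto
            then show ?thesis using 1 2 by (simp add: mult_ac)
          qed
          have "- (K * \<omega> * \<kappa>) - L * \<delta> * N1 = (\<Sum>l\<in>\<Lambda>. - (K * \<omega> * 2 ^ l) - (w l * \<gamma> l * (K * 2 ^ l + 1)) * \<delta> * N1)"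
            by (simp add: \<kappa>_def L_def sum_subtractf sum_negf sum_distrib_left sum_distrib_right mult_ac)
          also have "\<dots> \<le> (\<Sum>l\<in>\<Lambda>. w l * (g l \<bullet> \<xi>))" by (rule sum_mono[OF tm])
          also have "\<dots> = \<xi> \<bullet> G" unfolding Gx[symmetric] by (rule inner_commute)
          finally have "- (K * \<omega> * \<kappa>) - L * \<delta> * N1 \<le> \<xi> \<bullet> G" .
          moreover have "L * \<delta> * N1 \<le> \<epsilon> * N1" using \<delta>(2) N1 by (intro mult_right_mono) auto
          ultimately show "- (K * \<omega> * \<kappa>) - \<epsilon> * (1 + norm \<xi>) \<le> \<xi> \<bullet> G" by (simp add: N1_def)
        qed
      qed
    qed
    have "norm G \<le> \<omega> * \<kappa>" using Gs s\<kappa> by linarith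
    then show "\<exists>G \<kappa>. 0 \<le> \<kappa> \<and> norm G \<le> \<omega> * \<kappa> \<and> \<rho> * norm G \<le> G \<bullet> x0 \<and> (x0 \<in> M \<longrightarrow> N \<le> G \<bullet> x0) \<and>
       (\<forall>\<^sub>F x in nhds x0. P x \<le> P x0 + G \<bullet> (x - x0) + (1/2) * (\<omega> * \<kappa>) * (norm (x - x0))\<^sup>2) \<and>
       (\<forall>\<epsilon>>0. \<forall>\<^sub>F x in nhds x0. \<forall>\<xi>\<in>subdifferential \<psi> x. \<kappa> \<le> 2 * norm \<xi> \<and> - (K * \<omega> * \<kappa>) - \<epsilon> * (1 + norm \<xi>) \<le> \<xi> \<bullet> G)"
      using \<kappa> \<rho>G NM quad sd by blast
  qed
qed

end

section \<open>The comparison principle\<close>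

text \<open>The maximum is sought on the closure of \<open>D\<close>, which is where compactness is
  available. Joint continuity combines the Lipschitz constant, uniform in time, with continuity in
  time at one nearby point of \<open>D\<close>.\<close>

lemma lipschitz_spacetime_extension:
  fixes u :: "real \<Rightarrow> 'a::euclidean_space \<Rightarrow> real"
  assumes L: "\<And>t. t \<in> {0..T} \<Longrightarrow> L-lipschitz_on D (u t)"
    and c: "\<And>x. x \<in> D \<Longrightarrow> continuous_on {0..T} (\<lambda>t. u t x)"
  obtains U where "\<And>t x. t \<in> {0..T} \<Longrightarrow> x \<in> D \<Longrightarrow> U t x = u t x"
    "\<And>t. t \<in> {0..T} \<Longrightarrow> L-lipschitz_on (closure D) (U t)"
    "continuous_on ({0..T} \<times> closure D) (\<lambda>(t, x). U t x)"
proof -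
  have "\<forall>t. \<exists>g. t \<in> {0..T} \<longrightarrow> L-lipschitz_on (closure D) g \<and> (\<forall>x\<in>D. g x = u t x)"
    using lipschitz_extend_closure[OF L] by metis
  then obtain U where U: "\<And>t. t \<in> {0..T} \<Longrightarrow> L-lipschitz_on (closure D) (U t)" "\<And>t x. t \<in> {0..T} \<Longrightarrow> x \<in> D \<Longrightarrow> U t x = u t x"
    by metis
  have "continuous_on ({0..T} \<times> closure D) (\<lambda>(t, x). U t x)"
    unfolding continuous_on_iff
  proof (intro ballI allI impI)
    fix z :: "real \<times> 'a" and e :: real assume z: "z \<in> {0..T} \<times> closure D" and e: "0 < e"
    obtain t x where zt: "z = (t, x)" "t \<in> {0..T}" "x \<in> closure D" using z by auto
    have L0: "0 \<le> L" using lipschitz_on_nonneg[OF U(1)[OF zt(2)]] .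
    define d where "d = e / (4 * (L + 1))"
    have d: "0 < d" "L * d < e / 4"
    proof -
      show "0 < d" using e L0 by (simp add: d_def)
      then have "L * d < (L + 1) * d" by simp
      also have "\<dots> = e / 4" using L0 by (simp add: d_def field_simps)
      finally show "L * d < e / 4" .
    qed
    obtain y where y: "y \<in> D" "dist y x < d" using zt(3) d(1) closure_approachable by blast
    obtain d2 where d2: "d2 > 0" "\<And>s. s \<in> {0..T} \<Longrightarrow> dist s t < d2 \<Longrightarrow> dist (u s y) (u t y) < e / 4"
      using c[OF y(1)] zt(2) e unfolding continuous_on_iff by (metis divide_pos_pos zero_less_numeral)
    have yc: "y \<in> closure D" using y(1) closure_subset by blast
    have "dist (case z' of (t, x) \<Rightarrow> U t x) (case z of (t, x) \<Rightarrow> U t x) < e"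
      if z': "z' \<in> {0..T} \<times> closure D" "dist z' z < min d d2" for z'
    proof -
      obtain s w where zs: "z' = (s, w)" "s \<in> {0..T}" "w \<in> closure D" using z' by auto
      have dd: "dist s t < d2" "dist w x < d"
        using z'(2) dist_fst_le[of z' z] dist_snd_le[of z' z] by (auto simp: zs zt)
      have "dist (U s w) (U s x) \<le> L * dist w x" by (rule lipschitz_onD[OF U(1)[OF zs(2)] zs(3) zt(3)])
      also have "\<dots> \<le> L * d" using dd L0 by (intro mult_left_mono) auto
      finally have 1: "dist (U s w) (U s x) < e / 4" using d by linarith
      have "dist (U r x) (U r y) \<le> L * d" if "r \<in> {0..T}" for r
        using lipschitz_onD[OF U(1)[OF that] zt(3) yc] mult_left_mono[OF less_imp_le[OF y(2)] L0] by (simp add: dist_commute)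
      then have 2: "dist (U s x) (U s y) < e / 4" "dist (U t x) (U t y) < e / 4" using d zs zt by force+
      have 3: "dist (U s y) (U t y) < e / 4" using d2(2)[OF zs(2) dd(1)] U(2)[OF zs(2) y(1)] U(2)[OF zt(2) y(1)] by simp
      show ?thesis using 1 2 3 unfolding zs zt prod.case dist_real_def by arith
    qed
    then show "\<exists>d>0. \<forall>x'\<in>{0..T} \<times> closure D. dist x' z < d \<longrightarrow> dist (case x' of (t, x) \<Rightarrow> U t x) (case z of (t, x) \<Rightarrow> U t x) < e"
      using d(1) d2(1) by (intro exI[of _ "min d d2"]) auto
  qed
  then show thesis using that U by blast
qed

text \<open>Controls the effect of different times at the maximum point, uniformly in the other
  arguments.\<close>

lemma uniform_time_modulus:
  fixes h :: "real \<times> 'a::metric_space \<Rightarrow> 'b::metric_space"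
  assumes K: "compact K" and h: "continuous_on ({0..T} \<times> K) h" and \<epsilon>: "0 < \<epsilon>"
  obtains d where "0 < d" "\<And>t s k. t \<in> {0..T} \<Longrightarrow> s \<in> {0..T} \<Longrightarrow> k \<in> K \<Longrightarrow> \<bar>t - s\<bar> < d \<Longrightarrow> dist (h (t, k)) (h (s, k)) < \<epsilon>"
proof -
  have "uniformly_continuous_on ({0..T} \<times> K) h"
    by (intro compact_uniformly_continuous h compact_Times compact_Icc K)
  then obtain d where d: "d > 0" "\<And>x x'. x \<in> {0..T} \<times> K \<Longrightarrow> x' \<in> {0..T} \<times> K \<Longrightarrow> dist x' x < d \<Longrightarrow> dist (h x') (h x) < \<epsilon>"
    using \<epsilon> unfolding uniformly_continuous_on_def by metis
  show thesis
  proof (rule that[OF d(1)])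
    fix t s k assume "t \<in> {0..T}" "s \<in> {0..T}" "k \<in> K" "\<bar>t - s\<bar> < d"
    then show "dist (h (t, k)) (h (s, k)) < \<epsilon>" by (intro d(2)) (auto simp: dist_Pair_Pair dist_real_def)
  qed
qed

section \<open>Bounds for the first-order terms\<close>

lemma norm_square_sum_rows:
  fixes A :: "real^'d^'n"
  shows "(norm A)\<^sup>2 = (\<Sum>i\<in>UNIV. \<Sum>k\<in>UNIV. (A $ i $ k)\<^sup>2)"
  unfolding power2_norm_eq_inner by (simp add: inner_vec_def power2_eq_square)

lemma sum_norm_column_square:
  fixes A :: "real^'d^'n"
  shows "(\<Sum>k\<in>UNIV. (norm (column k A))\<^sup>2) = (norm A)\<^sup>2"
proof -
  have "(norm (column k A))\<^sup>2 = (\<Sum>i\<in>UNIV. (A $ i $ k)\<^sup>2)" for k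
    unfolding power2_norm_eq_inner by (simp add: inner_vec_def column_def power2_eq_square)
  then show ?thesis unfolding norm_square_sum_rows by (simp add: sum.swap[of "\<lambda>k i. (A $ i $ k)\<^sup>2"])
qed

lemma norm_vector_matrix_mult_le:
  fixes A :: "real^'d^'n"
  shows "norm (q v* A) \<le> norm q * norm A"
proof (rule power2_le_imp_le)
  have "(norm (q v* A))\<^sup>2 = (\<Sum>k\<in>UNIV. (column k A \<bullet> q)\<^sup>2)"
    unfolding power2_norm_eq_inner by (simp add: inner_vec_def vector_matrix_mult_def column_def power2_eq_square mult.commute)
  also have "\<dots> \<le> (\<Sum>k\<in>UNIV. (norm (column k A))\<^sup>2 * (norm q)\<^sup>2)"
  proof (rule sum_mono)
    fix k :: 'd
    have "\<bar>column k A \<bullet> q\<bar>\<^sup>2 \<le> (norm (column k A) * norm q)\<^sup>2" by (intro power_mono Cauchy_Schwarz_ineq2) auto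
    then show "(column k A \<bullet> q)\<^sup>2 \<le> (norm (column k A))\<^sup>2 * (norm q)\<^sup>2" by (simp add: power_mult_distrib)
  qed
  also have "\<dots> = (norm q * norm A)\<^sup>2"
    by (simp add: sum_distrib_right[symmetric] sum_norm_column_square power_mult_distrib)
  finally show "(norm (q v* A))\<^sup>2 \<le> (norm q * norm A)\<^sup>2" .
qed simp

text \<open>Bounds a weight gradient times a coefficient of linear growth by the weight
  itself.\<close>

lemma norm_mult_one_plus_norm_le: "r * (1 + r) \<le> 2 * (1 + r\<^sup>2)" for r :: real
proof -
  have "0 \<le> (r - 1)\<^sup>2" by simp
  also have "(r - 1)\<^sup>2 = r\<^sup>2 - 2 * r + 1" by (simp add: power2_diff)
  finally have "r \<le> r\<^sup>2 + 2" using zero_le_power2[of r] by linarith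
  moreover have e: "r * (1 + r) = r + r\<^sup>2" by (simp add: distrib_left power2_eq_square)
  ultimately show ?thesis unfolding e by simp
qed

text \<open>The constant in front of the weights \<open>w1, w2\<close>
  does not involve \<open>R\<close> or \<open>\<Gamma>\<close>; this uses that the gradients \<open>m e |x|\<close> of the weights are bounded by \<open>L3\<close>.\<close>

lemma gradient_terms_estimate:
  fixes x y a G1 G2 b1 b2 :: "real^'n" and s1 s2 :: "real^'d^'n"
  assumes nn: "0 \<le> La" "0 \<le> S0" "0 \<le> B0" "0 \<le> Lb" "0 \<le> \<epsilon>1" "0 < m" "0 \<le> e1" "0 \<le> e2" "0 \<le> L3"
    and w: "w1 = e1 * (1 + (norm x)\<^sup>2)" "w2 = e2 * (1 + (norm y)\<^sup>2)"
    and q: "q1 = a + (m * e1) *\<^sub>R x + G1" "q2 = a - (m * e2) *\<^sub>R y - G2" and a: "norm a \<le> La"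
    and s: "norm s1 \<le> S0 * (1 + norm x)" "norm s2 \<le> S0 * (1 + norm y)" "norm (s1 - s2) \<le> \<epsilon>1"
    and z: "z1 = q1 v* s1" "z2 = q2 v* s2"
    and b: "norm b1 \<le> B0 * (1 + norm x + norm z1)" "norm b2 \<le> B0 * (1 + norm y + norm z2)"
    and db: "norm (b1 - b2) \<le> Lb * (\<epsilon>2 + 2 * m * w1 + norm (z1 - z2))" and df: "f1 - f2 \<le> Lb * (\<epsilon>2 + 2 * m * w1 + norm (z1 - z2))"
    and L3: "m * e1 * norm x \<le> L3" "m * e2 * norm y \<le> L3" and R: "norm x \<le> R" "norm y \<le> R"
    and G: "norm G1 \<le> \<Gamma>" "norm G2 \<le> \<Gamma>"
  defines "X \<equiv> (La + 1) * Lb * S0 * (1 + R) + B0 * S0 * (1 + R) * L3 + B0 * (1 + R) * (1 + (La + L3 + \<Gamma>) * S0)"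
  shows "b1 \<bullet> q1 - b2 \<bullet> q2 + (f1 - f2) \<le> ((La + 1) * Lb * (2 + 2 * S0) + 2 * B0 * (1 + (La + L3) * S0)) * m * (w1 + w2)
     + X * (norm G1 + norm G2) + (La + 1) * Lb * (\<epsilon>2 + La * \<epsilon>1)"
proof -
  have R0: "0 \<le> R" using R(1) norm_ge_zero[of x] by linarith
  have \<Gamma>0: "0 \<le> \<Gamma>" using G(1) norm_ge_zero[of G1] by linarith
  have w0: "0 \<le> w1" "0 \<le> w2" using nn by (auto simp: w)
  have mw: "m * e * norm v * (S * (1 + norm v)) \<le> 2 * S * (m * (e * (1 + (norm v)\<^sup>2)))" if "0 \<le> e" "0 \<le> S" for e S and v :: "real^'n"
    using mult_left_mono[OF norm_mult_one_plus_norm_le[of "norm v"], of "m * e * S"] that nn by (simp add: mult_ac)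
  have sR: "S0 * (1 + norm v) \<le> S0 * (1 + R)" if "norm v \<le> R" for v :: "real^'n" using that nn by (intro mult_left_mono) auto
  have G0: "0 \<le> norm G1" "0 \<le> norm G2" by simp_all
  have v1: "norm ((m * e1) *\<^sub>R x) = m * e1 * norm x" "norm ((m * e2) *\<^sub>R y) = m * e2 * norm y" using nn by simp_all
  \<comment> \<open>Only the common part \<open>a\<close> of the two gradients meets the difference
    \<open>s1 - s2\<close>. The weight gradients give multiples of the weights, and the barrier
    gradients are kept as a separate term.\<close>
  have zz: "norm (z1 - z2) \<le> La * \<epsilon>1 + 2 * S0 * (m * w1) + 2 * S0 * (m * w2) + S0 * (1 + R) * (norm G1 + norm G2)"
  proof -
    have "z1 - z2 = a v* (s1 - s2) + ((m * e1) *\<^sub>R x) v* s1 + G1 v* s1 + ((m * e2) *\<^sub>R y) v* s2 + G2 v* s2"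
      unfolding z q by (simp add: vector_matrix_mult_def vec_eq_iff sum.distrib sum_subtractf algebra_simps)
    also have "norm \<dots> \<le> norm (a v* (s1 - s2)) + norm (((m * e1) *\<^sub>R x) v* s1) + norm (G1 v* s1) + norm (((m * e2) *\<^sub>R y) v* s2) + norm (G2 v* s2)"
      by (intro norm_triangle_le add_mono order_refl)
    also have "\<dots> \<le> La * \<epsilon>1 + m * e1 * norm x * (S0 * (1 + norm x)) + norm G1 * (S0 * (1 + R)) + m * e2 * norm y * (S0 * (1 + norm y)) + norm G2 * (S0 * (1 + R))"
    proof (intro add_mono)
      show "norm (a v* (s1 - s2)) \<le> La * \<epsilon>1" by (rule order_trans[OF norm_vector_matrix_mult_le mult_mono[OF a s(3)]]) (use nn in auto)
      show "norm (((m * e1) *\<^sub>R x) v* s1) \<le> m * e1 * norm x * (S0 * (1 + norm x))"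
        by (rule order_trans[OF norm_vector_matrix_mult_le], unfold v1, rule mult_left_mono[OF s(1)]) (use nn in auto)
      show "norm (((m * e2) *\<^sub>R y) v* s2) \<le> m * e2 * norm y * (S0 * (1 + norm y))"
        by (rule order_trans[OF norm_vector_matrix_mult_le], unfold v1, rule mult_left_mono[OF s(2)]) (use nn in auto)
      show "norm (G1 v* s1) \<le> norm G1 * (S0 * (1 + R))"
        by (rule order_trans[OF norm_vector_matrix_mult_le], rule mult_left_mono[OF order_trans[OF s(1) sR[OF R(1)]]]) simp
      show "norm (G2 v* s2) \<le> norm G2 * (S0 * (1 + R))"
        by (rule order_trans[OF norm_vector_matrix_mult_le], rule mult_left_mono[OF order_trans[OF s(2) sR[OF R(2)]]]) simp
    qed
    also have "\<dots> \<le> La * \<epsilon>1 + 2 * S0 * (m * w1) + norm G1 * (S0 * (1 + R)) + 2 * S0 * (m * w2) + norm G2 * (S0 * (1 + R))"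
      using mw[OF nn(7) nn(2), of x] mw[OF nn(8) nn(2), of y] by (simp add: w)
    finally show ?thesis by (simp add: algebra_simps)
  qed
  define Df where "Df = \<epsilon>2 + 2 * m * w1 + norm (z1 - z2)"
  have Df: "Df \<le> (\<epsilon>2 + La * \<epsilon>1) + (2 + 2 * S0) * m * (w1 + w2) + S0 * (1 + R) * (norm G1 + norm G2)"
  proof -
    have "0 \<le> m * w2" using nn w0 by simp
    then show ?thesis using zz by (simp add: Df_def algebra_simps)
  qed
  have main1: "(b1 - b2) \<bullet> a + (f1 - f2) \<le> (La + 1) * Lb * Df"
  proof -
    have "(b1 - b2) \<bullet> a \<le> norm (b1 - b2) * norm a" by (rule norm_cauchy_schwarz)
    also have "\<dots> \<le> (Lb * Df) * La"
      using db a by (intro mult_mono) (auto simp: Df_def intro: order_trans[OF norm_ge_zero])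
    finally show ?thesis using df by (simp add: Df_def algebra_simps)
  qed
  \<comment> \<open>The drift grows linearly in \<open>z\<close>, which is the gradient times a
    linearly growing matrix, so its product with the gradient is a priori of third order in
    \<open>|v|\<close>; the bound \<open>m * e * norm v \<le> L3\<close> on one factor reduces it to
    the weight.\<close>
  have half: "bb \<bullet> ((m * e) *\<^sub>R v + G) \<le> 2 * B0 * (1 + (La + L3) * S0) * (m * (e * (1 + (norm v)\<^sup>2)))
      + (B0 * S0 * (1 + R) * L3 + B0 * (1 + R) * (1 + (La + L3 + \<Gamma>) * S0)) * norm G"
    if e: "0 \<le> e" and bb: "norm bb \<le> B0 * (1 + norm v + norm zz)" and zzb: "norm zz \<le> (La + L3 + norm G) * (S0 * (1 + norm v))"
      and vR: "norm v \<le> R" and vL: "m * e * norm v \<le> L3" and GG: "norm G \<le> \<Gamma>" for bb v G :: "real^'n" and e and zz :: "real^'d"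
  proof -
    define n where "n = norm v" define g where "g = norm G"
    have n: "0 \<le> n" "n \<le> R" "0 \<le> g" "g \<le> \<Gamma>" using vR GG by (auto simp: n_def g_def)
    have bn: "norm bb \<le> B0 * (1 + (La + L3 + g) * S0) * (1 + n)"
    proof -
      have "B0 * (1 + norm v + norm zz) \<le> B0 * (1 + n + (La + L3 + g) * (S0 * (1 + n)))" using zzb nn by (intro mult_left_mono) (auto simp: n_def g_def)
      then show ?thesis using bb by (simp add: algebra_simps)
    qed
    have "bb \<bullet> ((m * e) *\<^sub>R v + G) \<le> norm bb * (m * e * n + g)"
    proof -
      have "bb \<bullet> ((m * e) *\<^sub>R v + G) \<le> norm bb * norm ((m * e) *\<^sub>R v + G)" by (rule norm_cauchy_schwarz)
      also have "\<dots> \<le> norm bb * (m * e * n + g)"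
        using norm_triangle_ineq[of "(m * e) *\<^sub>R v" G] e nn by (intro mult_left_mono) (auto simp: n_def g_def)
      finally show ?thesis .
    qed
    also have "\<dots> \<le> (B0 * (1 + (La + L3 + g) * S0) * (1 + n)) * (m * e * n + g)"
      using bn e nn n by (intro mult_right_mono) auto
    also have "\<dots> = B0 * (1 + (La + L3) * S0) * (m * e * n * (1 * (1 + n))) + B0 * S0 * (1 + n) * (m * e * n) * g + B0 * (1 + n) * (1 + (La + L3 + g) * S0) * g"
      by (simp add: algebra_simps)
    also have "\<dots> \<le> B0 * (1 + (La + L3) * S0) * (2 * 1 * (m * (e * (1 + n\<^sup>2)))) + B0 * S0 * (1 + R) * L3 * g + B0 * (1 + R) * (1 + (La + L3 + \<Gamma>) * S0) * g"
    proof (intro add_mono mult_right_mono mult_left_mono)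
      show "m * e * n * (1 * (1 + n)) \<le> 2 * 1 * (m * (e * (1 + n\<^sup>2)))" unfolding n_def by (rule mw[OF e]) simp
      show "B0 * S0 * (1 + n) * (m * e * n) \<le> B0 * S0 * (1 + R) * L3"
        using nn n vL e R0 by (intro mult_mono) (auto simp: n_def)
      show "B0 * (1 + n) * (1 + (La + L3 + g) * S0) \<le> B0 * (1 + R) * (1 + (La + L3 + \<Gamma>) * S0)"
        using nn n R0 by (intro mult_mono add_mono mult_right_mono) auto
    qed (use nn n in auto)
    finally show ?thesis by (simp add: n_def g_def algebra_simps)
  qed
  have q1n: "norm q1 \<le> La + L3 + norm G1" 
    unfolding q using norm_triangle_ineq[of "a + (m * e1) *\<^sub>R x" G1] norm_triangle_ineq[of a "(m * e1) *\<^sub>R x"] a L3(1) unfolding v1 by linarith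
  have q2n: "norm q2 \<le> La + L3 + norm G2"
    unfolding q using norm_triangle_ineq4[of "a - (m * e2) *\<^sub>R y" G2] norm_triangle_ineq4[of a "(m * e2) *\<^sub>R y"] a L3(2) unfolding v1 by linarith
  have z1n: "norm z1 \<le> (La + L3 + norm G1) * (S0 * (1 + norm x))"
    unfolding z by (rule order_trans[OF norm_vector_matrix_mult_le mult_mono[OF q1n s(1)]]) (use nn in auto)
  have z2n: "norm z2 \<le> (La + L3 + norm G2) * (S0 * (1 + norm y))"
    unfolding z by (rule order_trans[OF norm_vector_matrix_mult_le mult_mono[OF q2n s(2)]]) (use nn in auto)
  note h1 = half[OF nn(7) b(1) z1n R(1) L3(1) G(1)] and h2 = half[OF nn(8) b(2) z2n R(2) L3(2) G(2)]
  have "b1 \<bullet> q1 - b2 \<bullet> q2 + (f1 - f2) = ((b1 - b2) \<bullet> a + (f1 - f2)) + b1 \<bullet> ((m * e1) *\<^sub>R x + G1) + b2 \<bullet> ((m * e2) *\<^sub>R y + G2)"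
    unfolding q by (simp add: inner_diff_left inner_diff_right inner_add_right)
  also have "\<dots> \<le> (La + 1) * Lb * ((\<epsilon>2 + La * \<epsilon>1) + (2 + 2 * S0) * m * (w1 + w2) + S0 * (1 + R) * (norm G1 + norm G2))
     + (2 * B0 * (1 + (La + L3) * S0) * (m * w1) + (B0 * S0 * (1 + R) * L3 + B0 * (1 + R) * (1 + (La + L3 + \<Gamma>) * S0)) * norm G1)
     + (2 * B0 * (1 + (La + L3) * S0) * (m * w2) + (B0 * S0 * (1 + R) * L3 + B0 * (1 + R) * (1 + (La + L3 + \<Gamma>) * S0)) * norm G2)"
  proof (intro add_mono)
    show "(b1 - b2) \<bullet> a + (f1 - f2) \<le> (La + 1) * Lb * ((\<epsilon>2 + La * \<epsilon>1) + (2 + 2 * S0) * m * (w1 + w2) + S0 * (1 + R) * (norm G1 + norm G2))"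
      by (rule order_trans[OF main1 mult_left_mono[OF Df]]) (use nn in auto)
  qed (use h1 h2 in \<open>auto simp: w\<close>)
  also have "\<dots> = ((La + 1) * Lb * (2 + 2 * S0) + 2 * B0 * (1 + (La + L3) * S0)) * m * (w1 + w2)
     + X * (norm G1 + norm G2) + (La + 1) * Lb * (\<epsilon>2 + La * \<epsilon>1)"
    unfolding X_def by (simp add: distrib_left distrib_right mult_ac)
  finally show ?thesis .
qed

section \<open>Expansion of the weight\<close>

lemma exp_quadratic_upper: "exp y \<le> 1 + y + y\<^sup>2 * exp \<bar>y\<bar>" for y :: real
proof (cases "0 \<le> y")
  case True
  have "exp y - 1 \<le> y * exp y"
  proof -
    have "(1 - y) * exp y \<le> exp (- y) * exp y" using exp_ge_add_one_self[of "- y"] by (intro mult_right_mono) auto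
    also have "\<dots> = 1" by (simp add: exp_minus)
    finally show ?thesis by (simp add: algebra_simps)
  qed
  moreover have "y * (exp y - 1) \<le> y * (y * exp y)" using calculation True by (intro mult_left_mono) auto
  moreover have "exp y - 1 - y \<le> y * (exp y - 1)"
  proof -
    have "(1 - y) * exp y \<le> 1" using \<open>exp y - 1 \<le> y * exp y\<close> by (simp add: algebra_simps)
    then show ?thesis by (simp add: algebra_simps)
  qed
  ultimately show ?thesis using True by (simp add: power2_eq_square algebra_simps)
next
  case False
  define z where "z = - y"
  have z: "0 < z" using False by (simp add: z_def)
  have "exp (- z) * (1 + z) \<le> exp (- z) * exp z" using exp_ge_add_one_self[of z] by (intro mult_left_mono) (auto simp: add.commute)
  also have "\<dots> = 1" by (simp add: exp_minus)
  also have "1 \<le> (1 - z + z\<^sup>2) * (1 + z)" using z by (simp add: algebra_simps power2_eq_square)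
  finally have "exp (- z) \<le> 1 - z + z\<^sup>2" using z by (simp add: mult_le_cancel_right)
  moreover have "z\<^sup>2 * 1 \<le> z\<^sup>2 * exp z" using z by (intro mult_left_mono) auto
  ultimately have "exp (- z) \<le> 1 + (- z) + (- z)\<^sup>2 * exp \<bar>- z\<bar>"
    unfolding power2_minus abs_minus_cancel abs_of_pos[OF z] by linarith
  then show ?thesis by (simp add: z_def)
qed

text \<open>The mixed space-time term is split by Young's inequality: its spatial part is paid by
  the extra \<open>1\<close> in the coefficient of \<open>(norm h)\<^sup>2\<close>, its temporal
  part by \<open>C\<close>. \<open>C\<close> may depend on \<open>lam\<close> and \<open>R\<close>,
  since second-order terms in time leave no trace in the doubling inequality.\<close>

lemma weight_expansion:
  fixes T lam R :: real
  assumes T: "0 \<le> T" and lam: "0 \<le> lam" and R: "1 \<le> R"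
  obtains C where "0 \<le> C" "\<And>t s (x::'a::real_inner) h. t \<in> {0..T} \<Longrightarrow> s \<in> {0..T} \<Longrightarrow> norm x \<le> R \<Longrightarrow> norm h \<le> 1 \<Longrightarrow>
     exp (lam * (T - s)) * (1 + (norm (x + h))\<^sup>2) \<le> exp (lam * (T - t)) * (1 + (norm x)\<^sup>2) - lam * (exp (lam * (T - t)) * (1 + (norm x)\<^sup>2)) * (s - t)
       + 2 * exp (lam * (T - t)) * (x \<bullet> h) + (exp (lam * (T - t)) + 1) * (norm h)\<^sup>2 + C * (s - t)\<^sup>2"
proof -
  define E where "E = exp (lam * T)"
  have E: "1 \<le> E" using T lam by (simp add: E_def)
  define C where "C = E * (lam\<^sup>2 * E) * (1 + R\<^sup>2) + 3 * R\<^sup>2 * lam\<^sup>2 * E\<^sup>2"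
  have C: "0 \<le> C" using E lam R by (simp add: C_def)
  have "exp (lam * (T - s)) * (1 + (norm (x + h))\<^sup>2) \<le> exp (lam * (T - t)) * (1 + (norm x)\<^sup>2) - lam * (exp (lam * (T - t)) * (1 + (norm x)\<^sup>2)) * (s - t)
       + 2 * exp (lam * (T - t)) * (x \<bullet> h) + (exp (lam * (T - t)) + 1) * (norm h)\<^sup>2 + C * (s - t)\<^sup>2"
    if t: "t \<in> {0..T}" and s: "s \<in> {0..T}" and x: "norm x \<le> R" and h: "norm h \<le> 1" for t s and x h :: 'a
  proof -
    define e where "e = exp (lam * (T - t))"
    define e' where "e' = exp (lam * (T - s))"
    define d where "d = s - t"
    have eE: "0 < e" "e \<le> E" "0 < e'" "e' \<le> E" using t s lam by (auto simp: e_def e'_def E_def intro!: mult_left_mono)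
    have ee: "e' = e * exp (- lam * d)" "e = e' * exp (lam * d)"
      unfolding e_def e'_def d_def exp_add[symmetric] by (simp_all add: algebra_simps)
    have dT: "\<bar>d\<bar> \<le> T" using t s by (auto simp: d_def)
    have ab: "\<bar>lam * d\<bar> \<le> lam * T" using lam dT by (simp add: abs_mult mult_left_mono)
    have x2: "(norm x)\<^sup>2 \<le> R\<^sup>2" using x by (intro power_mono) auto
    have 1: "e' * (1 + (norm x)\<^sup>2) \<le> e * (1 + (norm x)\<^sup>2) - lam * (e * (1 + (norm x)\<^sup>2)) * d + E * (lam\<^sup>2 * E) * (1 + R\<^sup>2) * d\<^sup>2"
    proof -
      have "exp (- lam * d) \<le> 1 - lam * d + (lam * d)\<^sup>2 * exp \<bar>lam * d\<bar>" using exp_quadratic_upper[of "- lam * d"] by simp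
      also have "\<dots> \<le> 1 - lam * d + (lam * d)\<^sup>2 * E" using ab by (intro add_left_mono mult_left_mono) (auto simp: E_def)
      finally have "e' \<le> e * (1 - lam * d + (lam * d)\<^sup>2 * E)" unfolding ee(1) using eE by (intro mult_left_mono) auto
      then have "e' * (1 + (norm x)\<^sup>2) \<le> e * (1 - lam * d + (lam * d)\<^sup>2 * E) * (1 + (norm x)\<^sup>2)" by (intro mult_right_mono) auto
      also have "\<dots> = e * (1 + (norm x)\<^sup>2) - lam * (e * (1 + (norm x)\<^sup>2)) * d + e * (lam\<^sup>2 * E) * (1 + (norm x)\<^sup>2) * d\<^sup>2"
        by (simp add: algebra_simps power2_eq_square)
      also have "e * (lam\<^sup>2 * E) * (1 + (norm x)\<^sup>2) * d\<^sup>2 \<le> E * (lam\<^sup>2 * E) * (1 + R\<^sup>2) * d\<^sup>2"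
        using eE E x2 by (intro mult_right_mono mult_mono) auto
      finally show ?thesis by simp
    qed
    have de: "\<bar>e' - e\<bar> \<le> lam * E * \<bar>d\<bar>"
    proof -
      have "e' * (1 + lam * d) \<le> e" unfolding ee(2) using eE exp_ge_add_one_self[of "lam * d"] by (intro mult_left_mono) (auto simp: add.commute)
      then have a: "e' - e \<le> e' * (lam * (- d))" by (simp add: algebra_simps)
      have "e * (1 - lam * d) \<le> e'" unfolding ee(1) using eE exp_ge_add_one_self[of "- lam * d"] by (intro mult_left_mono) (auto simp: add.commute)
      then have b: "e - e' \<le> e * (lam * d)" by (simp add: algebra_simps)
      have "c * (lam * r) \<le> E * (lam * \<bar>d\<bar>)" if "0 < c" "c \<le> E" "r \<le> \<bar>d\<bar>" for c r
      proof -
        have "c * (lam * r) \<le> c * (lam * \<bar>d\<bar>)" using that lam by (intro mult_left_mono) auto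
        also have "\<dots> \<le> E * (lam * \<bar>d\<bar>)" using that lam by (intro mult_right_mono) auto
        finally show ?thesis .
      qed
      from this[of e' "- d"] this[of e d]
      have "e' * (lam * (- d)) \<le> E * (lam * \<bar>d\<bar>)" "e * (lam * d) \<le> E * (lam * \<bar>d\<bar>)" using eE by auto
      then show ?thesis using a b by (simp add: mult_ac)
    qed
    have h2: "(norm h)\<^sup>2 \<le> norm h" using h mult_left_mono[of "norm h" 1 "norm h"] by (simp add: power2_eq_square)
    have 2: "(e' - e) * (2 * (x \<bullet> h) + (norm h)\<^sup>2) \<le> (norm h)\<^sup>2 + 3 * R\<^sup>2 * lam\<^sup>2 * E\<^sup>2 * d\<^sup>2"
    proof -
      define n where "n = norm h"
      have "\<bar>x \<bullet> h\<bar> \<le> norm x * n" unfolding n_def by (rule Cauchy_Schwarz_ineq2)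
      also have "\<dots> \<le> R * n" using x by (intro mult_right_mono) (auto simp: n_def)
      finally have xh: "\<bar>x \<bullet> h\<bar> \<le> R * n" .
      have "\<bar>2 * (x \<bullet> h) + (norm h)\<^sup>2\<bar> \<le> 2 * (R * n) + n"
        using h2 abs_le_D1[OF xh] abs_le_D2[OF xh] zero_le_power2[of "norm h"] unfolding n_def by (intro abs_leI) linarith+
      also have "\<dots> \<le> 3 * (R * n)" using R mult_right_mono[of 1 R n] by (simp add: n_def)
      finally have "\<bar>e' - e\<bar> * \<bar>2 * (x \<bullet> h) + (norm h)\<^sup>2\<bar> \<le> (lam * E * \<bar>d\<bar>) * (3 * (R * n))" using de by (intro mult_mono) auto
      also have "\<dots> = 2 * n * ((3/2) * (R * (lam * E * \<bar>d\<bar>)))" by simp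
      also have "\<dots> \<le> n\<^sup>2 + ((3/2) * (R * (lam * E * \<bar>d\<bar>)))\<^sup>2" by (rule sum_squares_bound)
      also have "((3/2) * (R * (lam * E * \<bar>d\<bar>)))\<^sup>2 = (9/4) * (R\<^sup>2 * lam\<^sup>2 * E\<^sup>2 * d\<^sup>2)" by (simp add: power_mult_distrib power_divide)
      also have "\<dots> \<le> 3 * (R\<^sup>2 * lam\<^sup>2 * E\<^sup>2 * d\<^sup>2)" by (intro mult_right_mono) auto
      finally have "\<bar>(e' - e) * (2 * (x \<bullet> h) + (norm h)\<^sup>2)\<bar> \<le> n\<^sup>2 + 3 * (R\<^sup>2 * lam\<^sup>2 * E\<^sup>2 * d\<^sup>2)" by (simp add: abs_mult)
      then show ?thesis by (simp add: n_def)
    qed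
    have "(norm (x + h))\<^sup>2 = (norm x)\<^sup>2 + 2 * (x \<bullet> h) + (norm h)\<^sup>2" using norm_add_scaleR_square[of x 1 h] by simp
    then have "e' * (1 + (norm (x + h))\<^sup>2) = e' * (1 + (norm x)\<^sup>2) + e * (2 * (x \<bullet> h) + (norm h)\<^sup>2) + (e' - e) * (2 * (x \<bullet> h) + (norm h)\<^sup>2)"
      by (simp add: algebra_simps)
    also have "\<dots> \<le> e * (1 + (norm x)\<^sup>2) - lam * (e * (1 + (norm x)\<^sup>2)) * d + 2 * e * (x \<bullet> h) + (e + 1) * (norm h)\<^sup>2 + C * d\<^sup>2"
      using 1 2 unfolding C_def by (simp add: algebra_simps)
    finally show ?thesis unfolding e_def e'_def d_def .
  qed
  then show thesis using that C by blast
qed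

context convex_potential
begin

section \<open>Coercivity and the balance with the barrier\<close>

text \<open>Test the subgradient inequality at the vector of norm \<open>\<rho>\<close> in the
  direction of \<open>\<xi>\<close>: there \<open>\<psi>\<close> is at most \<open>C\<close>, and at
  \<open>x\<close> it is nonnegative.\<close>

lemma subgradient_coercive:
  assumes \<rho>: "0 < \<rho>" "\<And>x. norm x \<le> 2 * \<rho> \<Longrightarrow> \<psi> x \<le> ereal C" and \<xi>: "\<xi> \<in> subdifferential \<psi> x"
  shows "\<rho> * norm \<xi> - C \<le> \<xi> \<bullet> x"
proof -
  define y where "y = (if \<xi> = 0 then 0 else (\<rho> / norm \<xi>) *\<^sub>R \<xi>)"
  have y: "norm y \<le> \<rho>" "\<xi> \<bullet> y = \<rho> * norm \<xi>" using \<rho>(1) by (auto simp: y_def dot_square_norm power2_eq_square)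
  obtain p where p: "\<psi> x = ereal p" "0 \<le> p" using finiteE[OF subdifferential_finite[OF \<xi>]] by blast
  have "\<psi> x + ereal (\<xi> \<bullet> (y - x)) \<le> \<psi> y" using \<xi> unfolding subdifferential_def by blast
  also have "\<dots> \<le> ereal C" using y \<rho> by simp
  finally show ?thesis using p y by (simp add: inner_diff_right)
qed

lemma subdifferential_monotone:
  assumes "\<xi> \<in> subdifferential \<psi> x" "\<eta> \<in> subdifferential \<psi> y"
  shows "0 \<le> (\<xi> - \<eta>) \<bullet> (x - y)"
proof -
  obtain p where p: "\<psi> x = ereal p" using finiteE[OF subdifferential_finite[OF assms(1)]] by blast
  obtain q where q: "\<psi> y = ereal q" using finiteE[OF subdifferential_finite[OF assms(2)]] by blast
  have "\<psi> x + ereal (\<xi> \<bullet> (y - x)) \<le> \<psi> y" "\<psi> y + ereal (\<eta> \<bullet> (x - y)) \<le> \<psi> x"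
    using assms unfolding subdifferential_def by blast+
  then show ?thesis using p q by (simp add: inner_diff_left inner_diff_right)
qed

text \<open>The weight gradient gains \<open>m \<rho> |\<xi>|\<close>. A quarter of it pays for the
  barrier, by \<open>8 * (K * \<omega>) \<le> m * \<rho>\<close>; a quarter pays for all
  perturbations; the remaining half yields \<open>(m * \<rho> / 4) * \<kappa>1\<close>, since
  \<open>\<kappa>1 \<le> 2 |\<xi>|\<close>. The same holds at the second point. The term in
  \<open>\<alpha>\<close> is nonnegative up to perturbations, by monotonicity.\<close>

lemma penalized_subgradient_bound:
  assumes \<rho>: "0 < \<rho>" "0 \<le> C" "\<And>x. norm x \<le> 2 * \<rho> \<Longrightarrow> \<psi> x \<le> ereal C"
    and m: "0 < m" "1 \<le> e1" "1 \<le> e2" "0 \<le> \<alpha>" and \<omega>: "8 * (K * \<omega>) \<le> m * \<rho>" "0 \<le> K * \<omega>"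
    and G1: "\<And>\<epsilon>. 0 < \<epsilon> \<Longrightarrow> \<forall>\<^sub>F x in nhds x1. \<forall>\<xi>\<in>subdifferential \<psi> x. \<kappa>1 \<le> 2 * norm \<xi> \<and> - (K * \<omega> * \<kappa>1) - \<epsilon> * (1 + norm \<xi>) \<le> \<xi> \<bullet> G1"
    and G2: "\<And>\<epsilon>. 0 < \<epsilon> \<Longrightarrow> \<forall>\<^sub>F x in nhds x2. \<forall>\<xi>\<in>subdifferential \<psi> x. \<kappa>2 \<le> 2 * norm \<xi> \<and> - (K * \<omega> * \<kappa>2) - \<epsilon> * (1 + norm \<xi>) \<le> \<xi> \<bullet> G2"
    and q: "q1 = \<alpha> *\<^sub>R (x1 - x2) + (m * e1) *\<^sub>R x1 + G1" "q2 = \<alpha> *\<^sub>R (x1 - x2) - (m * e2) *\<^sub>R x2 - G2"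
  obtains \<delta> where "0 < \<delta>" "\<And>x' q' \<xi> y' r' \<eta>. dist x' x1 < \<delta> \<Longrightarrow> dist q' q1 < \<delta> \<Longrightarrow> \<xi> \<in> subdifferential \<psi> x' \<Longrightarrow>
        dist y' x2 < \<delta> \<Longrightarrow> dist r' (- q2) < \<delta> \<Longrightarrow> \<eta> \<in> subdifferential \<psi> y' \<Longrightarrow>
        (m * \<rho> / 4) * (\<kappa>1 + \<kappa>2) - m * (C + 1) * (e1 + e2) \<le> \<xi> \<bullet> q' + \<eta> \<bullet> r'"
proof -
  \<comment> \<open>Bounds the coefficient of \<open>\<epsilon> |\<xi>|\<close> accumulated by
    perturbing points, gradients and the barrier estimate.\<close>
  define Q where "Q = 2 * \<alpha> + m * e1 + m * e2 + 2"
  have Q: "2 \<le> Q" using m by (simp add: Q_def)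
  define \<epsilon> where "\<epsilon> = min m (m * \<rho> / (4 * Q))"
  have \<epsilon>: "0 < \<epsilon>" "\<epsilon> \<le> m" "\<epsilon> * Q \<le> m * \<rho> / 4"
  proof -
    show "0 < \<epsilon>" using m \<rho> Q by (simp add: \<epsilon>_def)
    have "\<epsilon> * Q \<le> (m * \<rho> / (4 * Q)) * Q" using Q by (intro mult_right_mono) (auto simp: \<epsilon>_def)
    also have "\<dots> = m * \<rho> / 4" using Q by simp
    finally show "\<epsilon> * Q \<le> m * \<rho> / 4" .
  qed (simp add: \<epsilon>_def)
  obtain d1 where d1: "d1 > 0" "\<And>x \<xi>. dist x x1 < d1 \<Longrightarrow> \<xi> \<in> subdifferential \<psi> x \<Longrightarrow> \<kappa>1 \<le> 2 * norm \<xi> \<and> - (K * \<omega> * \<kappa>1) - \<epsilon> * (1 + norm \<xi>) \<le> \<xi> \<bullet> G1"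
    using G1[OF \<epsilon>(1)] unfolding eventually_nhds_metric by blast
  obtain d2 where d2: "d2 > 0" "\<And>x \<xi>. dist x x2 < d2 \<Longrightarrow> \<xi> \<in> subdifferential \<psi> x \<Longrightarrow> \<kappa>2 \<le> 2 * norm \<xi> \<and> - (K * \<omega> * \<kappa>2) - \<epsilon> * (1 + norm \<xi>) \<le> \<xi> \<bullet> G2"
    using G2[OF \<epsilon>(1)] unfolding eventually_nhds_metric by blast
  define \<delta> where "\<delta> = min \<epsilon> (min d1 d2)"
  have \<delta>: "0 < \<delta>" "\<delta> \<le> \<epsilon>" "\<delta> \<le> d1" "\<delta> \<le> d2" using \<epsilon> d1 d2 by (auto simp: \<delta>_def)
  have part: "(m * \<rho> / 4) * \<kappa> - m * (C + 1) * e \<le> m * e * (\<xi> \<bullet> x) + \<xi> \<bullet> G - \<epsilon> * (2 * \<alpha> + m * e + 1) * norm \<xi>"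
    if \<xi>: "\<xi> \<in> subdifferential \<psi> x" and \<kappa>: "\<kappa> \<le> 2 * norm \<xi>" and G: "- (K * \<omega> * \<kappa>) - \<epsilon> * (1 + norm \<xi>) \<le> \<xi> \<bullet> G" and e: "1 \<le> e" "m * e \<le> m * e1 + m * e2"
    for \<xi> x G \<kappa> e
  proof -
    define n where "n = norm \<xi>"
    have n: "0 \<le> n" by (simp add: n_def)
    have "m * e * (\<rho> * n - C) \<le> m * e * (\<xi> \<bullet> x)" using subgradient_coercive[OF \<rho>(1,3) \<xi>] m e by (intro mult_left_mono) (auto simp: n_def)
    moreover have "m * e * (\<rho> * n - C) = e * (m * \<rho> * n) - m * C * e" by (simp add: algebra_simps)
    moreover have "1 * (m * \<rho> * n) \<le> e * (m * \<rho> * n)" using m \<rho> n e by (intro mult_right_mono) auto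
    moreover have "K * \<omega> * \<kappa> \<le> K * \<omega> * (2 * n)" using \<kappa> \<omega> by (intro mult_left_mono) (auto simp: n_def)
    moreover have "K * \<omega> * (2 * n) = (1/4) * (8 * (K * \<omega>) * n)" by simp
    moreover have "8 * (K * \<omega>) * n \<le> m * \<rho> * n" using \<omega>(1) n by (rule mult_right_mono)
    moreover have "\<epsilon> * (2 * \<alpha> + m * e + 1) * n + \<epsilon> * n \<le> (1/4) * (m * \<rho> * n)"
    proof -
      have "\<epsilon> * (2 * \<alpha> + m * e + 2) \<le> \<epsilon> * Q" using \<epsilon>(1) e by (intro mult_left_mono) (auto simp: Q_def)
      then have "\<epsilon> * (2 * \<alpha> + m * e + 2) * n \<le> (m * \<rho> / 4) * n" using \<epsilon>(3) n by (intro mult_right_mono) auto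
      then show ?thesis by (simp add: algebra_simps)
    qed
    moreover have "(m * \<rho> / 4) * \<kappa> \<le> (m * \<rho> / 4) * (2 * n)" using \<kappa> m \<rho> by (intro mult_left_mono) (auto simp: n_def)
    moreover have "(m * \<rho> / 4) * (2 * n) = (1/2) * (m * \<rho> * n)" by simp
    moreover have "1 * m \<le> e * m" using e m by (intro mult_right_mono) auto
    moreover have "m * (C + 1) * e = m * C * e + e * m" by (simp add: algebra_simps)
    moreover have "\<epsilon> * (1 + norm \<xi>) = \<epsilon> + \<epsilon> * n" by (simp add: n_def distrib_left)
    ultimately show ?thesis using G \<epsilon>(2) unfolding n_def[symmetric] by linarith
  qed
  show thesis
  proof (rule that[OF \<delta>(1)])
    fix x' q' \<xi> y' r' \<eta> assume h: "dist x' x1 < \<delta>" "dist q' q1 < \<delta>" "\<xi> \<in> subdifferential \<psi> x'"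
        "dist y' x2 < \<delta>" "dist r' (- q2) < \<delta>" "\<eta> \<in> subdifferential \<psi> y'"
    have ie: "\<bar>\<zeta> \<bullet> v\<bar> \<le> \<epsilon> * norm \<zeta>" if "norm v < \<delta>" for \<zeta> v :: 'a
    proof -
      have "\<bar>\<zeta> \<bullet> v\<bar> \<le> norm \<zeta> * norm v" by (rule Cauchy_Schwarz_ineq2)
      also have "\<dots> \<le> norm \<zeta> * \<epsilon>" using that \<delta>(2) by (intro mult_left_mono) auto
      finally show ?thesis by (simp add: mult.commute)
    qed
    have i1: "\<bar>\<xi> \<bullet> (q' - q1)\<bar> \<le> \<epsilon> * norm \<xi>" "\<bar>\<eta> \<bullet> (r' + q2)\<bar> \<le> \<epsilon> * norm \<eta>"
      using ie[of "q' - q1" \<xi>] ie[of "r' + q2" \<eta>] h by (auto simp: dist_norm)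
    have i2: "\<bar>\<xi> \<bullet> (x' - x1)\<bar> \<le> \<epsilon> * norm \<xi>" "\<bar>\<xi> \<bullet> (y' - x2)\<bar> \<le> \<epsilon> * norm \<xi>" "\<bar>\<eta> \<bullet> (x' - x1)\<bar> \<le> \<epsilon> * norm \<eta>" "\<bar>\<eta> \<bullet> (y' - x2)\<bar> \<le> \<epsilon> * norm \<eta>"
      using ie[of "x' - x1"] ie[of "y' - x2"] h by (auto simp: dist_norm)
    have "0 \<le> (\<xi> - \<eta>) \<bullet> (x' - y')" by (rule subdifferential_monotone[OF h(3,6)])
    then have "- (2 * \<epsilon> * norm \<xi> + 2 * \<epsilon> * norm \<eta>) \<le> (\<xi> - \<eta>) \<bullet> (x1 - x2)"
      using i2 by (simp add: inner_diff_left inner_diff_right abs_le_iff)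
    then have mono: "\<alpha> * - (2 * \<epsilon> * norm \<xi> + 2 * \<epsilon> * norm \<eta>) \<le> \<alpha> * ((\<xi> - \<eta>) \<bullet> (x1 - x2))" using m(4) by (rule mult_left_mono)
    have k1: "\<kappa>1 \<le> 2 * norm \<xi>" "- (K * \<omega> * \<kappa>1) - \<epsilon> * (1 + norm \<xi>) \<le> \<xi> \<bullet> G1" using d1(2)[OF _ h(3)] h(1) \<delta> by auto
    have k2: "\<kappa>2 \<le> 2 * norm \<eta>" "- (K * \<omega> * \<kappa>2) - \<epsilon> * (1 + norm \<eta>) \<le> \<eta> \<bullet> G2" using d2(2)[OF _ h(6)] h(4) \<delta> by auto
    have p1: "(m * \<rho> / 4) * \<kappa>1 - m * (C + 1) * e1 \<le> m * e1 * (\<xi> \<bullet> x') + \<xi> \<bullet> G1 - \<epsilon> * (2 * \<alpha> + m * e1 + 1) * norm \<xi>"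
      by (rule part[OF h(3) k1 m(2)]) (use m in simp)
    have p2: "(m * \<rho> / 4) * \<kappa>2 - m * (C + 1) * e2 \<le> m * e2 * (\<eta> \<bullet> y') + \<eta> \<bullet> G2 - \<epsilon> * (2 * \<alpha> + m * e2 + 1) * norm \<eta>"
      by (rule part[OF h(6) k2 m(3)]) (use m in simp)
    have x1': "m * e1 * (\<xi> \<bullet> x' - \<epsilon> * norm \<xi>) \<le> m * e1 * (\<xi> \<bullet> x1)" using i2(1) m by (intro mult_left_mono) (auto simp: inner_diff_right abs_le_iff)
    have x2': "m * e2 * (\<eta> \<bullet> y' - \<epsilon> * norm \<eta>) \<le> m * e2 * (\<eta> \<bullet> x2)" using i2(4) m by (intro mult_left_mono) (auto simp: inner_diff_right abs_le_iff)
    have "\<xi> \<bullet> q' + \<eta> \<bullet> r' = \<alpha> * ((\<xi> - \<eta>) \<bullet> (x1 - x2)) + m * e1 * (\<xi> \<bullet> x1) + \<xi> \<bullet> G1 + m * e2 * (\<eta> \<bullet> x2) + \<eta> \<bullet> G2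
        + \<xi> \<bullet> (q' - q1) + \<eta> \<bullet> (r' + q2)"
      by (simp add: q inner_diff_left inner_diff_right inner_add_right algebra_simps)
    then show "(m * \<rho> / 4) * (\<kappa>1 + \<kappa>2) - m * (C + 1) * (e1 + e2) \<le> \<xi> \<bullet> q' + \<eta> \<bullet> r'"
      using mono p1 p2 x1' x2' i1 by (simp add: algebra_simps abs_le_iff)
  qed
qed

end

section \<open>The maximum of the penalized difference\<close>

text \<open>The maximum is compared only with points on the segment from \<open>z\<close> to
  \<open>0\<close>, which stays in a convex domain, so points of its boundary are covered. The
  outcome bounds the outward derivative of the barrier by Lipschitz data.\<close>

lemma inward_derivative_bound:
  fixes f P :: "'a::real_inner \<Rightarrow> real"
  assumes P: "\<forall>\<^sub>F x in nhds z. P x \<le> P z + G \<bullet> (x - z) + \<kappa> * (norm (x - z))\<^sup>2"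
    and lip: "\<And>\<tau>. 0 < \<tau> \<Longrightarrow> \<tau> \<le> 1 \<Longrightarrow> f z - f ((1 - \<tau>) *\<^sub>R z) \<le> L * \<tau> * norm z"
    and max: "\<And>\<tau>. 0 < \<tau> \<Longrightarrow> \<tau> \<le> 1 \<Longrightarrow>
       f ((1 - \<tau>) *\<^sub>R z) - \<alpha> / 2 * (norm ((1 - \<tau>) *\<^sub>R z - y))\<^sup>2 - c * (norm ((1 - \<tau>) *\<^sub>R z))\<^sup>2 - P ((1 - \<tau>) *\<^sub>R z)
       \<le> f z - \<alpha> / 2 * (norm (z - y))\<^sup>2 - c * (norm z)\<^sup>2 - P z"
    and \<alpha>: "0 \<le> \<alpha>"
  shows "G \<bullet> z + 2 * c * (norm z)\<^sup>2 \<le> (L + \<alpha> * norm (z - y)) * norm z"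
proof -
  define B where "B = \<kappa> * (norm z)\<^sup>2 + c * (norm z)\<^sup>2 + \<alpha> / 2 * (norm z)\<^sup>2"
  obtain d where d: "d > 0" "\<And>x. dist x z < d \<Longrightarrow> P x \<le> P z + G \<bullet> (x - z) + \<kappa> * (norm (x - z))\<^sup>2"
    using P unfolding eventually_nhds_metric by blast
  have step: "G \<bullet> z + 2 * c * (norm z)\<^sup>2 \<le> (L + \<alpha> * norm (z - y)) * norm z + \<tau> * B"
    if \<tau>: "0 < \<tau>" "\<tau> < min 1 (d / (norm z + 1))" for \<tau>
  proof -
    have t1: "\<tau> \<le> 1" using \<tau> by simp
    have e: "(1 - \<tau>) *\<^sub>R z - z = (- \<tau>) *\<^sub>R z" by (simp add: algebra_simps)
    have nz: "norm z + 1 > 0" using norm_ge_zero[of z] by linarith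
    have "\<tau> * norm z \<le> \<tau> * (norm z + 1)" using \<tau> by simp
    also have "\<dots> < d" using \<tau>(2) nz by (simp add: less_divide_eq)
    finally have "dist ((1 - \<tau>) *\<^sub>R z) z < d" using \<tau> by (simp add: dist_norm e)
    from d(2)[OF this] have p: "P ((1 - \<tau>) *\<^sub>R z) \<le> P z - \<tau> * (G \<bullet> z) + \<kappa> * (\<tau>\<^sup>2 * (norm z)\<^sup>2)"
      unfolding e by (simp add: power_mult_distrib)
    have q1: "(norm ((1 - \<tau>) *\<^sub>R z - y))\<^sup>2 = (norm (z - y))\<^sup>2 - 2 * \<tau> * ((z - y) \<bullet> z) + \<tau>\<^sup>2 * (norm z)\<^sup>2"
      using norm_add_scaleR_square[of "z - y" "- \<tau>" z] by (simp add: algebra_simps)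
    have q2: "(norm ((1 - \<tau>) *\<^sub>R z))\<^sup>2 = (norm z)\<^sup>2 - 2 * \<tau> * (norm z)\<^sup>2 + \<tau>\<^sup>2 * (norm z)\<^sup>2"
      by (simp add: power_mult_distrib) (simp add: power2_eq_square algebra_simps)
    have "f ((1 - \<tau>) *\<^sub>R z) - \<alpha> / 2 * ((norm (z - y))\<^sup>2 - 2 * \<tau> * ((z - y) \<bullet> z) + \<tau>\<^sup>2 * (norm z)\<^sup>2)
         - c * ((norm z)\<^sup>2 - 2 * \<tau> * (norm z)\<^sup>2 + \<tau>\<^sup>2 * (norm z)\<^sup>2) - (P z - \<tau> * (G \<bullet> z) + \<kappa> * (\<tau>\<^sup>2 * (norm z)\<^sup>2))
       \<le> f z - \<alpha> / 2 * (norm (z - y))\<^sup>2 - c * (norm z)\<^sup>2 - P z"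
      using max[OF \<tau>(1) t1] p unfolding q1 q2 by linarith
    then have "\<tau> * (G \<bullet> z) + \<tau> * (2 * c * (norm z)\<^sup>2) \<le> (f z - f ((1 - \<tau>) *\<^sub>R z)) - \<tau> * (\<alpha> * ((z - y) \<bullet> z)) + \<tau>\<^sup>2 * B"
      unfolding B_def by (simp add: algebra_simps)
    then have "\<tau> * (G \<bullet> z) + \<tau> * (2 * c * (norm z)\<^sup>2) \<le> L * \<tau> * norm z - \<tau> * (\<alpha> * ((z - y) \<bullet> z)) + \<tau>\<^sup>2 * B"
      using lip[OF \<tau>(1) t1] by linarith
    moreover have "- (\<tau> * (\<alpha> * ((z - y) \<bullet> z))) \<le> \<tau> * (\<alpha> * (norm (z - y) * norm z))"
    proof -
      have "- ((z - y) \<bullet> z) \<le> norm (z - y) * norm z" using Cauchy_Schwarz_ineq2[of "z - y" z] by linarith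
      then have "\<tau> * (\<alpha> * - ((z - y) \<bullet> z)) \<le> \<tau> * (\<alpha> * (norm (z - y) * norm z))" using \<tau> \<alpha> by (intro mult_left_mono) auto
      then show ?thesis by simp
    qed
    ultimately have "\<tau> * (G \<bullet> z + 2 * c * (norm z)\<^sup>2) \<le> \<tau> * ((L + \<alpha> * norm (z - y)) * norm z + \<tau> * B)"
      by (simp add: algebra_simps power2_eq_square)
    then show ?thesis using \<tau> by simp
  qed
  have "((\<lambda>\<tau>. (L + \<alpha> * norm (z - y)) * norm z + \<tau> * B) \<longlongrightarrow> (L + \<alpha> * norm (z - y)) * norm z + 0 * B) (at_right 0)"
    by (intro tendsto_intros)
  moreover have "\<forall>\<^sub>F \<tau> in at_right 0. G \<bullet> z + 2 * c * (norm z)\<^sup>2 \<le> (L + \<alpha> * norm (z - y)) * norm z + \<tau> * B"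
  proof -
    have "0 < min 1 (d / (norm z + 1))" using d(1) by (simp add: add_nonneg_pos)
    then show ?thesis using step unfolding eventually_at_right_field by blast
  qed
  ultimately have "G \<bullet> z + 2 * c * (norm z)\<^sup>2 \<le> (L + \<alpha> * norm (z - y)) * norm z + 0 * B" by (rule tendsto_lowerbound) simp
  then show ?thesis by simp
qed

text \<open>Comparing the maximum of the penalized difference with the points obtained by replacing one of \<open>x, y\<close> by the
  other one, and adding the two inequalities, the barrier \<open>P\<close> cancels: \<open>\<alpha> |x - y|\<close> is bounded independently of it.\<close>

lemma penalized_maximum:
  fixes U V :: "real \<Rightarrow> 'a::euclidean_space \<Rightarrow> real" and P :: "'a \<Rightarrow> real"
  assumes D: "closed D" "convex D" "0 \<in> D"
    and L: "\<And>t. t \<in> {0..T} \<Longrightarrow> L-lipschitz_on D (U t)" "\<And>t. t \<in> {0..T} \<Longrightarrow> L-lipschitz_on D (V t)"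
    and cont: "continuous_on ({0..T} \<times> D) (\<lambda>(t, x). U t x)" "continuous_on ({0..T} \<times> D) (\<lambda>(t, x). V t x)"
    and P: "continuous_on UNIV P" "\<And>x. 0 \<le> P x"
    and pos: "0 < m" "0 \<le> lam" "0 \<le> \<alpha>" "0 \<le> \<beta>" "0 \<le> A"
    and A: "\<And>t s x y. t \<in> {0..T} \<Longrightarrow> s \<in> {0..T} \<Longrightarrow> x \<in> D \<Longrightarrow> y \<in> D \<Longrightarrow> U t x - V s y \<le> A + L * norm x + L * norm y"
    and R: "1 \<le> R" "(4 / m) * (A + 2 * L\<^sup>2 / m) < R"
    and pt: "t0 \<in> {0..T}" "x0 \<in> D" "norm x0 \<le> R" "P x0 = 0" "0 < c0"
       "c0 \<le> U t0 x0 - V t0 x0 - m * (exp (lam * (T - t0)) * (1 + (norm x0)\<^sup>2))"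
  defines "\<Phi> \<equiv> \<lambda>t x s y. U t x - V s y - \<alpha> / 2 * (norm (x - y))\<^sup>2 - \<beta> / 2 * (t - s)\<^sup>2
     - m / 2 * (exp (lam * (T - t)) * (1 + (norm x)\<^sup>2)) - m / 2 * (exp (lam * (T - s)) * (1 + (norm y)\<^sup>2)) - P x - P y"
  obtains t1 x1 t2 x2 where "t1 \<in> {0..T}" "x1 \<in> D" "t2 \<in> {0..T}" "x2 \<in> D" "norm x1 < R" "norm x2 < R"
    "c0 \<le> U t1 x1 - V t2 x2"
    "\<And>t x s y. t \<in> {0..T} \<Longrightarrow> x \<in> D \<Longrightarrow> norm x \<le> R \<Longrightarrow> s \<in> {0..T} \<Longrightarrow> y \<in> D \<Longrightarrow> norm y \<le> R \<Longrightarrow> \<Phi> t x s y \<le> \<Phi> t1 x1 t2 x2"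
    "\<beta> / 2 * (t1 - t2)\<^sup>2 \<le> A + 2 * L * R"
    "\<alpha> * norm (x1 - x2) \<le> 2 * L + m * R * \<bar>exp (lam * (T - t1)) - exp (lam * (T - t2))\<bar>"
    "\<And>G \<kappa>. \<forall>\<^sub>F x in nhds x1. P x \<le> P x1 + G \<bullet> (x - x1) + \<kappa> * (norm (x - x1))\<^sup>2 \<Longrightarrow>
       G \<bullet> x1 + m * exp (lam * (T - t1)) * (norm x1)\<^sup>2 \<le> (L + \<alpha> * norm (x1 - x2)) * norm x1"
    "\<And>G \<kappa>. \<forall>\<^sub>F x in nhds x2. P x \<le> P x2 + G \<bullet> (x - x2) + \<kappa> * (norm (x - x2))\<^sup>2 \<Longrightarrow>
       G \<bullet> x2 + m * exp (lam * (T - t2)) * (norm x2)\<^sup>2 \<le> (L + \<alpha> * norm (x1 - x2)) * norm x2"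
proof -
  define K where "K = ({0..T} \<times> (D \<inter> cball 0 R)) \<times> ({0..T} \<times> (D \<inter> cball 0 R))"
  define F where "F z = \<Phi> (fst (fst z)) (snd (fst z)) (fst (snd z)) (snd (snd z))" for z
  have L0: "0 \<le> L" using lipschitz_on_nonneg[OF L(1)[OF pt(1)]] .
  have "compact K" unfolding K_def
    by (intro compact_Times compact_Icc closed_Int_compact D(1) compact_cball)
  moreover have z0: "((t0, x0), (t0, x0)) \<in> K" using pt by (auto simp: K_def)
  moreover have "continuous_on K F"
  proof -
    have U: "continuous_on K (\<lambda>z. U (fst (fst z)) (snd (fst z)))"
    proof -
      have "continuous_on K (\<lambda>z. (\<lambda>(t, x). U t x) (fst z))"
        by (rule continuous_on_compose2[OF cont(1)]) (auto simp: K_def intro!: continuous_intros)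
      then show ?thesis by (simp add: case_prod_unfold)
    qed
    have V: "continuous_on K (\<lambda>z. V (fst (snd z)) (snd (snd z)))"
    proof -
      have "continuous_on K (\<lambda>z. (\<lambda>(t, x). V t x) (snd z))"
        by (rule continuous_on_compose2[OF cont(2)]) (auto simp: K_def intro!: continuous_intros)
      then show ?thesis by (simp add: case_prod_unfold)
    qed
    have P1: "continuous_on K (\<lambda>z. P (snd (fst z)))" "continuous_on K (\<lambda>z. P (snd (snd z)))"
      by (intro continuous_on_compose2[OF P(1)] continuous_intros; simp)+
    show ?thesis unfolding F_def \<Phi>_def by (intro continuous_intros U V P1)
  qed
  ultimately obtain z where z: "z \<in> K" "\<And>w. w \<in> K \<Longrightarrow> F w \<le> F z"
    using continuous_attains_sup[of K F] by blast
  obtain t1 x1 t2 x2 where zz: "z = ((t1, x1), (t2, x2))" by (metis surj_pair)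
  have in1: "t1 \<in> {0..T}" "x1 \<in> D" "norm x1 \<le> R" and in2: "t2 \<in> {0..T}" "x2 \<in> D" "norm x2 \<le> R" using z(1) by (auto simp: zz K_def)
  have max: "\<Phi> t x s y \<le> \<Phi> t1 x1 t2 x2" if "t \<in> {0..T}" "x \<in> D" "norm x \<le> R" "s \<in> {0..T}" "y \<in> D" "norm y \<le> R" for t x s y
    using z(2)[of "((t, x), (s, y))"] that by (auto simp: F_def zz K_def)
  define e where "e t = exp (lam * (T - t))" for t
  have e1: "1 \<le> e t" if "t \<in> {0..T}" for t using that pos by (simp add: e_def)
  have \<Phi>: "\<Phi> t x s y = U t x - V s y - \<alpha> / 2 * (norm (x - y))\<^sup>2 - \<beta> / 2 * (t - s)\<^sup>2
     - m / 2 * (e t * (1 + (norm x)\<^sup>2)) - m / 2 * (e s * (1 + (norm y)\<^sup>2)) - P x - P y" for t x s y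
    by (simp add: \<Phi>_def e_def)
  have c0: "c0 \<le> \<Phi> t1 x1 t2 x2"
    using max[OF pt(1,2,3) pt(1,2,3)] pt(4,6) by (simp add: \<Phi>_def)
  have nn: "0 \<le> \<alpha> / 2 * (norm (x1 - x2))\<^sup>2" "0 \<le> \<beta> / 2 * (t1 - t2)\<^sup>2" "0 \<le> P x1" "0 \<le> P x2" using pos P by auto
  have wge: "m / 2 * (norm x)\<^sup>2 \<le> m / 2 * (e t * (1 + (norm x)\<^sup>2))" if "t \<in> {0..T}" for t x
  proof -
    have "(norm x)\<^sup>2 \<le> 1 * (1 + (norm x)\<^sup>2)" by simp
    also have "\<dots> \<le> e t * (1 + (norm x)\<^sup>2)" using e1[OF that] by (intro mult_right_mono) auto
    finally show ?thesis using pos by (intro mult_left_mono) auto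
  qed
  note w1 = wge[OF in1(1), of x1] and w2 = wge[OF in2(1), of x2]
  have wn: "0 \<le> m / 2 * (norm x1)\<^sup>2" "0 \<le> m / 2 * (norm x2)\<^sup>2" using pos by auto
  have UV: "c0 \<le> U t1 x1 - V t2 x2" using c0 nn w1 w2 wn unfolding \<Phi> by linarith
  have sq: "m / 2 * (norm x1)\<^sup>2 + m / 2 * (norm x2)\<^sup>2 \<le> A + L * norm x1 + L * norm x2"
    using c0 nn w1 w2 A[OF in1(1) in2(1) in1(2) in2(2)] pt(5) unfolding \<Phi> by linarith
  \<comment> \<open>Half of the quadratic weight absorbs the linear growth of \<open>U\<close> and
    \<open>V\<close>; this confines the maximum points independently of \<open>P\<close>,
    \<open>\<alpha>\<close> and \<open>\<beta>\<close>.\<close>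
  have yng: "L * r \<le> m / 4 * r\<^sup>2 + L\<^sup>2 / m" for r
  proof -
    have "0 \<le> (m / 2 * r - L)\<^sup>2 / m" using pos by simp
    also have "\<dots> = m / 4 * r\<^sup>2 - L * r + L\<^sup>2 / m" using pos by (simp add: power2_eq_square field_simps)
    finally show ?thesis by simp
  qed
  have "m / 4 * (norm x1)\<^sup>2 + m / 4 * (norm x2)\<^sup>2 \<le> A + 2 * L\<^sup>2 / m"
    using sq yng[of "norm x1"] yng[of "norm x2"] by simp
  then have "m / 4 * (norm x)\<^sup>2 \<le> A + 2 * L\<^sup>2 / m" if "x = x1 \<or> x = x2" for x using wn that by auto
  then have nsq: "(norm x)\<^sup>2 \<le> (4 / m) * (A + 2 * L\<^sup>2 / m)" if "x = x1 \<or> x = x2" for x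
    using that pos by (simp add: field_simps)
  have "(norm x)\<^sup>2 < R\<^sup>2" if "x = x1 \<or> x = x2" for x
  proof -
    have "(norm x)\<^sup>2 \<le> (4 / m) * (A + 2 * L\<^sup>2 / m)" using nsq[OF that] .
    also note R(2)
    also have "R \<le> R\<^sup>2" using R(1) mult_left_mono[of 1 R R] by (simp add: power2_eq_square)
    finally show ?thesis .
  qed
  then have nR: "norm x1 < R" "norm x2 < R" using R by (auto intro: power2_less_imp_less)
  have tb: "\<beta> / 2 * (t1 - t2)\<^sup>2 \<le> A + 2 * L * R"
  proof -
    have "L * norm x1 \<le> L * R" "L * norm x2 \<le> L * R" using L0 in1 in2 by (auto intro: mult_left_mono)
    then show ?thesis using c0 nn w1 w2 wn A[OF in1(1) in2(1) in1(2) in2(2)] pt(5) unfolding \<Phi> by linarith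
  qed
  have lipU: "\<bar>U t x - U t y\<bar> \<le> L * norm (x - y)" and lipV: "\<bar>V t x - V t y\<bar> \<le> L * norm (x - y)"
    if "t \<in> {0..T}" "x \<in> D" "y \<in> D" for t x y
    using lipschitz_onD[OF L(1)[OF that(1)] that(2,3)] lipschitz_onD[OF L(2)[OF that(1)] that(2,3)] by (auto simp: dist_norm)
  have xy: "\<alpha> * norm (x1 - x2) \<le> 2 * L + m * R * \<bar>e t1 - e t2\<bar>"
  proof (cases "x1 = x2")
    case True then show ?thesis using L0 pos R by simp
  next
    case False
    define r where "r = norm (x1 - x2)"
    have r: "0 < r" using False by (simp add: r_def)
    have "\<Phi> t1 x1 t2 x1 \<le> \<Phi> t1 x1 t2 x2" "\<Phi> t1 x2 t2 x2 \<le> \<Phi> t1 x1 t2 x2" using in1 in2 by (auto intro: max)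
    moreover have "V t2 x1 - V t2 x2 \<le> L * r" "U t1 x1 - U t1 x2 \<le> L * r"
      using lipU[OF in1(1,2) in2(2)] lipV[OF in2(1) in1(2) in2(2)] by (auto simp: r_def abs_le_iff)
    \<comment> \<open>The barrier has cancelled, the weights only up to the difference of their time
      factors.\<close>
    ultimately have "\<alpha> * r\<^sup>2 \<le> 2 * (L * r) + m / 2 * ((e t2 - e t1) * ((norm x1)\<^sup>2 - (norm x2)\<^sup>2))"
      unfolding \<Phi> r_def[symmetric] by (simp add: algebra_simps)
    moreover have "(e t2 - e t1) * ((norm x1)\<^sup>2 - (norm x2)\<^sup>2) \<le> \<bar>e t1 - e t2\<bar> * (r * (2 * R))"
    proof -
      have "\<bar>(norm x1)\<^sup>2 - (norm x2)\<^sup>2\<bar> = \<bar>norm x1 - norm x2\<bar> * (norm x1 + norm x2)"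
      proof -
        have "(norm x1)\<^sup>2 - (norm x2)\<^sup>2 = (norm x1 - norm x2) * (norm x1 + norm x2)" by (simp add: power2_eq_square algebra_simps)
        then show ?thesis by (simp add: abs_mult)
      qed
      also have "\<dots> \<le> r * (2 * R)" using norm_triangle_ineq3[of x1 x2] in1 in2 r by (intro mult_mono) (auto simp: r_def)
      finally have "\<bar>e t2 - e t1\<bar> * \<bar>(norm x1)\<^sup>2 - (norm x2)\<^sup>2\<bar> \<le> \<bar>e t1 - e t2\<bar> * (r * (2 * R))"
        by (simp add: abs_minus_commute mult_left_mono)
      then show ?thesis using abs_ge_self[of "(e t2 - e t1) * ((norm x1)\<^sup>2 - (norm x2)\<^sup>2)"] unfolding abs_mult by linarith
    qed
    then have "m / 2 * ((e t2 - e t1) * ((norm x1)\<^sup>2 - (norm x2)\<^sup>2)) \<le> m / 2 * (\<bar>e t1 - e t2\<bar> * (r * (2 * R)))" using pos by (intro mult_left_mono) auto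
    ultimately have "r * (\<alpha> * r) \<le> r * (2 * L + m * R * \<bar>e t1 - e t2\<bar>)" by (simp add: power2_eq_square algebra_simps)
    then show ?thesis using r by (simp add: r_def)
  qed
  have shrink: "(1 - \<tau>) *\<^sub>R x \<in> D" "norm ((1 - \<tau>) *\<^sub>R x) \<le> R" "norm (x - (1 - \<tau>) *\<^sub>R x) = \<tau> * norm x"
    if "x \<in> D" "norm x \<le> R" "0 < \<tau>" "\<tau> \<le> 1" for x \<tau>
  proof -
    show "(1 - \<tau>) *\<^sub>R x \<in> D" using convexD[OF D(2) that(1) D(3), of "1 - \<tau>" \<tau>] that by simp
    have "(1 - \<tau>) * norm x \<le> 1 * norm x" using that by (intro mult_right_mono) auto
    then show "norm ((1 - \<tau>) *\<^sub>R x) \<le> R" using that by simp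
    have "x - (1 - \<tau>) *\<^sub>R x = \<tau> *\<^sub>R x" by (simp add: algebra_simps)
    then show "norm (x - (1 - \<tau>) *\<^sub>R x) = \<tau> * norm x" using that by simp
  qed
  have in_x1: "G \<bullet> x1 + m * e t1 * (norm x1)\<^sup>2 \<le> (L + \<alpha> * norm (x1 - x2)) * norm x1"
    if ev: "\<forall>\<^sub>F x in nhds x1. P x \<le> P x1 + G \<bullet> (x - x1) + \<kappa> * (norm (x - x1))\<^sup>2" for G \<kappa>
  proof -
    have "G \<bullet> x1 + 2 * (m / 2 * e t1) * (norm x1)\<^sup>2 \<le> (L + \<alpha> * norm (x1 - x2)) * norm x1"
    proof (rule inward_derivative_bound[OF ev _ _ pos(3), of "U t1"])
      fix \<tau> :: real assume \<tau>: "0 < \<tau>" "\<tau> \<le> 1"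
      note s = shrink[OF in1(2,3) \<tau>]
      show "U t1 x1 - U t1 ((1 - \<tau>) *\<^sub>R x1) \<le> L * \<tau> * norm x1"
        using lipU[OF in1(1,2) s(1)] s(3) by (simp add: mult.assoc)
      show "U t1 ((1 - \<tau>) *\<^sub>R x1) - \<alpha> / 2 * (norm ((1 - \<tau>) *\<^sub>R x1 - x2))\<^sup>2 - m / 2 * e t1 * (norm ((1 - \<tau>) *\<^sub>R x1))\<^sup>2 - P ((1 - \<tau>) *\<^sub>R x1)
         \<le> U t1 x1 - \<alpha> / 2 * (norm (x1 - x2))\<^sup>2 - m / 2 * e t1 * (norm x1)\<^sup>2 - P x1"
        using max[OF in1(1) s(1,2) in2] unfolding \<Phi> by (simp add: distrib_left mult.assoc)
    qed
    then show ?thesis by simp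
  qed
  have in_x2: "G \<bullet> x2 + m * e t2 * (norm x2)\<^sup>2 \<le> (L + \<alpha> * norm (x1 - x2)) * norm x2"
    if ev: "\<forall>\<^sub>F x in nhds x2. P x \<le> P x2 + G \<bullet> (x - x2) + \<kappa> * (norm (x - x2))\<^sup>2" for G \<kappa>
  proof -
    have "G \<bullet> x2 + 2 * (m / 2 * e t2) * (norm x2)\<^sup>2 \<le> (L + \<alpha> * norm (x2 - x1)) * norm x2"
    proof (rule inward_derivative_bound[OF ev _ _ pos(3), of "\<lambda>x. - V t2 x"])
      fix \<tau> :: real assume \<tau>: "0 < \<tau>" "\<tau> \<le> 1"
      note s = shrink[OF in2(2,3) \<tau>]
      show "- V t2 x2 - - V t2 ((1 - \<tau>) *\<^sub>R x2) \<le> L * \<tau> * norm x2"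
        using lipV[OF in2(1,2) s(1)] s(3) by (simp add: mult.assoc)
      show "- V t2 ((1 - \<tau>) *\<^sub>R x2) - \<alpha> / 2 * (norm ((1 - \<tau>) *\<^sub>R x2 - x1))\<^sup>2 - m / 2 * e t2 * (norm ((1 - \<tau>) *\<^sub>R x2))\<^sup>2 - P ((1 - \<tau>) *\<^sub>R x2)
         \<le> - V t2 x2 - \<alpha> / 2 * (norm (x2 - x1))\<^sup>2 - m / 2 * e t2 * (norm x2)\<^sup>2 - P x2"
        using max[OF in1 in2(1) s(1,2)] unfolding \<Phi> by (simp add: distrib_left mult.assoc norm_minus_commute)
    qed
    then show ?thesis by (simp add: norm_minus_commute)
  qed
  show thesis
    by (rule that[OF in1(1,2) in2(1,2) nR UV max tb xy[unfolded e_def] in_x1[unfolded e_def] in_x2[unfolded e_def]])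
qed

lemma (in convex_potential) convex_domain: "Convex.convex (effective_domain \<psi>)"
  unfolding convex_alt
proof (intro ballI allI impI)
  fix x y u assume x: "x \<in> effective_domain \<psi>" and y: "y \<in> effective_domain \<psi>" and u: "0 \<le> u \<and> u \<le> (1::real)"
  obtain p where p: "\<psi> x = ereal p" using finiteE x unfolding effective_domain_def by blast
  obtain q where q: "\<psi> y = ereal q" using finiteE y unfolding effective_domain_def by blast
  have "\<psi> (u *\<^sub>R y + (1 - u) *\<^sub>R x) \<le> ereal (u * q + (1 - u) * p)" using convexD_real[of y q x p u] p q u by simp
  then have "\<psi> (u *\<^sub>R y + (1 - u) *\<^sub>R x) < \<infinity>" by (rule le_less_trans) simp
  then show "(1 - u) *\<^sub>R x + u *\<^sub>R y \<in> effective_domain \<psi>" by (simp add: effective_domain_def add.commute)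
qed

lemma bounded_in_time:
  fixes h :: "real \<Rightarrow> 'b::real_normed_vector"
  assumes "continuous_on {0..T} h"
  obtains B where "0 \<le> B" "\<And>t. t \<in> {0..T} \<Longrightarrow> norm (h t) \<le> B"
proof -
  have "bounded (h ` {0..T})" by (intro compact_imp_bounded compact_continuous_image assms compact_Icc)
  then obtain B where "B > 0" "\<And>t. t \<in> {0..T} \<Longrightarrow> norm (h t) \<le> B" unfolding bounded_pos by auto
  then show thesis using that[of B] by simp
qed

lemma norm_triple_le: "norm (x, y, z) \<le> norm x + norm y + norm z"
  using norm_Pair_le[of x "(y, z)"] norm_Pair_le[of y z] by linarith

lemma lipschitz_linear_growth:
  fixes b :: "real \<Rightarrow> 'a::real_normed_vector \<Rightarrow> 'c::real_normed_vector \<Rightarrow> 'd::real_normed_vector \<Rightarrow> 'b::real_normed_vector"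
  assumes c: "continuous_on ({0..T} \<times> UNIV) (\<lambda>(t, x, y, z). b t x y z)"
    and L: "\<And>t. t \<in> {0..T} \<Longrightarrow> L-lipschitz_on UNIV (\<lambda>(x, y, z). b t x y z)" "0 \<le> L"
  obtains B where "0 \<le> B" "\<And>t x y z. t \<in> {0..T} \<Longrightarrow> norm (b t x y z) \<le> B * (1 + norm x + norm y + norm z)"
proof -
  have "continuous_on {0..T} (\<lambda>r. (\<lambda>(t, x, y, z). b t x y z) (r, 0, 0, 0))"
    by (rule continuous_on_compose2[OF c]) (auto intro!: continuous_intros)
  then have "continuous_on {0..T} (\<lambda>t. b t 0 0 0)" by simp
  then obtain B where B: "0 \<le> B" "\<And>t. t \<in> {0..T} \<Longrightarrow> norm (b t 0 0 0) \<le> B" using bounded_in_time by blast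
  show thesis
  proof (rule that[of "max B L"])
    fix t :: real and x y z assume t: "t \<in> {0..T}"
    have "norm (b t x y z - b t 0 0 0) \<le> L * norm (x, y, z)"
      using lipschitz_onD[OF L(1)[OF t], of "(x, y, z)" "(0, 0, 0)"] by (simp add: dist_norm)
    also have "\<dots> \<le> L * (norm x + norm y + norm z)" using L norm_triple_le by (intro mult_left_mono) auto
    also have "\<dots> \<le> max B L * (norm x + norm y + norm z)" by (intro mult_right_mono) auto
    finally have "norm (b t x y z - b t 0 0 0) \<le> max B L * (norm x + norm y + norm z)" .
    moreover have "norm (b t x y z) \<le> norm (b t x y z - b t 0 0 0) + norm (b t 0 0 0)" using norm_triangle_ineq[of "b t x y z - b t 0 0 0" "b t 0 0 0"] by simp
    ultimately show "norm (b t x y z) \<le> max B L * (1 + norm x + norm y + norm z)" using B(2)[OF t] by (simp add: algebra_simps)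
  qed (use B in simp)
qed

section \<open>Proof of comparison\<close>

text \<open>The parameters are chosen in the order \<open>lam\<close>, \<open>m\<close>,
  \<open>R\<close>, \<open>P\<close>, \<open>\<alpha>\<close>, \<open>\<eta>\<close>,
  \<open>\<beta>\<close>. The bounds \<open>La\<close> and \<open>L3\<close> for the gradients at
  the maximum point come before all of them, which makes this order possible. Instead of a limit,
  finitely many smallness conditions lead to \<open>m * ww \<le> m\<close> although
  \<open>ww \<ge> 2\<close>.\<close>

theorem comparison:
  fixes \<psi> :: "real^'n \<Rightarrow> ereal" and \<sigma> :: "real \<Rightarrow> real^'n \<Rightarrow> real \<Rightarrow> real^'d^'n"
  assumes T: "0 < T"
    and psi: "ereal_convex \<psi>" "lower_semicontinuous \<psi>" "0 \<in> interior (effective_domain \<psi>)" "\<psi> 0 = 0" "\<And>z. 0 \<le> \<psi> z"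
    and phi: "ereal_convex \<phi>" "\<And>y. \<phi> y \<noteq> -\<infinity>"
    and lc: "locally compact (effective_domain \<psi>)"
    and contb: "continuous_on ({0..T} \<times> UNIV) (\<lambda>(t, x, y, z). b t x y z)"
    and conts: "continuous_on ({0..T} \<times> UNIV) (\<lambda>(t, x, y). \<sigma> t x y)"
    and contf: "continuous_on ({0..T} \<times> UNIV) (\<lambda>(t, x, y, z). f t x y z)"
    and lipb: "\<And>t. t \<in> {0..T} \<Longrightarrow> Lb-lipschitz_on UNIV (\<lambda>(x, y, z). b t x y z)"
    and lipf: "\<And>t. t \<in> {0..T} \<Longrightarrow> Lb-lipschitz_on UNIV (\<lambda>(x, y, z). f t x y z)" and Lb: "1 \<le> Lb"
    and indep: "\<And>t x y y'. t \<in> {0..T} \<Longrightarrow> \<sigma> t x y = \<sigma> t x y'"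
    and lips: "\<And>t y. t \<in> {0..T} \<Longrightarrow> Ls-lipschitz_on UNIV (\<lambda>x. \<sigma> t x y)"
    and sub: "viscosity_subsolution T \<psi> \<phi> b \<sigma> f g u" and super: "viscosity_supersolution T \<psi> \<phi> b \<sigma> f g v"
    and lipu: "\<And>t. t \<in> {0..T} \<Longrightarrow> L-lipschitz_on (effective_domain \<psi>) (u t)"
    and lipv: "\<And>t. t \<in> {0..T} \<Longrightarrow> L-lipschitz_on (effective_domain \<psi>) (v t)"
    and ctu: "\<And>x. x \<in> effective_domain \<psi> \<Longrightarrow> continuous_on {0..T} (\<lambda>t. u t x)"
    and ctv: "\<And>x. x \<in> effective_domain \<psi> \<Longrightarrow> continuous_on {0..T} (\<lambda>t. v t x)"
    and tx: "t \<in> {0..T}" "x \<in> effective_domain \<psi>"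
  shows "u t x \<le> v t x"
proof (rule ccontr)
  assume bad: "\<not> u t x \<le> v t x"
  interpret convex_potential \<psi> by unfold_locales (use psi in auto)

  \<comment> \<open>Extensions and growth of the coefficients\<close>
  define D where "D = effective_domain \<psi>"
  have D0: "0 \<in> D" using psi(3) interior_subset by (auto simp: D_def)
  have convD: "convex D" unfolding D_def by (rule convex_domain)
  let ?D = "closure D"
  have DD: "D \<subseteq> ?D" by (rule closure_subset)
  have fD: "\<psi> y < \<infinity>" if "y \<in> D" for y using that by (simp add: D_def effective_domain_def)
  obtain U where U: "\<And>t x. t \<in> {0..T} \<Longrightarrow> x \<in> D \<Longrightarrow> U t x = u t x" "\<And>t. t \<in> {0..T} \<Longrightarrow> L-lipschitz_on ?D (U t)"
      and cU: "continuous_on ({0..T} \<times> ?D) (\<lambda>(t, x). U t x)"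
    using lipschitz_spacetime_extension[OF lipu ctu] unfolding D_def by blast
  obtain V where V: "\<And>t x. t \<in> {0..T} \<Longrightarrow> x \<in> D \<Longrightarrow> V t x = v t x" "\<And>t. t \<in> {0..T} \<Longrightarrow> L-lipschitz_on ?D (V t)"
      and cV: "continuous_on ({0..T} \<times> ?D) (\<lambda>(t, x). V t x)"
    using lipschitz_spacetime_extension[OF lipv ctv] unfolding D_def by blast
  have T0: "0 \<in> {0..T}" using T by simp
  have L0: "0 \<le> L" using lipschitz_on_nonneg[OF U(2)[OF T0]] .
  have lU: "\<bar>U r y - U r z\<bar> \<le> L * norm (y - z)" and lV: "\<bar>V r y - V r z\<bar> \<le> L * norm (y - z)" if "r \<in> {0..T}" "y \<in> ?D" "z \<in> ?D" for r y z
    using lipschitz_onD[OF U(2)[OF that(1)] that(2,3)] lipschitz_onD[OF V(2)[OF that(1)] that(2,3)] by (auto simp: dist_norm)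
  have D0c: "0 \<in> ?D" using D0 DD by blast
  obtain AU where AU: "0 \<le> AU" "\<And>r. r \<in> {0..T} \<Longrightarrow> \<bar>U r 0\<bar> \<le> AU"
  proof -
    have "continuous_on {0..T} (\<lambda>r. (\<lambda>(t, x). U t x) (r, 0))"
      by (rule continuous_on_compose2[OF cU]) (use D0c in \<open>auto intro!: continuous_intros\<close>)
    then have "continuous_on {0..T} (\<lambda>r. U r 0)" by simp
    then obtain B where "0 \<le> B" "\<And>r. r \<in> {0..T} \<Longrightarrow> norm (U r 0) \<le> B" by (rule bounded_in_time) blast
    then show thesis using that by simp
  qed
  obtain AV where AV: "0 \<le> AV" "\<And>r. r \<in> {0..T} \<Longrightarrow> \<bar>V r 0\<bar> \<le> AV"
  proof -
    have "continuous_on {0..T} (\<lambda>r. (\<lambda>(t, x). V t x) (r, 0))"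
      by (rule continuous_on_compose2[OF cV]) (use D0c in \<open>auto intro!: continuous_intros\<close>)
    then have "continuous_on {0..T} (\<lambda>r. V r 0)" by simp
    then obtain B where "0 \<le> B" "\<And>r. r \<in> {0..T} \<Longrightarrow> norm (V r 0) \<le> B" by (rule bounded_in_time) blast
    then show thesis using that by simp
  qed
  define A where "A = AU + AV"
  have A: "0 \<le> A" "AU \<le> A" "AV \<le> A" using AU AV by (auto simp: A_def)
  have gU: "\<bar>U r y\<bar> \<le> AU + L * norm y" and gV: "\<bar>V r y\<bar> \<le> AV + L * norm y" if "r \<in> {0..T}" "y \<in> ?D" for r y
    using lU[OF that D0c] lV[OF that D0c] AU(2)[OF that(1)] AV(2)[OF that(1)] by simp_all
  have gUV: "U r y - V s z \<le> A + L * norm y + L * norm z" if "r \<in> {0..T}" "s \<in> {0..T}" "y \<in> ?D" "z \<in> ?D" for r s y z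
    using gU[OF that(1,3)] gV[OF that(2,4)] unfolding A_def by linarith
  define Cu where "Cu = A + L"
  have Cu: "0 \<le> Cu" using A L0 by (simp add: Cu_def)
  have gU': "\<bar>U r y\<bar> \<le> Cu * (1 + norm y)" and gV': "\<bar>V r y\<bar> \<le> Cu * (1 + norm y)" if "r \<in> {0..T}" "y \<in> ?D" for r y
  proof -
    have eq: "Cu * (1 + norm y) = A + A * norm y + L + L * norm y" by (simp add: Cu_def algebra_simps)
    have "0 \<le> A * norm y" using A by simp
    then show "\<bar>U r y\<bar> \<le> Cu * (1 + norm y)" "\<bar>V r y\<bar> \<le> Cu * (1 + norm y)"
      using gU[OF that] gV[OF that] A L0 unfolding eq by linarith+
  qed
  obtain Bb where Bb: "0 \<le> Bb" "\<And>t x y z. t \<in> {0..T} \<Longrightarrow> norm (b t x y z) \<le> Bb * (1 + norm x + norm y + norm z)"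
    using lipschitz_linear_growth[OF contb lipb] Lb by (metis order_trans zero_le_one)
  \<comment> \<open>The linear growth of the solutions converts growth of the drift in the solution
    argument into growth in space.\<close>
  define B0 where "B0 = Bb * (1 + Cu)"
  have B0: "0 \<le> B0" using Bb Cu by (simp add: B0_def)
  have gb: "norm (b r y c z) \<le> B0 * (1 + norm y + norm z)" if "r \<in> {0..T}" "\<bar>c\<bar> \<le> Cu * (1 + norm y)" for r y c z
  proof -
    have "norm (b r y c z) \<le> Bb * (1 + norm y + \<bar>c\<bar> + norm z)" using Bb(2)[OF that(1)] by simp
    also have "\<dots> \<le> Bb * ((1 + Cu) * (1 + norm y + norm z))"
    proof (rule mult_left_mono)
      have "0 \<le> Cu * norm z" using Cu by simp
      then show "1 + norm y + \<bar>c\<bar> + norm z \<le> (1 + Cu) * (1 + norm y + norm z)" using that(2) by (simp add: algebra_simps)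
    qed (rule Bb)
    finally show ?thesis by (simp add: B0_def mult.assoc)
  qed
  have csx: "continuous_on ({0..T} \<times> UNIV) (\<lambda>(r, y). \<sigma> r y 0)"
  proof -
    have "continuous_on ({0..T} \<times> UNIV) (\<lambda>p. (\<lambda>(t, x, y). \<sigma> t x y) (fst p, snd p, 0))"
      by (rule continuous_on_compose2[OF conts]) (auto intro!: continuous_intros)
    then show ?thesis by (simp add: case_prod_unfold)
  qed
  obtain Sb where Sb: "0 \<le> Sb" "\<And>r. r \<in> {0..T} \<Longrightarrow> norm (\<sigma> r 0 0) \<le> Sb"
  proof -
    have "continuous_on {0..T} (\<lambda>r. (\<lambda>(r, y). \<sigma> r y 0) (r, 0))"
      by (rule continuous_on_compose2[OF csx]) (auto intro!: continuous_intros)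
    then have "continuous_on {0..T} (\<lambda>r. \<sigma> r 0 0)" by simp
    then show thesis by (rule bounded_in_time) (rule that)
  qed
  define S0 where "S0 = max Sb Ls"
  have S0: "0 \<le> S0" using Sb by (simp add: S0_def)
  have ls: "norm (\<sigma> r y c - \<sigma> r z c') \<le> S0 * norm (y - z)" if "r \<in> {0..T}" for r y z c c'
  proof -
    have "norm (\<sigma> r y c - \<sigma> r z c') \<le> Ls * norm (y - z)"
      using lipschitz_onD[OF lips[OF that, of c], of y z] indep[OF that, of z c c'] by (simp add: dist_norm)
    also have "\<dots> \<le> S0 * norm (y - z)" by (intro mult_right_mono) (auto simp: S0_def)
    finally show ?thesis .
  qed
  have gs: "norm (\<sigma> r y c) \<le> S0 * (1 + norm y)" if "r \<in> {0..T}" for r y c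
  proof -
    have "norm (\<sigma> r y c) \<le> norm (\<sigma> r y c - \<sigma> r 0 0) + norm (\<sigma> r 0 0)" using norm_triangle_ineq[of "\<sigma> r y c - \<sigma> r 0 0" "\<sigma> r 0 0"] by simp
    then show ?thesis using ls[OF that, of y c 0 0] Sb(2)[OF that] by (simp add: S0_def distrib_left)
  qed

  \<comment> \<open>Constants fixed by the data\<close>
  obtain \<rho> C where \<rho>: "0 < \<rho>" "0 \<le> C" "\<And>x. norm x \<le> 2 * \<rho> \<Longrightarrow> \<psi> x \<le> ereal C" using bounded_near_0 by blast
  \<comment> \<open>Bound for \<open>\<alpha> |x1 - x2|\<close>: \<open>2 * L\<close> from the
    Lipschitz constants, and \<open>1\<close> reserved for the mismatch of the weights at two
    different times.\<close>
  define La where "La = 2 * L + 1"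
  define L3 where "L3 = 3 * L + 1"
  have LaL3: "0 \<le> La" "0 \<le> L3" "1 \<le> La" "L + La = L3" using L0 by (auto simp: La_def L3_def)
  define C1 where "C1 = (La + 1) * Lb * (2 + 2 * S0) + 2 * B0 * (1 + (La + L3) * S0)"
  have C1: "0 \<le> C1" using LaL3 Lb S0 B0 by (simp add: C1_def)
  define CC where "CC = C1 + 2 * S0\<^sup>2 + C + 1"
  have CC: "0 \<le> CC" using C1 \<rho> by (simp add: CC_def)
  \<comment> \<open>\<open>lam / 2\<close> is the gain from the time derivative of the weights; it
    exceeds the sum \<open>CC\<close> of the coefficients of \<open>m * ww\<close> in the final
    estimate by one.\<close>
  define lam where "lam = 2 * CC + 2"
  have lam: "0 \<le> lam" using CC by (simp add: lam_def)
  define e where "e r = exp (lam * (T - r))" for r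
  have e1: "1 \<le> e r" if "r \<in> {0..T}" for r using that lam by (simp add: e_def)
  define W where "W r y = e r * (1 + (norm y)\<^sup>2)" for r and y :: "real^'n"
  have We: "e r \<le> W r y" "1 + (norm y)\<^sup>2 \<le> W r y" "1 \<le> W r y" if "r \<in> {0..T}" for r y
  proof -
    show "e r \<le> W r y" using e1[OF that] mult_left_mono[of 1 "1 + (norm y)\<^sup>2" "e r"] by (simp add: W_def)
    show "1 + (norm y)\<^sup>2 \<le> W r y" using e1[OF that] mult_right_mono[of 1 "e r" "1 + (norm y)\<^sup>2"] by (simp add: W_def)
    then show "1 \<le> W r y" using zero_le_power2[of "norm y"] by linarith
  qed

  \<comment> \<open>The excess of the subsolution\<close>
  define Q where "Q = (\<lambda>(r, y). (u r y - v r y) / W r y) ` ({0..T} \<times> D)"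
  have bdd: "bdd_above Q"
  proof (rule bdd_aboveI)
    fix q assume "q \<in> Q"
    then obtain r y where ry: "r \<in> {0..T}" "y \<in> D" "q = (u r y - v r y) / W r y" by (auto simp: Q_def)
    have "norm y \<le> 1 + (norm y)\<^sup>2" using sum_squares_bound[of "norm y" 1] norm_ge_zero[of y] unfolding power_one mult_1_right by linarith
    then have ny: "norm y \<le> W r y" using We(2)[OF ry(1), of y] by linarith
    have "u r y - v r y \<le> A + L * norm y + L * norm y" using gUV[OF ry(1,1), of y y] DD U(1) V(1) ry by auto
    also have "\<dots> \<le> A * W r y + 2 * L * W r y"
      using mult_left_mono[OF ny L0] mult_left_mono[OF We(3)[OF ry(1), of y] A(1)] by simp
    finally have "u r y - v r y \<le> (A + 2 * L) * W r y" by (simp add: distrib_right)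
    then show "q \<le> A + 2 * L" using We(3)[OF ry(1), of y] by (simp add: ry(3) divide_le_eq)
  qed
  \<comment> \<open>Half of the supremum: some point still has an excess above \<open>m\<close>
    times the weight, while everywhere it is at most \<open>2 * m\<close> times the weight. The
    latter bounds the zero-order differences in the coefficients.\<close>
  define m where "m = Sup Q / 2"
  have qS: "(u r y - v r y) / W r y \<le> 2 * m" if "r \<in> {0..T}" "y \<in> D" for r y
  proof -
    have "(u r y - v r y) / W r y \<in> Q" unfolding Q_def using that by force
    from cSup_upper[OF this bdd] show ?thesis by (simp add: m_def)
  qed
  have m: "0 < m"
  proof -
    have "0 < (u t x - v t x) / W t x" using bad We(3)[OF tx(1), of x] by simp
    then show ?thesis using qS[of t x] tx by (simp add: D_def)
  qed
  have uv2: "u r y - v r y \<le> 2 * m * W r y" if "r \<in> {0..T}" "y \<in> D" for r y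
    using qS[OF that] We(3)[OF that(1), of y] by (simp add: divide_le_eq)
  obtain t0 x' where t0: "t0 \<in> {0..T}" "x' \<in> D" "m * W t0 x' < u t0 x' - v t0 x'"
  proof -
    have "Q \<noteq> {}" using T0 D0 by (auto simp: Q_def)
    then obtain q where "q \<in> Q" "m < q" using less_cSup_iff[OF _ bdd, of m] m by (auto simp: m_def)
    then obtain r y where "r \<in> {0..T}" "y \<in> D" "m < (u r y - v r y) / W r y" by (auto simp: Q_def)
    then show thesis using that[of r y] We(3)[of r y] by (simp add: less_divide_eq)
  qed
  have shrinkD: "(1 - \<tau>) *\<^sub>R x' \<in> D" if "0 \<le> \<tau>" "\<tau> \<le> 1" for \<tau>
    using convexD[OF convD t0(2) D0, of "1 - \<tau>" \<tau>] that by simp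
  \<comment> \<open>A small step towards \<open>0\<close> preserves the strict inequality and
    reaches a point of bounded slope, where the barrier can vanish.\<close>
  obtain \<tau> where \<tau>: "0 < \<tau>" "\<tau> \<le> 1" "m * W t0 ((1 - \<tau>) *\<^sub>R x') < u t0 ((1 - \<tau>) *\<^sub>R x') - v t0 ((1 - \<tau>) *\<^sub>R x')"
  proof -
    let ?y = "\<lambda>n. (1 - 1 / real (Suc n)) *\<^sub>R x'"
    have s0: "(\<lambda>n. 1 / real (Suc n)) \<longlonglongrightarrow> 0" using LIMSEQ_inverse_real_of_nat by (simp add: inverse_eq_divide)
    have "?y \<longlonglongrightarrow> (1 - 0) *\<^sub>R x'" by (intro tendsto_intros s0)
    then have ly: "?y \<longlonglongrightarrow> x'" by simp
    have yD: "?y n \<in> D" for n by (rule shrinkD) auto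
    have cu: "continuous_on D (u t0)" "continuous_on D (v t0)"
      using lipu[OF t0(1)] lipv[OF t0(1)] lipschitz_on_continuous_on unfolding D_def by blast+
    have "(\<lambda>n. u t0 (?y n) - v t0 (?y n) - m * W t0 (?y n)) \<longlonglongrightarrow> u t0 x' - v t0 x' - m * W t0 x'"
      unfolding W_def
      by (intro tendsto_intros ly continuous_on_tendsto_compose[OF cu(1) ly t0(2)] continuous_on_tendsto_compose[OF cu(2) ly t0(2)] always_eventually allI yD)
    then have "\<forall>\<^sub>F n in sequentially. 0 < u t0 (?y n) - v t0 (?y n) - m * W t0 (?y n)"
      by (rule order_tendstoD) (use t0 in simp)
    then obtain n where "0 < u t0 (?y n) - v t0 (?y n) - m * W t0 (?y n)" by (meson eventually_happens sequentially_bot)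
    then show thesis using that[of "1 / real (Suc n)"] by simp
  qed
  define x0 where "x0 = (1 - \<tau>) *\<^sub>R x'"
  have x0D: "x0 \<in> D" unfolding x0_def using shrinkD \<tau> by simp
  obtain k0 where k0: "calm k0 x0" using calm_shrink[OF fD[OF t0(2)] \<tau>(1,2)] unfolding x0_def by blast

  \<comment> \<open>Radius and barrier\<close>
  define c0 where "c0 = U t0 x0 - V t0 x0 - m * W t0 x0"
  have c0: "0 < c0" using \<tau>(3) U(1)[OF t0(1) x0D] V(1)[OF t0(1) x0D] by (simp add: c0_def x0_def)
  define R where "R = 1 + norm x0 + (4 / m) * (A + 2 * L\<^sup>2 / m)"
  have RR: "1 \<le> R" "(4 / m) * (A + 2 * L\<^sup>2 / m) < R" "norm x0 \<le> R"
  proof -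
    have "0 \<le> (4 / m) * (A + 2 * L\<^sup>2 / m)" using m A by simp
    then show "1 \<le> R" "(4 / m) * (A + 2 * L\<^sup>2 / m) < R" "norm x0 \<le> R" using norm_ge_zero[of x0] unfolding R_def by linarith+
  qed
  \<comment> \<open>A bound for the barrier gradient at the maximum, known before the barrier is
    chosen: its outward derivative there is at most \<open>L3 * R\<close> and at least
    \<open>\<rho>\<close> times its norm.\<close>
  define \<Gamma> where "\<Gamma> = L3 * R / \<rho>"
  have \<Gamma>: "0 \<le> \<Gamma>" using LaL3 RR \<rho> by (simp add: \<Gamma>_def)
  define K where "K = (C + (R + 1) + \<rho>) / \<rho>"
  have K: "0 \<le> K" using \<rho> RR by (simp add: K_def)
  define X where "X = (La + 1) * Lb * S0 * (1 + R) + B0 * S0 * (1 + R) * L3 + B0 * (1 + R) * (1 + (La + L3 + \<Gamma>) * S0)"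
  have X: "0 \<le> X" using LaL3 Lb S0 B0 RR \<Gamma> by (simp add: X_def)
  \<comment> \<open>Cost of the barrier per unit of \<open>\<omega> \<kappa>\<close>: its Hessian
    through the covariance, its gradient through the first-order coefficients.
    \<open>\<omega>\<close> keeps this cost below the gain
    \<open>(m * \<rho> / 4) \<kappa>\<close>.\<close>
  define Q' where "Q' = (1/2) * (S0\<^sup>2 * (1 + R)\<^sup>2) + X"
  have Q': "0 \<le> Q'" using X by (simp add: Q'_def)
  define \<omega> where "\<omega> = m * \<rho> / (8 * K + 4 * Q' + 1)"
  have \<omega>: "0 < \<omega>" "8 * (K * \<omega>) \<le> m * \<rho>" "4 * (\<omega> * Q') \<le> m * \<rho>"
  proof -
    have z: "0 < 8 * K + 4 * Q' + 1" using K Q' by simp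
    have mr: "0 < m * \<rho>" using m \<rho> by simp
    show "0 < \<omega>" using z mr by (simp add: \<omega>_def)
    have e: "\<omega> * (8 * K + 4 * Q' + 1) = m * \<rho>" using z by (simp add: \<omega>_def)
    have "0 \<le> \<omega> * K" "0 \<le> \<omega> * Q'" using \<open>0 < \<omega>\<close> K Q' by simp_all
    then show "8 * (K * \<omega>) \<le> m * \<rho>" "4 * (\<omega> * Q') \<le> m * \<rho>" using e \<open>0 < \<omega>\<close> by (auto simp: algebra_simps)
  qed
  \<comment> \<open>The points to be excluded. A locally compact domain is open in its closure,
    hence this set is compact.\<close>
  define M where "M = (?D - D) \<inter> cball 0 R"
  have M: "compact M" "\<And>x. x \<in> M \<Longrightarrow> \<psi> x = \<infinity>"
  proof -
    obtain O1 where O1: "open O1" "D = O1 \<inter> ?D" using locally_compact_open_Int_closure[of D] lc unfolding D_def by blast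
    then have e: "?D - D = ?D - O1" by blast
    have "closed (?D - D)" unfolding e by (rule closed_Diff[OF closed_closure O1(1)])
    then show "compact M" unfolding M_def by (rule closed_Int_compact) (rule compact_cball)
    show "\<psi> x = \<infinity>" if "x \<in> M" for x using that by (auto simp: M_def D_def effective_domain_def)
  qed
  have x0R1: "norm x0 \<le> R + 1" using RR by simp
  have R0: "0 \<le> R" using RR(1) by simp
  \<comment> \<open>The requested outward derivative \<open>L3 * R + 1\<close> exceeds the bound
    \<open>L3 * R\<close> that holds at the maximum.\<close>
  have "\<exists>P. continuous_on UNIV P \<and> (\<forall>x. 0 \<le> P x) \<and> P x0 = 0 \<and> (\<forall>x0. norm x0 \<le> R \<longrightarrow> (\<exists>G \<kappa>. 0 \<le> \<kappa> \<and> norm G \<le> \<omega> * \<kappa> \<and> \<rho> * norm G \<le> G \<bullet> x0 \<and> (x0 \<in> M \<longrightarrow> L3 * R + 1 \<le> G \<bullet> x0) \<and>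
       (\<forall>\<^sub>F x in nhds x0. P x \<le> P x0 + G \<bullet> (x - x0) + (1/2) * (\<omega> * \<kappa>) * (norm (x - x0))\<^sup>2) \<and>
       (\<forall>\<epsilon>>0. \<forall>\<^sub>F x in nhds x0. \<forall>\<xi>\<in>subdifferential \<psi> x. \<kappa> \<le> 2 * norm \<xi> \<and> - (K * \<omega> * \<kappa>) - \<epsilon> * (1 + norm \<xi>) \<le> \<xi> \<bullet> G)))"
    apply (rule barrier_exists[OF \<rho> R0 \<omega>(1) M k0 x0R1, of "L3 * R + 1", folded K_def])
      apply assumption+
    subgoal premises p for P by (intro exI[of _ P] conjI allI impI p)
    done
  then obtain P where P0: "continuous_on UNIV P" "\<forall>x. 0 \<le> P x" "P x0 = 0" and Pex0: "\<forall>x0. norm x0 \<le> R \<longrightarrow> (\<exists>G \<kappa>. 0 \<le> \<kappa> \<and> norm G \<le> \<omega> * \<kappa> \<and> \<rho> * norm G \<le> G \<bullet> x0 \<and> (x0 \<in> M \<longrightarrow> L3 * R + 1 \<le> G \<bullet> x0) \<and>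
       (\<forall>\<^sub>F x in nhds x0. P x \<le> P x0 + G \<bullet> (x - x0) + (1/2) * (\<omega> * \<kappa>) * (norm (x - x0))\<^sup>2) \<and>
       (\<forall>\<epsilon>>0. \<forall>\<^sub>F x in nhds x0. \<forall>\<xi>\<in>subdifferential \<psi> x. \<kappa> \<le> 2 * norm \<xi> \<and> - (K * \<omega> * \<kappa>) - \<epsilon> * (1 + norm \<xi>) \<le> \<xi> \<bullet> G))"
    by (elim exE conjE) (rule that)
  note P = P0(1) P0(2)[rule_format] P0(3) and Pex = Pex0[rule_format]

  \<comment> \<open>Penalization parameters\<close>
  define Y0 where "Y0 = (La + 1) * Lb"
  have Y0: "0 \<le> Y0" using LaL3 Lb by (simp add: Y0_def)
  \<comment> \<open>The total coefficient of the distance \<open>rr\<close> of the maximum points in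
    the error terms; \<open>\<alpha> * rr \<le> La\<close> removes \<open>\<alpha>\<close> from the
    squared term.\<close>
  define Q0 where "Q0 = S0\<^sup>2 * La + Y0 * (1 + L + La * S0)"
  have Q0: "0 \<le> Q0" using LaL3 Y0 L0 S0 by (simp add: Q0_def)
  \<comment> \<open>The summand with \<open>m\<close> keeps the errors from \<open>rr\<close> below
    \<open>m / 2\<close>; the one with \<open>c0\<close> keeps the maximum away from the terminal
    time.\<close>
  define \<alpha> where "\<alpha> = 1 + 2 * (Q0 * La) / m + 4 * (L * La) / c0"
  have \<alpha>: "1 \<le> \<alpha>" "Q0 * La \<le> \<alpha> * (m / 2)" "L * La \<le> \<alpha> * (c0 / 4)"
  proof -
    have a: "0 \<le> 2 * (Q0 * La) / m" "0 \<le> 4 * (L * La) / c0" using Q0 LaL3 m c0 L0 by auto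
    then show "1 \<le> \<alpha>" unfolding \<alpha>_def by linarith
    have "2 * (Q0 * La) / m \<le> \<alpha>" "4 * (L * La) / c0 \<le> \<alpha>" using a unfolding \<alpha>_def by linarith+
    then show "Q0 * La \<le> \<alpha> * (m / 2)" "L * La \<le> \<alpha> * (c0 / 4)" using m c0 by (auto simp: divide_le_eq)
  qed
  define ZZ where "ZZ = \<alpha> + Y0 * (2 + La) + 1"
  have ZZ: "1 \<le> ZZ" using \<alpha> Y0 LaL3 mult_nonneg_nonneg[of Y0 "2 + La"] by (simp add: ZZ_def)
  \<comment> \<open>Tolerance for all variations in time, chosen after \<open>\<alpha>\<close>
    because \<open>\<alpha> * \<eta>\<^sup>2\<close> occurs among the errors.\<close>
  define \<eta> where "\<eta> = min 1 (min (c0 / 4) (m / (2 * ZZ)))"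
  have \<eta>: "0 < \<eta>" "\<eta> \<le> 1" "\<eta> \<le> c0 / 4" "\<alpha> * \<eta>\<^sup>2 + Y0 * (2 + La) * \<eta> \<le> m / 2"
  proof -
    show "0 < \<eta>" "\<eta> \<le> 1" "\<eta> \<le> c0 / 4" using c0 m ZZ by (auto simp: \<eta>_def)
    then have "\<eta>\<^sup>2 \<le> \<eta>" using mult_left_mono[of \<eta> 1 \<eta>] by (simp add: power2_eq_square)
    then have "\<alpha> * \<eta>\<^sup>2 + Y0 * (2 + La) * \<eta> \<le> \<alpha> * \<eta> + Y0 * (2 + La) * \<eta>" using \<alpha> by (intro add_right_mono mult_left_mono) auto
    also have "\<dots> \<le> ZZ * \<eta>" using \<open>0 < \<eta>\<close> by (simp add: ZZ_def algebra_simps)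
    also have "\<dots> \<le> ZZ * (m / (2 * ZZ))" using ZZ by (intro mult_left_mono) (auto simp: \<eta>_def)
    also have "\<dots> = m / 2" using ZZ by simp
    finally show "\<alpha> * \<eta>\<^sup>2 + Y0 * (2 + La) * \<eta> \<le> m / 2" .
  qed
  \<comment> \<open>\<open>BY\<close> and \<open>BZ\<close> bound the solution value and the
    argument \<open>z2\<close> at the maximum, so that \<open>b\<close> and \<open>f\<close> are
    compared at different times on a compact set only.\<close>
  define BY where "BY = Cu * (1 + R)"
  define BZ where "BZ = (La + L3 + \<Gamma>) * (S0 * (1 + R))"
  have kD: "compact (?D \<inter> cball 0 R)" by (intro closed_Int_compact closed_closure compact_cball)
  obtain dU where dU: "0 < dU" "\<And>r s y. r \<in> {0..T} \<Longrightarrow> s \<in> {0..T} \<Longrightarrow> y \<in> ?D \<Longrightarrow> norm y \<le> R \<Longrightarrow> \<bar>r - s\<bar> < dU \<Longrightarrow> \<bar>U r y - U s y\<bar> < \<eta>"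
    by (rule uniform_time_modulus[OF kD continuous_on_subset[OF cU] \<eta>(1)]) (auto simp: dist_real_def)
  obtain dV where dV: "0 < dV" "\<And>r s y. r \<in> {0..T} \<Longrightarrow> s \<in> {0..T} \<Longrightarrow> y \<in> ?D \<Longrightarrow> norm y \<le> R \<Longrightarrow> \<bar>r - s\<bar> < dV \<Longrightarrow> \<bar>V r y - V s y\<bar> < \<eta>"
    by (rule uniform_time_modulus[OF kD continuous_on_subset[OF cV] \<eta>(1)]) (auto simp: dist_real_def)
  obtain dS where dS: "0 < dS" "\<And>r s y. r \<in> {0..T} \<Longrightarrow> s \<in> {0..T} \<Longrightarrow> norm y \<le> R \<Longrightarrow> \<bar>r - s\<bar> < dS \<Longrightarrow> norm (\<sigma> r y 0 - \<sigma> s y 0) < \<eta>"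
    by (rule uniform_time_modulus[OF compact_cball[of 0 R] continuous_on_subset[OF csx] \<eta>(1)]) (auto simp: dist_norm)
  have kB: "compact (cball (0::real^'n) R \<times> cball (0::real) BY \<times> cball (0::real^'d) BZ)" by (intro compact_Times compact_cball)
  obtain dB where dB: "0 < dB" "\<And>r s y c z. r \<in> {0..T} \<Longrightarrow> s \<in> {0..T} \<Longrightarrow> norm y \<le> R \<Longrightarrow> \<bar>c\<bar> \<le> BY \<Longrightarrow> norm z \<le> BZ \<Longrightarrow> \<bar>r - s\<bar> < dB \<Longrightarrow>
      norm (b r y c z - b s y c z) < \<eta>"
    by (rule uniform_time_modulus[OF kB continuous_on_subset[OF contb] \<eta>(1)]) (auto simp: dist_norm)
  obtain dF where dF: "0 < dF" "\<And>r s y c z. r \<in> {0..T} \<Longrightarrow> s \<in> {0..T} \<Longrightarrow> norm y \<le> R \<Longrightarrow> \<bar>c\<bar> \<le> BY \<Longrightarrow> norm z \<le> BZ \<Longrightarrow> \<bar>r - s\<bar> < dF \<Longrightarrow>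
      \<bar>f r y c z - f s y c z\<bar> < \<eta>"
    by (rule uniform_time_modulus[OF kB continuous_on_subset[OF contf] \<eta>(1)]) (auto simp: dist_norm)
  have mR: "0 < 1 / (m * R)" using m RR by simp
  obtain dE where dE: "0 < dE" "\<And>r s. r \<in> {0..T} \<Longrightarrow> s \<in> {0..T} \<Longrightarrow> \<bar>r - s\<bar> < dE \<Longrightarrow> \<bar>e r - e s\<bar> < 1 / (m * R)"
  proof -
    have ce: "continuous_on ({0..T} \<times> {0::real}) (\<lambda>z. e (fst z))" unfolding e_def by (intro continuous_intros)
    show thesis by (rule uniform_time_modulus[OF _ ce mR]) (use that in \<open>auto simp: dist_real_def\<close>)
  qed
  define d where "d = min (min dU dV) (min (min dS dB) (min dF dE))"
  have d: "0 < d" "d \<le> dU" "d \<le> dV" "d \<le> dS" "d \<le> dB" "d \<le> dF" "d \<le> dE" using dU dV dS dB dF dE by (auto simp: d_def)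
  \<comment> \<open>Turns the bound on \<open>\<beta> / 2 * (t1 - t2)\<^sup>2\<close> from
    \<open>penalized_maximum\<close> into \<open>|t1 - t2| < d\<close>.\<close>
  define \<beta> where "\<beta> = 2 * (A + 2 * L * R + 1) / d\<^sup>2"
  have AL: "0 \<le> A + 2 * L * R" using A L0 RR by simp
  have \<beta>: "0 < \<beta>" using AL d by (simp add: \<beta>_def)
  have pt: "c0 \<le> U t0 x0 - V t0 x0 - m * (exp (lam * (T - t0)) * (1 + (norm x0)\<^sup>2))" by (simp add: c0_def W_def e_def)
  have x0Dc: "x0 \<in> ?D" using x0D DD by blast
  have convc: "convex ?D" by (rule convex_closure[OF convD])
  have \<alpha>0: "0 \<le> \<alpha>" using \<alpha> by simp
  have \<beta>0: "0 \<le> \<beta>" using \<beta> by simp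

  \<comment> \<open>The maximum lies in the domain and before the terminal time\<close>
  define \<Phi> where "\<Phi> t x s y = U t x - V s y - \<alpha> / 2 * (norm (x - y))\<^sup>2 - \<beta> / 2 * (t - s)\<^sup>2
     - m / 2 * (exp (lam * (T - t)) * (1 + (norm x)\<^sup>2)) - m / 2 * (exp (lam * (T - s)) * (1 + (norm y)\<^sup>2)) - P x - P y" for t x s y
  have "\<exists>t1 x1 t2 x2. t1 \<in> {0..T} \<and> x1 \<in> ?D \<and> t2 \<in> {0..T} \<and> x2 \<in> ?D \<and> norm x1 < R \<and> norm x2 < R \<and> c0 \<le> U t1 x1 - V t2 x2 \<and>
      (\<forall>t x s y. t \<in> {0..T} \<longrightarrow> x \<in> ?D \<longrightarrow> norm x \<le> R \<longrightarrow> s \<in> {0..T} \<longrightarrow> y \<in> ?D \<longrightarrow> norm y \<le> R \<longrightarrow> \<Phi> t x s y \<le> \<Phi> t1 x1 t2 x2) \<and>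
      \<beta> / 2 * (t1 - t2)\<^sup>2 \<le> A + 2 * L * R \<and> \<alpha> * norm (x1 - x2) \<le> 2 * L + m * R * \<bar>e t1 - e t2\<bar> \<and>
      (\<forall>G \<kappa>. (\<forall>\<^sub>F x in nhds x1. P x \<le> P x1 + G \<bullet> (x - x1) + \<kappa> * (norm (x - x1))\<^sup>2) \<longrightarrow>
         G \<bullet> x1 + m * e t1 * (norm x1)\<^sup>2 \<le> (L + \<alpha> * norm (x1 - x2)) * norm x1) \<and>
      (\<forall>G \<kappa>. (\<forall>\<^sub>F x in nhds x2. P x \<le> P x2 + G \<bullet> (x - x2) + \<kappa> * (norm (x - x2))\<^sup>2) \<longrightarrow>
         G \<bullet> x2 + m * e t2 * (norm x2)\<^sup>2 \<le> (L + \<alpha> * norm (x1 - x2)) * norm x2)"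
    apply (rule penalized_maximum[OF closed_closure convc D0c U(2) V(2) cU cV P(1,2) m lam \<alpha>0 \<beta>0 A(1) gUV RR(1,2) t0(1) x0Dc RR(3) P(3) c0 pt])
    apply assumption+
    subgoal premises p for t1 x1 t2 x2
      unfolding \<Phi>_def e_def
      by (intro exI[of _ t1] exI[of _ x1] exI[of _ t2] exI[of _ x2] conjI allI impI p(1-7,9,10))
        (rule p(8) p(11) p(12); assumption)+
    done
  then obtain t1 x1 t2 x2 where in1: "t1 \<in> {0..T}" "x1 \<in> ?D" and in2: "t2 \<in> {0..T}" "x2 \<in> ?D" and nR: "norm x1 < R" "norm x2 < R"
      and UV: "c0 \<le> U t1 x1 - V t2 x2"
      and max0: "\<forall>t x s y. t \<in> {0..T} \<longrightarrow> x \<in> ?D \<longrightarrow> norm x \<le> R \<longrightarrow> s \<in> {0..T} \<longrightarrow> y \<in> ?D \<longrightarrow> norm y \<le> R \<longrightarrow> \<Phi> t x s y \<le> \<Phi> t1 x1 t2 x2"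
      and tb: "\<beta> / 2 * (t1 - t2)\<^sup>2 \<le> A + 2 * L * R"
      and xy: "\<alpha> * norm (x1 - x2) \<le> 2 * L + m * R * \<bar>e t1 - e t2\<bar>"
      and inw0: "\<forall>G \<kappa>. (\<forall>\<^sub>F x in nhds x1. P x \<le> P x1 + G \<bullet> (x - x1) + \<kappa> * (norm (x - x1))\<^sup>2) \<longrightarrow>
         G \<bullet> x1 + m * e t1 * (norm x1)\<^sup>2 \<le> (L + \<alpha> * norm (x1 - x2)) * norm x1"
      "\<forall>G \<kappa>. (\<forall>\<^sub>F x in nhds x2. P x \<le> P x2 + G \<bullet> (x - x2) + \<kappa> * (norm (x - x2))\<^sup>2) \<longrightarrow>
         G \<bullet> x2 + m * e t2 * (norm x2)\<^sup>2 \<le> (L + \<alpha> * norm (x1 - x2)) * norm x2"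
    by (elim exE conjE) (rule that)
  note max = max0[rule_format] and inw1 = inw0(1)[rule_format] and inw2 = inw0(2)[rule_format]
  have t12: "\<bar>t1 - t2\<bar> < d"
  proof -
    have "\<beta> / 2 * (t1 - t2)\<^sup>2 < \<beta> / 2 * d\<^sup>2" using tb d by (simp add: \<beta>_def)
    then have "\<bar>t1 - t2\<bar>\<^sup>2 < d\<^sup>2" using \<beta> by simp
    then show ?thesis using d by (intro power2_less_imp_less[of _ d]) auto
  qed
  define rr where "rr = norm (x1 - x2)"
  have rr0: "0 \<le> rr" by (simp add: rr_def)
  have rr: "\<alpha> * rr \<le> La"
  proof -
    have "m * R * \<bar>e t1 - e t2\<bar> \<le> m * R * (1 / (m * R))"
      using dE(2)[OF in1(1) in2(1)] t12 d m RR by (intro mult_left_mono) auto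
    also have "\<dots> = 1" using m RR by simp
    finally show ?thesis using xy by (simp add: rr_def La_def)
  qed
  have rrk: "Q0 * rr \<le> m / 2" "L * rr \<le> c0 / 4"
  proof -
    have "\<alpha> * (Q0 * rr) \<le> \<alpha> * (m / 2)" using mult_left_mono[OF rr Q0] \<alpha>(2) by (simp add: mult_ac)
    then show "Q0 * rr \<le> m / 2" using \<alpha>(1) by (simp only: mult_le_cancel_left_pos)
    have "\<alpha> * (L * rr) \<le> \<alpha> * (c0 / 4)" using mult_left_mono[OF rr L0] \<alpha>(3) by (simp add: mult_ac)
    then show "L * rr \<le> c0 / 4" using \<alpha>(1) by (simp only: mult_le_cancel_left_pos)
  qed
  obtain G1 \<kappa>1 where G1: "0 \<le> \<kappa>1" "norm G1 \<le> \<omega> * \<kappa>1" "\<rho> * norm G1 \<le> G1 \<bullet> x1" "x1 \<in> M \<Longrightarrow> L3 * R + 1 \<le> G1 \<bullet> x1"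
       and q1: "\<forall>\<^sub>F x in nhds x1. P x \<le> P x1 + G1 \<bullet> (x - x1) + (1/2) * (\<omega> * \<kappa>1) * (norm (x - x1))\<^sup>2"
       and s1: "\<And>\<epsilon>. 0 < \<epsilon> \<Longrightarrow> \<forall>\<^sub>F x in nhds x1. \<forall>\<xi>\<in>subdifferential \<psi> x. \<kappa>1 \<le> 2 * norm \<xi> \<and> - (K * \<omega> * \<kappa>1) - \<epsilon> * (1 + norm \<xi>) \<le> \<xi> \<bullet> G1"
    using Pex[OF less_imp_le[OF nR(1)]] by blast
  obtain G2 \<kappa>2 where G2: "0 \<le> \<kappa>2" "norm G2 \<le> \<omega> * \<kappa>2" "\<rho> * norm G2 \<le> G2 \<bullet> x2" "x2 \<in> M \<Longrightarrow> L3 * R + 1 \<le> G2 \<bullet> x2"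
       and q2: "\<forall>\<^sub>F x in nhds x2. P x \<le> P x2 + G2 \<bullet> (x - x2) + (1/2) * (\<omega> * \<kappa>2) * (norm (x - x2))\<^sup>2"
       and s2: "\<And>\<epsilon>. 0 < \<epsilon> \<Longrightarrow> \<forall>\<^sub>F x in nhds x2. \<forall>\<xi>\<in>subdifferential \<psi> x. \<kappa>2 \<le> 2 * norm \<xi> \<and> - (K * \<omega> * \<kappa>2) - \<epsilon> * (1 + norm \<xi>) \<le> \<xi> \<bullet> G2"
    using Pex[OF less_imp_le[OF nR(2)]] by blast
  \<comment> \<open>Since \<open>\<rho> * norm G \<le> G \<bullet> y\<close>, both terms on the left
    of the inward inequality are nonnegative, and each is bounded by \<open>L3\<close> times the
    norm of \<open>y\<close>.\<close>
  have inward: "m * er * norm y \<le> L3 \<and> norm G \<le> \<Gamma> \<and> G \<bullet> y \<le> L3 * R"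
    if i: "G \<bullet> y + m * er * (norm y)\<^sup>2 \<le> (L + \<alpha> * norm (x1 - x2)) * norm y" and Gy: "\<rho> * norm G \<le> G \<bullet> y" and y: "norm y < R" and er: "1 \<le> er" for G y :: "real^'n" and er
  proof -
    have "(L + \<alpha> * norm (x1 - x2)) * norm y \<le> L3 * norm y" using rr LaL3(4) by (intro mult_right_mono) (auto simp: rr_def)
    then have i': "G \<bullet> y + m * er * (norm y)\<^sup>2 \<le> L3 * norm y" using i by linarith
    have nn: "0 \<le> \<rho> * norm G" "0 \<le> m * er * (norm y)\<^sup>2" using \<rho> m er by auto
    have "m * er * norm y \<le> L3"
    proof (cases "y = 0")
      case False
      have "(m * er * norm y) * norm y \<le> L3 * norm y" using i' Gy nn by (simp add: power2_eq_square mult.assoc)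
      then show ?thesis using False by simp
    qed (use LaL3 in simp)
    moreover have Gb: "G \<bullet> y \<le> L3 * R" using i' nn mult_left_mono[OF less_imp_le[OF y] LaL3(2)] by linarith
    moreover have "norm G \<le> \<Gamma>" using Gb Gy \<rho> by (simp add: \<Gamma>_def le_divide_eq mult.commute)
    ultimately show ?thesis by blast
  qed
  note iw1 = inward[OF inw1[OF q1] G1(3) nR(1) e1[OF in1(1)]] and iw2 = inward[OF inw2[OF q2] G2(3) nR(2) e1[OF in2(1)]]
  have x1D: "x1 \<in> D"
  proof (rule ccontr)
    assume "x1 \<notin> D"
    then have "x1 \<in> M" using in1(2) nR(1) by (simp add: M_def)
    then show False using G1(4) iw1 by linarith
  qed
  have x2D: "x2 \<in> D"
  proof (rule ccontr)
    assume "x2 \<notin> D"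
    then have "x2 \<in> M" using in2(2) nR(2) by (simp add: M_def)
    then show False using G2(4) iw2 by linarith
  qed
  have uU: "U t1 x1 = u t1 x1" "V t2 x2 = v t2 x2" using U(1) V(1) in1 in2 x1D x2D by auto
  have gT: "U T y = V T y" if "y \<in> D" for y
    using sub super U(1)[of T y] V(1)[of T y] that T unfolding viscosity_subsolution_def viscosity_supersolution_def D_def by auto
  have tT: "T \<in> {0..T}" using T by simp
  \<comment> \<open>At the terminal time the two solutions coincide, so the excess, which is at
    least \<open>c0\<close>, would be below \<open>L * rr + \<eta> \<le> c0 / 2\<close>.\<close>
  have t1T: "t1 < T"
  proof (rule ccontr)
    assume "\<not> t1 < T"
    then have t1: "t1 = T" using in1 by simp
    have "U t1 x1 - V t2 x2 = (V T x1 - V T x2) + (V T x2 - V t2 x2)" using gT[OF x1D] t1 by simp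
    moreover have "V T x1 - V T x2 \<le> L * rr" using lV[OF tT in1(2) in2(2)] by (simp add: rr_def abs_le_iff)
    moreover have "\<bar>V T x2 - V t2 x2\<bar> < \<eta>" using dV(2)[OF tT in2(1,2)] nR t12 d t1 by auto
    ultimately show False using UV rrk(2) \<eta>(3) c0 by linarith
  qed
  have t2T: "t2 < T"
  proof (rule ccontr)
    assume "\<not> t2 < T"
    then have t2: "t2 = T" using in2 by simp
    have "U t1 x1 - V t2 x2 = (U t1 x1 - U T x1) + (U T x1 - U T x2)" using gT[OF x2D] t2 by simp
    moreover have "U T x1 - U T x2 \<le> L * rr" using lU[OF tT in1(2) in2(2)] by (simp add: rr_def abs_le_iff)
    moreover have "\<bar>U t1 x1 - U T x1\<bar> < \<eta>" using dU(2)[OF in1(1) tT in1(2)] nR t12 d t2 by auto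
    ultimately show False using UV rrk(2) \<eta>(3) c0 by linarith
  qed

  \<comment> \<open>Expansion at the maximum and the doubled inequality\<close>
  define a where "a = \<alpha> *\<^sub>R (x1 - x2)"
  have na: "norm a \<le> La" using rr \<alpha>(1) by (simp add: a_def rr_def)
  define Q1 where "Q1 = a + (m * e t1) *\<^sub>R x1 + G1"
  define Q2 where "Q2 = a - (m * e t2) *\<^sub>R x2 - G2"
  \<comment> \<open>The time penalty contributes equally to \<open>p1\<close> and \<open>p2\<close>,
    so \<open>p1 - p2\<close> retains only the weights, with a negative sign.\<close>
  define p1 where "p1 = \<beta> * (t1 - t2) - m / 2 * lam * W t1 x1"
  define p2 where "p2 = \<beta> * (t1 - t2) + m / 2 * lam * W t2 x2"
  \<comment> \<open>The first summand is twice the Hessian of the weight term, which covers the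
    extra \<open>1\<close> in \<open>weight_expansion\<close> because
    \<open>e t1 \<ge> 1\<close>.\<close>
  define A1 where "A1 = 2 * m * e t1 + \<omega> * \<kappa>1"
  define A2 where "A2 = 2 * m * e t2 + \<omega> * \<kappa>2"
  obtain \<delta> where \<delta>: "0 < \<delta>" "\<And>x' q' \<xi> y' r' \<eta>. dist x' x1 < \<delta> \<Longrightarrow> dist q' Q1 < \<delta> \<Longrightarrow> \<xi> \<in> subdifferential \<psi> x' \<Longrightarrow>
        dist y' x2 < \<delta> \<Longrightarrow> dist r' (- Q2) < \<delta> \<Longrightarrow> \<eta> \<in> subdifferential \<psi> y' \<Longrightarrow>
        (m * \<rho> / 4) * (\<kappa>1 + \<kappa>2) - m * (C + 1) * (e t1 + e t2) \<le> \<xi> \<bullet> q' + \<eta> \<bullet> r'"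
  proof -
    have kw: "0 \<le> K * \<omega>" using K \<omega> by simp
    show thesis
      by (rule penalized_subgradient_bound[OF \<rho> m e1[OF in1(1)] e1[OF in2(1)] \<alpha>0 \<omega>(2) kw s1 s2 Q1_def[unfolded a_def] Q2_def[unfolded a_def]])
        (use that in blast)+
  qed
  obtain Cw where Cw: "0 \<le> Cw" "\<And>t s (x::real^'n) h. t \<in> {0..T} \<Longrightarrow> s \<in> {0..T} \<Longrightarrow> norm x \<le> R \<Longrightarrow> norm h \<le> 1 \<Longrightarrow>
     exp (lam * (T - s)) * (1 + (norm (x + h))\<^sup>2) \<le> exp (lam * (T - t)) * (1 + (norm x)\<^sup>2) - lam * (exp (lam * (T - t)) * (1 + (norm x)\<^sup>2)) * (s - t)
       + 2 * exp (lam * (T - t)) * (x \<bullet> h) + (exp (lam * (T - t)) + 1) * (norm h)\<^sup>2 + Cw * (s - t)\<^sup>2"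
    using weight_expansion[where 'a="real^'n", OF less_imp_le[OF T] lam RR(1)] by blast
  obtain r1 where r1: "0 < r1" "\<And>x. dist x x1 < r1 \<Longrightarrow> P x \<le> P x1 + G1 \<bullet> (x - x1) + (1/2) * (\<omega> * \<kappa>1) * (norm (x - x1))\<^sup>2"
    using q1 unfolding eventually_nhds_metric by blast
  obtain r2 where r2: "0 < r2" "\<And>x. dist x x2 < r2 \<Longrightarrow> P x \<le> P x2 + G2 \<bullet> (x - x2) + (1/2) * (\<omega> * \<kappa>2) * (norm (x - x2))\<^sup>2"
    using q2 unfolding eventually_nhds_metric by blast
  define r where "r = min (min r1 r2) (min 1 (min (R - norm x1) (R - norm x2)))"
  have r: "0 < r" "r \<le> r1" "r \<le> r2" "r \<le> 1" "r \<le> R - norm x1" "r \<le> R - norm x2" using r1 r2 nR by (auto simp: r_def)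
  have locmax: "u t x - v s y \<le> u t1 x1 - v t2 x2 + p1 * (t - t1) + Q1 \<bullet> (x - x1) - p2 * (s - t2) - Q2 \<bullet> (y - x2)
          + (1/2) * (\<alpha> * (norm ((x - x1) - (y - x2)))\<^sup>2 + A1 * (norm (x - x1))\<^sup>2 + A2 * (norm (y - x2))\<^sup>2)
          + (\<beta> + m / 2 * Cw) * ((t - t1)\<^sup>2 + (s - t2)\<^sup>2)"
    if tx: "t \<in> {0..T}" "x \<in> D" "s \<in> {0..T}" "y \<in> D" "norm ((t, x) - (t1, x1)) < r" "norm ((s, y) - (t2, x2)) < r" for t x s y
  proof -
    define h where "h = x - x1" define k where "k = y - x2"
    have hk: "norm h < r" "norm k < r"
      using tx(5,6) norm_snd_le[of "x - x1" "t - t1"] norm_snd_le[of "y - x2" "s - t2"] unfolding diff_Pair h_def k_def by linarith+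
    have xh: "x = x1 + h" "y = x2 + k" by (simp_all add: h_def k_def)
    have xR: "norm x \<le> R" "norm y \<le> R" unfolding xh using norm_triangle_ineq[of x1 h] norm_triangle_ineq[of x2 k] hk r by linarith+
    have hk1: "norm h \<le> 1" "norm k \<le> 1" using hk r by linarith+
    have "\<Phi> t x s y \<le> \<Phi> t1 x1 t2 x2" using tx DD xR by (intro max) auto
    then have main: "u t x - v s y \<le> u t1 x1 - v t2 x2 + (\<alpha> / 2 * (norm (x - y))\<^sup>2 - \<alpha> / 2 * (norm (x1 - x2))\<^sup>2)
        + (\<beta> / 2 * (t - s)\<^sup>2 - \<beta> / 2 * (t1 - t2)\<^sup>2) + (m / 2 * W t x - m / 2 * W t1 x1) + (m / 2 * W s y - m / 2 * W t2 x2) + (P x - P x1) + (P y - P x2)"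
      unfolding \<Phi>_def U(1)[OF tx(1,2)] V(1)[OF tx(3,4)] uU W_def e_def by linarith
    have t_a: "\<alpha> / 2 * (norm (x - y))\<^sup>2 - \<alpha> / 2 * (norm (x1 - x2))\<^sup>2 = a \<bullet> h - a \<bullet> k + \<alpha> / 2 * (norm (h - k))\<^sup>2"
    proof -
      have e: "x - y = (x1 - x2) + 1 *\<^sub>R (h - k)" unfolding xh by simp
      have n: "(norm (x - y))\<^sup>2 = (norm (x1 - x2))\<^sup>2 + 2 * ((x1 - x2) \<bullet> (h - k)) + (norm (h - k))\<^sup>2"
        using norm_add_scaleR_square[of "x1 - x2" 1 "h - k"] unfolding e by simp
      have "\<alpha> / 2 * (p + 2 * q + w) - \<alpha> / 2 * p = \<alpha> * q + \<alpha> / 2 * w" for p q w by (simp add: algebra_simps)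
      then have "\<alpha> / 2 * (norm (x - y))\<^sup>2 - \<alpha> / 2 * (norm (x1 - x2))\<^sup>2 = \<alpha> * ((x1 - x2) \<bullet> (h - k)) + \<alpha> / 2 * (norm (h - k))\<^sup>2" unfolding n .
      then show ?thesis by (simp only: a_def inner_scaleR_left inner_diff_right right_diff_distrib)
    qed
    \<comment> \<open>The defect in this inequality is the square
      \<open>\<beta> / 2 * ((t - t1) + (s - t2))\<^sup>2\<close>.\<close>
    have t_b: "\<beta> / 2 * (t - s)\<^sup>2 - \<beta> / 2 * (t1 - t2)\<^sup>2 \<le> \<beta> * (t1 - t2) * (t - t1) - \<beta> * (t1 - t2) * (s - t2) + \<beta> * ((t - t1)\<^sup>2 + (s - t2)\<^sup>2)"
    proof -
      have "\<beta> / 2 * (p + q)\<^sup>2 = \<beta> * c * p - \<beta> * c * q + \<beta> * (p\<^sup>2 + q\<^sup>2) - (\<beta> / 2 * (c + p - q)\<^sup>2 - \<beta> / 2 * c\<^sup>2)" for p q c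
        by (simp add: power2_eq_square algebra_simps)
      from this[of "t - t1" "s - t2" "t1 - t2"]
      have "\<beta> / 2 * ((t - t1) + (s - t2))\<^sup>2 = \<beta> * (t1 - t2) * (t - t1) - \<beta> * (t1 - t2) * (s - t2) + \<beta> * ((t - t1)\<^sup>2 + (s - t2)\<^sup>2) - (\<beta> / 2 * (t - s)\<^sup>2 - \<beta> / 2 * (t1 - t2)\<^sup>2)"
        by simp
      moreover have "0 \<le> \<beta> / 2 * ((t - t1) + (s - t2))\<^sup>2" using \<beta> by simp
      ultimately show ?thesis by linarith
    qed
    have t_w: "m / 2 * W t' (z + l) - m / 2 * W t'' z \<le> - (m / 2 * lam * W t'' z) * (t' - t'') + m * e t'' * (z \<bullet> l) + m * e t'' * (norm l)\<^sup>2 + m / 2 * Cw * (t' - t'')\<^sup>2"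
      if "t' \<in> {0..T}" "t'' \<in> {0..T}" "norm z \<le> R" "norm l \<le> 1" for t' t'' and z l :: "real^'n"
    proof -
      have "W t' (z + l) \<le> W t'' z - lam * W t'' z * (t' - t'') + 2 * e t'' * (z \<bullet> l) + (e t'' + 1) * (norm l)\<^sup>2 + Cw * (t' - t'')\<^sup>2"
        using Cw(2)[OF that(2,1,3,4)] by (simp add: W_def e_def)
      also have "\<dots> \<le> W t'' z - lam * W t'' z * (t' - t'') + 2 * e t'' * (z \<bullet> l) + (2 * e t'') * (norm l)\<^sup>2 + Cw * (t' - t'')\<^sup>2"
        using e1[OF that(2)] by (intro add_mono mult_right_mono order_refl) auto
      finally have st: "m / 2 * W t' (z + l) \<le> m / 2 * (W t'' z - lam * W t'' z * (t' - t'') + 2 * e t'' * (z \<bullet> l) + (2 * e t'') * (norm l)\<^sup>2 + Cw * (t' - t'')\<^sup>2)"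
        using m by (intro mult_left_mono) auto
      have "m / 2 * (w - lam * w * dt + 2 * E * zl + 2 * E * nl + Cw * dt2) = m / 2 * w - (m / 2 * lam * w) * dt + m * E * zl + m * E * nl + m / 2 * Cw * dt2"
        for w dt E zl nl dt2 by (simp add: algebra_simps)
      from this[of "W t'' z" "t' - t''" "e t''" "z \<bullet> l" "(norm l)\<^sup>2" "(t' - t'')\<^sup>2"] st show ?thesis unfolding minus_mult_left[symmetric] by linarith
    qed
    have w1: "m / 2 * W t x - m / 2 * W t1 x1 \<le> - (m / 2 * lam * W t1 x1) * (t - t1) + m * e t1 * (x1 \<bullet> h) + m * e t1 * (norm h)\<^sup>2 + m / 2 * Cw * (t - t1)\<^sup>2"
      unfolding xh(1) by (rule t_w[OF tx(1) in1(1) less_imp_le[OF nR(1)] hk1(1)])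
    have w2: "m / 2 * W s y - m / 2 * W t2 x2 \<le> - (m / 2 * lam * W t2 x2) * (s - t2) + m * e t2 * (x2 \<bullet> k) + m * e t2 * (norm k)\<^sup>2 + m / 2 * Cw * (s - t2)\<^sup>2"
      unfolding xh(2) by (rule t_w[OF tx(3) in2(1) less_imp_le[OF nR(2)] hk1(2)])
    have P1: "P x - P x1 \<le> G1 \<bullet> h + (1/2) * (\<omega> * \<kappa>1) * (norm h)\<^sup>2" using r1(2)[of x] hk r by (simp add: dist_norm h_def)
    have P2: "P y - P x2 \<le> G2 \<bullet> k + (1/2) * (\<omega> * \<kappa>2) * (norm k)\<^sup>2" using r2(2)[of y] hk r by (simp add: dist_norm k_def)
    have "u t x - v s y \<le> u t1 x1 - v t2 x2 + (a \<bullet> h - a \<bullet> k + \<alpha> / 2 * (norm (h - k))\<^sup>2)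
        + (\<beta> * (t1 - t2) * (t - t1) - \<beta> * (t1 - t2) * (s - t2) + \<beta> * ((t - t1)\<^sup>2 + (s - t2)\<^sup>2))
        + (- (m / 2 * lam * W t1 x1) * (t - t1) + m * e t1 * (x1 \<bullet> h) + m * e t1 * (norm h)\<^sup>2 + m / 2 * Cw * (t - t1)\<^sup>2)
        + (- (m / 2 * lam * W t2 x2) * (s - t2) + m * e t2 * (x2 \<bullet> k) + m * e t2 * (norm k)\<^sup>2 + m / 2 * Cw * (s - t2)\<^sup>2)
        + (G1 \<bullet> h + (1/2) * (\<omega> * \<kappa>1) * (norm h)\<^sup>2) + (G2 \<bullet> k + (1/2) * (\<omega> * \<kappa>2) * (norm k)\<^sup>2)"
      using main t_a t_b w1 w2 P1 P2 by linarith
    also have "\<dots> = u t1 x1 - v t2 x2 + p1 * (t - t1) + Q1 \<bullet> h - p2 * (s - t2) - Q2 \<bullet> k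
          + (1/2) * (\<alpha> * (norm (h - k))\<^sup>2 + A1 * (norm h)\<^sup>2 + A2 * (norm k)\<^sup>2)
          + (\<beta> + m / 2 * Cw) * ((t - t1)\<^sup>2 + (s - t2)\<^sup>2)"
      unfolding p1_def p2_def Q1_def Q2_def A1_def A2_def inner_add_left inner_diff_left inner_scaleR_left by (simp add: algebra_simps)
    finally show ?thesis unfolding h_def k_def .
  qed
  have T1: "t1 \<in> {0..<T}" "t2 \<in> {0..<T}" using in1 in2 t1T t2T by auto
  have gt: "v t2 x2 < u t1 x1" using UV c0 uU by simp
  define S1 where "S1 = \<sigma> t1 x1 (u t1 x1)"
  define S2 where "S2 = \<sigma> t2 x2 (v t2 x2)"
  define z1 where "z1 = Q1 v* S1"
  define z2 where "z2 = Q2 v* S2"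
  define b1 where "b1 = b t1 x1 (u t1 x1) z1"
  define b2 where "b2 = b t2 x2 (v t2 x2) z2"
  define f1 where "f1 = f t1 x1 (u t1 x1) z1"
  define f2 where "f2 = f t2 x2 (v t2 x2) z2"
  have dbl: "- (p1 - p2) - (1/2) * (\<Sum>k\<in>UNIV. \<alpha> * (norm (column k S1 - column k S2))\<^sup>2 + A1 * (norm (column k S1))\<^sup>2 + A2 * (norm (column k S2))\<^sup>2)
     - (b1 \<bullet> Q1 - b2 \<bullet> Q2) - (f1 - f2) \<le> - ((m * \<rho> / 4) * (\<kappa>1 + \<kappa>2) - m * (C + 1) * (e t1 + e t2))"
    unfolding b1_def b2_def f1_def f2_def z1_def z2_def S1_def S2_def
    by (rule doubling_inequality[OF sub super phi D_def lc[folded D_def] contb conts contf T1(1) x1D T1(2) x2D gt r(1) locmax \<delta>(1,2)])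

  \<comment> \<open>Coefficient estimates and contradiction\<close>
  define \<epsilon>1 where "\<epsilon>1 = S0 * rr + \<eta>"
  \<comment> \<open>\<open>1 + L\<close> counts \<open>|x1 - x2|\<close> and the variation of
    \<open>v\<close> in space; one \<open>\<eta>\<close> is the variation of \<open>v\<close> in
    time, the other that of the coefficient.\<close>
  define \<epsilon>2 where "\<epsilon>2 = (1 + L) * rr + 2 * \<eta>"
  have \<epsilon>1: "0 \<le> \<epsilon>1" using S0 rr0 \<eta> by (simp add: \<epsilon>1_def)
  have nS: "norm S1 \<le> S0 * (1 + norm x1)" "norm S2 \<le> S0 * (1 + norm x2)" unfolding S1_def S2_def by (rule gs[OF in1(1)], rule gs[OF in2(1)])
  have dSS: "norm (S1 - S2) \<le> \<epsilon>1"
  proof -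
    have "S2 = \<sigma> t2 x2 0" unfolding S2_def by (rule indep[OF in2(1)])
    then have "S1 - S2 = (S1 - \<sigma> t1 x2 0) + (\<sigma> t1 x2 0 - \<sigma> t2 x2 0)" by simp
    then have "norm (S1 - S2) \<le> norm (S1 - \<sigma> t1 x2 0) + norm (\<sigma> t1 x2 0 - \<sigma> t2 x2 0)" by (metis norm_triangle_ineq)
    moreover have "norm (S1 - \<sigma> t1 x2 0) \<le> S0 * rr" unfolding S1_def rr_def by (rule ls[OF in1(1)])
    moreover have "norm (\<sigma> t1 x2 0 - \<sigma> t2 x2 0) < \<eta>" using dS(2)[OF in1(1) in2(1)] nR t12 d by auto
    ultimately show ?thesis by (simp add: \<epsilon>1_def)
  qed
  have cu1: "\<bar>u t1 x1\<bar> \<le> Cu * (1 + norm x1)" "\<bar>v t2 x2\<bar> \<le> Cu * (1 + norm x2)" using gU'[OF in1] gV'[OF in2] uU by auto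
  have nb: "norm b1 \<le> B0 * (1 + norm x1 + norm z1)" "norm b2 \<le> B0 * (1 + norm x2 + norm z2)"
    unfolding b1_def b2_def by (rule gb[OF in1(1) cu1(1)], rule gb[OF in2(1) cu1(2)])
  have vBY: "\<bar>v t2 x2\<bar> \<le> BY"
  proof -
    have "Cu * (1 + norm x2) \<le> Cu * (1 + R)" using Cu nR by (intro mult_left_mono) auto
    then show ?thesis using cu1(2) by (simp add: BY_def)
  qed
  have zBZ: "norm z2 \<le> BZ"
  proof -
    have m2: "0 \<le> m * e t2" using m e1[OF in2(1)] by simp
    have "norm Q2 \<le> norm a + norm ((m * e t2) *\<^sub>R x2) + norm G2"
      unfolding Q2_def using norm_triangle_ineq4[of "a - (m * e t2) *\<^sub>R x2" G2] norm_triangle_ineq4[of a "(m * e t2) *\<^sub>R x2"] by linarith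
    also have "norm ((m * e t2) *\<^sub>R x2) = m * e t2 * norm x2" using m2 by simp
    finally have n1: "norm Q2 \<le> La + L3 + \<Gamma>" using na iw2 by linarith
    have n2: "norm S2 \<le> S0 * (1 + R)"
    proof -
      have "S0 * (1 + norm x2) \<le> S0 * (1 + R)" using S0 nR by (intro mult_left_mono) auto
      then show ?thesis using nS(2) by linarith
    qed
    have "norm z2 \<le> norm Q2 * norm S2" unfolding z2_def by (rule norm_vector_matrix_mult_le)
    also have "\<dots> \<le> (La + L3 + \<Gamma>) * (S0 * (1 + R))" using n1 n2 LaL3 \<Gamma> by (intro mult_mono) auto
    finally show ?thesis by (simp add: BZ_def)
  qed
  \<comment> \<open>The choice of \<open>m\<close> enters here: the difference of the solution
    values is bounded by a multiple of \<open>m\<close> times the weight.\<close>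
  have duv: "\<bar>u t1 x1 - v t2 x2\<bar> \<le> 2 * m * W t1 x1 + L * rr + \<eta>"
  proof -
    have "u t1 x1 - v t1 x1 \<le> 2 * m * W t1 x1" by (rule uv2[OF in1(1) x1D])
    moreover have "v t1 x1 - v t2 x2 = (V t1 x1 - V t1 x2) + (V t1 x2 - V t2 x2)" using V(1)[OF in1(1) x1D] uU by simp
    moreover have "V t1 x1 - V t1 x2 \<le> L * rr" using lV[OF in1(1,2) in2(2)] by (simp add: rr_def abs_le_iff)
    moreover have "\<bar>V t1 x2 - V t2 x2\<bar> < \<eta>" using dV(2)[OF in1(1) in2] nR t12 d by auto
    ultimately show ?thesis using gt by linarith
  qed
  have trip: "norm (x1 - x2, u t1 x1 - v t2 x2, z1 - z2) \<le> rr + (2 * m * W t1 x1 + L * rr + \<eta>) + norm (z1 - z2)"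
    using norm_triple_le[of "x1 - x2" "u t1 x1 - v t2 x2" "z1 - z2"] duv by (simp add: rr_def)
  have small_lip: "Lb * norm (x1 - x2, u t1 x1 - v t2 x2, z1 - z2) + \<eta> \<le> Lb * (\<epsilon>2 + 2 * m * W t1 x1 + norm (z1 - z2))"
  proof -
    have "Lb * norm (x1 - x2, u t1 x1 - v t2 x2, z1 - z2) \<le> Lb * (rr + (2 * m * W t1 x1 + L * rr + \<eta>) + norm (z1 - z2))" using trip Lb by (intro mult_left_mono) auto
    moreover have "\<eta> \<le> Lb * \<eta>" using Lb \<eta>(1) mult_right_mono[of 1 Lb \<eta>] by simp
    ultimately show ?thesis by (simp add: \<epsilon>2_def algebra_simps)
  qed
  have db: "norm (b1 - b2) \<le> Lb * (\<epsilon>2 + 2 * m * W t1 x1 + norm (z1 - z2))"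
  proof -
    have "norm (b1 - b t1 x2 (v t2 x2) z2) \<le> Lb * norm (x1 - x2, u t1 x1 - v t2 x2, z1 - z2)"
      using lipschitz_onD[OF lipb[OF in1(1)], of "(x1, u t1 x1, z1)" "(x2, v t2 x2, z2)"] by (simp add: dist_norm b1_def diff_Pair)
    moreover have "norm (b t1 x2 (v t2 x2) z2 - b2) < \<eta>" unfolding b2_def using dB(2)[OF in1(1) in2(1) _ vBY zBZ] nR t12 d by auto
    moreover have "norm (b1 - b2) \<le> norm (b1 - b t1 x2 (v t2 x2) z2) + norm (b t1 x2 (v t2 x2) z2 - b2)"
      using norm_triangle_ineq[of "b1 - b t1 x2 (v t2 x2) z2" "b t1 x2 (v t2 x2) z2 - b2"] by simp
    ultimately show ?thesis using small_lip by linarith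
  qed
  have df: "f1 - f2 \<le> Lb * (\<epsilon>2 + 2 * m * W t1 x1 + norm (z1 - z2))"
  proof -
    have "\<bar>f1 - f t1 x2 (v t2 x2) z2\<bar> \<le> Lb * norm (x1 - x2, u t1 x1 - v t2 x2, z1 - z2)"
      using lipschitz_onD[OF lipf[OF in1(1)], of "(x1, u t1 x1, z1)" "(x2, v t2 x2, z2)"] by (simp add: dist_norm f1_def diff_Pair)
    moreover have "\<bar>f t1 x2 (v t2 x2) z2 - f2\<bar> < \<eta>" unfolding f2_def using dF(2)[OF in1(1) in2(1) _ vBY zBZ] nR t12 d by auto
    ultimately show ?thesis using small_lip by linarith
  qed
  have Lb0: "0 \<le> Lb" using Lb by simp
  have ep: "0 \<le> e t1" "0 \<le> e t2" using e1[OF in1(1)] e1[OF in2(1)] by auto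
  have "b1 \<bullet> Q1 - b2 \<bullet> Q2 + (f1 - f2) \<le> ((La + 1) * Lb * (2 + 2 * S0) + 2 * B0 * (1 + (La + L3) * S0)) * m * (W t1 x1 + W t2 x2)
     + ((La + 1) * Lb * S0 * (1 + R) + B0 * S0 * (1 + R) * L3 + B0 * (1 + R) * (1 + (La + L3 + \<Gamma>) * S0)) * (norm G1 + norm G2) + (La + 1) * Lb * (\<epsilon>2 + La * \<epsilon>1)"
    by (rule gradient_terms_estimate[OF LaL3(1) S0 B0 Lb0 \<epsilon>1 m ep LaL3(2) W_def W_def Q1_def Q2_def na nS dSS z1_def z2_def nb db df _ _ less_imp_le[OF nR(1)] less_imp_le[OF nR(2)]])
      (use iw1 iw2 in auto)
  then have grad: "b1 \<bullet> Q1 - b2 \<bullet> Q2 + (f1 - f2) \<le> C1 * m * (W t1 x1 + W t2 x2) + X * (norm G1 + norm G2) + Y0 * (\<epsilon>2 + La * \<epsilon>1)"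
    unfolding C1_def X_def Y0_def .
  \<comment> \<open>Origin of the coefficient \<open>2 * S0\<^sup>2\<close> in \<open>CC\<close> and
    of the Hessian part of \<open>Q'\<close>.\<close>
  have half: "(1/2) * ((2 * m * er + \<omega> * \<kappa>) * (norm S)\<^sup>2) \<le> 2 * S0\<^sup>2 * (m * (er * (1 + (norm y)\<^sup>2))) + (1/2) * (S0\<^sup>2 * (1 + R)\<^sup>2) * (\<omega> * \<kappa>)"
    if S: "norm S \<le> S0 * (1 + norm y)" and y: "norm y < R" and p: "0 \<le> er" "0 \<le> \<kappa>" for S :: "real^'d^'n" and y :: "real^'n" and er \<kappa>
  proof -
    have a: "(norm S)\<^sup>2 \<le> S0\<^sup>2 * (1 + norm y)\<^sup>2" using power_mono[OF S, of 2] by (simp add: power_mult_distrib)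
    have "(1 + norm y)\<^sup>2 \<le> 2 * (1 + (norm y)\<^sup>2)" using sum_squares_bound[of 1 "norm y"] by (simp add: power2_sum)
    then have "S0\<^sup>2 * (1 + norm y)\<^sup>2 \<le> S0\<^sup>2 * (2 * (1 + (norm y)\<^sup>2))" by (intro mult_left_mono) auto
    then have "m * er * (norm S)\<^sup>2 \<le> m * er * (S0\<^sup>2 * (2 * (1 + (norm y)\<^sup>2)))" using a m p by (intro mult_left_mono) auto
    moreover have "(1 + norm y)\<^sup>2 \<le> (1 + R)\<^sup>2" using y by (intro power_mono) auto
    then have "S0\<^sup>2 * (1 + norm y)\<^sup>2 \<le> S0\<^sup>2 * (1 + R)\<^sup>2" by (intro mult_left_mono) auto
    then have "\<omega> * \<kappa> * (norm S)\<^sup>2 \<le> \<omega> * \<kappa> * (S0\<^sup>2 * (1 + R)\<^sup>2)" using a \<omega> p by (intro mult_left_mono) auto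
    ultimately show ?thesis by (simp add: algebra_simps)
  qed
  have trs: "(1/2) * (\<Sum>k\<in>UNIV. \<alpha> * (norm (column k S1 - column k S2))\<^sup>2 + A1 * (norm (column k S1))\<^sup>2 + A2 * (norm (column k S2))\<^sup>2)
     \<le> \<alpha> / 2 * \<epsilon>1\<^sup>2 + 2 * S0\<^sup>2 * (m * (W t1 x1 + W t2 x2)) + (1/2) * (S0\<^sup>2 * (1 + R)\<^sup>2) * (\<omega> * (\<kappa>1 + \<kappa>2))"
  proof -
    have cc: "column k S1 - column k S2 = column k (S1 - S2)" for k by (simp add: column_def vec_eq_iff)
    have "(\<Sum>k\<in>UNIV. \<alpha> * (norm (column k S1 - column k S2))\<^sup>2 + A1 * (norm (column k S1))\<^sup>2 + A2 * (norm (column k S2))\<^sup>2)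
        = \<alpha> * (norm (S1 - S2))\<^sup>2 + A1 * (norm S1)\<^sup>2 + A2 * (norm S2)\<^sup>2"
      unfolding cc sum.distrib sum_distrib_left[symmetric] sum_norm_column_square ..
    then have "(1/2) * (\<Sum>k\<in>UNIV. \<alpha> * (norm (column k S1 - column k S2))\<^sup>2 + A1 * (norm (column k S1))\<^sup>2 + A2 * (norm (column k S2))\<^sup>2)
        = \<alpha> / 2 * (norm (S1 - S2))\<^sup>2 + (1/2) * (A1 * (norm S1)\<^sup>2) + (1/2) * (A2 * (norm S2)\<^sup>2)" by linarith
    moreover have "(norm (S1 - S2))\<^sup>2 \<le> \<epsilon>1\<^sup>2" using dSS by (intro power_mono) auto
    then have "\<alpha> / 2 * (norm (S1 - S2))\<^sup>2 \<le> \<alpha> / 2 * \<epsilon>1\<^sup>2" using \<alpha>0 by (intro mult_left_mono) auto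
    moreover have "(1/2) * (A1 * (norm S1)\<^sup>2) \<le> 2 * S0\<^sup>2 * (m * W t1 x1) + (1/2) * (S0\<^sup>2 * (1 + R)\<^sup>2) * (\<omega> * \<kappa>1)"
      unfolding A1_def W_def by (rule half[OF nS(1) nR(1) ep(1) G1(1)])
    moreover have "(1/2) * (A2 * (norm S2)\<^sup>2) \<le> 2 * S0\<^sup>2 * (m * W t2 x2) + (1/2) * (S0\<^sup>2 * (1 + R)\<^sup>2) * (\<omega> * \<kappa>2)"
      unfolding A2_def W_def by (rule half[OF nS(2) nR(2) ep(2) G2(1)])
    ultimately show ?thesis unfolding distrib_left[of m] distrib_left[of \<omega>] distrib_left[of "2 * S0\<^sup>2"] distrib_left[of "(1/2) * (S0\<^sup>2 * (1 + R)\<^sup>2)"] by linarith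
  qed
  define ww where "ww = W t1 x1 + W t2 x2"
  define kk where "kk = \<kappa>1 + \<kappa>2"
  have kk: "0 \<le> kk" using G1 G2 by (simp add: kk_def)
  have ww: "2 \<le> ww" using We(3)[OF in1(1), of x1] We(3)[OF in2(1), of x2] by (simp add: ww_def)
  have small: "\<alpha> / 2 * \<epsilon>1\<^sup>2 + Y0 * (\<epsilon>2 + La * \<epsilon>1) \<le> m"
  proof -
    have "\<epsilon>1\<^sup>2 \<le> 2 * ((S0 * rr)\<^sup>2 + \<eta>\<^sup>2)" using sum_squares_bound[of "S0 * rr" \<eta>] by (simp add: \<epsilon>1_def power2_sum)
    then have "\<alpha> / 2 * \<epsilon>1\<^sup>2 \<le> \<alpha> / 2 * (2 * ((S0 * rr)\<^sup>2 + \<eta>\<^sup>2))" using \<alpha>0 by (intro mult_left_mono) auto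
    also have "\<dots> = S0\<^sup>2 * rr * (\<alpha> * rr) + \<alpha> * \<eta>\<^sup>2" by (simp add: power2_eq_square algebra_simps)
    also have "\<dots> \<le> S0\<^sup>2 * rr * La + \<alpha> * \<eta>\<^sup>2" using rr rr0 by (intro add_right_mono mult_left_mono) auto
    finally have "\<alpha> / 2 * \<epsilon>1\<^sup>2 + Y0 * (\<epsilon>2 + La * \<epsilon>1) \<le> Q0 * rr + (\<alpha> * \<eta>\<^sup>2 + Y0 * (2 + La) * \<eta>)"
      unfolding Q0_def \<epsilon>1_def \<epsilon>2_def by (simp add: algebra_simps)
    then show ?thesis using rrk(1) \<eta>(4) by linarith
  qed
  have XG: "X * (norm G1 + norm G2) \<le> X * (\<omega> * kk)" using G1(2) G2(2) X by (intro mult_left_mono) (auto simp: kk_def distrib_left)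
  have ee: "m * (C + 1) * (e t1 + e t2) \<le> (C + 1) * (m * ww)"
  proof -
    have "(m * (C + 1)) * (e t1 + e t2) \<le> (m * (C + 1)) * ww" using We(1)[OF in1(1), of x1] We(1)[OF in2(1), of x2] m \<rho> by (intro mult_left_mono) (auto simp: ww_def)
    then show ?thesis by (simp add: mult_ac)
  qed
  have pp: "- (p1 - p2) = lam / 2 * (m * ww)" by (simp add: p1_def p2_def ww_def algebra_simps)
  have wk: "4 * (\<omega> * Q') * kk \<le> m * \<rho> * kk" using \<omega>(3) kk by (rule mult_right_mono)
  \<comment> \<open>The gain \<open>(m * \<rho> / 4) * kk\<close> outweighs the barrier terms, and
    \<open>lam / 2\<close> leaves one surplus multiple of \<open>m * ww\<close> against the small
    errors.\<close>
  have "lam / 2 * (m * ww) \<le> (\<alpha> / 2 * \<epsilon>1\<^sup>2 + 2 * S0\<^sup>2 * (m * ww) + (1/2) * (S0\<^sup>2 * (1 + R)\<^sup>2) * (\<omega> * kk))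
     + (C1 * m * ww + X * (\<omega> * kk) + Y0 * (\<epsilon>2 + La * \<epsilon>1)) - ((m * \<rho> / 4) * kk - (C + 1) * (m * ww))"
    using dbl trs grad XG ee unfolding pp ww_def[symmetric] kk_def[symmetric] by linarith
  moreover have "(1/2) * (S0\<^sup>2 * (1 + R)\<^sup>2) * (\<omega> * kk) + X * (\<omega> * kk) = (1/4) * (4 * (\<omega> * Q') * kk)"
    by (simp add: Q'_def algebra_simps)
  moreover have "(m * \<rho> / 4) * kk = (1/4) * (m * \<rho> * kk)" by simp
  moreover have "lam / 2 * (m * ww) = C1 * m * ww + 2 * S0\<^sup>2 * (m * ww) + (C + 1) * (m * ww) + m * ww"
    by (simp add: lam_def CC_def algebra_simps)
  ultimately have "m * ww \<le> m" using small wk by linarith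
  then show False using m ww by simp
qed

theorem theorem4:
  fixes T :: real
    and \<psi> :: "real^'n \<Rightarrow> ereal"
    and \<phi> :: "real \<Rightarrow> ereal"
    and b :: "real \<Rightarrow> real^'n \<Rightarrow> real \<Rightarrow> real^'d \<Rightarrow> real^'n"
    and \<sigma> :: "real \<Rightarrow> real^'n \<Rightarrow> real \<Rightarrow> real^'d^'n"
    and f :: "real \<Rightarrow> real^'n \<Rightarrow> real \<Rightarrow> real^'d \<Rightarrow> real"
    and g :: "real^'n \<Rightarrow> real"
  assumes "T > 0"
    and "\<forall>x. \<psi> x \<noteq> -\<infinity>" and "ereal_convex \<psi>" and "lower_semicontinuous \<psi>"
    and "0 \<in> interior (effective_domain \<psi>)"
    and "\<psi> 0 = 0" and "\<forall>z. \<psi> z \<ge> \<psi> 0"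
    and "\<forall>y. \<phi> y \<noteq> -\<infinity>" and "ereal_convex \<phi>" and "lower_semicontinuous \<phi>"
    and "\<phi> 0 = 0" and "\<forall>y. \<phi> y \<ge> \<phi> 0"
    and "locally compact (effective_domain \<psi>)"
    and "continuous_on ({0..T} \<times> UNIV) (\<lambda>(t, x, y, z). b t x y z)"
    and "continuous_on ({0..T} \<times> UNIV) (\<lambda>(t, x, y). \<sigma> t x y)"
    and "continuous_on ({0..T} \<times> UNIV) (\<lambda>(t, x, y, z). f t x y z)"
    and "continuous_on UNIV g"
    and "\<exists>L. \<forall>t \<in> {0..T}. L-lipschitz_on UNIV (\<lambda>(x, y, z). b t x y z)"
    and "\<exists>L. \<forall>t \<in> {0..T}. L-lipschitz_on UNIV (\<lambda>(x, y, z). f t x y z)"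
    and "\<forall>t \<in> {0..T}. \<forall>x y y'. \<sigma> t x y = \<sigma> t x y'"
    and "\<exists>L. \<forall>t \<in> {0..T}. \<forall>y. L-lipschitz_on UNIV (\<lambda>x. \<sigma> t x y)"
  shows "\<forall>u v.
      viscosity_solution T \<psi> \<phi> b \<sigma> f g u \<and>
      lipschitz_in_space_continuous_in_time T (effective_domain \<psi>) u \<and>
      viscosity_solution T \<psi> \<phi> b \<sigma> f g v \<and>
      lipschitz_in_space_continuous_in_time T (effective_domain \<psi>) v \<longrightarrow>
      (\<forall>t \<in> {0..T}. \<forall>x \<in> effective_domain \<psi>. u t x = v t x)"
proof -
  obtain Lb where Lb: "\<And>t. t \<in> {0..T} \<Longrightarrow> Lb-lipschitz_on UNIV (\<lambda>(x, y, z). b t x y z)" using assms(18) by blast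
  obtain Lf where Lf: "\<And>t. t \<in> {0..T} \<Longrightarrow> Lf-lipschitz_on UNIV (\<lambda>(x, y, z). f t x y z)" using assms(19) by blast
  obtain Ls where Ls: "\<And>t y. t \<in> {0..T} \<Longrightarrow> Ls-lipschitz_on UNIV (\<lambda>x. \<sigma> t x y)" using assms(21) by blast
  define Lm where "Lm = max 1 (max Lb Lf)"
  have Lm: "Lm-lipschitz_on UNIV (\<lambda>(x, y, z). b t x y z)" "Lm-lipschitz_on UNIV (\<lambda>(x, y, z). f t x y z)" if "t \<in> {0..T}" for t
    by (rule lipschitz_on_le[OF Lb[OF that]], simp add: Lm_def, rule lipschitz_on_le[OF Lf[OF that]], simp add: Lm_def)
  have le: "u t x \<le> v t x"
    if sol: "viscosity_solution T \<psi> \<phi> b \<sigma> f g u" "viscosity_solution T \<psi> \<phi> b \<sigma> f g v"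
      and reg: "lipschitz_in_space_continuous_in_time T (effective_domain \<psi>) u" "lipschitz_in_space_continuous_in_time T (effective_domain \<psi>) v"
      and tx: "t \<in> {0..T}" "x \<in> effective_domain \<psi>" for u v t x
  proof -
    obtain Lu where Lu: "\<And>t. t \<in> {0..T} \<Longrightarrow> Lu-lipschitz_on (effective_domain \<psi>) (u t)" and cu: "\<And>x. x \<in> effective_domain \<psi> \<Longrightarrow> continuous_on {0..T} (\<lambda>t. u t x)"
      using reg(1) unfolding lipschitz_in_space_continuous_in_time_def by blast
    obtain Lv where Lv: "\<And>t. t \<in> {0..T} \<Longrightarrow> Lv-lipschitz_on (effective_domain \<psi>) (v t)" and cv: "\<And>x. x \<in> effective_domain \<psi> \<Longrightarrow> continuous_on {0..T} (\<lambda>t. v t x)"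
      using reg(2) unfolding lipschitz_in_space_continuous_in_time_def by blast
    have Lu': "(max Lu Lv)-lipschitz_on (effective_domain \<psi>) (u t)" if "t \<in> {0..T}" for t by (rule lipschitz_on_le[OF Lu[OF that]]) simp
    have Lv': "(max Lu Lv)-lipschitz_on (effective_domain \<psi>) (v t)" if "t \<in> {0..T}" for t by (rule lipschitz_on_le[OF Lv[OF that]]) simp
    have su: "viscosity_subsolution T \<psi> \<phi> b \<sigma> f g u" "viscosity_supersolution T \<psi> \<phi> b \<sigma> f g v"
      using sol unfolding viscosity_solution_def by auto
    have ps: "0 \<le> \<psi> z" for z using assms(6,7) by simp
    have ph: "\<phi> y \<noteq> -\<infinity>" for y using assms(8) by simp
    have ind: "\<sigma> t x y = \<sigma> t x y'" if "t \<in> {0..T}" for t x y y' using assms(20) that by blast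
    have L1: "1 \<le> Lm" by (simp add: Lm_def)
    show ?thesis
      by (rule comparison[OF assms(1,3,4,5,6) ps assms(9) ph assms(13,14,15,16) Lm(1) Lm(2) L1 ind Ls su Lu' Lv' cu cv tx])
  qed
  show ?thesis
  proof (intro allI impI ballI)
    fix u v t x
    assume "viscosity_solution T \<psi> \<phi> b \<sigma> f g u \<and> lipschitz_in_space_continuous_in_time T (effective_domain \<psi>) u \<and>
      viscosity_solution T \<psi> \<phi> b \<sigma> f g v \<and> lipschitz_in_space_continuous_in_time T (effective_domain \<psi>) v"
      and "t \<in> {0..T}" "x \<in> effective_domain \<psi>"
    then show "u t x = v t x" using le[of u v t x] le[of v u t x] by (intro antisym) auto
  qed
qed

end
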